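(* For any $1 \leq s \leq n$, the extension $k(S[<s])/k(W_s)$ is Galois and its degree $d_s:=[k(S[<s]):k(W_s)]$ satisfies $d_s \leq 4$. Moreover, one of the following must occur (with $r_0=\#S[0]$): (a) $d_s = 1$, i.e., $k(S[<s]) = k(W_s)$; (b) $\ell = 3$, $S[<s] = S[0]$, $r_0 = 3$, $s = 1$, and $d_s = 3$; (c) $\ell = 2$, $S[<s] = S[0]$, $r_0 = 4$, $s \leq 2$, and $d_s = 4$; (d) $\ell = 2$, $S[<s] = S[0]$, $r_0 = 4$, and $d_s = 2$; (e) $\ell = 2$, $S[<s] = S[0]$, $r_0 = 2$, $s = 1$, and $d_s = 2$; (f) $\ell = 2$, $S[<s] \neq S[0]$, $r_0 = 2$, and $d_s = 2$.
   Context: $k$ is a number field, $\bar k$ a fixed algebraic closure, $G_k=\mathrm{Gal}(\bar k/k)$, $\ell$ a prime. $\mathcal{T}(k,\ell)$ is the maximal pro-$\ell$ extension of $k(\mu_{\ell^\infty})$ unramified away from $\ell$. For a $G_k$-set $T$, $k(T)$ is the subfield of $\bar k$ fixed by the kernel of $G_k\to\mathrm{Aut}(T)$. Curve: $C/k$ is a smooth projective geometrically irreducible curve with affine model $y^{\ell^n}=f(x)$, $n\ge1$, $f=\lambda\prod_{\xi\in S}(x-\xi)^{n_\xi}\in k[x]$, $\lambda\in k^\times$, $S\subset\bar k$ the (finite) set of distinct roots of $f$, $0<n_\xi<\ell^n$, and $S$ equals the branch locus of the $x$-coordinate covering $C\to\mathbb{P}^1$ (in particular $\infty$ is not a branch point,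 so $\ell^n\mid\deg f$). The Jacobian $J$ of $C$ has good reduction at all finite places not above $\ell$, and $k(S)\subseteq\mathcal{T}(k,\ell)$. Tower: for $0\le s\le n$, $C_s/k$ is the smooth projective curve with affine model $(y_s)^{\ell^s}=f(x)$ (so $C_0=\mathbb{P}^1$, $C_n=C$); $\Pi_s\colon C_s\to\mathbb{P}^1$ is the $x$-coordinate, and for $s\ge1$, $\pi_s\colon C_s\to C_{s-1}$ is the degree $\ell$ map given by $y_{s-1}=y_s^\ell$. $J_s=\mathrm{Jac}(C_s)$. The pullback $\pi_s^*\colon J_{s-1}\to J_s$ is a closed immersion, by which $J_{s-1}$ is viewed as an abelian subvariety of $J_s$; $A_s:=J_s/J_{s-1}$ for $1\le s\le n$. Branch strata: $S[j]:=\{\xi\in S:\mathrm{ord}_\ell n_\xi=j\}$, $r_j:=\#S[j]$, and $S[<s]:=\bigcup_{j=0}^{s-1}S[j]$. Divisors: $\mathrm{Div}\,C_s$ is the group of divisors of $C_s$ over $\bar k$, $\mathrm{Div}^0$ its degree zero part. For $\xi\in\mathbb{P}^1(\bar k)$, $[\xi]_s:=\sum_{\eta\in\Pi_s^{-1}(\xi)}\eta$ (each point with coefficient 1). $\mathcal{W}_s:=\langle[\xi]_s:\xi\in S[<s]\rangle$, $\mathcal{W}_s^0:=\mathcal{W}_s\cap\mathrm{Div}^0C_s$. $\alpha_s\colon\mathcal{W}_s^0\to A_s$ is the composite $\mathcal{W}_s^0\hookrightarrow\mathrm{Div}^0C_s\twoheadrightarrow J_s(\bar k)\twoheadrightarrow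 A_s(\bar k)$, and $W_s:=\alpha_s(\mathcal{W}_s^0)$, which is a $G_k$-stable $\mathbb{F}_\ell$-subspace of $A_s[\ell]$ with $k(W_s)\subseteq k(S[<s])$. *)

theory Defs
  imports
    "HOL-Algebra.Algebra"
    "HOL-Algebra.Algebraic_Closure_Type"
    "HOL-Library.Poly_Mapping"
begin

section \<open>Field extensions and Galois groups\<close>

text \<open>
  All fields are subfields (as sets) of an ambient field given as a type; the notions of
  HOL-Algebra are used for the ring \<open>type_ring\<close> of that type.
\<close>

abbreviation type_ring :: "'a::field ring" where
  "type_ring \<equiv> ring_of_type_algebra"

definition number_field :: "'a::field_char_0 set \<Rightarrow> bool" where
  "number_field k \<longleftrightarrow> subfield k type_ring \<and> ring.finite_dimension type_ring \<rat> k"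

definition algebraic_extension :: "'a::field set \<Rightarrow> 'a set \<Rightarrow> bool" where
  "algebraic_extension K L \<longleftrightarrow>
     subfield K type_ring \<and> subfield L type_ring \<and> K \<subseteq> L \<and>
     (\<forall>z\<in>L. ring.algebraic type_ring K z)"

text \<open>The elements are functions on the ambient type of which only the restriction to \<open>L\<close> matters.\<close>

definition Gal :: "'a::field set \<Rightarrow> 'a set \<Rightarrow> ('a \<Rightarrow> 'a) set" where
  "Gal K L = {\<sigma> \<in> ring_iso (type_ring\<lparr>carrier := L\<rparr>) (type_ring\<lparr>carrier := L\<rparr>). \<forall>z\<in>K. \<sigma> z = z}"

abbreviation absolute_Gal :: "'a::field set \<Rightarrow> ('a \<Rightarrow> 'a) set" where
  "absolute_Gal k \<equiv> Gal k UNIV"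

definition galois_extension :: "'a::field set \<Rightarrow> 'a set \<Rightarrow> bool" where
  "galois_extension K L \<longleftrightarrow>
     algebraic_extension K L \<and> {z\<in>L. \<forall>\<sigma>\<in>Gal K L. \<sigma> z = z} = K"

definition finite_extension :: "'a::field set \<Rightarrow> 'a set \<Rightarrow> bool" where
  "finite_extension K L \<longleftrightarrow> algebraic_extension K L \<and> ring.finite_dimension type_ring K L"

text \<open>Only meaningful for finite extensions.\<close>

definition ext_degree :: "'a::field set \<Rightarrow> 'a set \<Rightarrow> nat" where
  "ext_degree K L = ring.dim type_ring K L"

text \<open>\<open>k(T)\<close> for a set \<open>T\<close> on which the absolute Galois group of \<open>k\<close> acts by \<open>act\<close>.\<close>

definition gset_field :: "'a::field set \<Rightarrow> (('a \<Rightarrow> 'a) \<Rightarrow> 't \<Rightarrow> 't) \<Rightarrow> 't set \<Rightarrow> 'a set" where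
  "gset_field k act T =
     {z. \<forall>\<sigma>\<in>absolute_Gal k. (\<forall>t\<in>T. act \<sigma> t = t) \<longrightarrow> \<sigma> z = z}"


section \<open>Valuation rings\<close>

definition valuation_ring :: "'a::field set \<Rightarrow> 'a set \<Rightarrow> bool" where
  "valuation_ring F V \<longleftrightarrow>
     subring V type_ring \<and> V \<subseteq> F \<and> (\<forall>z\<in>F. z \<in> V \<or> inverse z \<in> V)"

text \<open>The trivial valuation ring \<open>V = F\<close> is allowed above; its maximal ideal is \<open>{0}\<close>.\<close>

definition max_ideal :: "'a::field set \<Rightarrow> 'a set" where
  "max_ideal V = {z\<in>V. z = 0 \<or> inverse z \<notin> V}"

definition uniformizer :: "'a::field set \<Rightarrow> 'a \<Rightarrow> bool" where
  "uniformizer V t \<longleftrightarrow> t \<noteq> 0 \<and> max_ideal V = (\<lambda>a. t * a) ` V"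

text \<open>The normalized valuation of a discrete valuation ring, at nonzero elements of its fraction field.\<close>

definition valuation :: "'a::field set \<Rightarrow> 'a \<Rightarrow> int" where
  "valuation V z = (THE e. \<exists>t u. uniformizer V t \<and> u \<in> V - max_ideal V \<and> z = t powi e * u)"

text \<open>
  The finite places of a number field \<open>k\<close> correspond to its nontrivial valuation rings.
\<close>

definition finite_places_away :: "nat \<Rightarrow> 'a::field set \<Rightarrow> 'a set set" where
  "finite_places_away l k =
     {V. valuation_ring k V \<and> V \<noteq> k \<and> of_nat l \<notin> max_ideal V}"

definition inertia_group :: "'a::field set \<Rightarrow> 'a set \<Rightarrow> ('a \<Rightarrow> 'a) set" where
  "inertia_group K V =
     {\<sigma> \<in> absolute_Gal K. \<sigma> ` V = V \<and> (\<forall>z\<in>V. \<sigma> z - z \<in> max_ideal V)}"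

text \<open>
  Ramification in possibly infinite algebraic extensions is expressed by inertia groups inside the
  absolute Galois group of \<open>K\<close>; their images in the Galois group of \<open>L\<close> over \<open>K\<close> are the inertia
  groups of \<open>L\<close> over \<open>K\<close>.
\<close>

definition unramified_away :: "nat \<Rightarrow> 'a::field set \<Rightarrow> 'a set \<Rightarrow> bool" where
  "unramified_away l K L \<longleftrightarrow>
     (\<forall>V\<in>finite_places_away l UNIV. \<forall>\<sigma>\<in>inertia_group K V. \<forall>z\<in>L. \<sigma> z = z)"

definition cyclotomic_tower :: "'a::field set \<Rightarrow> nat \<Rightarrow> 'a set" where
  "cyclotomic_tower k l = generate_field type_ring (k \<union> {z. \<exists>m. z ^ (l ^ m) = 1})"

text \<open>
  The maximal pro-\<open>l\<close> extension of \<open>k(\<mu>\<^bsub>l^\<infinity>\<^esub>)\<close> unramified away from \<open>l\<close>, as a compositum of finite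
  ones.  Archimedean places need no condition, as \<open>k(\<mu>\<^bsub>l^\<infinity>\<^esub>)\<close> is totally imaginary.
\<close>

definition max_pro_unramified :: "'a::field set \<Rightarrow> nat \<Rightarrow> 'a set" where
  "max_pro_unramified k l =
     (let K = cyclotomic_tower k l in
      generate_field type_ring
        (\<Union>{L. galois_extension K L \<and> finite_extension K L \<and>
              (\<exists>m. ext_degree K L = l ^ m) \<and> unramified_away l K L}))"


section \<open>Curves as function fields\<close>

text \<open>
  \<open>'a\<close> plays the role of \<open>\<bar>k\<close> (an algebraic closure of \<open>k\<close>).  All function fields live in a fixed
  algebraic closure of the rational function field in \<open>x\<close> over \<open>'a\<close>.
\<close>

type_synonym 'a fn = "'a poly fract alg_closure"

definition fn_of_poly :: "'a::field poly \<Rightarrow> 'a fn" where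
  "fn_of_poly p = to_ac (Fract p 1)"

definition fn_const :: "'a::field \<Rightarrow> 'a fn" where
  "fn_const c = fn_of_poly [:c:]"

definition fn_x :: "'a::field fn" where
  "fn_x = fn_of_poly [:0, 1:]"

definition fn_field :: "'a::field fn \<Rightarrow> 'a fn set" where
  "fn_field y = generate_field type_ring (range fn_const \<union> {fn_x, y})"

definition rational_fn_field :: "'a::field fn set" where
  "rational_fn_field = generate_field type_ring (range fn_const \<union> {fn_x})"

text \<open>
  The points over \<open>\<bar>k\<close> of the smooth projective curve with function field \<open>F\<close>, given by their local
  rings: the nontrivial valuation rings of \<open>F\<close> containing the constants.  For an inclusion of function
  fields \<open>E \<subseteq> F\<close>, the corresponding map of curves sends \<open>Q\<close> to \<open>Q \<inter> E\<close>.
\<close>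

definition points :: "'a::field fn set \<Rightarrow> 'a fn set set" where
  "points F = {P. valuation_ring F P \<and> range fn_const \<subset> P \<and> P \<subset> F}"

definition ram_index :: "'a::field fn set \<Rightarrow> 'a fn set \<Rightarrow> int" where
  "ram_index E Q = valuation Q (SOME t. uniformizer (Q \<inter> E) t)"

text \<open>The local ring of the projective line at the point with \<open>x\<close>-coordinate \<open>\<xi>\<close>.\<close>

definition line_point :: "'a::field \<Rightarrow> 'a fn set" where
  "line_point \<xi> = {fn_of_poly a / fn_of_poly b | a b. poly b \<xi> \<noteq> 0}"

definition branch_locus :: "'a::field fn set \<Rightarrow> 'a fn set set" where
  "branch_locus F =
     {P \<in> points rational_fn_field.
        \<exists>Q\<in>points F. Q \<inter> rational_fn_field = P \<and> ram_index rational_fn_field Q > 1}"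


subsection \<open>Divisors and Jacobians\<close>

type_synonym 'a divisor = "'a fn set \<Rightarrow> int"

definition Div :: "'a::field fn set \<Rightarrow> 'a divisor monoid" where
  "Div F = \<lparr>carrier = {D. finite {P. D P \<noteq> 0} \<and> {P. D P \<noteq> 0} \<subseteq> points F},
            monoid.mult = (\<lambda>D E P. D P + E P), one = (\<lambda>_. 0)\<rparr>"

definition div_deg :: "'a::field divisor \<Rightarrow> int" where
  "div_deg D = (\<Sum>P | D P \<noteq> 0. D P)"

definition Div0 :: "'a::field fn set \<Rightarrow> 'a divisor monoid" where
  "Div0 F = (Div F)\<lparr>carrier := {D \<in> carrier (Div F). div_deg D = 0}\<rparr>"

definition point_div :: "'a::field fn set \<Rightarrow> 'a divisor" where
  "point_div P = (\<lambda>Q. if Q = P then 1 else 0)"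

definition principal_div :: "'a::field fn set \<Rightarrow> 'a fn \<Rightarrow> 'a divisor" where
  "principal_div F z = (\<lambda>P. if P \<in> points F then valuation P z else 0)"

text \<open>The group of \<open>\<bar>k\<close>-points of the Jacobian.\<close>

definition Jac :: "'a::field fn set \<Rightarrow> 'a divisor set monoid" where
  "Jac F = Div0 F Mod (principal_div F ` (F - {0}))"

definition div_class :: "'a::field fn set \<Rightarrow> 'a divisor \<Rightarrow> 'a divisor set" where
  "div_class F D = (principal_div F ` (F - {0})) #>\<^bsub>Div0 F\<^esub> D"

definition div_pullback :: "'a::field fn set \<Rightarrow> 'a fn set \<Rightarrow> 'a divisor \<Rightarrow> 'a divisor" where
  "div_pullback E F D = (\<lambda>Q. if Q \<in> points F then ram_index E Q * D (Q \<inter> E) else 0)"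

text \<open>The image of the pullback homomorphism from \<open>Jac E\<close> to \<open>Jac F\<close>.\<close>

definition Jac_pullback :: "'a::field fn set \<Rightarrow> 'a fn set \<Rightarrow> 'a divisor set set" where
  "Jac_pullback E F = (\<lambda>D. div_class F (div_pullback E F D)) ` carrier (Div0 E)"


subsection \<open>Galois action\<close>

text \<open>
  For \<open>\<sigma>\<close> in the absolute Galois group of \<open>k\<close> and \<open>y\<close> generating the function field of a curve
  defined over \<open>k\<close>, \<open>fn_aut y \<sigma>\<close> is the extension of \<open>\<sigma>\<close> to \<open>fn_field y\<close> fixing the coordinates \<open>x\<close>
  and \<open>y\<close>, i.e. \<open>\<sigma>\<close> applied to coefficients.  It is unique on \<open>fn_field y\<close>.
\<close>

definition fn_aut :: "'a::field fn \<Rightarrow> ('a \<Rightarrow> 'a) \<Rightarrow> 'a fn \<Rightarrow> 'a fn" where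
  "fn_aut y \<sigma> =
     (SOME \<phi>. \<phi> \<in> ring_iso (type_ring\<lparr>carrier := fn_field y\<rparr>) (type_ring\<lparr>carrier := fn_field y\<rparr>) \<and>
               (\<forall>c. \<phi> (fn_const c) = fn_const (\<sigma> c)) \<and> \<phi> fn_x = fn_x \<and> \<phi> y = y)"

definition div_act :: "'a::field fn \<Rightarrow> ('a \<Rightarrow> 'a) \<Rightarrow> 'a divisor \<Rightarrow> 'a divisor" where
  "div_act y \<sigma> D = (\<lambda>Q. \<Sum>P | D P \<noteq> 0 \<and> fn_aut y \<sigma> ` P = Q. D P)"

definition Jac_act :: "'a::field fn \<Rightarrow> ('a \<Rightarrow> 'a) \<Rightarrow> 'a divisor set \<Rightarrow> 'a divisor set" where
  "Jac_act y \<sigma> c = div_act y \<sigma> ` c"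

text \<open>The induced action on a quotient of the Jacobian, whose elements are sets of divisor classes.\<close>

definition quot_act :: "'a::field fn \<Rightarrow> ('a \<Rightarrow> 'a) \<Rightarrow> 'a divisor set set \<Rightarrow> 'a divisor set set" where
  "quot_act y \<sigma> Y = Jac_act y \<sigma> ` Y"


section \<open>Good reduction of the Jacobian\<close>

text \<open>
  Multivariate polynomials in variables indexed by natural numbers; a monomial is its exponent vector.
\<close>

type_synonym 'a mpol = "(nat \<Rightarrow>\<^sub>0 nat) \<Rightarrow>\<^sub>0 'a"

definition mpols :: "'a::comm_ring_1 set \<Rightarrow> nat \<Rightarrow> 'a mpol set" where
  "mpols V N = {F. \<forall>m\<in>Poly_Mapping.keys F. Poly_Mapping.lookup F m \<in> V \<and> Poly_Mapping.keys m \<subseteq> {..N}}"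

definition homogeneous_in :: "nat set \<Rightarrow> nat \<Rightarrow> 'a::comm_ring_1 mpol \<Rightarrow> bool" where
  "homogeneous_in I d F \<longleftrightarrow> (\<forall>m\<in>Poly_Mapping.keys F. (\<Sum>i\<in>Poly_Mapping.keys m \<inter> I. Poly_Mapping.lookup m i) = d)"

definition mp_eval :: "'a::comm_ring_1 mpol \<Rightarrow> (nat \<Rightarrow> 'a) \<Rightarrow> 'a" where
  "mp_eval F p = (\<Sum>m\<in>Poly_Mapping.keys F. Poly_Mapping.lookup F m * (\<Prod>i\<in>Poly_Mapping.keys m. p i ^ Poly_Mapping.lookup m i))"

text \<open>The value at \<open>p\<close> of the partial derivative of \<open>F\<close> with respect to the \<open>j\<close>-th variable.\<close>

definition mp_pderiv_eval :: "nat \<Rightarrow> 'a::comm_ring_1 mpol \<Rightarrow> (nat \<Rightarrow> 'a) \<Rightarrow> 'a" where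
  "mp_pderiv_eval j F p =
     (\<Sum>m\<in>Poly_Mapping.keys F. Poly_Mapping.lookup F m * of_nat (Poly_Mapping.lookup m j) *
        (\<Prod>i\<in>Poly_Mapping.keys m. p i ^ (if i = j then Poly_Mapping.lookup m i - 1 else Poly_Mapping.lookup m i)))"

definition mp_ideal :: "'a::comm_ring_1 set \<Rightarrow> nat \<Rightarrow> 'a mpol set \<Rightarrow> 'a mpol set" where
  "mp_ideal V N \<F> = {\<Sum>F\<in>\<F>. H F * F | H. \<forall>F\<in>\<F>. H F \<in> mpols V N}"

definition proj_point :: "nat \<Rightarrow> (nat \<Rightarrow> 'a::field) \<Rightarrow> (nat \<Rightarrow> 'a) set" where
  "proj_point N p = {\<lambda>i. if i \<le> N then c * p i else 0 | c. c \<noteq> 0}"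

text \<open>
  Let \<open>V\<close> be a discrete valuation ring with fraction field \<open>k\<close>, and let \<open>\<F>\<close> be a finite set of
  homogeneous polynomials over \<open>V\<close>, defining a closed subscheme \<open>X\<close> of projective \<open>N\<close>-space over \<open>V\<close>.
  The geometric points of \<open>Spec V\<close> are obtained from the valuation rings \<open>W \<supseteq> V\<close> of \<open>\<bar>k\<close>: the residue
  field of \<open>W\<close> is an algebraic closure of that of \<open>V\<close>, except if \<open>W = \<bar>k\<close>, which gives the generic
  point.  Points of \<open>X\<close> over the residue field of \<open>W\<close> are given by homogeneous coordinates in \<open>W\<close>, read
  modulo the maximal ideal of \<open>W\<close>.
\<close>

definition geometric_rings :: "'a::field set \<Rightarrow> 'a set set" where
  "geometric_rings V = {W. valuation_ring UNIV W \<and> V \<subseteq> W}"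

definition fibre_points :: "nat \<Rightarrow> 'a::field mpol set \<Rightarrow> 'a set \<Rightarrow> (nat \<Rightarrow> 'a) set" where
  "fibre_points N \<F> W =
     {p. (\<forall>i\<le>N. p i \<in> W) \<and> (\<exists>i\<le>N. p i \<notin> max_ideal W) \<and> (\<forall>F\<in>\<F>. mp_eval F p \<in> max_ideal W)}"

text \<open>
  \<open>X\<close> is smooth over \<open>V\<close> of relative dimension \<open>N - r\<close>: locally at each point the ideal of \<open>X\<close> is
  generated by \<open>r\<close> elements with linearly independent differentials (stated on the punctured
  affine cone over \<open>X\<close>).
\<close>

definition smooth_over :: "'a::field set \<Rightarrow> nat \<Rightarrow> nat \<Rightarrow> 'a mpol set \<Rightarrow> bool" where
  "smooth_over V N r \<F> \<longleftrightarrow>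
     (\<forall>W\<in>geometric_rings V. \<forall>p\<in>fibre_points N \<F> W. \<exists>G :: nat \<Rightarrow> 'a mpol.
        (\<forall>i<r. G i \<in> mp_ideal V N \<F>) \<and>
        (\<forall>c. (\<forall>i<r. c i \<in> W) \<and>
             (\<forall>j\<le>N. (\<Sum>i<r. c i * mp_pderiv_eval j (G i) p) \<in> max_ideal W) \<longrightarrow>
             (\<forall>i<r. c i \<in> max_ideal W)) \<and>
        (\<forall>F\<in>\<F>. \<exists>H\<in>mpols V N.
             mp_eval H p \<notin> max_ideal W \<and> H * F \<in> mp_ideal V N (G ` {..<r})))"

text \<open>
  A map \<open>op\<close> on the projective points of the generic fibre extends to a morphism over \<open>V\<close>: near every
  point of every fibre it is given by homogeneous polynomials over \<open>V\<close> without common zero there.  For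
  the binary version, the coordinates of the second factor are shifted by \<open>N + 1\<close>.
\<close>

definition extends_unary ::
  "'a::field set \<Rightarrow> nat \<Rightarrow> 'a mpol set \<Rightarrow> ((nat \<Rightarrow> 'a) set \<Rightarrow> (nat \<Rightarrow> 'a) set) \<Rightarrow> bool" where
  "extends_unary V N \<F> op \<longleftrightarrow>
     (\<forall>W\<in>geometric_rings V. \<forall>p\<in>fibre_points N \<F> W. \<exists>d. \<exists>G :: nat \<Rightarrow> 'a mpol.
        (\<forall>i\<le>N. G i \<in> mpols V N \<and> homogeneous_in {..N} d (G i)) \<and>
        (\<exists>i\<le>N. mp_eval (G i) p \<notin> max_ideal W) \<and>
        (\<forall>p'\<in>fibre_points N \<F> UNIV. (\<exists>i\<le>N. mp_eval (G i) p' \<noteq> 0) \<longrightarrow>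
           op (proj_point N p') = proj_point N (\<lambda>i. mp_eval (G i) p')))"

definition pair_coords :: "nat \<Rightarrow> (nat \<Rightarrow> 'a) \<Rightarrow> (nat \<Rightarrow> 'a) \<Rightarrow> nat \<Rightarrow> 'a" where
  "pair_coords N p q = (\<lambda>i. if i \<le> N then p i else q (i - (N + 1)))"

definition extends_binary ::
  "'a::field set \<Rightarrow> nat \<Rightarrow> 'a mpol set \<Rightarrow>
     ((nat \<Rightarrow> 'a) set \<Rightarrow> (nat \<Rightarrow> 'a) set \<Rightarrow> (nat \<Rightarrow> 'a) set) \<Rightarrow> bool" where
  "extends_binary V N \<F> op \<longleftrightarrow>
     (\<forall>W\<in>geometric_rings V. \<forall>p\<in>fibre_points N \<F> W. \<forall>q\<in>fibre_points N \<F> W.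
        \<exists>d e. \<exists>G :: nat \<Rightarrow> 'a mpol.
        (\<forall>i\<le>N. G i \<in> mpols V (2 * N + 1) \<and>
           homogeneous_in {..N} d (G i) \<and> homogeneous_in {N + 1..2 * N + 1} e (G i)) \<and>
        (\<exists>i\<le>N. mp_eval (G i) (pair_coords N p q) \<notin> max_ideal W) \<and>
        (\<forall>p'\<in>fibre_points N \<F> UNIV. \<forall>q'\<in>fibre_points N \<F> UNIV.
           (\<exists>i\<le>N. mp_eval (G i) (pair_coords N p' q') \<noteq> 0) \<longrightarrow>
           op (proj_point N p') (proj_point N q') =
             proj_point N (\<lambda>i. mp_eval (G i) (pair_coords N p' q'))))"

text \<open>
  A map from the curve with function field \<open>F\<close> to projective \<open>N\<close>-space is a morphism if and only if it is
  given by a tuple of rational functions \<open>h\<close>, evaluated at each \<open>Q\<close> after scaling by some \<open>u\<close>.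
\<close>

definition curve_morphism ::
  "'a::field fn set \<Rightarrow> nat \<Rightarrow> ('a fn set \<Rightarrow> (nat \<Rightarrow> 'a) set) \<Rightarrow> bool" where
  "curve_morphism F N \<psi> \<longleftrightarrow>
     (\<exists>h. (\<forall>i\<le>N. h i \<in> F) \<and>
        (\<forall>Q\<in>points F. \<exists>u\<in>F - {0}. \<exists>a\<in>\<psi> Q. \<forall>i\<le>N. u * h i - fn_const (a i) \<in> max_ideal Q))"

text \<open>
  The Jacobian of the curve over \<open>k\<close> with function field \<open>fn_field y\<close> has good reduction at the place
  of \<open>k\<close> with valuation ring \<open>V\<close>: there is an abelian scheme over \<open>V\<close>, embedded in some projective
  space (abelian schemes over discrete valuation rings are projective), whose generic fibre is the
  Jacobian.  The latter means that there is a Galois equivariant isomorphism of groups \<open>\<phi>\<close> from degree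
  zero divisor classes to \<open>\<bar>k\<close>-points of the generic fibre for which the Abel-Jacobi maps are morphisms
  of varieties; by the Albanese property this determines the generic fibre up to isomorphism over \<open>k\<close>.
  The fibres of the model are then connected: the generic one because it is generated by the image of
  the curve, the special one by Zariski's connectedness theorem.
\<close>

definition good_reduction_Jac :: "'a::field set \<Rightarrow> 'a fn \<Rightarrow> 'a set \<Rightarrow> bool" where
  "good_reduction_Jac k y V \<longleftrightarrow>
     (\<exists>N r. \<exists>\<F> :: 'a mpol set. \<exists>\<phi> :: 'a divisor set \<Rightarrow> (nat \<Rightarrow> 'a) set.
        let F = fn_field y; J = Jac F; Z = proj_point N ` fibre_points N \<F> UNIV;
            \<psi> = the_inv_into (carrier J) \<phi>
        in finite \<F> \<and> (\<forall>H\<in>\<F>. H \<in> mpols V N \<and> (\<exists>d. homogeneous_in {..N} d H)) \<and>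
           r \<le> N \<and> smooth_over V N r \<F> \<and>
           bij_betw \<phi> (carrier J) Z \<and>
           extends_binary V N \<F> (\<lambda>P Q. \<phi> (\<psi> P \<otimes>\<^bsub>J\<^esub> \<psi> Q)) \<and>
           extends_unary V N \<F> (\<lambda>P. \<phi> (inv\<^bsub>J\<^esub> (\<psi> P))) \<and>
           (\<forall>\<sigma>\<in>absolute_Gal k. \<forall>a\<in>carrier J. \<phi> (Jac_act y \<sigma> a) = (\<lambda>p. \<sigma> \<circ> p) ` \<phi> a) \<and>
           (\<forall>P0\<in>points F.
              curve_morphism F N (\<lambda>Q. \<phi> (div_class F (\<lambda>R. point_div Q R - point_div P0 R)))))"


section \<open>The tower of superelliptic curves\<close>

text \<open>
  \<open>y\<close> is the coordinate on \<open>C\<^sub>n\<close>, so that \<open>y\<^sub>s = y ^ (l ^ (n - s))\<close> satisfies \<open>y\<^sub>s ^ (l ^ s) = f(x)\<close> and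
  \<open>y\<^bsub>s-1\<^esub> = y\<^sub>s ^ l\<close>.
\<close>

definition tower_coord :: "nat \<Rightarrow> nat \<Rightarrow> 'a::field fn \<Rightarrow> nat \<Rightarrow> 'a fn" where
  "tower_coord l n y s = y ^ (l ^ (n - s))"

definition tower_field :: "nat \<Rightarrow> nat \<Rightarrow> 'a::field fn \<Rightarrow> nat \<Rightarrow> 'a fn set" where
  "tower_field l n y s = fn_field (tower_coord l n y s)"

definition stratum :: "nat \<Rightarrow> 'a set \<Rightarrow> ('a \<Rightarrow> nat) \<Rightarrow> nat \<Rightarrow> 'a set" where
  "stratum l S e j = {\<xi>\<in>S. multiplicity l (e \<xi>) = j}"

definition strata_below :: "nat \<Rightarrow> 'a set \<Rightarrow> ('a \<Rightarrow> nat) \<Rightarrow> nat \<Rightarrow> 'a set" where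
  "strata_below l S e s = (\<Union>j<s. stratum l S e j)"

text \<open>The reduced fibre \<open>[\<xi>]\<^sub>s\<close>, on the curve with function field \<open>F\<close>.\<close>

definition fibre_div :: "'a::field fn set \<Rightarrow> 'a \<Rightarrow> 'a divisor" where
  "fibre_div F \<xi> = (\<lambda>Q. if Q \<in> points F \<and> Q \<inter> rational_fn_field = line_point \<xi> then 1 else 0)"

definition W_div0 ::
  "nat \<Rightarrow> nat \<Rightarrow> 'a::field fn \<Rightarrow> 'a set \<Rightarrow> ('a \<Rightarrow> nat) \<Rightarrow> nat \<Rightarrow> 'a divisor set" where
  "W_div0 l n y S e s =
     (let F = tower_field l n y s in
      generate (Div F) (fibre_div F ` strata_below l S e s) \<inter> carrier (Div0 F))"

text \<open>The \<open>\<bar>k\<close>-points of \<open>A\<^sub>s\<close>.\<close>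

definition A_quot :: "nat \<Rightarrow> nat \<Rightarrow> 'a::field fn \<Rightarrow> nat \<Rightarrow> 'a divisor set set monoid" where
  "A_quot l n y s =
     Jac (tower_field l n y s) Mod Jac_pullback (tower_field l n y (s - 1)) (tower_field l n y s)"

definition alpha ::
  "nat \<Rightarrow> nat \<Rightarrow> 'a::field fn \<Rightarrow> nat \<Rightarrow> 'a divisor \<Rightarrow> 'a divisor set set" where
  "alpha l n y s D =
     (let E = tower_field l n y (s - 1); F = tower_field l n y s
      in Jac_pullback E F #>\<^bsub>Jac F\<^esub> div_class F D)"

text \<open>A subset of the carrier of \<open>A_quot l n y s\<close>.\<close>

definition W_space ::
  "nat \<Rightarrow> nat \<Rightarrow> 'a::field fn \<Rightarrow> 'a set \<Rightarrow> ('a \<Rightarrow> nat) \<Rightarrow> nat \<Rightarrow> 'a divisor set set set" where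
  "W_space l n y S e s = alpha l n y s ` W_div0 l n y S e s"

end

theory Submission
  imports Defs
begin

text \<open>
  The points of the curve \<open>Y\<^sup>N = f(x)\<close> are made explicit by embedding its function field into Laurent
  series: over a point \<open>p\<close> of the line where \<open>f\<close> has order \<open>n\<close>, put \<open>g = gcd N n\<close>, \<open>e = N / g\<close> and
  \<open>m = n / g\<close>; there are \<open>g\<close> points over \<open>p\<close>, all of ramification index \<open>e\<close>, and \<open>y\<close> has order \<open>m\<close>.  If
  \<open>\<Sum> a\<^sub>\<xi> [\<xi>]\<^sub>s\<close> vanishes in \<open>A\<^sub>s\<close>, it is the sum of a pullback from \<open>C\<^bsub>s-1\<^esub>\<close> and the divisor of a
  function \<open>h\<close>, and the latter is invariant under the automorphisms \<open>y \<mapsto> \<zeta> y\<close> with \<open>\<zeta>\<^sup>l = 1\<close>.  Hence \<open>h\<close> is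
  a product of a power \<open>y\<^sup>i\<close> and a function on \<open>C\<^bsub>s-1\<^esub>\<close>, and comparing orders gives
  \<open>a\<^sub>\<xi> \<equiv> i m\<^sub>\<xi> (mod l)\<close> for all \<open>\<xi>\<close>.

  Therefore a Galois automorphism \<open>\<sigma>\<close> acting trivially on \<open>W\<^sub>s\<close> induces a permutation of \<open>S[<s]\<close> such that
  for every degree zero combination \<open>a\<close> the function \<open>a \<circ> \<sigma> - a\<close> is a multiple of \<open>m\<close> modulo \<open>l\<close>.
  As \<open>m\<^sub>\<xi>\<close> is never divisible by \<open>l\<close>, inserting the combinations supported on one or two roots shows that
  \<open>\<sigma>\<close> moves only elements of \<open>S[0]\<close>, and that a nontrivial \<open>\<sigma>\<close> exists only for \<open>#S[0] \<le> 4\<close>.  Since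
  \<open>\<infinity>\<close> is unramified, \<open>l\<^sup>n\<close> divides the degree of \<open>f\<close>, which limits \<open>l\<close> and \<open>s\<close> in the remaining cases.
  The group of these permutations has order \<open>d\<^sub>s\<close> by Artin's theorem.
\<close>

section \<open>Subfields of a type and their homomorphisms\<close>

text \<open>The geometry is reduced to averaging over roots of unity. Expanding a function at
  \<open>pt p c\<close> for all \<open>c\<close> in \<open>mu N\<close> and averaging with weights
  c^(-i) isolates its term in \<open>y ^ i\<close>, and the \<open>N\<close>-th power of a term is a
  rational function of x. Regularity on the curve thus becomes regularity on the line. This yields
  the constancy of everywhere regular functions and also the classification of the points, which are
  given only as abstract valuation rings. In the kernel computation the same averaging over
  \<open>mu l\<close> shows that the quotient of each term of h by h is regular, hence constant, so
  any nonzero term supplies the exponent i. The independence of the powers of y below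
  \<open>N\<close> over the rational functions rests on one root \<open>\<xi>\<^sub>0\<close> whose
  exponent is prime to l; it comes from the irreducibility of Y^(l^n) - f and serves all levels of
  the tower. On the arithmetic side, the stabilizer of the elements of W_s is an infinite subgroup
  of the absolute Galois group. Only its finite image in the permutations of S[<s] is counted, and
  Artin's theorem is applied to one lift of each permutation, so no topology on Galois groups
  enters.\<close>

lemma type_ring_simps [simp]:
  "carrier type_ring = UNIV"
  "x \<otimes>\<^bsub>type_ring\<^esub> y = x * y"
  "x \<oplus>\<^bsub>type_ring\<^esub> y = x + y"
  "\<one>\<^bsub>type_ring\<^esub> = 1"
  "\<zero>\<^bsub>type_ring\<^esub> = 0"
  by (simp_all add: ring_of_type_algebra_def)

lemma field_type_ring: "field (type_ring :: 'a::field ring)"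
  by (rule field_from_type_algebra)

lemma ring_type_ring: "ring (type_ring :: 'a::field ring)"
  by (rule ring_from_type_algebra)

lemma type_ring_minus [simp]: "\<ominus>\<^bsub>type_ring\<^esub> x = - (x :: 'a::field)"
proof -
  interpret field "type_ring :: 'a ring" by (rule field_type_ring)
  show ?thesis
    by (rule minus_equality) auto
qed

lemma type_ring_inv [simp]: "x \<noteq> 0 \<Longrightarrow> inv\<^bsub>type_ring\<^esub> x = inverse (x :: 'a::field)"
proof -
  interpret field "type_ring :: 'a ring" by (rule field_type_ring)
  show "x \<noteq> 0 \<Longrightarrow> inv\<^bsub>type_ring\<^esub> x = inverse x"
    by (rule comm_inv_char) auto
qed

lemma subring_type_ring_iff:
  "subring V (type_ring :: 'a::field ring) \<longleftrightarrow>
     1 \<in> V \<and> (\<forall>a\<in>V. - a \<in> V) \<and> (\<forall>a\<in>V. \<forall>b\<in>V. a + b \<in> V \<and> a * b \<in> V)"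
proof -
  interpret field "type_ring :: 'a ring" by (rule field_type_ring)
  show ?thesis
  proof
    assume V: "subring V type_ring"
    show "1 \<in> V \<and> (\<forall>a\<in>V. - a \<in> V) \<and> (\<forall>a\<in>V. \<forall>b\<in>V. a + b \<in> V \<and> a * b \<in> V)"
      using subringE(3,5,6,7)[OF V] by simp
  qed (intro subringI, simp_all)
qed

lemma subfield_type_ring_iff:
  "subfield K (type_ring :: 'a::field ring) \<longleftrightarrow>
     1 \<in> K \<and> (\<forall>a\<in>K. - a \<in> K \<and> inverse a \<in> K) \<and> (\<forall>a\<in>K. \<forall>b\<in>K. a + b \<in> K \<and> a * b \<in> K)"
proof -
  interpret field "type_ring :: 'a ring" by (rule field_type_ring)
  show ?thesis
  proof
    assume K: "subfield K type_ring"
    have "inverse a \<in> K" if "a \<in> K" for a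
      using subfield_m_inv(1)[OF K, of a] that by (cases "a = 0") auto
    thus "1 \<in> K \<and> (\<forall>a\<in>K. - a \<in> K \<and> inverse a \<in> K) \<and> (\<forall>a\<in>K. \<forall>b\<in>K. a + b \<in> K \<and> a * b \<in> K)"
      using subfieldE(1)[OF K] by (auto simp: subring_type_ring_iff)
  next
    assume *: "1 \<in> K \<and> (\<forall>a\<in>K. - a \<in> K \<and> inverse a \<in> K) \<and> (\<forall>a\<in>K. \<forall>b\<in>K. a + b \<in> K \<and> a * b \<in> K)"
    show "subfield K type_ring"
    proof (rule subfieldI')
      show "inv\<^bsub>type_ring\<^esub> k \<in> K" if "k \<in> K - {\<zero>\<^bsub>type_ring\<^esub>}" for k
        using that * by simp
    qed (use * in \<open>simp add: subring_type_ring_iff\<close>)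
  qed
qed

locale subfld =
  fixes K :: "'a::field set"
  assumes subfield: "subfield K type_ring"
begin

lemma one [simp, intro]: "1 \<in> K"
  and uminus [simp, intro]: "a \<in> K \<Longrightarrow> - a \<in> K"
  and inverse [simp, intro]: "a \<in> K \<Longrightarrow> inverse a \<in> K"
  and add [simp, intro]: "a \<in> K \<Longrightarrow> b \<in> K \<Longrightarrow> a + b \<in> K"
  and mult [simp, intro]: "a \<in> K \<Longrightarrow> b \<in> K \<Longrightarrow> a * b \<in> K"
  using subfield by (auto simp: subfield_type_ring_iff)

lemma diff [simp, intro]: "a \<in> K \<Longrightarrow> b \<in> K \<Longrightarrow> a - b \<in> K"
  using add[of a "- b"] by simp

lemma zero [simp, intro]: "0 \<in> K"
  using diff[OF one one] by simp

lemma divide [simp, intro]: "a \<in> K \<Longrightarrow> b \<in> K \<Longrightarrow> a / b \<in> K"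
  by (simp add: divide_inverse)

lemma power [simp, intro]: "a \<in> K \<Longrightarrow> a ^ n \<in> K"
  by (induction n) auto

lemma power_int [simp, intro]: "a \<in> K \<Longrightarrow> a powi n \<in> K"
  by (auto simp: power_int_def)

lemma sum [intro]: "(\<And>i. i \<in> A \<Longrightarrow> g i \<in> K) \<Longrightarrow> sum g A \<in> K"
  by (induction A rule: infinite_finite_induct) auto

lemma prod [intro]: "(\<And>i. i \<in> A \<Longrightarrow> g i \<in> K) \<Longrightarrow> prod g A \<in> K"
  by (induction A rule: infinite_finite_induct) auto

end

lemma subfld_generate_field: "subfld (generate_field type_ring H)"
proof -
  interpret field "type_ring :: 'a ring" by (rule field_type_ring)
  show ?thesis
    unfolding subfld_def by (rule generate_field_is_subfield) simp
qed

lemma generate_field_minimal: "subfld K \<Longrightarrow> H \<subseteq> K \<Longrightarrow> generate_field type_ring H \<subseteq> K"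
proof -
  interpret field "type_ring :: 'a ring" by (rule field_type_ring)
  show "subfld K \<Longrightarrow> H \<subseteq> K \<Longrightarrow> ?thesis"
    using generate_field_min_subfield1[of H K] by (simp add: subfld_def)
qed

text \<open>The laws are required on \<open>F\<close> only: elements of \<open>Gal\<close> and
  choices such as \<open>fn_aut\<close> are total functions with uncontrolled values outside their
  field.\<close>

locale fld_hom = subfld F for F :: "'a::field set" +
  fixes \<phi> :: "'a \<Rightarrow> 'b::field"
  assumes hom_add: "a \<in> F \<Longrightarrow> b \<in> F \<Longrightarrow> \<phi> (a + b) = \<phi> a + \<phi> b"
    and hom_mult: "a \<in> F \<Longrightarrow> b \<in> F \<Longrightarrow> \<phi> (a * b) = \<phi> a * \<phi> b"
    and hom_one [simp]: "\<phi> 1 = 1"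
begin

lemma hom_zero [simp]: "\<phi> 0 = 0"
  using hom_add[OF zero zero] by (metis add_cancel_right_left)

lemma hom_uminus: "a \<in> F \<Longrightarrow> \<phi> (- a) = - \<phi> a"
  using hom_add[of a "- a"] by (simp add: eq_neg_iff_add_eq_0 add.commute)

lemma hom_diff: "a \<in> F \<Longrightarrow> b \<in> F \<Longrightarrow> \<phi> (a - b) = \<phi> a - \<phi> b"
  using hom_add[of a "- b"] by (simp add: hom_uminus)

lemma hom_eq_0_iff [simp]: "a \<in> F \<Longrightarrow> \<phi> a = 0 \<longleftrightarrow> a = 0"
proof
  assume a: "a \<in> F" "\<phi> a = 0"
  show "a = 0"
  proof (rule ccontr)
    assume "a \<noteq> 0"
    thus False
      using hom_mult[of a "inverse a"] a by simp
  qed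
qed auto

lemma hom_inverse: "a \<in> F \<Longrightarrow> \<phi> (inverse a) = inverse (\<phi> a)"
  using hom_mult[of a "inverse a"] by (cases "a = 0") (auto simp: field_simps)

lemma hom_divide: "a \<in> F \<Longrightarrow> b \<in> F \<Longrightarrow> \<phi> (a / b) = \<phi> a / \<phi> b"
  by (simp add: divide_inverse hom_mult hom_inverse)

lemma hom_power: "a \<in> F \<Longrightarrow> \<phi> (a ^ n) = \<phi> a ^ n"
  by (induction n) (auto simp: hom_mult)

lemma hom_power_int: "a \<in> F \<Longrightarrow> \<phi> (a powi n) = \<phi> a powi n"
  by (auto simp: power_int_def hom_power hom_inverse)

lemma hom_sum: "(\<And>i. i \<in> A \<Longrightarrow> g i \<in> F) \<Longrightarrow> \<phi> (sum g A) = (\<Sum>i\<in>A. \<phi> (g i))"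
  by (induction A rule: infinite_finite_induct) (auto simp: hom_add sum)

lemma hom_prod: "(\<And>i. i \<in> A \<Longrightarrow> g i \<in> F) \<Longrightarrow> \<phi> (prod g A) = (\<Prod>i\<in>A. \<phi> (g i))"
  by (induction A rule: infinite_finite_induct) (auto simp: hom_mult prod)

lemma hom_inj: "inj_on \<phi> F"
proof (rule inj_onI)
  fix a b assume "a \<in> F" "b \<in> F" "\<phi> a = \<phi> b"
  thus "a = b"
    using hom_diff[of a b] hom_eq_0_iff[of "a - b"] by simp
qed

lemma subfld_eq:
  assumes "fld_hom F \<psi>"
  shows "subfld {z\<in>F. \<phi> z = \<psi> z}"
proof -
  interpret \<psi>: fld_hom F \<psi> by fact
  show ?thesis
    by (auto simp: subfld_def subfield_type_ring_iff hom_add hom_mult hom_uminus hom_inverse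
        \<psi>.hom_add \<psi>.hom_mult \<psi>.hom_uminus \<psi>.hom_inverse)
qed

lemma subfld_vimage:
  assumes "subfld E"
  shows "subfld {z\<in>F. \<phi> z \<in> E}"
proof -
  interpret E: subfld E by fact
  show ?thesis
    by (auto simp: subfld_def subfield_type_ring_iff hom_add hom_mult hom_uminus hom_inverse)
qed

lemma subfld_image:
  assumes "subfld E" "E \<subseteq> F"
  shows "subfld (\<phi> ` E)"
proof -
  interpret E: subfld E by fact
  have E: "a \<in> E \<Longrightarrow> a \<in> F" for a using assms(2) by auto
  have "1 \<in> \<phi> ` E" using E.one hom_one by (metis image_eqI)
  moreover have "- \<phi> a \<in> \<phi> ` E" "inverse (\<phi> a) \<in> \<phi> ` E" if "a \<in> E" for a
    using that E hom_uminus[of a] hom_inverse[of a] by (metis E.uminus E.inverse image_eqI)+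
  moreover have "\<phi> a + \<phi> b \<in> \<phi> ` E" "\<phi> a * \<phi> b \<in> \<phi> ` E" if "a \<in> E" "b \<in> E" for a b
    using that E hom_add[of a b] hom_mult[of a b] by (metis E.add E.mult image_eqI)+
  ultimately show ?thesis
    by (auto simp: subfld_def subfield_type_ring_iff)
qed

end

lemma fld_homI:
  assumes "subfld F" "\<And>a b. a \<in> F \<Longrightarrow> b \<in> F \<Longrightarrow> \<phi> (a + b) = \<phi> a + \<phi> b"
    "\<And>a b. a \<in> F \<Longrightarrow> b \<in> F \<Longrightarrow> \<phi> (a * b) = \<phi> a * \<phi> b" "\<phi> 1 = 1"
  shows "fld_hom F \<phi>"
  using assms by (simp add: fld_hom_def fld_hom_axioms_def)

lemma fld_hom_subset: "fld_hom F \<phi> \<Longrightarrow> subfld E \<Longrightarrow> E \<subseteq> F \<Longrightarrow> fld_hom E \<phi>"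
  by (auto simp: fld_hom_def fld_hom_axioms_def subset_iff)

lemma fld_hom_comp:
  assumes "fld_hom F \<phi>" "fld_hom E \<psi>" "\<phi> ` F \<subseteq> E"
  shows "fld_hom F (\<lambda>z. \<psi> (\<phi> z))"
proof -
  interpret \<phi>: fld_hom F \<phi> by fact
  interpret \<psi>: fld_hom E \<psi> by fact
  have "\<phi> z \<in> E" if "z \<in> F" for z using that assms(3) by auto
  thus ?thesis
    by (intro fld_homI) (auto simp: \<phi>.hom_add \<phi>.hom_mult \<psi>.hom_add \<psi>.hom_mult \<phi>.subfld_axioms)
qed

text \<open>The equalizer of two homomorphisms is a subfield, so it contains everything generated by
  a set on which they agree.\<close>

lemma fld_hom_eq_generate_field:
  assumes "fld_hom (generate_field type_ring H) \<phi>" "fld_hom (generate_field type_ring H) \<psi>"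
    and "\<And>z. z \<in> H \<Longrightarrow> \<phi> z = \<psi> z" and "z \<in> generate_field type_ring H"
  shows "\<phi> z = \<psi> z"
proof -
  have "H \<subseteq> {z\<in>generate_field type_ring H. \<phi> z = \<psi> z}"
    using assms(3) by (auto intro: generate_field.incl)
  from generate_field_minimal[OF fld_hom.subfld_eq[OF assms(1,2)] this] show ?thesis
    using assms(4) by auto
qed

lemma ring_iso_type_ring_iff:
  assumes "subfld F" "subfld E"
  shows "\<phi> \<in> ring_iso (type_ring\<lparr>carrier := F\<rparr>) (type_ring\<lparr>carrier := E\<rparr>) \<longleftrightarrow>
     fld_hom F \<phi> \<and> \<phi> ` F = E"
proof
  assume "\<phi> \<in> ring_iso (type_ring\<lparr>carrier := F\<rparr>) (type_ring\<lparr>carrier := E\<rparr>)"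
  thus "fld_hom F \<phi> \<and> \<phi> ` F = E"
    using assms(1) by (auto simp: ring_iso_def ring_hom_def bij_betw_def fld_hom_def fld_hom_axioms_def)
next
  assume *: "fld_hom F \<phi> \<and> \<phi> ` F = E"
  then interpret fld_hom F \<phi> by simp
  show "\<phi> \<in> ring_iso (type_ring\<lparr>carrier := F\<rparr>) (type_ring\<lparr>carrier := E\<rparr>)"
    using * hom_inj by (auto simp: ring_iso_def ring_hom_def bij_betw_def hom_add hom_mult)
qed

lemma Gal_iff:
  assumes "subfld L"
  shows "\<sigma> \<in> Gal K L \<longleftrightarrow> fld_hom L \<sigma> \<and> \<sigma> ` L = L \<and> (\<forall>z\<in>K. \<sigma> z = z)"
  by (auto simp: Gal_def ring_iso_type_ring_iff[OF assms assms])

lemma subfld_UNIV: "subfld UNIV"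
  by (simp add: subfld_def subfield_type_ring_iff)

lemma Gal_comp:
  assumes "subfld L" "\<sigma> \<in> Gal K L" "\<tau> \<in> Gal K L"
  shows "\<sigma> \<circ> \<tau> \<in> Gal K L"
  using assms(2,3) fld_hom_comp[of L \<tau> L \<sigma>]
  by (auto simp: Gal_iff[OF assms(1)] o_def simp flip: image_image)

lemma absolute_Gal_inv:
  assumes "\<sigma> \<in> absolute_Gal k"
  shows "bij \<sigma>" "inv_into UNIV \<sigma> \<in> absolute_Gal k"
proof -
  interpret fld_hom UNIV \<sigma> using assms by (simp add: Gal_iff subfld_UNIV)
  show b: "bij \<sigma>"
    using assms hom_inj by (simp add: bij_def Gal_iff subfld_UNIV)
  have s: "\<sigma> (inv_into UNIV \<sigma> z) = z" for z
    using b by (simp add: bij_is_surj surj_f_inv_f)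
  have eqI: "inv_into UNIV \<sigma> a = b" if "a = \<sigma> b" for a b
    using b that by (simp add: bij_is_inj)
  have "fld_hom UNIV (inv_into UNIV \<sigma>)"
    by (intro fld_homI subfld_UNIV eqI) (simp_all add: hom_add hom_mult s)
  moreover have "inv_into UNIV \<sigma> z = z" if "z \<in> k" for z
    using assms that by (intro eqI) (simp add: Gal_iff subfld_UNIV)
  ultimately show "inv_into UNIV \<sigma> \<in> absolute_Gal k"
    using b by (simp add: Gal_iff subfld_UNIV bij_imp_bij_inv bij_is_surj)
qed

hide_const (open) Polynomials.degree Polynomials.lead_coeff

section \<open>Artin's theorem\<close>

text \<open>Dropping each element that lies in the span of the later ones leaves an independent
  list. A dimension is certified by a list that is independent and spans.\<close>

lemma (in ring) spanning_list_base:
  assumes K: "subfield K R" and "set Us \<subseteq> carrier R"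
  shows "\<exists>Vs. independent K Vs \<and> Span K Vs = Span K Us \<and> length Vs \<le> length Us"
  using assms(2)
proof (induction Us)
  case Nil
  show ?case by (rule exI[of _ "[]"]) simp
next
  case (Cons u Us)
  then obtain Vs where Vs: "independent K Vs" "Span K Vs = Span K Us" "length Vs \<le> length Us"
    by auto
  have car: "set Vs \<subseteq> carrier R" "u \<in> carrier R" "set Us \<subseteq> carrier R"
    using Vs(1) Cons(2) independent_in_carrier by auto
  show ?case
  proof (cases "u \<in> Span K Us")
    case True
    hence "Span K (u # Us) = Span K Us"
      using Span_base_incl[OF K car(3)] mono_Span_subset[OF K _ car(3), of "u # Us"]
        mono_Span[OF K car(3,2)] by auto
    thus ?thesis using Vs by (intro exI[of _ Vs]) simp
  next
    case False
    hence "Span K (u # Vs) = Span K (u # Us)" "independent K (u # Vs)"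
      using li_Cons[of u K Vs] car Vs by auto
    thus ?thesis using Vs(3) by (intro exI[of _ "u # Vs"]) simp
  qed
qed

lemma combine_type_ring:
  "ring.combine (type_ring :: 'a::field ring) (map k xs) (map v xs) = (\<Sum>i\<leftarrow>xs. k i * v i)"
proof -
  interpret field "type_ring :: 'a ring" by (rule field_type_ring)
  show ?thesis by (induction xs) auto
qed

text \<open>Two families are used because in Artin's theorem the powers of a suitable element are
  visibly independent, while the Lagrange coefficients visibly span. Both have \<open>d\<close>
  members, so a basis extracted from \<open>v\<close> must have exactly \<open>d\<close>.\<close>

lemma (in subfld) dimension_type_ringI:
  fixes u v :: "nat \<Rightarrow> 'a"
  assumes E: "subfld E" "\<And>i. i < d \<Longrightarrow> v i \<in> E" "K \<subseteq> E"
    and u: "\<And>i. i < d \<Longrightarrow> u i \<in> E"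
    and ind: "\<And>k. (\<And>i. i < d \<Longrightarrow> k i \<in> K) \<Longrightarrow> (\<Sum>i<d. k i * u i) = 0 \<Longrightarrow> \<forall>i<d. k i = 0"
    and span: "\<And>b. b \<in> E \<Longrightarrow> \<exists>k. (\<forall>i<d. k i \<in> K) \<and> b = (\<Sum>i<d. k i * v i)"
  shows "ring.dimension type_ring d K E"
proof -
  interpret R: field "type_ring :: 'a ring" by (rule field_type_ring)
  interpret E: subfld E by fact
  have list: "\<exists>k. Ks = map k [0..<d]" if "length Ks = d" for Ks :: "'a list"
    using that map_nth[of Ks] by (intro exI[of _ "(!) Ks"]) simp
  have comb: "R.combine (map k [0..<d]) (map w [0..<d]) = (\<Sum>i<d. k i * w i)" for k w
    by (simp add: combine_type_ring sum_list_sum_nth atLeast0LessThan)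
  have span_iff: "R.Span K (map w [0..<d]) = {\<Sum>i<d. k i * w i | k. \<forall>i<d. k i \<in> K}" for w
  proof -
    have "R.Span K (map w [0..<d]) =
        {R.combine Ks (map w [0..<d]) | Ks. length Ks = d \<and> set Ks \<subseteq> K}"
      using R.Span_eq_combine_set_length_version[OF subfield, of "map w [0..<d]"] by simp
    also have "\<dots> = {\<Sum>i<d. k i * w i | k. \<forall>i<d. k i \<in> K}"
    proof (intro equalityI subsetI)
      fix z assume "z \<in> {R.combine Ks (map w [0..<d]) | Ks. length Ks = d \<and> set Ks \<subseteq> K}"
      then obtain Ks where Ks: "z = R.combine Ks (map w [0..<d])" "length Ks = d" "set Ks \<subseteq> K" by auto
      then obtain k where k: "Ks = map k [0..<d]" using list by blast
      thus "z \<in> {\<Sum>i<d. k i * w i | k. \<forall>i<d. k i \<in> K}"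
        using Ks comb[of k w] by (intro CollectI exI[of _ k]) auto
    next
      fix z assume "z \<in> {\<Sum>i<d. k i * w i | k. \<forall>i<d. k i \<in> K}"
      then obtain k where k: "z = (\<Sum>i<d. k i * w i)" "\<forall>i<d. k i \<in> K" by auto
      thus "z \<in> {R.combine Ks (map w [0..<d]) | Ks. length Ks = d \<and> set Ks \<subseteq> K}"
        using comb[of k w] by (intro CollectI exI[of _ "map k [0..<d]"]) auto
    qed
    finally show ?thesis .
  qed
  have "R.independent K (map u [0..<d])"
  proof (rule R.trivial_combine_imp_independent[OF subfield])
    fix Ks assume Ks: "set Ks \<subseteq> K" "R.combine Ks (map u [0..<d]) = \<zero>\<^bsub>type_ring\<^esub>"
    have car: "set Ks \<subseteq> carrier type_ring" "set (map u [0..<d]) \<subseteq> carrier type_ring" by simp_all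
    obtain Ks' where Ks': "set (take d Ks) \<subseteq> set Ks'" "set Ks' \<subseteq> set (take d Ks) \<union> {0}"
        "length Ks' = d" "R.combine Ks' (map u [0..<d]) = 0"
      using R.combine_normalize[OF car Ks(2)] by auto
    obtain k where k: "Ks' = map k [0..<d]" using list[OF Ks'(3)] by blast
    have "set Ks' \<subseteq> K"
      using Ks'(2) Ks(1) set_take_subset[of d Ks] zero by blast
    hence "k i \<in> K" if "i < d" for i using that by (auto simp: k)
    moreover have "(\<Sum>i<d. k i * u i) = 0" using Ks'(4) by (simp add: k comb)
    ultimately have "\<forall>i<d. k i = 0" using ind by blast
    hence "set Ks' \<subseteq> {0}" by (auto simp: k)
    thus "set (take (length (map u [0..<d])) Ks) \<subseteq> {\<zero>\<^bsub>type_ring\<^esub>}"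
      using Ks'(1) by simp
  qed simp
  obtain Vs where Vs: "R.independent K Vs" "R.Span K Vs = R.Span K (map v [0..<d])" "length Vs \<le> d"
    using R.spanning_list_base[OF subfield, of "map v [0..<d]"] by auto
  have spanE: "R.Span K (map v [0..<d]) = E"
    unfolding span_iff
  proof (intro equalityI subsetI)
    fix z assume "z \<in> {\<Sum>i<d. k i * v i | k. \<forall>i<d. k i \<in> K}"
    then obtain k where "z = (\<Sum>i<d. k i * v i)" "\<forall>i<d. k i \<in> K" by blast
    thus "z \<in> E" using E(2,3) by (auto intro!: E.sum E.mult)
  next
    fix z assume "z \<in> E"
    from span[OF this] show "z \<in> {\<Sum>i<d. k i * v i | k. \<forall>i<d. k i \<in> K}" by blast
  qed
  have "set (map u [0..<d]) \<subseteq> R.Span K Vs"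
    using u Vs(2) spanE by (auto simp del: R.Span.simps)
  hence "length (map u [0..<d]) \<le> length Vs"
    using R.independent_length_le[OF subfield \<open>R.independent K (map u [0..<d])\<close> Vs(1)] u Vs(2) spanE by auto
  hence "length Vs = d" using Vs(3) by simp
  thus ?thesis
    using R.dimensionI[OF subfield Vs(1) Vs(2)] spanE by simp
qed

lemma (in subfld) coeff_prod_linear:
  "finite A \<Longrightarrow> (\<And>a. a \<in> A \<Longrightarrow> g a \<in> K) \<Longrightarrow> Polynomial.coeff (\<Prod>a\<in>A. [:- g a, 1:]) i \<in> K"
proof (induction A arbitrary: i rule: finite_induct)
  case empty
  show ?case by (cases i) (auto simp: coeff_1)
next
  case (insert a A)
  thus ?case by (cases i) (auto simp: coeff_pCons)
qed

text \<open>
  Evaluating \<open>\<Sum>\<^sub>i (\<sigma> t\<^sub>i - \<tau> t\<^sub>i) X\<^sup>i\<close> at a natural number avoiding the finitely many roots gives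
  an element with distinct conjugates.
\<close>

lemma distinct_conjugates:
  fixes T :: "'a::field_char_0 set" and R :: "('a \<Rightarrow> 'a) set"
  assumes L: "subfld L" and T: "finite T" "T \<subseteq> L" and R: "finite R"
    and hom: "\<And>\<sigma>. \<sigma> \<in> R \<Longrightarrow> fld_hom L \<sigma>"
    and dist: "\<And>\<sigma> \<tau>. \<sigma> \<in> R \<Longrightarrow> \<tau> \<in> R \<Longrightarrow> \<sigma> \<noteq> \<tau> \<Longrightarrow> \<exists>t\<in>T. \<sigma> t \<noteq> \<tau> t"
  obtains \<theta> where "\<theta> \<in> L" "inj_on (\<lambda>\<sigma>. \<sigma> \<theta>) R"
proof -
  interpret subfld L by fact
  obtain t where t: "bij_betw t {..<card T} T"
    using ex_bij_betw_nat_finite[OF T(1)] by (auto simp: atLeast0LessThan)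
  have tT: "t i \<in> L" if "i < card T" for i
    using t T(2) that by (auto simp: bij_betw_def)
  define p where "p = (\<lambda>\<sigma> \<tau>. \<Sum>i<card T. Polynomial.monom (\<sigma> (t i) - \<tau> (t i) :: 'a) i)"
  have p_nz: "p \<sigma> \<tau> \<noteq> 0" if st: "\<sigma> \<in> R" "\<tau> \<in> R" "\<sigma> \<noteq> \<tau>" for \<sigma> \<tau>
  proof -
    obtain i where i: "i < card T" "\<sigma> (t i) \<noteq> \<tau> (t i)"
      using dist[OF st] t unfolding bij_betw_def by (metis imageE lessThan_iff)
    have "Polynomial.coeff (p \<sigma> \<tau>) i = \<sigma> (t i) - \<tau> (t i)"
      using i(1) by (simp add: p_def coeff_sum)
    thus ?thesis using i by auto
  qed
  define B where "B = (\<Union>(\<sigma>, \<tau>)\<in>{(\<sigma>, \<tau>). \<sigma> \<in> R \<and> \<tau> \<in> R \<and> \<sigma> \<noteq> \<tau>}. {z. poly (p \<sigma> \<tau>) z = 0})"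
  have "finite {(\<sigma>, \<tau>). \<sigma> \<in> R \<and> \<tau> \<in> R \<and> \<sigma> \<noteq> \<tau>}"
    by (rule finite_subset[of _ "R \<times> R"]) (use R in auto)
  hence "finite B"
    unfolding B_def using p_nz by (auto intro: poly_roots_finite)
  moreover have "infinite (range (of_nat :: nat \<Rightarrow> 'a))"
    by (simp add: range_inj_infinite inj_of_nat)
  ultimately obtain n :: nat where n: "(of_nat n :: 'a) \<notin> B"
    by (metis finite_subset image_subsetI)
  define \<theta> where "\<theta> = (\<Sum>i<card T. of_nat n ^ i * t i)"
  have nL: "of_nat n \<in> L" by (induction n) auto
  have "\<theta> \<in> L"
    unfolding \<theta>_def using nL tT by (auto intro!: sum)
  moreover have "\<sigma> \<theta> \<noteq> \<tau> \<theta>" if "\<sigma> \<in> R" "\<tau> \<in> R" "\<sigma> \<noteq> \<tau>" for \<sigma> \<tau>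
  proof -
    have *: "\<rho> \<theta> = (\<Sum>i<card T. of_nat n ^ i * \<rho> (t i))" if "\<rho> \<in> R" for \<rho>
    proof -
      interpret \<rho>: fld_hom L \<rho> using hom that .
      have of_nat: "of_nat m \<in> L \<and> \<rho> (of_nat m) = of_nat m" for m
        by (induction m) (auto simp: \<rho>.hom_add)
      have "\<rho> \<theta> = (\<Sum>i<card T. \<rho> (of_nat n ^ i * t i))"
        unfolding \<theta>_def using nL tT by (intro \<rho>.hom_sum) auto
      thus ?thesis
        using nL tT of_nat by (simp add: \<rho>.hom_mult \<rho>.hom_power)
    qed
    have "\<sigma> \<theta> - \<tau> \<theta> = poly (p \<sigma> \<tau>) (of_nat n)"
      by (simp add: * that p_def poly_sum poly_monom algebra_simps sum_subtractf)
    moreover have "poly (p \<sigma> \<tau>) (of_nat n) \<noteq> 0"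
      using n that by (auto simp: B_def)
    ultimately show ?thesis by auto
  qed
  ultimately show ?thesis using that by (force simp: inj_on_def)
qed

text \<open>
  The coefficients \<open>v\<^sub>i\<close> of the Lagrange polynomial which is \<open>1\<close> at \<open>\<theta>\<close> and \<open>0\<close> at its other
  conjugates satisfy \<open>b = \<Sum>\<^sub>i Tr(b \<theta>\<^sup>i) v\<^sub>i\<close>.
\<close>

theorem artin:
  fixes T :: "'a::field_char_0 set" and H :: "('a \<Rightarrow> 'a) set"
  assumes L: "subfld L" and T: "finite T" "T \<subseteq> L"
    and hom: "\<And>\<sigma>. \<sigma> \<in> H \<Longrightarrow> fld_hom L \<sigma>" and onto: "\<And>\<sigma>. \<sigma> \<in> H \<Longrightarrow> \<sigma> ` L = L"
    and perm: "\<And>\<sigma>. \<sigma> \<in> H \<Longrightarrow> \<sigma> ` T = T"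
    and id: "id \<in> H" and comp: "\<And>\<sigma> \<tau>. \<sigma> \<in> H \<Longrightarrow> \<tau> \<in> H \<Longrightarrow> \<sigma> \<circ> \<tau> \<in> H"
    and faithful: "\<And>\<sigma> \<tau> z. \<sigma> \<in> H \<Longrightarrow> \<tau> \<in> H \<Longrightarrow> (\<And>t. t \<in> T \<Longrightarrow> \<sigma> t = \<tau> t) \<Longrightarrow> z \<in> L \<Longrightarrow> \<sigma> z = \<tau> z"
    and M: "M = {z\<in>L. \<forall>\<sigma>\<in>H. \<sigma> z = z}"
  defines "\<Gamma> \<equiv> (\<lambda>\<sigma>. restrict \<sigma> T) ` H"
  shows "galois_extension M L" "finite_extension M L" "ext_degree M L = card \<Gamma>"
proof -
  interpret L: subfld L by fact
  have "\<Gamma> \<subseteq> T \<rightarrow>\<^sub>E T"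
  proof
    fix \<gamma> assume "\<gamma> \<in> \<Gamma>"
    then obtain \<sigma> where "\<sigma> \<in> H" "\<gamma> = restrict \<sigma> T" by (auto simp: \<Gamma>_def)
    thus "\<gamma> \<in> T \<rightarrow>\<^sub>E T" using perm[of \<sigma>] by auto
  qed
  hence fin: "finite \<Gamma>"
    by (rule finite_subset) (simp add: T(1) finite_PiE)
  \<comment> \<open>\<open>H\<close> may be infinite, with many elements inducing the same
    permutation of \<open>T\<close>. One lift per permutation gives the finite set \<open>R\<close>
    over which traces are summed; it is closed under composition only up to agreement on
    \<open>L\<close>.\<close>
  define rep where "rep = inv_into H (\<lambda>\<sigma>. restrict \<sigma> T)"
  have rep: "rep \<gamma> \<in> H" "restrict (rep \<gamma>) T = \<gamma>" if "\<gamma> \<in> \<Gamma>" for \<gamma>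
    using that f_inv_into_f[of \<gamma> "\<lambda>\<sigma>. restrict \<sigma> T" H] inv_into_into[of \<gamma> "\<lambda>\<sigma>. restrict \<sigma> T" H]
    by (simp_all add: \<Gamma>_def rep_def)
  define R where "R = rep ` \<Gamma>"
  have R_fin: "finite R" using fin by (simp add: R_def)
  have R_H: "\<sigma> \<in> H" if "\<sigma> \<in> R" for \<sigma> using that rep by (auto simp: R_def)
  have "inj_on rep \<Gamma>" using rep(2) by (metis inj_onI)
  hence R_card: "card R = card \<Gamma>" by (simp add: R_def card_image)
  have R_eq: "\<sigma> = \<tau>" if "\<sigma> \<in> R" "\<tau> \<in> R" "\<And>t. t \<in> T \<Longrightarrow> \<sigma> t = \<tau> t" for \<sigma> \<tau>
  proof -
    have "restrict \<sigma> T = restrict \<tau> T" using that(3) by auto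
    thus ?thesis using that(1,2) rep(2) by (auto simp: R_def)
  qed
  have R_ex: "\<exists>\<tau>\<in>R. \<forall>z\<in>L. \<tau> z = \<sigma> z" if "\<sigma> \<in> H" for \<sigma>
  proof (rule bexI, rule ballI)
    have g: "restrict \<sigma> T \<in> \<Gamma>" using that by (simp add: \<Gamma>_def)
    show "rep (restrict \<sigma> T) \<in> R" using g by (simp add: R_def)
    fix z assume "z \<in> L"
    show "rep (restrict \<sigma> T) z = \<sigma> z"
    proof (rule faithful[OF rep(1)[OF g] that _ \<open>z \<in> L\<close>])
      fix t assume "t \<in> T"
      thus "rep (restrict \<sigma> T) t = \<sigma> t" using rep(2)[OF g] by (metis restrict_apply')
    qed
  qed
  have R_closed: "\<sigma> z \<in> L" if "\<sigma> \<in> H" "z \<in> L" for \<sigma> z using onto that by blast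
  have M_sub: "M \<subseteq> L" by (auto simp: M)
  have M_subfld: "subfld M"
    unfolding subfld_def subfield_type_ring_iff M
    by (auto simp: fld_hom.hom_one[OF hom] fld_hom.hom_uminus[OF hom] fld_hom.hom_inverse[OF hom]
        fld_hom.hom_add[OF hom] fld_hom.hom_mult[OF hom])
  interpret M: subfld M by fact

  have trace: "(\<Sum>\<tau>\<in>R. \<tau> z) \<in> M" if z: "z \<in> L" for z
    unfolding M
  proof (intro CollectI conjI ballI)
    show "(\<Sum>\<tau>\<in>R. \<tau> z) \<in> L" using z R_closed R_H by (auto intro: L.sum)
    fix \<sigma> assume \<sigma>: "\<sigma> \<in> H"
    interpret \<sigma>: fld_hom L \<sigma> using hom[OF \<sigma>] .
    \<comment> \<open>Composing with \<open>\<sigma>\<close> and passing back to representatives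
      permutes \<open>R\<close>, so it only rearranges the trace.\<close>
    have "\<exists>\<tau>'\<in>R. \<forall>w\<in>L. \<tau>' w = \<sigma> (\<tau> w)" if "\<tau> \<in> R" for \<tau>
      using R_ex[OF comp[OF \<sigma> R_H[OF that]]] by simp
    then obtain \<rho> where \<rho>: "\<And>\<tau>. \<tau> \<in> R \<Longrightarrow> \<rho> \<tau> \<in> R" "\<And>\<tau> w. \<tau> \<in> R \<Longrightarrow> w \<in> L \<Longrightarrow> \<rho> \<tau> w = \<sigma> (\<tau> w)"
      by metis
    have "inj_on \<rho> R"
    proof (rule inj_onI)
      fix \<tau> \<tau>' assume *: "\<tau> \<in> R" "\<tau>' \<in> R" "\<rho> \<tau> = \<rho> \<tau>'"
      have "\<tau> t = \<tau>' t" if "t \<in> T" for t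
      proof -
        have tL: "t \<in> L" using that T by auto
        hence "\<sigma> (\<tau> t) = \<sigma> (\<tau>' t)" using * \<rho>(2) by metis
        thus ?thesis
          using \<sigma>.hom_inj R_closed R_H * tL by (meson inj_onD)
      qed
      thus "\<tau> = \<tau>'" using R_eq * by blast
    qed
    hence "bij_betw \<rho> R R"
      using \<rho>(1) R_fin by (metis bij_betw_def endo_inj_surj image_subsetI)
    have "\<sigma> (\<Sum>\<tau>\<in>R. \<tau> z) = (\<Sum>\<tau>\<in>R. \<sigma> (\<tau> z))"
      using z R_closed R_H by (intro \<sigma>.hom_sum) auto
    also have "\<dots> = (\<Sum>\<tau>\<in>R. \<rho> \<tau> z)" using \<rho>(2) z by simp
    also have "\<dots> = (\<Sum>\<tau>\<in>R. \<tau> z)"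
      using sum.reindex_bij_betw[OF \<open>bij_betw \<rho> R R\<close>, of "\<lambda>\<tau>. \<tau> z"] by simp
    finally show "\<sigma> (\<Sum>\<tau>\<in>R. \<tau> z) = (\<Sum>\<tau>\<in>R. \<tau> z)" .
  qed

  obtain \<theta> where \<theta>: "\<theta> \<in> L" "inj_on (\<lambda>\<sigma>. \<sigma> \<theta>) R"
    using distinct_conjugates[OF L T R_fin hom[OF R_H]] R_eq by metis
  \<comment> \<open>The representative of the identity permutation need not be \<open>id\<close>; it
    agrees with \<open>id\<close> on \<open>L\<close>.\<close>
  obtain \<iota> where \<iota>: "\<iota> \<in> R" "\<And>z. z \<in> L \<Longrightarrow> \<iota> z = z"
    using R_ex[OF id] by auto
  have \<theta>_neq: "\<theta> \<noteq> \<tau> \<theta>" if "\<tau> \<in> R - {\<iota>}" for \<tau>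
    using \<theta> \<iota>(1) \<iota>(2)[of \<theta>] that by (metis DiffE inj_onD insertI1)
  define d where "d = card R"
  define \<Lambda> where "\<Lambda> = Polynomial.smult (inverse (\<Prod>\<tau>\<in>R - {\<iota>}. \<theta> - \<tau> \<theta>)) (\<Prod>\<tau>\<in>R - {\<iota>}. [:- \<tau> \<theta>, 1:])"
  define v where "v = Polynomial.coeff \<Lambda>"
  have vL: "v i \<in> L" for i
    unfolding v_def \<Lambda>_def coeff_smult using \<theta> R_fin R_closed R_H
    by (intro L.mult L.inverse L.prod L.diff L.coeff_prod_linear) auto
  have d_pos: "d > 0" using \<iota>(1) R_fin by (auto simp: d_def card_gt_0_iff)
  have deg: "Polynomial.degree \<Lambda> < d"
  proof -
    have "Polynomial.degree \<Lambda> \<le> Polynomial.degree (\<Prod>\<tau>\<in>R - {\<iota>}. [:- \<tau> \<theta>, 1:])"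
      unfolding \<Lambda>_def by (rule degree_smult_le)
    also have "\<dots> \<le> (\<Sum>\<tau>\<in>R - {\<iota>}. Polynomial.degree [:- \<tau> \<theta>, 1:])"
      using degree_prod_sum_le[of "R - {\<iota>}" "\<lambda>\<tau>. [:- \<tau> \<theta>, 1:]"] R_fin by (simp only: o_def finite_Diff)
    also have "\<dots> = card (R - {\<iota>})" by simp
    also have "\<dots> < d" using card_Diff1_less[OF R_fin \<iota>(1)] by (simp only: d_def)
    finally show ?thesis .
  qed
  have lagrange: "(\<Sum>i<d. v i * \<tau> \<theta> ^ i) = (if \<tau> = \<iota> then 1 else 0)" if "\<tau> \<in> R" for \<tau>
  proof -
    have "(\<Sum>i<d. v i * \<tau> \<theta> ^ i) = poly \<Lambda> (\<tau> \<theta>)"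
      unfolding v_def poly_altdef using deg
      by (intro sum.mono_neutral_right) (auto simp: coeff_eq_0)
    also have "\<dots> = inverse (\<Prod>\<tau>'\<in>R - {\<iota>}. \<theta> - \<tau>' \<theta>) * (\<Prod>\<tau>'\<in>R - {\<iota>}. \<tau> \<theta> - \<tau>' \<theta>)"
      by (simp add: \<Lambda>_def poly_prod)
    also have "\<dots> = (if \<tau> = \<iota> then 1 else 0)"
    proof (cases "\<tau> = \<iota>")
      case True
      have "(\<Prod>\<tau>'\<in>R - {\<iota>}. \<theta> - \<tau>' \<theta>) \<noteq> 0"
        using R_fin \<theta>_neq by (simp add: prod_zero_iff)
      thus ?thesis using True \<iota>(2)[OF \<theta>(1)] by simp
    next
      case False
      hence "\<tau> \<in> R - {\<iota>}" using \<open>\<tau> \<in> R\<close> by simp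
      hence "(\<Prod>\<tau>'\<in>R - {\<iota>}. \<tau> \<theta> - \<tau>' \<theta>) = 0"
        using R_fin by (intro prod_zero) auto
      thus ?thesis using False by simp
    qed
    finally show ?thesis .
  qed
  have span: "\<exists>k. (\<forall>i<d. k i \<in> M) \<and> b = (\<Sum>i<d. k i * v i)" if b: "b \<in> L" for b
  proof (intro exI conjI allI impI)
    show "(\<Sum>\<tau>\<in>R. \<tau> (b * \<theta> ^ i)) \<in> M" for i using b \<theta> by (intro trace) auto
    have "(\<Sum>i<d. (\<Sum>\<tau>\<in>R. \<tau> (b * \<theta> ^ i)) * v i) = (\<Sum>i<d. \<Sum>\<tau>\<in>R. \<tau> b * (v i * \<tau> \<theta> ^ i))"
      unfolding sum_distrib_right using b \<theta> R_H
      by (intro sum.cong refl) (auto simp: fld_hom.hom_mult[OF hom] fld_hom.hom_power[OF hom])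
    also have "\<dots> = (\<Sum>\<tau>\<in>R. \<tau> b * (\<Sum>i<d. v i * \<tau> \<theta> ^ i))"
      by (subst sum.swap) (simp add: sum_distrib_left)
    also have "\<dots> = (\<Sum>\<tau>\<in>R. if \<tau> = \<iota> then \<tau> b else 0)"
      by (intro sum.cong refl) (auto simp: lagrange)
    also have "\<dots> = b" using R_fin \<iota> b by simp
    finally show "b = (\<Sum>i<d. (\<Sum>\<tau>\<in>R. \<tau> (b * \<theta> ^ i)) * v i)" ..
  qed
  \<comment> \<open>The coefficients of a relation are fixed by all of \<open>R\<close>, so the
    polynomial \<open>q\<close> vanishes at all \<open>d\<close> distinct conjugates of
    \<open>\<theta>\<close> although its degree is below \<open>d\<close>.\<close>
  have ind: "\<forall>i<d. k i = 0" if k: "\<And>i. i < d \<Longrightarrow> k i \<in> M" and 0: "(\<Sum>i<d. k i * \<theta> ^ i) = 0" for k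
  proof -
    define q where "q = (\<Sum>i<d. Polynomial.monom (k i) i)"
    have q_coeff: "Polynomial.coeff q i = (if i < d then k i else 0)" for i
      by (simp add: q_def coeff_sum)
    have "poly q (\<tau> \<theta>) = 0" if "\<tau> \<in> R" for \<tau>
    proof -
      interpret \<tau>: fld_hom L \<tau> using hom[OF R_H[OF that]] .
      have "\<tau> (\<Sum>i<d. k i * \<theta> ^ i) = (\<Sum>i<d. \<tau> (k i * \<theta> ^ i))"
        using k M_sub \<theta> by (intro \<tau>.hom_sum) auto
      also have "\<dots> = (\<Sum>i<d. k i * \<tau> \<theta> ^ i)"
        using k M_sub \<theta> R_H[OF that] by (intro sum.cong) (auto simp: \<tau>.hom_mult \<tau>.hom_power M subset_iff)
      finally show ?thesis by (simp add: 0 q_def poly_sum poly_monom)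
    qed
    hence sub: "(\<lambda>\<sigma>. \<sigma> \<theta>) ` R \<subseteq> {z. poly q z = 0}" by auto
    have "q = 0"
    proof (rule ccontr)
      assume q: "q \<noteq> 0"
      have "d = card ((\<lambda>\<sigma>. \<sigma> \<theta>) ` R)" using \<theta>(2) by (simp add: d_def card_image)
      also have "\<dots> \<le> card {z. poly q z = 0}" by (intro card_mono poly_roots_finite q sub)
      also have "\<dots> \<le> Polynomial.degree q" by (rule card_poly_roots_bound[OF q])
      also have "\<dots> < d"
      proof -
        have "Polynomial.coeff q (Polynomial.degree q) \<noteq> 0" using q by simp
        thus ?thesis unfolding q_coeff by (auto split: if_splits)
      qed
      finally show False by simp
    qed
    thus ?thesis using q_coeff by (metis coeff_0)
  qed
  have dim: "ring.dimension type_ring d M L"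
    by (rule M.dimension_type_ringI[where u = "\<lambda>i. \<theta> ^ i" and v = v])
       (use L M_sub \<theta> vL ind span in auto)
  interpret T: field "type_ring :: 'a ring" by (rule field_type_ring)
  show "ext_degree M L = card \<Gamma>"
    using T.dimI[OF M.subfield dim] by (simp add: ext_degree_def d_def R_card over_def)
  have fd: "T.finite_dimension M L" using dim by (rule T.finite_dimensionI)
  have alg: "algebraic_extension M L"
    unfolding algebraic_extension_def
    using T.finite_dimension_imp_algebraic[OF M.subfield subfieldE(1)[OF L.subfield] fd] M.subfield L.subfield M_sub
    by (simp add: over_def)
  show "finite_extension M L" using alg fd by (simp add: finite_extension_def)
  have M_iff: "z \<in> M \<longleftrightarrow> z \<in> L \<and> (\<forall>\<sigma>\<in>H. \<sigma> z = z)" for z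
    by (simp add: M)
  have H_Gal: "\<sigma> \<in> Gal M L" if "\<sigma> \<in> H" for \<sigma>
    using hom[OF that] onto[OF that] that by (simp add: Gal_iff[OF L] M_iff)
  have Gal_fix: "\<sigma> z = z" if "\<sigma> \<in> Gal M L" "z \<in> M" for \<sigma> z
    using that by (simp add: Gal_iff[OF L])
  have "{z\<in>L. \<forall>\<sigma>\<in>Gal M L. \<sigma> z = z} = M"
  proof (intro equalityI subsetI)
    fix z assume "z \<in> {z\<in>L. \<forall>\<sigma>\<in>Gal M L. \<sigma> z = z}"
    thus "z \<in> M" unfolding M_iff using H_Gal by blast
  next
    fix z assume "z \<in> M"
    thus "z \<in> {z\<in>L. \<forall>\<sigma>\<in>Gal M L. \<sigma> z = z}" using Gal_fix M_sub by blast
  qed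
  thus "galois_extension M L" using alg by (simp add: galois_extension_def)
qed

section \<open>Permutations acting trivially on a quotient of a sum-zero space\<close>

text \<open>The combinatorial core, without curves. \<open>T\<close> is S[<s] and
  \<open>S\<^sub>0\<close> is S[0]; \<open>m \<xi>\<close> is the order of y_s at the points over
  \<xi>, and \<open>w \<xi>\<close> is the number of these points, so that the weighted sum in
  \<open>trivial\<close> is a degree. \<open>\<Gamma>\<close> consists of the permutations induced
  by Galois elements acting trivially on W_s, and \<open>sum_S0\<close> records the divisibility of
  the degree of f.\<close>

locale trivial_action =
  fixes T S\<^sub>0 :: "'a set" and l s :: nat and m :: "'a \<Rightarrow> int" and w :: "'a \<Rightarrow> int" and \<Gamma> :: "('a \<Rightarrow> 'a) set"
  assumes finite_T: "finite T" and S0_T: "S\<^sub>0 \<subseteq> T" and S0_nonempty: "S\<^sub>0 \<noteq> {}"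
    and l_prime: "Factorial_Ring.prime l"
    and m_unit: "\<And>\<xi>. \<xi> \<in> T \<Longrightarrow> \<not> int l dvd m \<xi>"
    and w_S0: "\<And>\<xi>. \<xi> \<in> S\<^sub>0 \<Longrightarrow> w \<xi> = 1" and w_T: "\<And>\<xi>. \<xi> \<in> T \<Longrightarrow> \<xi> \<notin> S\<^sub>0 \<Longrightarrow> int l dvd w \<xi>"
    and perm: "\<And>\<gamma>. \<gamma> \<in> \<Gamma> \<Longrightarrow> bij_betw \<gamma> T T"
    and perm_ext: "\<And>\<gamma>. \<gamma> \<in> \<Gamma> \<Longrightarrow> \<gamma> \<in> extensional T"
    and perm_S0: "\<And>\<gamma> \<xi>. \<gamma> \<in> \<Gamma> \<Longrightarrow> \<xi> \<in> T \<Longrightarrow> \<gamma> \<xi> \<in> S\<^sub>0 \<longleftrightarrow> \<xi> \<in> S\<^sub>0"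
    and perm_m: "\<And>\<gamma> \<xi>. \<gamma> \<in> \<Gamma> \<Longrightarrow> \<xi> \<in> T \<Longrightarrow> m (\<gamma> \<xi>) = m \<xi>"
    and id_\<Gamma>: "restrict id T \<in> \<Gamma>"
    and comp_\<Gamma>: "\<And>\<gamma> \<gamma>'. \<gamma> \<in> \<Gamma> \<Longrightarrow> \<gamma>' \<in> \<Gamma> \<Longrightarrow> restrict (\<gamma> \<circ> \<gamma>') T \<in> \<Gamma>"
    and trivial: "\<And>\<gamma> a. \<gamma> \<in> \<Gamma> \<Longrightarrow> (\<Sum>\<xi>\<in>T. a \<xi> * w \<xi>) = 0 \<Longrightarrow>
        \<exists>i. \<forall>\<xi>\<in>T. int l dvd a (\<gamma> \<xi>) - a \<xi> - i * m \<xi>"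
    and sum_S0: "int l dvd (\<Sum>\<xi>\<in>S\<^sub>0. m \<xi>)" "T = S\<^sub>0 \<Longrightarrow> int (l ^ s) dvd (\<Sum>\<xi>\<in>S\<^sub>0. m \<xi>)"
    and s_pos: "1 \<le> s"
begin

lemma l_ge_2: "l \<ge> 2"
  using l_prime by (rule prime_ge_2_nat)

lemma finite_S0: "finite S\<^sub>0"
  using finite_T S0_T by (rule rev_finite_subset)

lemma not_dvd_1: "\<not> int l dvd 1" "\<not> int l dvd - 1"
  using l_ge_2 by auto

lemma dvd_2: "int l dvd 2 \<or> int l dvd - 2 \<Longrightarrow> l = 2"
proof -
  assume "int l dvd 2 \<or> int l dvd - 2"
  hence "int l dvd 2" by simp
  hence "int l \<le> 2" by (rule zdvd_imp_le) simp
  thus "l = 2" using l_ge_2 by simp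
qed

lemma dvd_mult_m: "\<xi> \<in> T \<Longrightarrow> int l dvd i * m \<xi> \<longleftrightarrow> int l dvd i"
  using m_unit[of \<xi>] l_prime by (simp add: prime_dvd_mult_iff)

lemma perm_T: "\<gamma> \<in> \<Gamma> \<Longrightarrow> \<xi> \<in> T \<Longrightarrow> \<gamma> \<xi> \<in> T"
  using perm[of \<gamma>] by (auto simp: bij_betw_def)

lemma perm_inj: "\<gamma> \<in> \<Gamma> \<Longrightarrow> \<xi> \<in> T \<Longrightarrow> \<eta> \<in> T \<Longrightarrow> \<gamma> \<xi> = \<gamma> \<eta> \<longleftrightarrow> \<xi> = \<eta>"
  using perm[of \<gamma>] by (auto simp: bij_betw_def inj_on_def)

lemma perm_surj: "\<gamma> \<in> \<Gamma> \<Longrightarrow> \<eta> \<in> T \<Longrightarrow> \<exists>\<xi>\<in>T. \<gamma> \<xi> = \<eta>"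
  using perm[of \<gamma>] unfolding bij_betw_def by (metis imageE)

lemma S0_in_T: "\<xi> \<in> S\<^sub>0 \<Longrightarrow> \<xi> \<in> T"
  using S0_T by (rule subsetD)

text \<open>The test combination is [\<xi>] - w(\<xi>)[\<xi>0]: its degree is 0 because
  \<open>w \<xi>0 = 1\<close>, and modulo l it is supported at \<xi> alone because l divides
  \<open>w \<xi>\<close>. Since \<open>\<gamma>\<close> preserves \<open>S\<^sub>0\<close>, the
  value at \<xi>0 forces i = 0 modulo l, and then the value -1 at a moved \<xi> is
  impossible.\<close>

lemma fixes_higher:
  assumes \<gamma>: "\<gamma> \<in> \<Gamma>" and \<xi>: "\<xi> \<in> T" "\<xi> \<notin> S\<^sub>0"
  shows "\<gamma> \<xi> = \<xi>"
proof (rule ccontr)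
  assume neq: "\<gamma> \<xi> \<noteq> \<xi>"
  obtain \<xi>0 where \<xi>0: "\<xi>0 \<in> S\<^sub>0" using S0_nonempty by blast
  have \<xi>0T: "\<xi>0 \<in> T" and ne: "\<xi>0 \<noteq> \<xi>" using \<xi>0 \<xi> S0_in_T by auto
  define a where "a = (\<lambda>\<zeta>. if \<zeta> = \<xi> then 1 else if \<zeta> = \<xi>0 then - w \<xi> else 0)"
  have "(\<Sum>\<zeta>\<in>T. a \<zeta> * w \<zeta>) = (\<Sum>\<zeta>\<in>{\<xi>, \<xi>0}. a \<zeta> * w \<zeta>)"
    using \<xi>0T \<xi> finite_T by (intro sum.mono_neutral_right) (auto simp: a_def)
  also have "\<dots> = 0" using ne w_S0[OF \<xi>0] by (simp add: a_def)
  finally obtain i where i: "\<And>\<zeta>. \<zeta> \<in> T \<Longrightarrow> int l dvd a (\<gamma> \<zeta>) - a \<zeta> - i * m \<zeta>"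
    using trivial[OF \<gamma>, of a] by blast
  have lw: "int l dvd w \<xi>" using w_T \<xi> by simp
  have "\<gamma> \<xi>0 \<in> S\<^sub>0" using perm_S0[OF \<gamma> \<xi>0T] \<xi>0 by simp
  hence "\<gamma> \<xi>0 \<noteq> \<xi>" using \<xi> by auto
  hence "a (\<gamma> \<xi>0) - a \<xi>0 \<in> {0, w \<xi>}" using ne by (auto simp: a_def)
  hence "int l dvd a (\<gamma> \<xi>0) - a \<xi>0" using lw by auto
  hence "int l dvd i * m \<xi>0" using i[OF \<xi>0T] by (simp add: dvd_diff_right_iff)
  hence "int l dvd i" using dvd_mult_m[OF \<xi>0T] by simp
  hence "int l dvd a (\<gamma> \<xi>) - a \<xi>" using i[OF \<xi>(1)] by (simp add: dvd_diff_left_iff)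
  moreover have "\<gamma> \<xi> \<noteq> \<xi>0" using perm_S0[OF \<gamma> \<xi>(1)] \<xi>(2) \<xi>0 by auto
  hence "a (\<gamma> \<xi>) - a \<xi> = - 1" using neq by (simp add: a_def)
  ultimately show False using not_dvd_1 by simp
qed

text \<open>The value at \<zeta> of a \<circ> \<gamma> - a for the test combination a = [\<xi>] -
  [\<eta>], which has degree 0 for roots in \<open>S\<^sub>0\<close>.\<close>

definition val :: "('a \<Rightarrow> 'a) \<Rightarrow> 'a \<Rightarrow> 'a \<Rightarrow> 'a \<Rightarrow> int" where
  "val \<gamma> \<xi> \<eta> \<zeta> = of_bool (\<gamma> \<zeta> = \<xi>) - of_bool (\<gamma> \<zeta> = \<eta>) - of_bool (\<zeta> = \<xi>) + of_bool (\<zeta> = \<eta>)"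

lemma pair:
  assumes \<gamma>: "\<gamma> \<in> \<Gamma>" and \<xi>: "\<xi> \<in> S\<^sub>0" "\<eta> \<in> S\<^sub>0" "\<xi> \<noteq> \<eta>"
  obtains i where "\<And>\<zeta>. \<zeta> \<in> T \<Longrightarrow> int l dvd val \<gamma> \<xi> \<eta> \<zeta> - i * m \<zeta>"
proof -
  define a where "a = (\<lambda>\<zeta>. of_bool (\<zeta> = \<xi>) - of_bool (\<zeta> = \<eta>) :: int)"
  have "(\<Sum>\<zeta>\<in>T. a \<zeta> * w \<zeta>) = (\<Sum>\<zeta>\<in>{\<xi>, \<eta>}. a \<zeta> * w \<zeta>)"
    using \<xi> S0_in_T finite_T by (intro sum.mono_neutral_right) (auto simp: a_def)
  also have "\<dots> = 0" using \<xi> w_S0 by (simp add: a_def)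
  finally obtain i where i: "\<And>\<zeta>. \<zeta> \<in> T \<Longrightarrow> int l dvd a (\<gamma> \<zeta>) - a \<zeta> - i * m \<zeta>"
    using trivial[OF \<gamma>, of a] by blast
  have "a (\<gamma> \<zeta>) - a \<zeta> = val \<gamma> \<xi> \<eta> \<zeta>" for \<zeta> by (simp add: a_def val_def)
  hence "int l dvd val \<gamma> \<xi> \<eta> \<zeta> - i * m \<zeta>" if "\<zeta> \<in> T" for \<zeta> using i[OF that] by simp
  thus ?thesis by (rule that)
qed

text \<open>At a moved \<xi> the value is -2 if \<open>\<gamma> \<xi> = \<eta>\<close> and -1
  otherwise; only the former can be divisible by a prime.\<close>

lemma pair_zero:
  assumes \<gamma>: "\<gamma> \<in> \<Gamma>" and \<xi>: "\<xi> \<in> S\<^sub>0" "\<eta> \<in> S\<^sub>0" "\<xi> \<noteq> \<eta>" "\<gamma> \<xi> \<noteq> \<xi>"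
    and 0: "int l dvd val \<gamma> \<xi> \<eta> \<xi>"
  shows "\<gamma> \<xi> = \<eta>" "l = 2"
proof -
  show "\<gamma> \<xi> = \<eta>"
  proof (rule ccontr)
    assume "\<gamma> \<xi> \<noteq> \<eta>"
    hence "val \<gamma> \<xi> \<eta> \<xi> = - 1" using \<xi> by (simp add: val_def)
    thus False using 0 not_dvd_1 by simp
  qed
  hence "val \<gamma> \<xi> \<eta> \<xi> = - 2" using \<xi> by (simp add: val_def)
  thus "l = 2" using 0 dvd_2 by simp
qed

text \<open>With a single root in \<open>S\<^sub>0\<close> the sum in \<open>sum_S0\<close> would be
  one value of \<open>m\<close>, which l does not divide.\<close>

lemma two_le_card_S0: "2 \<le> card S\<^sub>0"
proof (rule ccontr)
  assume "\<not> 2 \<le> card S\<^sub>0"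
  moreover have "card S\<^sub>0 \<noteq> 0" using S0_nonempty finite_S0 by simp
  ultimately have "card S\<^sub>0 = 1" by simp
  then obtain \<xi> where "S\<^sub>0 = {\<xi>}" by (auto simp: card_1_singleton_iff)
  thus False using sum_S0(1) m_unit[of \<xi>] S0_in_T[of \<xi>] by simp
qed

lemma moved_in_S0: "\<gamma> \<in> \<Gamma> \<Longrightarrow> \<xi> \<in> T \<Longrightarrow> \<gamma> \<xi> \<noteq> \<xi> \<Longrightarrow> \<xi> \<in> S\<^sub>0"
  using fixes_higher by blast

lemma \<Gamma>_eqI: "\<gamma> \<in> \<Gamma> \<Longrightarrow> \<gamma>' \<in> \<Gamma> \<Longrightarrow> (\<And>\<xi>. \<xi> \<in> T \<Longrightarrow> \<gamma> \<xi> = \<gamma>' \<xi>) \<Longrightarrow> \<gamma> = \<gamma>'"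
  using perm_ext by (metis extensionalityI)

lemma nontrivial_moves:
  assumes "\<gamma> \<in> \<Gamma>" "\<gamma> \<noteq> restrict id T"
  obtains \<xi> where "\<xi> \<in> S\<^sub>0" "\<gamma> \<xi> \<noteq> \<xi>"
proof -
  have "\<exists>\<xi>\<in>T. \<gamma> \<xi> \<noteq> \<xi>"
  proof (rule ccontr)
    assume "\<not> (\<exists>\<xi>\<in>T. \<gamma> \<xi> \<noteq> \<xi>)"
    hence "\<gamma> = restrict id T" by (intro \<Gamma>_eqI[OF assms(1) id_\<Gamma>]) simp
    thus False using assms(2) by simp
  qed
  thus ?thesis using that moved_in_S0[OF assms(1)] by blast
qed

lemma finite_\<Gamma>: "finite \<Gamma>"
proof (rule finite_subset)
  show "\<Gamma> \<subseteq> T \<rightarrow>\<^sub>E T"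
    using perm_T perm_ext by (auto simp: PiE_def)
  show "finite (T \<rightarrow>\<^sub>E T)" using finite_T by (simp add: finite_PiE)
qed

lemma card_\<Gamma>_pos: "card \<Gamma> > 0"
  using finite_\<Gamma> id_\<Gamma> by (auto simp: card_gt_0_iff)

text \<open>Everything outside \<open>S\<^sub>0\<close> is fixed, so the only possible nontrivial
  element is the transposition of the two roots.\<close>

lemma card_\<Gamma>_swap:
  assumes "card S\<^sub>0 = 2" "\<gamma> \<in> \<Gamma>" "\<gamma> \<noteq> restrict id T"
  shows "card \<Gamma> = 2"
proof -
  have swap: "\<delta> = \<delta>'" if \<delta>: "\<delta> \<in> \<Gamma>" "\<delta>' \<in> \<Gamma>" "\<delta> \<noteq> restrict id T" "\<delta>' \<noteq> restrict id T" for \<delta> \<delta>'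
  proof -
    obtain \<xi> \<eta> where S0: "S\<^sub>0 = {\<xi>, \<eta>}" "\<xi> \<noteq> \<eta>" using assms(1) by (auto simp: card_2_iff)
    have sw: "\<rho> \<xi> = \<eta> \<and> \<rho> \<eta> = \<xi>" if \<rho>: "\<rho> \<in> \<Gamma>" "\<rho> \<noteq> restrict id T" for \<rho>
    proof -
      have T: "\<xi> \<in> T" "\<eta> \<in> T" using S0 S0_in_T by auto
      have in2: "\<rho> \<xi> \<in> {\<xi>, \<eta>}" "\<rho> \<eta> \<in> {\<xi>, \<eta>}" using perm_S0[OF \<rho>(1)] T S0 by auto
      obtain \<zeta> where "\<zeta> \<in> {\<xi>, \<eta>}" "\<rho> \<zeta> \<noteq> \<zeta>" using nontrivial_moves[OF \<rho>] S0 by metis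
      thus ?thesis using in2 perm_inj[OF \<rho>(1) T] S0(2) by auto
    qed
    show ?thesis
    proof (rule \<Gamma>_eqI[OF \<delta>(1,2)])
      fix \<zeta> assume "\<zeta> \<in> T"
      show "\<delta> \<zeta> = \<delta>' \<zeta>"
      proof (cases "\<zeta> \<in> S\<^sub>0")
        case True
        thus ?thesis using sw[OF \<delta>(1,3)] sw[OF \<delta>(2,4)] S0 by auto
      next
        case False
        thus ?thesis
          using fixes_higher[OF \<delta>(1) \<open>\<zeta> \<in> T\<close>] fixes_higher[OF \<delta>(2) \<open>\<zeta> \<in> T\<close>] by simp
      qed
    qed
  qed
  have "\<Gamma> = {restrict id T, \<gamma>}"
    using swap assms(2,3) id_\<Gamma> by blast
  thus ?thesis using assms(3) by simp
qed

text \<open>A root outside \<open>S\<^sub>0\<close> is fixed, so every test difference [\<xi>] -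
  [\<eta>] has value 0 there, which forces i = 0 modulo l. Hence the value at \<xi> is divisible by
  l, and \<open>pair_zero\<close> makes every other element \<eta> of \<open>S\<^sub>0\<close> equal
  to \<open>\<gamma> \<xi>\<close>.\<close>

lemma higher_case:
  assumes T: "T \<noteq> S\<^sub>0" and \<gamma>: "\<gamma> \<in> \<Gamma>" "\<gamma> \<noteq> restrict id T"
  shows "l = 2" "card S\<^sub>0 = 2"
proof -
  obtain \<xi> where \<xi>: "\<xi> \<in> S\<^sub>0" "\<gamma> \<xi> \<noteq> \<xi>" using nontrivial_moves[OF \<gamma>] .
  obtain \<zeta> where \<zeta>: "\<zeta> \<in> T" "\<zeta> \<notin> S\<^sub>0" using T S0_T by blast
  have *: "\<gamma> \<xi> = \<eta> \<and> l = 2" if \<eta>: "\<eta> \<in> S\<^sub>0" "\<eta> \<noteq> \<xi>" for \<eta>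
  proof -
    obtain i where i: "\<And>\<zeta>. \<zeta> \<in> T \<Longrightarrow> int l dvd val \<gamma> \<xi> \<eta> \<zeta> - i * m \<zeta>"
      using pair[OF \<gamma>(1) \<xi>(1) \<eta>(1)] \<eta>(2) by blast
    have "val \<gamma> \<xi> \<eta> \<zeta> = 0" using fixes_higher[OF \<gamma>(1) \<zeta>] \<zeta>(2) \<xi> \<eta> by (auto simp: val_def)
    hence "int l dvd i * m \<zeta>" using i[OF \<zeta>(1)] by simp
    hence "int l dvd i" using dvd_mult_m[OF \<zeta>(1)] by simp
    hence "int l dvd val \<gamma> \<xi> \<eta> \<xi>" using i[OF S0_in_T[OF \<xi>(1)]] by (simp add: dvd_diff_left_iff)
    thus ?thesis using pair_zero[OF \<gamma>(1) \<xi>(1) \<eta>(1) _ \<xi>(2)] \<eta>(2) by metis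
  qed
  obtain \<eta> where \<eta>: "\<eta> \<in> S\<^sub>0" "\<eta> \<noteq> \<xi>"
  proof -
    have "S\<^sub>0 \<noteq> {\<xi>}" using two_le_card_S0 by auto
    thus ?thesis using that \<xi>(1) by blast
  qed
  show "l = 2" using *[OF \<eta>] by simp
  have "S\<^sub>0 = {\<xi>, \<gamma> \<xi>}" using * \<eta> \<xi>(1) by blast
  thus "card S\<^sub>0 = 2" using \<xi>(2) by simp
qed

text \<open>For such \<eta> the value at \<xi> is -1, so i is a unit modulo l. As every
  \<open>m \<zeta>\<close> is a unit too, no value can vanish.\<close>

lemma pair_nonzero:
  assumes T: "T = S\<^sub>0" and \<gamma>: "\<gamma> \<in> \<Gamma>" and \<xi>: "\<xi> \<in> T" "\<gamma> \<xi> \<noteq> \<xi>" and \<eta>: "\<eta> \<in> T" "\<eta> \<noteq> \<xi>" "\<eta> \<noteq> \<gamma> \<xi>"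
  obtains i where "\<And>\<zeta>. \<zeta> \<in> T \<Longrightarrow> int l dvd val \<gamma> \<xi> \<eta> \<zeta> - i * m \<zeta>" "\<And>\<zeta>. \<zeta> \<in> T \<Longrightarrow> val \<gamma> \<xi> \<eta> \<zeta> \<noteq> 0"
proof -
  obtain i where i: "\<And>\<zeta>. \<zeta> \<in> T \<Longrightarrow> int l dvd val \<gamma> \<xi> \<eta> \<zeta> - i * m \<zeta>"
    using pair[OF \<gamma>, of \<xi> \<eta>] \<xi> \<eta> T by metis
  have "\<not> int l dvd i"
  proof
    assume "int l dvd i"
    hence "int l dvd val \<gamma> \<xi> \<eta> \<xi>" using i[OF \<xi>(1)] by (simp add: dvd_diff_left_iff)
    thus False using pair_zero(1)[OF \<gamma>, of \<xi> \<eta>] \<xi> \<eta> T by metis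
  qed
  hence "val \<gamma> \<xi> \<eta> \<zeta> \<noteq> 0" if "\<zeta> \<in> T" for \<zeta>
    using i[OF that] dvd_mult_m[OF that, of i] by auto
  thus ?thesis using that i by blast
qed

text \<open>The value vanishes away from \<xi>, \<eta> and their preimages \<alpha>, \<beta>, while
  \<open>pair_nonzero\<close> forbids the value 0. This is where the bound 4 comes from.\<close>

lemma T_subset:
  assumes T: "T = S\<^sub>0" and \<gamma>: "\<gamma> \<in> \<Gamma>" and \<xi>: "\<xi> \<in> T" "\<gamma> \<xi> \<noteq> \<xi>" and \<eta>: "\<eta> \<in> T" "\<eta> \<noteq> \<xi>" "\<eta> \<noteq> \<gamma> \<xi>"
    and \<alpha>: "\<alpha> \<in> T" "\<gamma> \<alpha> = \<xi>" and \<beta>: "\<beta> \<in> T" "\<gamma> \<beta> = \<eta>"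
  shows "T = {\<xi>, \<eta>, \<alpha>, \<beta>}"
proof -
  obtain i where i: "\<And>\<zeta>. \<zeta> \<in> T \<Longrightarrow> val \<gamma> \<xi> \<eta> \<zeta> \<noteq> 0" using pair_nonzero[OF T \<gamma> \<xi> \<eta>] by blast
  have "\<zeta> \<in> {\<xi>, \<eta>, \<alpha>, \<beta>}" if \<zeta>: "\<zeta> \<in> T" for \<zeta>
  proof (rule ccontr)
    assume "\<zeta> \<notin> {\<xi>, \<eta>, \<alpha>, \<beta>}"
    hence "val \<gamma> \<xi> \<eta> \<zeta> = 0"
      using perm_inj[OF \<gamma> \<zeta> \<alpha>(1)] perm_inj[OF \<gamma> \<zeta> \<beta>(1)] \<alpha>(2) \<beta>(2) by (simp add: val_def)
    thus False using i[OF \<zeta>] by simp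
  qed
  thus ?thesis using \<xi> \<eta> \<alpha> \<beta> by blast
qed

lemma ex_third:
  assumes "3 \<le> card T" "\<xi> \<in> T" "\<xi>' \<in> T"
  obtains \<eta> where "\<eta> \<in> T" "\<eta> \<noteq> \<xi>" "\<eta> \<noteq> \<xi>'"
proof -
  have "card {\<xi>, \<xi>'} \<le> 2" by (simp add: card_insert_if)
  hence "\<not> T \<subseteq> {\<xi>, \<xi>'}" using assms(1) card_mono[of "{\<xi>, \<xi>'}" T] by auto
  thus ?thesis using that by blast
qed

lemma card_4_distinct: "card {a, b, c, d} = 4 \<Longrightarrow> a \<noteq> b \<and> a \<noteq> c \<and> a \<noteq> d \<and> b \<noteq> c \<and> b \<noteq> d \<and> c \<noteq> d"
  by (auto simp: card_insert_if split: if_splits)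

lemma card_le_4:
  assumes T: "T = S\<^sub>0" and \<gamma>: "\<gamma> \<in> \<Gamma>" "\<gamma> \<noteq> restrict id T"
  shows "card T \<le> 4"
proof (cases "3 \<le> card T")
  case True
  obtain \<xi> where \<xi>: "\<xi> \<in> T" "\<gamma> \<xi> \<noteq> \<xi>" using nontrivial_moves[OF \<gamma>] T by blast
  obtain \<eta> where \<eta>: "\<eta> \<in> T" "\<eta> \<noteq> \<xi>" "\<eta> \<noteq> \<gamma> \<xi>" using ex_third[OF True \<xi>(1) perm_T[OF \<gamma>(1) \<xi>(1)]] .
  obtain \<alpha> \<beta> where "\<alpha> \<in> T" "\<gamma> \<alpha> = \<xi>" "\<beta> \<in> T" "\<gamma> \<beta> = \<eta>"
    using perm_surj[OF \<gamma>(1)] \<xi>(1) \<eta>(1) by metis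
  from T_subset[OF T \<gamma>(1) \<xi> \<eta> this] have "card T = card {\<xi>, \<eta>, \<alpha>, \<beta>}" by simp
  also have "\<dots> \<le> 4" by (simp add: card_insert_if)
  finally show ?thesis .
qed simp

text \<open>With four roots the elements \<xi>, \<eta>, \<alpha>, \<beta> of \<open>T_subset\<close>
  are distinct. The values at \<xi> and at its preimage \<alpha> are -1 and 1, whereas
  \<open>m\<close> agrees there, so l divides 2. Distinctness of \<eta> and \<beta> says that \<eta>
  is moved.\<close>

lemma four_moved:
  assumes T: "T = S\<^sub>0" "card T = 4" and \<gamma>: "\<gamma> \<in> \<Gamma>" and \<xi>: "\<xi> \<in> T" "\<gamma> \<xi> \<noteq> \<xi>"
  shows "l = 2" "\<zeta> \<in> T \<Longrightarrow> \<gamma> \<zeta> \<noteq> \<zeta>" "\<gamma> (\<gamma> \<xi>) = \<xi>"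
proof -
  have main: "l = 2 \<and> \<gamma> \<eta> \<noteq> \<eta>" if \<eta>: "\<eta> \<in> T" "\<eta> \<noteq> \<xi>" "\<eta> \<noteq> \<gamma> \<xi>" for \<eta>
  proof -
    obtain \<alpha> \<beta> where ab: "\<alpha> \<in> T" "\<gamma> \<alpha> = \<xi>" "\<beta> \<in> T" "\<gamma> \<beta> = \<eta>"
      using perm_surj[OF \<gamma>] \<xi>(1) \<eta>(1) by metis
    have "card {\<xi>, \<eta>, \<alpha>, \<beta>} = 4" using T_subset[OF T(1) \<gamma> \<xi> \<eta> ab] T(2) by simp
    hence d: "\<xi> \<noteq> \<eta> \<and> \<xi> \<noteq> \<alpha> \<and> \<xi> \<noteq> \<beta> \<and> \<eta> \<noteq> \<alpha> \<and> \<eta> \<noteq> \<beta> \<and> \<alpha> \<noteq> \<beta>" by (rule card_4_distinct)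
    obtain i where i: "\<And>\<zeta>. \<zeta> \<in> T \<Longrightarrow> int l dvd val \<gamma> \<xi> \<eta> \<zeta> - i * m \<zeta>" using pair_nonzero[OF T(1) \<gamma> \<xi> \<eta>] by blast
    have "val \<gamma> \<xi> \<eta> \<xi> = - 1" using \<xi> \<eta> by (simp add: val_def)
    moreover have "val \<gamma> \<xi> \<eta> \<alpha> = 1" using ab d \<eta> by (auto simp: val_def)
    moreover have "m \<alpha> = m \<xi>" using perm_m[OF \<gamma> ab(1)] ab(2) by simp
    ultimately have "int l dvd 1 - i * m \<xi>" "int l dvd - 1 - i * m \<xi>"
      using i[OF ab(1)] i[OF \<xi>(1)] by simp_all
    from dvd_diff[OF this] have "l = 2" by (intro dvd_2) simp
    moreover have "\<gamma> \<eta> \<noteq> \<eta>" using perm_inj[OF \<gamma> \<eta>(1) ab(3)] ab(4) d by simp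
    ultimately show ?thesis ..
  qed
  have c3: "3 \<le> card T" using T(2) by simp
  obtain \<eta> where \<eta>: "\<eta> \<in> T" "\<eta> \<noteq> \<xi>" "\<eta> \<noteq> \<gamma> \<xi>" using ex_third[OF c3 \<xi>(1) perm_T[OF \<gamma> \<xi>(1)]] .
  show l2: "l = 2" using main[OF \<eta>] by simp
  show "\<gamma> \<zeta> \<noteq> \<zeta>" if "\<zeta> \<in> T"
    using main[OF that] \<xi> perm_inj[OF \<gamma> perm_T[OF \<gamma> \<xi>(1)] \<xi>(1)] by metis
  \<comment> \<open>Now the pair is \<xi>, \<gamma> \<xi>: the value -2 at \<xi> vanishes modulo 2,
    so i does too. If \<open>\<gamma>\<close> were not an involution at \<xi>, the preimage of \<xi>
    would be a new root with value 1.\<close>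
  show "\<gamma> (\<gamma> \<xi>) = \<xi>"
  proof (rule ccontr)
    assume neq: "\<gamma> (\<gamma> \<xi>) \<noteq> \<xi>"
    have g: "\<gamma> \<xi> \<in> T" "\<gamma> (\<gamma> \<xi>) \<in> T" using perm_T[OF \<gamma>] \<xi>(1) by auto
    obtain \<alpha> where \<alpha>: "\<alpha> \<in> T" "\<gamma> \<alpha> = \<xi>" using perm_surj[OF \<gamma> \<xi>(1)] by blast
    have "\<alpha> \<noteq> \<gamma> \<xi>" using neq \<alpha>(2) by auto
    have "\<alpha> \<noteq> \<xi>" using \<alpha>(2) \<xi>(2) by auto
    obtain i where i: "\<And>\<zeta>. \<zeta> \<in> T \<Longrightarrow> int l dvd val \<gamma> \<xi> (\<gamma> \<xi>) \<zeta> - i * m \<zeta>"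
      using pair[OF \<gamma>, of \<xi> "\<gamma> \<xi>"] \<xi> g T(1) by metis
    have "val \<gamma> \<xi> (\<gamma> \<xi>) \<xi> = - 2" using \<xi>(2) by (simp add: val_def)
    hence "int l dvd val \<gamma> \<xi> (\<gamma> \<xi>) \<xi>" using l2 by simp
    hence "int l dvd i * m \<xi>" using i[OF \<xi>(1)] by (simp add: dvd_diff_right_iff)
    hence "int l dvd i" using dvd_mult_m[OF \<xi>(1)] by simp
    hence "int l dvd val \<gamma> \<xi> (\<gamma> \<xi>) \<alpha>" using i[OF \<alpha>(1)] by (simp add: dvd_diff_left_iff)
    moreover have "val \<gamma> \<xi> (\<gamma> \<xi>) \<alpha> = 1"
      using \<alpha>(2) \<xi>(2) \<open>\<alpha> \<noteq> \<gamma> \<xi>\<close> \<open>\<alpha> \<noteq> \<xi>\<close> by (auto simp: val_def)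
    ultimately show False using not_dvd_1 by simp
  qed
qed

text \<open>Transpositions are excluded: a fixed third root \<eta> would have value 0, contrary to
  \<open>pair_nonzero\<close>. So \<eta> maps to \<xi> and \<open>\<gamma>\<close> is a
  3-cycle.\<close>

lemma three_moved:
  assumes T: "T = S\<^sub>0" "card T = 3" and \<gamma>: "\<gamma> \<in> \<Gamma>" and \<xi>: "\<xi> \<in> T" "\<gamma> \<xi> \<noteq> \<xi>"
  shows "T = {\<xi>, \<gamma> \<xi>, \<gamma> (\<gamma> \<xi>)}" "\<gamma> (\<gamma> \<xi>) \<noteq> \<xi>" "\<gamma> (\<gamma> (\<gamma> \<xi>)) = \<xi>"
proof -
  have g: "\<gamma> \<xi> \<in> T" using perm_T[OF \<gamma>] \<xi>(1) by auto
  obtain \<eta> where \<eta>: "\<eta> \<in> T" "\<eta> \<noteq> \<xi>" "\<eta> \<noteq> \<gamma> \<xi>" using ex_third[OF _ \<xi>(1) g] T(2) by auto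
  have "card {\<xi>, \<gamma> \<xi>, \<eta>} = 3" using \<xi>(2) \<eta> by (auto simp: card_insert_if)
  hence T3: "T = {\<xi>, \<gamma> \<xi>, \<eta>}"
    using card_subset_eq[OF finite_T, of "{\<xi>, \<gamma> \<xi>, \<eta>}"] T(2) g \<xi>(1) \<eta>(1) by simp
  obtain i where "\<And>\<zeta>. \<zeta> \<in> T \<Longrightarrow> val \<gamma> \<xi> \<eta> \<zeta> \<noteq> 0" using pair_nonzero[OF T(1) \<gamma> \<xi> \<eta>] by blast
  from this[OF \<eta>(1)] have val: "val \<gamma> \<xi> \<eta> \<eta> \<noteq> 0" .
  have n1: "\<gamma> \<eta> \<noteq> \<eta>"
  proof
    assume "\<gamma> \<eta> = \<eta>"
    hence "val \<gamma> \<xi> \<eta> \<eta> = 0" using \<eta>(2) by (simp add: val_def)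
    thus False using val by simp
  qed
  have n2: "\<gamma> \<eta> \<noteq> \<gamma> \<xi>" using perm_inj[OF \<gamma> \<eta>(1) \<xi>(1)] \<eta>(2) by simp
  have "\<gamma> \<eta> \<in> {\<xi>, \<gamma> \<xi>, \<eta>}" using perm_T[OF \<gamma> \<eta>(1)] by (subst (asm) T3)
  with n1 n2 have ge: "\<gamma> \<eta> = \<xi>" by blast
  have n3: "\<gamma> (\<gamma> \<xi>) \<noteq> \<gamma> \<xi>" using perm_inj[OF \<gamma> g \<xi>(1)] \<xi>(2) by simp
  have n4: "\<gamma> (\<gamma> \<xi>) \<noteq> \<xi>"
  proof
    assume "\<gamma> (\<gamma> \<xi>) = \<xi>"
    hence "\<gamma> (\<gamma> \<xi>) = \<gamma> \<eta>" unfolding ge .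
    thus False using perm_inj[OF \<gamma> g \<eta>(1)] \<eta>(3) by blast
  qed
  have "\<gamma> (\<gamma> \<xi>) \<in> {\<xi>, \<gamma> \<xi>, \<eta>}" using perm_T[OF \<gamma> g] by (subst (asm) T3)
  with n3 n4 have gg: "\<gamma> (\<gamma> \<xi>) = \<eta>" by blast
  show "T = {\<xi>, \<gamma> \<xi>, \<gamma> (\<gamma> \<xi>)}" unfolding gg by (rule T3)
  show "\<gamma> (\<gamma> \<xi>) \<noteq> \<xi>" by (rule n4)
  show "\<gamma> (\<gamma> (\<gamma> \<xi>)) = \<xi>" unfolding gg by (rule ge)
qed

lemma comp_apply_\<Gamma>: "\<xi> \<in> T \<Longrightarrow> restrict (\<gamma> \<circ> \<gamma>') T \<xi> = \<gamma> (\<gamma>' \<xi>)"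
  by simp

lemma card_\<Gamma>_eq_orbit:
  assumes "\<xi> \<in> T" "inj_on (\<lambda>\<gamma>. \<gamma> \<xi>) \<Gamma>"
  shows "card \<Gamma> = card ((\<lambda>\<gamma>. \<gamma> \<xi>) ` \<Gamma>)" "(\<lambda>\<gamma>. \<gamma> \<xi>) ` \<Gamma> \<subseteq> T"
  using assms perm_T by (auto simp: card_image)

text \<open>For constant \<open>m\<close> the sum over \<open>S\<^sub>0\<close> is the number of
  roots times a unit modulo l. Applied to transitive \<Gamma>, this bounds both l and s.\<close>

lemma power_dvd_imp:
  assumes "T = S\<^sub>0" "\<And>\<zeta>. \<zeta> \<in> T \<Longrightarrow> m \<zeta> = m \<xi>" "\<xi> \<in> T"
  shows "l ^ s dvd card T" "l dvd card T"
proof -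
  have sum: "(\<Sum>\<zeta>\<in>S\<^sub>0. m \<zeta>) = int (card T) * m \<xi>" using assms(1,2) by simp
  have "algebraic_semidom_class.coprime (int (l ^ s)) (m \<xi>)"
    using m_unit[OF assms(3)] l_prime by (auto intro!: prime_imp_coprime)
  hence "int (l ^ s) dvd int (card T)"
    using sum_S0(2)[OF assms(1)] unfolding sum by (simp add: coprime_dvd_mult_left_iff)
  thus "l ^ s dvd card T" by (simp only: int_dvd_int_iff)
  moreover have "l dvd l ^ s" using s_pos by (intro dvd_power) simp
  ultimately show "l dvd card T" by (rule dvd_trans[rotated])
qed

text \<open>By \<open>three_moved\<close> a nontrivial element has no fixed point, and a 3-cycle on
  three roots is determined by one of its values.\<close>

lemma three_inj:
  assumes T: "T = S\<^sub>0" "card T = 3" and \<xi>: "\<xi> \<in> T"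
  shows "inj_on (\<lambda>\<delta>. \<delta> \<xi>) \<Gamma>"
proof (rule inj_onI)
  fix \<delta> \<delta>' assume d: "\<delta> \<in> \<Gamma>" "\<delta>' \<in> \<Gamma>" "\<delta> \<xi> = \<delta>' \<xi>"
  have fix_id: "\<rho> = restrict id T" if \<rho>: "\<rho> \<in> \<Gamma>" "\<rho> \<xi> = \<xi>" for \<rho>
  proof (rule ccontr)
    assume "\<rho> \<noteq> restrict id T"
    then obtain \<zeta> where \<zeta>: "\<zeta> \<in> T" "\<rho> \<zeta> \<noteq> \<zeta>" using nontrivial_moves[OF \<rho>(1)] T(1) by blast
    have "\<xi> \<in> {\<zeta>, \<rho> \<zeta>, \<rho> (\<rho> \<zeta>)}" using \<xi> by (subst (asm) three_moved(1)[OF T \<rho>(1) \<zeta>])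
    moreover have "\<xi> \<noteq> \<zeta>" using \<rho>(2) \<zeta>(2) by blast
    moreover have "\<xi> \<noteq> \<rho> \<zeta>"
    proof
      assume e: "\<xi> = \<rho> \<zeta>"
      hence "\<rho> (\<rho> \<zeta>) = \<rho> \<zeta>" using \<rho>(2) by simp
      thus False using perm_inj[OF \<rho>(1) perm_T[OF \<rho>(1) \<zeta>(1)] \<zeta>(1)] \<zeta>(2) by blast
    qed
    moreover have "\<xi> \<noteq> \<rho> (\<rho> \<zeta>)"
    proof
      assume e: "\<xi> = \<rho> (\<rho> \<zeta>)"
      have "\<rho> (\<rho> \<zeta>) = \<zeta>" using \<rho>(2) three_moved(3)[OF T \<rho>(1) \<zeta>] unfolding e by simp
      thus False using three_moved(2)[OF T \<rho>(1) \<zeta>] by blast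
    qed
    ultimately show False by blast
  qed
  show "\<delta> = \<delta>'"
  proof (cases "\<delta> \<xi> = \<xi>")
    case True
    have "\<delta>' \<xi> = \<xi>" using True d(3) by simp
    from fix_id[OF d(1) True] fix_id[OF d(2) this] show ?thesis by (rule trans[OF _ sym])
  next
    case False
    have a: "T = {\<xi>, \<delta> \<xi>, \<delta> (\<delta> \<xi>)}" "\<delta> (\<delta> \<xi>) \<noteq> \<xi>" "\<delta> (\<delta> (\<delta> \<xi>)) = \<xi>"
      using three_moved[OF T d(1) \<xi> False] .
    have b: "T = {\<xi>, \<delta> \<xi>, \<delta>' (\<delta> \<xi>)}" "\<delta>' (\<delta> \<xi>) \<noteq> \<xi>" "\<delta>' (\<delta>' (\<delta> \<xi>)) = \<xi>"
      using three_moved[OF T d(2) \<xi> False[unfolded d(3)]] unfolding d(3) .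
    have n: "\<delta>' (\<delta> \<xi>) \<noteq> \<delta> \<xi>"
    proof
      assume "\<delta>' (\<delta> \<xi>) = \<delta> \<xi>"
      hence "\<delta>' (\<delta> \<xi>) = \<delta>' \<xi>" using d(3) by (rule trans)
      thus False using perm_inj[OF d(2) perm_T[OF d(1) \<xi>] \<xi>] False by blast
    qed
    have "\<delta>' (\<delta> \<xi>) \<in> {\<xi>, \<delta> \<xi>, \<delta> (\<delta> \<xi>)}"
      using perm_T[OF d(2) perm_T[OF d(1) \<xi>]] by (subst (asm) a(1))
    hence "\<delta>' (\<delta> \<xi>) = \<delta> (\<delta> \<xi>)" using n b(2) by (simp only: insert_iff empty_iff simp_thms)
    hence e: "\<delta> (\<delta> \<xi>) = \<delta>' (\<delta> \<xi>)" by (rule sym)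
    show ?thesis
    proof (rule \<Gamma>_eqI[OF d(1,2)])
      fix \<zeta> assume "\<zeta> \<in> T"
      hence "\<zeta> \<in> {\<xi>, \<delta> \<xi>, \<delta> (\<delta> \<xi>)}" by (subst (asm) a(1))
      moreover have "\<delta> (\<delta> (\<delta> \<xi>)) = \<delta>' (\<delta> (\<delta> \<xi>))" unfolding a(3) unfolding e by (rule b(3)[symmetric])
      ultimately show "\<delta> \<zeta> = \<delta>' \<zeta>" using d(3) e by (elim insertE emptyE) (simp_all only:)
    qed
  qed
qed

lemma four_moved_all:
  assumes T: "T = S\<^sub>0" "card T = 4" and d: "\<delta> \<in> \<Gamma>" "\<delta> \<noteq> restrict id T" "\<zeta> \<in> T"
  shows "\<delta> \<zeta> \<noteq> \<zeta> \<and> \<delta> (\<delta> \<zeta>) = \<zeta>"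
proof -
  obtain \<eta> where \<eta>: "\<eta> \<in> T" "\<delta> \<eta> \<noteq> \<eta>" using nontrivial_moves[OF d(1,2)] T(1) by blast
  have ne: "\<delta> \<zeta> \<noteq> \<zeta>" by (rule four_moved(2)[OF T d(1) \<eta> d(3)])
  with four_moved(3)[OF T d(1) d(3) ne] show ?thesis by (rule conjI[rotated])
qed

text \<open>Nontrivial elements are involutions without fixed points. Once the partner of \<xi> is
  known, the two remaining roots have to be exchanged.\<close>

lemma four_inj:
  assumes T: "T = S\<^sub>0" "card T = 4" and \<xi>: "\<xi> \<in> T"
  shows "inj_on (\<lambda>\<delta>. \<delta> \<xi>) \<Gamma>"
proof (rule inj_onI)
  fix \<delta> \<delta>' assume d: "\<delta> \<in> \<Gamma>" "\<delta>' \<in> \<Gamma>" "\<delta> \<xi> = \<delta>' \<xi>"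
  note moved = four_moved_all[OF T]
  have fix_id: "\<rho> = restrict id T" if "\<rho> \<in> \<Gamma>" "\<rho> \<xi> = \<xi>" for \<rho>
    using moved[OF that(1) _ \<xi>] that(2) by blast
  show "\<delta> = \<delta>'"
  proof (cases "\<delta> \<xi> = \<xi>")
    case True
    have "\<delta>' \<xi> = \<xi>" using True d(3) by simp
    from fix_id[OF d(1) True] fix_id[OF d(2) this] show ?thesis by (rule trans[OF _ sym])
  next
    case False
    have d': "\<delta>' \<xi> \<noteq> \<xi>" using False d(3) by simp
    have id_at: "restrict id T \<xi> = \<xi>" using \<xi> by simp
    have ne: "\<delta> \<noteq> restrict id T" "\<delta>' \<noteq> restrict id T" using False d' id_at by metis+
    have dx: "\<delta> \<xi> \<in> T" by (rule perm_T[OF d(1) \<xi>])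
    show ?thesis
    proof (rule \<Gamma>_eqI[OF d(1,2)])
      fix \<zeta> assume \<zeta>: "\<zeta> \<in> T"
      consider "\<zeta> = \<xi>" | "\<zeta> = \<delta> \<xi>" | "\<zeta> \<noteq> \<xi>" "\<zeta> \<noteq> \<delta> \<xi>" by blast
      thus "\<delta> \<zeta> = \<delta>' \<zeta>"
      proof cases
        case 1
        show ?thesis unfolding 1 by (rule d(3))
      next
        case 2
        have "\<delta> \<zeta> = \<xi>" unfolding 2 using moved[OF d(1) ne(1) \<xi>] by (rule conjunct2)
        moreover have "\<delta>' \<zeta> = \<xi>" unfolding 2 d(3) using moved[OF d(2) ne(2) \<xi>] by (rule conjunct2)
        ultimately show ?thesis by (rule trans[OF _ sym])
      next
        case 3
        have out: "\<rho> \<zeta> \<in> T - {\<xi>, \<delta> \<xi>, \<zeta>}" if \<rho>: "\<rho> \<in> \<Gamma>" "\<rho> \<noteq> restrict id T" "\<rho> \<xi> = \<delta> \<xi>" for \<rho>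
        proof -
          have m: "\<rho> (\<rho> \<zeta>) = \<zeta>" "\<rho> \<zeta> \<noteq> \<zeta>" using moved[OF \<rho>(1,2) \<zeta>] by (rule conjunct2, rule conjunct1)
          have "\<rho> \<zeta> \<noteq> \<delta> \<xi>" using perm_inj[OF \<rho>(1) \<zeta> \<xi>] \<rho>(3) 3(1) by simp
          moreover have "\<rho> \<zeta> \<noteq> \<xi>"
          proof
            assume e: "\<rho> \<zeta> = \<xi>"
            show False using m(1) 3(2) unfolding e \<rho>(3) by simp
          qed
          ultimately show ?thesis using perm_T[OF \<rho>(1) \<zeta>] m(2) by simp
        qed
        have "card {\<xi>, \<delta> \<xi>, \<zeta>} = 3" using False 3 by (auto simp: card_insert_if)
        moreover have "card (T - {\<xi>, \<delta> \<xi>, \<zeta>}) = card T - card {\<xi>, \<delta> \<xi>, \<zeta>}"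
          using \<xi> dx \<zeta> by (intro card_Diff_subset) simp_all
        ultimately have "card (T - {\<xi>, \<delta> \<xi>, \<zeta>}) = 1" using T(2) by simp
        then obtain \<tau> where \<tau>: "T - {\<xi>, \<delta> \<xi>, \<zeta>} = {\<tau>}" by (rule card_1_singletonE)
        have "\<delta> \<zeta> = \<tau>" using out[OF d(1) ne(1) refl] unfolding \<tau> by (rule singletonD)
        moreover have "\<delta>' \<zeta> = \<tau>" using out[OF d(2) ne(2) d(3)[symmetric]] unfolding \<tau> by (rule singletonD)
        ultimately show ?thesis by (rule trans[OF _ sym])
      qed
    qed
  qed
qed

theorem cases:
  "card \<Gamma> \<le> 4 \<and>
     (card \<Gamma> = 1 \<or>
      l = 3 \<and> T = S\<^sub>0 \<and> card S\<^sub>0 = 3 \<and> s = 1 \<and> card \<Gamma> = 3 \<or>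
      l = 2 \<and> T = S\<^sub>0 \<and> card S\<^sub>0 = 4 \<and> s \<le> 2 \<and> card \<Gamma> = 4 \<or>
      l = 2 \<and> T = S\<^sub>0 \<and> card S\<^sub>0 = 4 \<and> card \<Gamma> = 2 \<or>
      l = 2 \<and> T = S\<^sub>0 \<and> card S\<^sub>0 = 2 \<and> s = 1 \<and> card \<Gamma> = 2 \<or>
      l = 2 \<and> T \<noteq> S\<^sub>0 \<and> card S\<^sub>0 = 2 \<and> card \<Gamma> = 2)"
proof (cases "\<Gamma> = {restrict id T}")
  case True
  thus ?thesis by simp
next
  case False
  then obtain \<gamma> where \<gamma>: "\<gamma> \<in> \<Gamma>" "\<gamma> \<noteq> restrict id T" using id_\<Gamma> by blast
  show ?thesis
  proof (cases "T = S\<^sub>0")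
    case False
    thus ?thesis using higher_case[OF False \<gamma>] card_\<Gamma>_swap[OF _ \<gamma>] by simp
  next
    case T: True
    obtain \<xi> where \<xi>: "\<xi> \<in> T" "\<gamma> \<xi> \<noteq> \<xi>" using nontrivial_moves[OF \<gamma>] T by blast
    have "card T \<le> 4" "2 \<le> card T" using card_le_4[OF T \<gamma>] two_le_card_S0 T by auto
    then consider "card T = 2" | "card T = 3" | "card T = 4" by linarith
    thus ?thesis
    proof cases
      case 1
      have "card \<Gamma> = 2" using card_\<Gamma>_swap[OF _ \<gamma>] 1 T by simp
      have "m \<zeta> = m \<xi>" if "\<zeta> \<in> T" for \<zeta>
      proof -
        have "card {\<xi>, \<gamma> \<xi>} = card T" using 1 \<xi>(2) by auto
        hence "T = {\<xi>, \<gamma> \<xi>}"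
          using card_subset_eq[OF finite_T, of "{\<xi>, \<gamma> \<xi>}"] perm_T[OF \<gamma>(1) \<xi>(1)] \<xi>(1) by simp
        thus ?thesis using that perm_m[OF \<gamma>(1) \<xi>(1)] by auto
      qed
      from power_dvd_imp[OF T this \<xi>(1)] have "l ^ s dvd 2" "l dvd 2" by (simp_all add: 1)
      hence "l = 2" using l_ge_2 dvd_imp_le[of l 2] by simp
      have "(2::nat) ^ s \<le> 2 ^ 1" using \<open>l ^ s dvd 2\<close> \<open>l = 2\<close> dvd_imp_le[of "2 ^ s" 2] by simp
      hence "s \<le> 1" by (rule power_le_imp_le_exp[rotated]) simp
      hence "s = 1" using s_pos by simp
      thus ?thesis using \<open>card \<Gamma> = 2\<close> \<open>l = 2\<close> T 1 by simp
    next
      case 2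
      note three = three_moved[OF T 2]
      have m: "m \<zeta> = m \<xi>" if "\<zeta> \<in> T" for \<zeta>
      proof -
        have "\<zeta> \<in> {\<xi>, \<gamma> \<xi>, \<gamma> (\<gamma> \<xi>)}" using that by (subst (asm) three(1)[OF \<gamma>(1) \<xi>])
        moreover have "m (\<gamma> \<xi>) = m \<xi>" by (rule perm_m[OF \<gamma>(1) \<xi>(1)])
        moreover have "m (\<gamma> (\<gamma> \<xi>)) = m (\<gamma> \<xi>)" by (rule perm_m[OF \<gamma>(1) perm_T[OF \<gamma>(1) \<xi>(1)]])
        ultimately show ?thesis by (elim insertE emptyE) simp_all
      qed
      from power_dvd_imp[OF T m \<xi>(1)] have "l ^ s dvd 3" "l dvd 3" by (simp_all add: 2)
      hence "l \<le> 3" "l \<noteq> 2" by (auto dest: dvd_imp_le)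
      hence "l = 3" using l_ge_2 by simp
      have "(3::nat) ^ s \<le> 3 ^ 1" using \<open>l ^ s dvd 3\<close> \<open>l = 3\<close> dvd_imp_le[of "3 ^ s" 3] by simp
      hence "s \<le> 1" by (rule power_le_imp_le_exp[rotated]) simp
      hence "s = 1" using s_pos by simp
      note inj = three_inj[OF T 2 \<xi>(1)]
      have "\<gamma> (\<gamma> \<xi>) \<in> (\<lambda>\<delta>. \<delta> \<xi>) ` \<Gamma>"
        using comp_\<Gamma>[OF \<gamma>(1) \<gamma>(1)] comp_apply_\<Gamma>[OF \<xi>(1), of \<gamma> \<gamma>]
          by (intro image_eqI[where x = "restrict (\<gamma> \<circ> \<gamma>) T"]) simp_all
      moreover have "\<xi> \<in> (\<lambda>\<delta>. \<delta> \<xi>) ` \<Gamma>" using id_\<Gamma> \<xi>(1)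
          by (intro image_eqI[where x = "restrict id T"]) simp_all
      moreover have "\<gamma> \<xi> \<in> (\<lambda>\<delta>. \<delta> \<xi>) ` \<Gamma>" using \<gamma>(1) by (rule imageI)
      ultimately have "T \<subseteq> (\<lambda>\<delta>. \<delta> \<xi>) ` \<Gamma>" by (subst three(1)[OF \<gamma>(1) \<xi>]) (simp only: insert_subset empty_subsetI simp_thms)
      hence "(\<lambda>\<delta>. \<delta> \<xi>) ` \<Gamma> = T"
        by (rule subset_antisym[OF card_\<Gamma>_eq_orbit(2)[OF \<xi>(1) inj]])
      hence "card \<Gamma> = 3" using card_\<Gamma>_eq_orbit(1)[OF \<xi>(1) inj] 2 by simp
      thus ?thesis using \<open>l = 3\<close> \<open>s = 1\<close> T 2 by simp
    next
      case 3
      note four = four_moved[OF T 3]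
      have l2: "l = 2" using four(1)[OF \<gamma>(1) \<xi>] .
      note moved = four_moved_all[OF T 3]
      note inj = four_inj[OF T 3 \<xi>(1)]
      note orbit = card_\<Gamma>_eq_orbit[OF \<xi>(1) inj]
      show ?thesis
      \<comment> \<open>Two elements cannot act transitively on four roots, so \<open>m\<close> need
        not be constant and no bound on s results. With a further element the orbit of \<xi> is
        everything: \<Gamma> is a Klein four-group acting simply transitively, and 2^s divides
        4.\<close>
      proof (cases "\<Gamma> = {restrict id T, \<gamma>}")
        case True
        hence "card \<Gamma> = 2" using \<gamma>(2) by simp
        thus ?thesis using l2 T 3 by simp
      next
        case False
        then obtain \<delta> where \<delta>: "\<delta> \<in> \<Gamma>" "\<delta> \<noteq> restrict id T" "\<delta> \<noteq> \<gamma>" using id_\<Gamma> \<gamma>(1) by blast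
        have ne: "\<delta> \<xi> \<noteq> \<gamma> \<xi>" using inj_onD[OF inj _ \<delta>(1) \<gamma>(1)] \<delta>(3) by (rule contrapos_nn[rotated])
        have dT: "\<delta> \<xi> \<in> T" using perm_T[OF \<delta>(1) \<xi>(1)] .
        have "\<gamma> (\<delta> \<xi>) \<noteq> \<delta> \<xi>" using moved[OF \<gamma> dT] by simp
        moreover have "\<gamma> (\<delta> \<xi>) \<noteq> \<gamma> \<xi>" using perm_inj[OF \<gamma>(1) dT \<xi>(1)] moved[OF \<delta>(1,2) \<xi>(1)] by simp
        moreover have "\<gamma> (\<delta> \<xi>) \<noteq> \<xi>"
        proof
          assume e: "\<gamma> (\<delta> \<xi>) = \<xi>"
          have "\<gamma> (\<gamma> (\<delta> \<xi>)) = \<delta> \<xi>" using moved[OF \<gamma> dT] by (rule conjunct2)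
          thus False using ne unfolding e by simp
        qed
        ultimately have c4: "card {\<xi>, \<gamma> \<xi>, \<delta> \<xi>, \<gamma> (\<delta> \<xi>)} = 4"
          using ne \<xi>(2) conjunct1[OF moved[OF \<delta>(1,2) \<xi>(1)]] by (auto simp: card_insert_if)
        have "\<gamma> (\<delta> \<xi>) \<in> (\<lambda>\<delta>. \<delta> \<xi>) ` \<Gamma>"
          using comp_\<Gamma>[OF \<gamma>(1) \<delta>(1)] comp_apply_\<Gamma>[OF \<xi>(1), of \<gamma> \<delta>]
          by (intro image_eqI[where x = "restrict (\<gamma> \<circ> \<delta>) T"]) simp_all
        moreover have "\<xi> \<in> (\<lambda>\<delta>. \<delta> \<xi>) ` \<Gamma>" using id_\<Gamma> \<xi>(1)
          by (intro image_eqI[where x = "restrict id T"]) simp_all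
        ultimately have sub: "{\<xi>, \<gamma> \<xi>, \<delta> \<xi>, \<gamma> (\<delta> \<xi>)} \<subseteq> (\<lambda>\<delta>. \<delta> \<xi>) ` \<Gamma>"
          using imageI[OF \<gamma>(1), of "\<lambda>\<delta>. \<delta> \<xi>"] imageI[OF \<delta>(1), of "\<lambda>\<delta>. \<delta> \<xi>"]
          by (simp only: insert_subset empty_subsetI simp_thms)
        have "card ((\<lambda>\<delta>. \<delta> \<xi>) ` \<Gamma>) \<le> card T" by (rule card_mono[OF finite_T orbit(2)])
        moreover have "4 \<le> card ((\<lambda>\<delta>. \<delta> \<xi>) ` \<Gamma>)"
          using card_mono[OF _ sub] finite_\<Gamma> c4 by simp
        ultimately have c: "card ((\<lambda>\<delta>. \<delta> \<xi>) ` \<Gamma>) = card T" using 3 by simp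
        hence orb: "(\<lambda>\<delta>. \<delta> \<xi>) ` \<Gamma> = T" by (rule card_subset_eq[OF finite_T orbit(2)])
        have "m \<zeta> = m \<xi>" if "\<zeta> \<in> T" for \<zeta>
        proof -
          have "\<zeta> \<in> (\<lambda>\<delta>. \<delta> \<xi>) ` \<Gamma>" unfolding orb by (rule that)
          thus ?thesis using perm_m[OF _ \<xi>(1)] by (elim imageE) simp
        qed
        from power_dvd_imp(1)[OF T this \<xi>(1)] have "2 ^ s dvd (2 :: nat) ^ 2" by (simp add: 3 l2)
        hence "(2 :: nat) ^ s \<le> 2 ^ 2" by (rule dvd_imp_le) simp
        hence "s \<le> 2" by (rule power_le_imp_le_exp[rotated]) simp
        moreover have "card \<Gamma> = 4" using orbit(1) c 3 by simp
        ultimately show ?thesis using l2 T 3 by simp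
      qed
    qed
  qed
qed

end

hide_const (open) Polynomials.degree Polynomials.lead_coeff
  up_ring.coeff up_ring.monom module.smult Coset.order Divisibility.prime Divisibility.irreducible

section \<open>Roots of unity\<close>

definition mu :: "nat \<Rightarrow> 'a::field set" where
  "mu N = {c. c ^ N = 1}"

lemma mu_iff [simp]: "c \<in> mu N \<longleftrightarrow> c ^ N = 1"
  by (simp add: mu_def)

lemma mu_nonzero: "c \<in> mu N \<Longrightarrow> N > 0 \<Longrightarrow> c \<noteq> 0"
  by (auto simp: zero_power)

text \<open>The derivative of X^N - 1 is N X^(N-1), which in characteristic 0 shares no root with
  it. All roots are therefore simple.\<close>

lemma mu_proots:
  fixes N :: nat
  assumes "N > 0"
  defines "P \<equiv> monom 1 N - 1 :: 'a::{alg_closed_field,field_char_0} poly"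
  shows "finite (mu N :: 'a set)" "card (mu N :: 'a set) = N" "P = (\<Prod>b\<in>mu N. [:- b, 1:])"
proof -
  have c1: "coeff P N = 1"
    using assms by (simp add: P_def coeff_1)
  hence c: "coeff P N = 1" "P \<noteq> 0"
    by auto
  have deg: "degree P = N"
  proof (rule antisym)
    show "degree P \<le> N"
      unfolding P_def by (intro degree_diff_le) (auto simp: degree_monom_le)
    show "N \<le> degree P" using c by (intro le_degree) simp
  qed
  obtain A where A: "size A = N" "P = (\<Prod>x\<in>#A. [:- x, 1:])"
    using alg_closed_imp_factorization[OF c(2)] c deg by auto
  have root: "poly P z = 0 \<longleftrightarrow> z \<in> mu N" for z
    by (simp add: P_def poly_monom)
  have "rsquarefree P"
    unfolding rsquarefree_roots
  proof (intro allI notI)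
    fix z assume z: "poly P z = 0 \<and> poly (pderiv P) z = 0"
    hence "z ^ N = 1" "z ^ (N - 1) = 0"
      using assms by (auto simp: P_def poly_monom pderiv_diff pderiv_monom)
    thus False
      using assms by (cases N) auto
  qed
  hence ord: "order z P \<le> 1" for z
    by (auto simp: rsquarefree_def elim!: allE[of _ z])
  have "proots (\<Prod>x\<in>#B. [:- x, 1:]) = B" for B :: "'a multiset"
  proof (induction B)
    case (add x B)
    have "(\<Prod>x\<in>#B. [:- x, 1:]) \<noteq> 0"
      by (auto simp: prod_mset_zero_iff)
    thus ?case
      using add proots_mult[of "[:- x, 1:]" "\<Prod>x\<in>#B. [:- x, 1:]"] by (simp del: mult_pCons_left)
  qed auto
  hence pr: "proots P = A"
    unfolding A(2) .
  have cnt: "count A z = (if z \<in> mu N then 1 else 0)" for z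
    using ord[of z] order_root[of P z] root[of z] c(2) count_proots[OF c(2), of z] pr by auto
  have fin: "finite (mu N :: 'a set)"
    using poly_roots_finite[OF c(2)] root by (simp add: mu_def)
  thus "finite (mu N :: 'a set)" .
  have A_eq: "A = mset_set (mu N)"
    by (rule multiset_eqI) (simp add: cnt fin count_mset_set')
  show "card (mu N :: 'a set) = N"
    using A(1) by (simp add: A_eq)
  show "P = (\<Prod>b\<in>mu N. [:- b, 1:])"
    unfolding A(2) A_eq by (simp add: prod_unfold_prod_mset)
qed

text \<open>Orthogonality of the characters of \<open>mu N\<close>. For distinct exponents some d
  separates them, since otherwise all N roots of unity would satisfy an equation of degree below N;
  translation by d then multiplies the sum by a factor other than 1.\<close>

lemma sum_mu:
  fixes N i j :: nat
  assumes "N > 0" "i < N" "j < N"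
  shows "(\<Sum>c\<in>mu N. c ^ j * inverse c ^ i) = (if i = j then of_nat N else (0::'a::{alg_closed_field,field_char_0}))"
proof (cases "i = j")
  case True
  have "(\<Sum>c\<in>(mu N :: 'a set). c ^ j * inverse c ^ i) = (\<Sum>c\<in>(mu N :: 'a set). 1)"
    using True assms(1) by (intro sum.cong) (auto simp: mu_nonzero simp flip: power_mult_distrib)
  thus ?thesis
    using True assms(1) by (simp add: mu_proots)
next
  case False
  have "\<exists>d::'a. d \<in> mu N \<and> d ^ j \<noteq> d ^ i"
  proof (rule ccontr)
    assume neg: "\<not> (\<exists>d::'a. d \<in> mu N \<and> d ^ j \<noteq> d ^ i)"
    define a b where "a = min i j" and "b = max i j"
    have ab: "a < b" "b < N" using False assms by (auto simp: a_def b_def)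
    have "mu N \<subseteq> (mu (b - a) :: 'a set)"
    proof
      fix d :: 'a assume d: "d \<in> mu N"
      hence "d ^ b = d ^ a" using neg by (auto simp: a_def b_def min_def max_def)
      moreover have "d ^ b = d ^ a * d ^ (b - a)" using ab by (simp flip: power_add)
      ultimately show "d \<in> mu (b - a)"
        using mu_nonzero[OF d assms(1)] by simp
    qed
    hence "N \<le> b - a"
      using card_mono[OF mu_proots(1)[of "b - a"], of "mu N :: 'a set"] ab assms(1) by (simp add: mu_proots)
    thus False using ab by simp
  qed
  then obtain d :: 'a where d: "d \<in> mu N" "d ^ j \<noteq> d ^ i" by blast
  have d0: "d \<noteq> 0" using mu_nonzero[OF d(1) assms(1)] .
  define S where "S = (\<Sum>c\<in>(mu N :: 'a set). c ^ j * inverse c ^ i)"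
  have "S = (\<Sum>c\<in>(mu N :: 'a set). (d * c) ^ j * inverse (d * c) ^ i)"
    unfolding S_def
    by (rule sum.reindex_bij_witness[of _ "\<lambda>c. d * c" "\<lambda>c. inverse d * c"])
       (use d(1) d0 in \<open>auto simp: power_mult_distrib power_inverse\<close>)
  also have "\<dots> = (d ^ j * inverse d ^ i) * S"
    unfolding S_def sum_distrib_left by (intro sum.cong) (auto simp: power_mult_distrib field_simps)
  finally have "S * (d ^ j - d ^ i) = 0"
    using d0 by (auto simp: field_simps)
  thus ?thesis
    using d(2) False by (simp add: S_def)
qed


section \<open>Evaluation of polynomials along an embedding of fields\<close>

text \<open>One notion serves all changes of coefficients below: \<open>\<kappa>\<close> is the
  embedding of constants into functions or into Laurent series, or of the fraction field into its
  closure or into another field.\<close>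

definition heval :: "('b::field \<Rightarrow> 'c::field) \<Rightarrow> 'c \<Rightarrow> 'b poly \<Rightarrow> 'c" where
  "heval \<kappa> z p = poly (map_poly \<kappa> p) z"

locale fld_emb = fld_hom UNIV \<kappa> for \<kappa> :: "'b::field \<Rightarrow> 'c::field"
begin

lemmas emb_simps = hom_add[OF UNIV_I UNIV_I] hom_mult[OF UNIV_I UNIV_I] hom_diff[OF UNIV_I UNIV_I]
  hom_uminus[OF UNIV_I] hom_inverse[OF UNIV_I] hom_divide[OF UNIV_I UNIV_I] hom_power[OF UNIV_I]
  hom_eq_0_iff[OF UNIV_I] hom_power_int[OF UNIV_I]

lemma heval_pCons [simp]: "heval \<kappa> z (pCons a p) = \<kappa> a + z * heval \<kappa> z p"
  by (simp add: heval_def map_poly_pCons)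

lemma heval_0 [simp]: "heval \<kappa> z 0 = 0"
  by (simp add: heval_def)

lemma heval_1 [simp]: "heval \<kappa> z 1 = 1"
  by (simp add: heval_def)

lemma heval_add: "heval \<kappa> z (p + q) = heval \<kappa> z p + heval \<kappa> z q"
  by (induction p q rule: poly_induct2) (simp_all add: emb_simps algebra_simps)

lemma heval_uminus: "heval \<kappa> z (- p) = - heval \<kappa> z p"
  using heval_add[of z p "- p"] by (simp add: eq_neg_iff_add_eq_0 add.commute)

lemma heval_diff: "heval \<kappa> z (p - q) = heval \<kappa> z p - heval \<kappa> z q"
  using heval_add[of z p "- q"] by (simp add: heval_uminus)

lemma heval_smult: "heval \<kappa> z (smult c p) = \<kappa> c * heval \<kappa> z p"
  by (induction p) (simp_all add: emb_simps algebra_simps)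

lemma heval_mult: "heval \<kappa> z (p * q) = heval \<kappa> z p * heval \<kappa> z q"
  by (induction p) (simp_all add: heval_add heval_smult algebra_simps)

lemma heval_power: "heval \<kappa> z (p ^ n) = heval \<kappa> z p ^ n"
  by (induction n) (simp_all add: heval_mult)

lemma heval_prod: "heval \<kappa> z (prod g A) = (\<Prod>i\<in>A. heval \<kappa> z (g i))"
  by (induction A rule: infinite_finite_induct) (simp_all add: heval_mult)

lemma heval_monom: "heval \<kappa> z (monom c n) = \<kappa> c * z ^ n"
  by (simp add: heval_def map_poly_monom poly_monom)

lemma heval_eq_sum: "degree p < N \<Longrightarrow> heval \<kappa> z p = (\<Sum>i<N. \<kappa> (coeff p i) * z ^ i)"
  unfolding heval_def
  by (subst poly_altdef, rule sum.mono_neutral_cong_left)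
     (auto simp: degree_map_poly coeff_map_poly coeff_eq_0)

end

lemma prod_mu_diff:
  assumes "fld_emb (\<kappa> :: 'a::{alg_closed_field,field_char_0} \<Rightarrow> 'c::field)" "N > 0"
  shows "(\<Prod>b\<in>mu N. z - \<kappa> b * a) = z ^ N - a ^ N"
proof -
  interpret fld_emb \<kappa> by fact
  have *: "(\<Prod>b\<in>mu N. z - \<kappa> b) = z ^ N - 1" for z
    using arg_cong[OF mu_proots(3)[OF assms(2)], of "heval \<kappa> z"]
    by (simp add: heval_prod heval_diff heval_monom emb_simps)
  show ?thesis
  proof (cases "a = 0")
    case True
    thus ?thesis using assms(2) by (simp add: mu_proots)
  next
    case False
    have "(\<Prod>b\<in>mu N. z - \<kappa> b * a) = (\<Prod>b\<in>(mu N :: 'a set). a * (z / a - \<kappa> b))"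
      using False by (intro prod.cong) (auto simp: field_simps)
    also have "\<dots> = a ^ N * ((z / a) ^ N - 1)"
      using assms(2) by (simp add: prod.distrib mu_proots *)
    also have "\<dots> = z ^ N - a ^ N"
      using False by (simp add: field_simps)
    finally show ?thesis .
  qed
qed

lemma fract_extend:
  fixes h :: "'d::idom \<Rightarrow> 'c::field"
  assumes add: "\<And>a b. h (a + b) = h a + h b" and mult: "\<And>a b. h (a * b) = h a * h b"
    and one: "h 1 = 1" and inj: "\<And>a. h a = 0 \<Longrightarrow> a = 0"
  obtains \<psi> where "fld_emb \<psi>" "\<And>a. \<psi> (Fract a 1) = h a"
proof -
  have h0: "h 0 = 0" using add[of 0 0] by (metis add_cancel_right_left add_0)
  have "\<exists>v. \<forall>a b. b \<noteq> 0 \<longrightarrow> r = Fract a b \<longrightarrow> v = h a / h b" for r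
  proof (cases r)
    case (Fract a b)
    show ?thesis
    proof (intro exI[of _ "h a / h b"] allI impI)
      fix c d assume "d \<noteq> 0" "r = Fract c d"
      hence "a * d = c * b" using Fract by (simp add: eq_fract)
      hence "h a * h d = h c * h b" by (metis mult)
      thus "h a / h b = h c / h d"
        using \<open>d \<noteq> 0\<close> \<open>b \<noteq> 0\<close> inj by (metis frac_eq_eq)
    qed
  qed
  then obtain \<psi> where \<psi>: "\<And>r a b. b \<noteq> 0 \<Longrightarrow> r = Fract a b \<Longrightarrow> \<psi> r = h a / h b"
    by metis
  have \<psi>': "\<psi> (Fract a b) = h a / h b" if "b \<noteq> 0" for a b
    using \<psi> that by simp
  have "fld_emb \<psi>"
    unfolding fld_emb_def
  proof (rule fld_homI[OF subfld_UNIV])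
    fix r s :: "'d fract"
    obtain a b where r: "r = Fract a b" "b \<noteq> 0" by (cases r)
    obtain c d where s: "s = Fract c d" "d \<noteq> 0" by (cases s)
    have nz: "h b \<noteq> 0" "h d \<noteq> 0" using inj r s by auto
    show "\<psi> (r + s) = \<psi> r + \<psi> s" "\<psi> (r * s) = \<psi> r * \<psi> s"
      using r s nz by (simp_all add: \<psi>' add mult field_simps)
  next
    show "\<psi> 1 = 1" by (simp add: One_fract_def \<psi>' one)
  qed
  moreover have "\<psi> (Fract a 1) = h a" for a by (simp add: \<psi>' one)
  ultimately show ?thesis using that by blast
qed

section \<open>Kummer extensions of the rational function field\<close>

lemma fld_emb_to_ac: "fld_emb (to_ac :: 'b::field \<Rightarrow> 'b alg_closure)"
  unfolding fld_emb_def by (intro fld_homI subfld_UNIV) auto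

interpretation to_ac: fld_emb to_ac
  by (rule fld_emb_to_ac)

lemma fn_of_poly_simps [simp]:
  "fn_of_poly (a + b) = fn_of_poly a + fn_of_poly b"
  "fn_of_poly (a * b) = fn_of_poly a * fn_of_poly b"
  "fn_of_poly 1 = 1" "fn_of_poly 0 = 0"
  "fn_of_poly a = 0 \<longleftrightarrow> a = 0"
  by (simp_all add: fn_of_poly_def Zero_fract_def eq_fract flip: to_ac_add to_ac_mult One_fract_def)

lemma fn_of_poly_power [simp]: "fn_of_poly (a ^ n) = fn_of_poly a ^ n"
  by (induction n) auto

lemma to_ac_Fract: "to_ac (Fract a b) = fn_of_poly a / fn_of_poly b"
  by (simp add: fn_of_poly_def flip: to_ac_divide)

lemma fld_emb_fn_const: "fld_emb (fn_const :: 'a::field \<Rightarrow> 'a fn)"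
  unfolding fld_emb_def fn_const_def
proof (intro fld_homI subfld_UNIV)
  show "fn_of_poly [:1 :: 'a:] = 1" by (simp flip: one_pCons)
qed (simp_all add: mult.commute flip: fn_of_poly_simps)

interpretation fn_const: fld_emb fn_const
  by (rule fld_emb_fn_const)

lemma fn_of_poly_eq_heval: "fn_of_poly p = heval fn_const fn_x p"
proof (induction p)
  case (pCons a p)
  have "fn_of_poly (pCons a p) = fn_of_poly [:a:] + fn_of_poly [:0, 1:] * fn_of_poly p"
    by (simp flip: fn_of_poly_simps)
  thus ?case
    by (simp add: pCons flip: fn_const_def fn_x_def)
qed auto

lemma rational_fn_field_eq: "rational_fn_field = range (to_ac :: 'a::field poly fract \<Rightarrow> 'a fn)"
proof
  show "rational_fn_field \<subseteq> range (to_ac :: 'a poly fract \<Rightarrow> 'a fn)"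
    unfolding rational_fn_field_def
  proof (rule generate_field_minimal)
    show "subfld (range (to_ac :: 'a poly fract \<Rightarrow> 'a fn))"
      by (rule to_ac.subfld_image) (auto simp: subfld_UNIV)
  qed (auto simp: fn_const_def fn_x_def fn_of_poly_def)
  interpret subfld "rational_fn_field :: 'a fn set"
    unfolding rational_fn_field_def by (rule subfld_generate_field)
  have inc: "fn_const c \<in> rational_fn_field" "fn_x \<in> rational_fn_field" for c :: 'a
    by (auto simp: rational_fn_field_def intro: generate_field.incl)
  have "fn_of_poly p \<in> rational_fn_field" for p :: "'a poly"
    unfolding fn_of_poly_eq_heval by (induction p) (auto intro!: inc)
  thus "range (to_ac :: 'a poly fract \<Rightarrow> 'a fn) \<subseteq> rational_fn_field"
    by (metis to_ac_Fract Fract_cases divide image_subsetI)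
qed

lemma order_power: "p \<noteq> 0 \<Longrightarrow> order a (p ^ n) = n * order a (p :: 'a::idom poly)"
  by (induction n) (auto simp: order_mult)

text \<open>Every level of the tower is an instance. The root \<open>\<xi>\<^sub>0\<close> only
  guarantees that Y^N - f is the minimal polynomial of \<open>y\<close>; the orders of f at its
  other roots are arbitrary.\<close>

locale kummer =
  fixes f :: "'a::{alg_closed_field,field_char_0} poly" and y :: "'a fn" and N :: nat and \<xi>\<^sub>0 :: 'a
  assumes N_pos: "N > 0" and f_nonzero: "f \<noteq> 0" and y_power: "y ^ N = fn_of_poly f"
    and coprime: "coprime (order \<xi>\<^sub>0 f) N"
begin

lemma y_nonzero: "y \<noteq> 0"
  using y_power f_nonzero N_pos by (auto simp: zero_power)

definition ev :: "'a poly fract poly \<Rightarrow> 'a fn" where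
  "ev = heval to_ac y"

definition kpoly :: "'a poly fract poly" where
  "kpoly = monom 1 N - [:Fract f 1:]"

lemma ev_kpoly: "ev kpoly = 0"
  by (simp add: ev_def kpoly_def to_ac.heval_diff to_ac.heval_monom to_ac_Fract y_power)

lemma degree_kpoly: "degree kpoly = N"
proof (rule antisym)
  show "degree kpoly \<le> N"
    unfolding kpoly_def by (intro degree_diff_le) (auto simp: degree_monom_le)
  have "coeff kpoly N = 1"
    unfolding kpoly_def using N_pos by (cases N) auto
  thus "N \<le> degree kpoly" by (intro le_degree) simp
qed

lemma ev_mod:
  assumes "ev q = 0"
  shows "ev (p mod q) = ev p"
proof -
  have "ev p = ev (p div q * q + p mod q)" by simp
  also have "\<dots> = ev (p mod q)"
    using assms unfolding ev_def to_ac.heval_add to_ac.heval_mult by simp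
  finally show ?thesis ..
qed

text \<open>
  The constant term of the minimal polynomial of \<open>y\<close> is up to sign a product of \<open>d\<close> roots of
  \<open>Y\<^sup>N - f\<close>, where \<open>d\<close> is its degree, so its \<open>N\<close>-th power is \<open>\<plusminus>f\<^sup>d\<close>; compare orders at \<open>\<xi>\<^sub>0\<close>.
\<close>

lemma degree_annihilator_ge:
  assumes "p \<noteq> 0" "ev p = 0"
  shows "N \<le> degree p"
proof -
  define P where "P = (\<lambda>d. \<exists>p. p \<noteq> 0 \<and> ev p = 0 \<and> degree p = d)"
  define d where "d = (LEAST d. P d)"
  have "P (degree p)" using assms by (auto simp: P_def)
  hence "P d" "d \<le> degree p"
    unfolding d_def by (auto intro: LeastI Least_le)
  then obtain q where q: "q \<noteq> 0" "ev q = 0" "degree q = d" by (auto simp: P_def)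
  have d0: "d > 0"
  proof (rule ccontr)
    assume "\<not> d > 0"
    then obtain c where "q = [:c:]" using q(3) by (auto elim: degree_eq_zeroE)
    thus False using q by (simp add: ev_def)
  qed
  have "kpoly mod q = 0"
  proof (rule ccontr)
    assume nz: "kpoly mod q \<noteq> 0"
    have "ev (kpoly mod q) = 0"
      using ev_mod[of q kpoly] q d0 ev_kpoly by simp
    hence "P (degree (kpoly mod q))" using nz by (auto simp: P_def)
    hence "d \<le> degree (kpoly mod q)" unfolding d_def by (rule Least_le)
    moreover have "degree (kpoly mod q) < degree q"
      using degree_mod_less[of q kpoly] nz q by auto
    ultimately show False using q by simp
  qed
  hence kq: "kpoly = (kpoly div q) * q"
    by (metis add.right_neutral div_mult_mod_eq)
  have root: "z ^ N = fn_of_poly f" if "poly (map_poly to_ac q) z = 0" for z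
  proof -
    have "heval to_ac z kpoly = 0"
      by (subst kq, simp only: to_ac.heval_mult) (use that in \<open>simp add: heval_def\<close>)
    thus ?thesis by (simp add: kpoly_def to_ac.heval_diff to_ac.heval_monom to_ac_Fract)
  qed
  define Q where "Q = map_poly to_ac q"
  have Q: "degree Q = d" "Q \<noteq> 0" "lead_coeff Q = to_ac (lead_coeff q)" "poly Q 0 = to_ac (coeff q 0)"
    using q by (auto simp: Q_def degree_map_poly coeff_map_poly map_poly_eq_0_iff poly_0_coeff_0)
  obtain A where A: "size A = d" "Q = smult (lead_coeff Q) (\<Prod>x\<in>#A. [:- x, 1:])"
    using alg_closed_imp_factorization[OF Q(2)] Q(1) by auto
  have "poly Q z = lead_coeff Q * (\<Prod>x\<in>#A. z - x)" for z
    by (subst A(2)) (simp add: poly_prod_mset)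
  hence Qz: "poly Q z = lead_coeff Q * (\<Prod>x\<in>#A. z - x)" for z .
  have "x ^ N = fn_of_poly f" if "x \<in># A" for x
  proof -
    have "poly Q x = 0" using Qz[of x] that by (auto simp: prod_mset_zero_iff)
    thus ?thesis using root by (simp add: Q_def)
  qed
  hence "(\<Prod>x\<in>#A. 0 - x) ^ N = ((-1) ^ N * fn_of_poly f) ^ size A"
    by (induction A) (auto simp: power_mult_distrib uminus_power_if)
  moreover have "(\<Prod>x\<in>#A. 0 - x) = to_ac (coeff q 0 / lead_coeff q)"
    using Qz[of 0] Q leading_coeff_neq_0[OF q(1)] by (simp add: field_simps)
  ultimately have "to_ac ((coeff q 0 / lead_coeff q) ^ N) = to_ac (((-1) ^ N * Fract f 1) ^ d)"
    using A(1) by (simp add: to_ac_Fract)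
  hence eq: "(coeff q 0 / lead_coeff q) ^ N = ((-1) ^ N * Fract f 1) ^ d"
    unfolding to_ac_eq_iff .
  obtain a b where ab: "coeff q 0 / lead_coeff q = Fract a b" "b \<noteq> 0"
    by (cases "coeff q 0 / lead_coeff q")
  define h where "h = (-1) ^ N * f"
  have Fp: "Fract u v ^ n = Fract (u ^ n) (v ^ n)" for u v :: "'a poly" and n
    by (induction n) (auto simp: One_fract_def)
  have "(-1) ^ N * Fract f 1 = Fract h 1"
    by (cases "even N") (auto simp: h_def)
  hence "Fract (a ^ N) (b ^ N) = Fract (h ^ d) 1"
    using eq ab by (simp add: Fp)
  hence "a ^ N = h ^ d * b ^ N"
    using ab by (simp add: eq_fract)
  moreover have h: "h \<noteq> 0" "order \<xi>\<^sub>0 h = order \<xi>\<^sub>0 f"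
    using f_nonzero by (cases "even N"; simp add: h_def)+
  ultimately have a: "a \<noteq> 0" using ab N_pos by (auto simp: zero_power)
  have "N * order \<xi>\<^sub>0 a = d * order \<xi>\<^sub>0 f + N * order \<xi>\<^sub>0 b"
    using arg_cong[OF \<open>a ^ N = _\<close>, of "order \<xi>\<^sub>0"] a h ab by (simp add: order_mult order_power)
  hence "N dvd d * order \<xi>\<^sub>0 f"
    by (metis dvd_add_left_iff dvd_triv_left)
  hence "N dvd d"
    using coprime by (metis coprime_commute coprime_dvd_mult_left_iff)
  thus ?thesis
    using d0 \<open>d \<le> degree p\<close> by (meson dvd_imp_le le_trans)
qed

lemma ev_eq_0_iff: "degree p < N \<Longrightarrow> ev p = 0 \<longleftrightarrow> p = 0"
  using degree_annihilator_ge[of p] by (auto simp: ev_def)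

lemma ev_mod_kpoly: "ev (p mod kpoly) = ev p" "degree (p mod kpoly) < N"
proof -
  show "ev (p mod kpoly) = ev p"
    using ev_mod[of kpoly p] degree_kpoly N_pos ev_kpoly by simp
  show "degree (p mod kpoly) < N"
    using degree_mod_less[of kpoly p] degree_kpoly N_pos by force
qed

lemma kpoly_dvd: "ev p = 0 \<longleftrightarrow> kpoly dvd p"
  using ev_mod_kpoly[of p] ev_eq_0_iff[of "p mod kpoly"] by (auto simp: mod_eq_0_iff_dvd)

text \<open>A nonzero element q of least degree in the ideal (p, kpoly) divides both generators. As
  q divides p, it does not annihilate y, so the cofactor of q in kpoly does and has degree at least
  N. Hence q is constant, and the Bezout relation yields the inverse.\<close>

lemma ev_inverse: "\<exists>q. ev q = inverse (ev p)"
proof (cases "ev p = 0")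
  case True
  thus ?thesis by (metis inverse_zero ev_def to_ac.heval_0)
next
  case False
  define I where "I = {a * p + b * kpoly | a b. True}"
  define d where "d = (LEAST d. \<exists>q\<in>I. q \<noteq> 0 \<and> degree q = d)"
  have pI: "p \<in> I" "kpoly \<in> I"
    unfolding I_def by (simp_all, rule exI[of _ 1], rule exI[of _ 0], simp, rule exI[of _ 0], rule exI[of _ 1], simp)
  have p0: "p \<noteq> 0" using False by (auto simp: ev_def)
  have "\<exists>q\<in>I. q \<noteq> 0 \<and> degree q = d"
    unfolding d_def by (rule LeastI[of _ "degree p"]) (use pI p0 in auto)
  then obtain q where q: "q \<in> I" "q \<noteq> 0" "degree q = d" by auto
  then obtain a b where ab: "q = a * p + b * kpoly" by (auto simp: I_def)
  have dvd: "q dvd r" if "r \<in> I" for r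
  proof (rule ccontr)
    assume "\<not> q dvd r"
    hence nz: "r mod q \<noteq> 0" by (simp add: mod_eq_0_iff_dvd)
    obtain a' b' where r: "r = a' * p + b' * kpoly" using \<open>r \<in> I\<close> by (auto simp: I_def)
    have "r mod q = r - (r div q) * q" by (simp add: minus_div_mult_eq_mod)
    also have "\<dots> = (a' - (r div q) * a) * p + (b' - (r div q) * b) * kpoly"
    proof -
      have "(r div q) * q = (r div q) * a * p + (r div q) * b * kpoly"
        by (subst (2) ab) (simp add: algebra_simps)
      thus ?thesis using r by (simp add: algebra_simps)
    qed
    finally have "r mod q \<in> I" unfolding I_def by blast
    hence "d \<le> degree (r mod q)"
      unfolding d_def using nz by (intro Least_le) auto
    thus False using degree_mod_less[of q r] nz q by auto
  qed
  obtain u where u: "p = q * u" using dvd[OF pI(1)] by (elim dvdE)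
  obtain v where v: "kpoly = q * v" using dvd[OF pI(2)] by (elim dvdE)
  have "ev q \<noteq> 0" using False u by (auto simp: ev_def to_ac.heval_mult)
  hence "ev v = 0" using v ev_kpoly by (auto simp: ev_def to_ac.heval_mult)
  moreover have "v \<noteq> 0" using v degree_kpoly N_pos by auto
  ultimately have "N \<le> degree v" by (intro degree_annihilator_ge)
  moreover have "N = degree q + degree v"
    using v degree_kpoly q(2) \<open>v \<noteq> 0\<close> by (simp add: degree_mult_eq)
  ultimately have "degree q = 0" by simp
  then obtain c where c: "q = [:c:]" by (auto elim: degree_eq_zeroE)
  have "to_ac c = ev a * ev p"
    using arg_cong[OF ab, of ev] c ev_kpoly by (simp add: ev_def to_ac.heval_add to_ac.heval_mult)
  moreover have "c \<noteq> 0" using c q by auto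
  moreover from calculation have "ev a \<noteq> 0" by auto
  ultimately have "ev (smult (inverse c) a) = inverse (ev p)"
    using False by (simp add: ev_def to_ac.heval_smult field_simps)
  thus ?thesis by blast
qed

abbreviation F :: "'a fn set" where "F \<equiv> fn_field y"

sublocale F: subfld F
  unfolding fn_field_def by (rule subfld_generate_field)

lemma fn_const_in_F [simp, intro]: "fn_const c \<in> F"
  and fn_x_in_F [simp, intro]: "fn_x \<in> F"
  and y_in_F [simp, intro]: "y \<in> F"
  by (auto simp: fn_field_def intro: generate_field.incl)

lemma rational_subset_F: "rational_fn_field \<subseteq> F"
  unfolding rational_fn_field_def
  by (rule generate_field_minimal) (auto simp: F.subfld_axioms)

lemma to_ac_in_F [simp, intro]: "to_ac r \<in> F"
  using rational_subset_F by (auto simp: rational_fn_field_eq)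

lemma fn_of_poly_in_F [simp, intro]: "fn_of_poly p \<in> F"
  by (simp add: fn_of_poly_def)

lemma F_eq: "F = range ev"
proof
  have "subfld (range ev)"
    unfolding subfld_def subfield_type_ring_iff
  proof (intro conjI ballI)
    show "1 \<in> range ev" by (rule range_eqI[of _ _ 1]) (simp add: ev_def)
  next
    fix a assume "a \<in> range ev"
    then obtain p where p: "a = ev p" by auto
    show "- a \<in> range ev" by (rule range_eqI[of _ _ "- p"]) (simp add: ev_def p to_ac.heval_uminus)
    show "inverse a \<in> range ev" using ev_inverse[of p] p by (metis rangeI)
  next
    fix a b assume "a \<in> range ev" "b \<in> range ev"
    then obtain p q where p: "a = ev p" "b = ev q" by auto
    show "a + b \<in> range ev" by (rule range_eqI[of _ _ "p + q"]) (simp add: ev_def p to_ac.heval_add)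
    show "a * b \<in> range ev" by (rule range_eqI[of _ _ "p * q"]) (simp add: ev_def p to_ac.heval_mult)
  qed
  moreover have "to_ac r \<in> range ev" for r
    by (rule range_eqI[of _ _ "[:r:]"]) (simp add: ev_def)
  moreover have "y \<in> range ev"
    by (rule range_eqI[of _ _ "[:0, 1:]"]) (simp add: ev_def)
  ultimately show "F \<subseteq> range ev"
    unfolding fn_field_def
    by (intro generate_field_minimal) (auto simp: fn_const_def fn_x_def fn_of_poly_def)
  have "ev p \<in> F" for p
    unfolding ev_def by (induction p) auto
  thus "range ev \<subseteq> F" by auto
qed

lemma F_expand:
  assumes "z \<in> F"
  obtains r where "z = (\<Sum>i<N. to_ac (r i) * y ^ i)"
proof -
  obtain p where "z = ev p" using assms F_eq by auto
  hence "z = ev (p mod kpoly)" by (simp add: ev_mod_kpoly)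
  hence "z = (\<Sum>i<N. to_ac (coeff (p mod kpoly) i) * y ^ i)"
    unfolding ev_def by (simp add: to_ac.heval_eq_sum[OF ev_mod_kpoly(2)])
  thus ?thesis using that by blast
qed

text \<open>The kernel of \<open>ev\<close> is generated by \<open>kpoly\<close>, so a homomorphism
  on polynomials extends once an N-th root of the image of f is chosen. Both the local expansions
  and the Galois automorphisms are obtained from this.\<close>

lemma hom_extend:
  fixes h :: "'a poly \<Rightarrow> 'c::field"
  assumes add: "\<And>a b. h (a + b) = h a + h b" and mult: "\<And>a b. h (a * b) = h a * h b"
    and one: "h 1 = 1" and inj: "\<And>a. h a = 0 \<Longrightarrow> a = 0" and Y: "Y ^ N = h f"
  obtains \<phi> where "fld_hom F \<phi>" "\<And>a. \<phi> (fn_of_poly a) = h a" "\<phi> y = Y"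
proof -
  obtain \<psi> where \<psi>: "fld_emb \<psi>" "\<And>a. \<psi> (Fract a 1) = h a"
    using fract_extend[OF add mult one inj] by blast
  interpret \<psi>: fld_emb \<psi> by fact
  have k: "heval \<psi> Y kpoly = 0"
    by (simp add: kpoly_def \<psi>.heval_diff \<psi>.heval_monom \<psi> Y)
  define \<phi> where "\<phi> = (\<lambda>z. heval \<psi> Y (SOME p. ev p = z))"
  have \<phi>: "\<phi> (ev p) = heval \<psi> Y p" for p
  proof -
    define q where "q = (SOME q. ev q = ev p)"
    have "ev q = ev p" unfolding q_def by (rule someI[of _ p]) simp
    hence "ev (q - p) = 0" by (simp add: ev_def to_ac.heval_diff)
    then obtain r where "q - p = kpoly * r" unfolding kpoly_dvd by (elim dvdE)
    hence "heval \<psi> Y (q - p) = 0" using k by (simp add: \<psi>.heval_mult)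
    thus ?thesis by (simp add: \<phi>_def \<psi>.heval_diff flip: q_def)
  qed
  have "fld_hom F \<phi>"
  proof (rule fld_homI[OF F.subfld_axioms])
    fix a b assume "a \<in> F" "b \<in> F"
    then obtain p q where p: "a = ev p" "b = ev q" using F_eq by auto
    have "a + b = ev (p + q)" "a * b = ev (p * q)"
      by (simp_all add: p ev_def to_ac.heval_add to_ac.heval_mult)
    thus "\<phi> (a + b) = \<phi> a + \<phi> b" "\<phi> (a * b) = \<phi> a * \<phi> b"
      by (simp_all add: p \<phi> \<psi>.heval_add \<psi>.heval_mult)
  next
    have "ev 1 = 1" by (simp add: ev_def)
    thus "\<phi> 1 = 1" using \<phi>[of 1] by simp
  qed
  moreover have "\<phi> (fn_of_poly a) = h a" for a
    using \<phi>[of "[:Fract a 1:]"] by (simp add: ev_def \<psi> to_ac_Fract)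
  moreover have "\<phi> y = Y"
    using \<phi>[of "[:0, 1:]"] by (simp add: ev_def)
  ultimately show ?thesis using that by blast
qed

lemma hom_unique:
  assumes "fld_hom F \<phi>" "fld_hom F \<psi>" "\<And>c. \<phi> (fn_const c) = \<psi> (fn_const c)"
    "\<phi> fn_x = \<psi> fn_x" "\<phi> y = \<psi> y" "z \<in> F"
  shows "\<phi> z = \<psi> z"
  using fld_hom_eq_generate_field[OF assms(1,2)[unfolded fn_field_def] _ assms(6)[unfolded fn_field_def]]
    assms(3-5) by auto

end

section \<open>Valuation rings\<close>

locale val_ring = F: subfld F for F :: "'a::field set" +
  fixes V :: "'a set"
  assumes val_ring: "valuation_ring F V"
begin

lemma one [simp, intro]: "1 \<in> V"
  and uminus [simp, intro]: "a \<in> V \<Longrightarrow> - a \<in> V"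
  and add [simp, intro]: "a \<in> V \<Longrightarrow> b \<in> V \<Longrightarrow> a + b \<in> V"
  and mult [simp, intro]: "a \<in> V \<Longrightarrow> b \<in> V \<Longrightarrow> a * b \<in> V"
  and in_F [intro]: "a \<in> V \<Longrightarrow> a \<in> F"
  and total: "a \<in> F \<Longrightarrow> a \<in> V \<or> inverse a \<in> V"
  using val_ring by (auto simp: valuation_ring_def subring_type_ring_iff)

lemma diff [simp, intro]: "a \<in> V \<Longrightarrow> b \<in> V \<Longrightarrow> a - b \<in> V"
  using add[of a "- b"] by simp

lemma zero [simp, intro]: "0 \<in> V"
  using diff[OF one one] by simp

lemma power [simp, intro]: "a \<in> V \<Longrightarrow> a ^ n \<in> V"
  by (induction n) auto

lemma sum [intro]: "(\<And>i. i \<in> A \<Longrightarrow> g i \<in> V) \<Longrightarrow> sum g A \<in> V"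
  by (induction A rule: infinite_finite_induct) auto

lemma prod [intro]: "(\<And>i. i \<in> A \<Longrightarrow> g i \<in> V) \<Longrightarrow> prod g A \<in> V"
  by (induction A rule: infinite_finite_induct) auto

lemma max_ideal_subset [intro]: "a \<in> max_ideal V \<Longrightarrow> a \<in> V"
  by (simp add: max_ideal_def)

lemma zero_max_ideal [simp]: "0 \<in> max_ideal V"
  by (simp add: max_ideal_def)

lemma unit_iff: "a \<in> V - max_ideal V \<longleftrightarrow> a \<in> V \<and> a \<noteq> 0 \<and> inverse a \<in> V"
  by (auto simp: max_ideal_def)

lemma one_notin_max_ideal: "1 \<notin> max_ideal V"
  using unit_iff[of 1] by simp

lemma inverse_max_ideal: "a \<in> F \<Longrightarrow> a \<notin> V \<Longrightarrow> inverse a \<in> max_ideal V"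
  using total[of a] by (auto simp: max_ideal_def)

lemma mult_max_ideal: "a \<in> V \<Longrightarrow> b \<in> max_ideal V \<Longrightarrow> a * b \<in> max_ideal V"
proof -
  assume a: "a \<in> V" and b: "b \<in> max_ideal V"
  have False if "a * b \<noteq> 0" "inverse (a * b) \<in> V"
  proof -
    have "inverse b = a * inverse (a * b)" using that(1) by (simp add: field_simps)
    hence "inverse b \<in> V" using mult[OF a that(2)] by metis
    thus False using b that(1) by (auto simp: max_ideal_def)
  qed
  thus ?thesis using a b by (auto simp: max_ideal_def)
qed

lemma add_max_ideal: "a \<in> max_ideal V \<Longrightarrow> b \<in> max_ideal V \<Longrightarrow> a + b \<in> max_ideal V"
proof -
  have *: "a + b \<in> max_ideal V" if a: "a \<in> max_ideal V" "b \<in> max_ideal V" "b \<noteq> 0" "a / b \<in> V" for a b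
  proof -
    have "(1 + a / b) * b = a + b" using that(3) by (simp add: field_simps)
    thus ?thesis using mult_max_ideal[of "1 + a / b" b] that by auto
  qed
  assume a: "a \<in> max_ideal V" and b: "b \<in> max_ideal V"
  show ?thesis
  proof (cases "a = 0 \<or> b = 0")
    case False
    hence "a / b \<in> V \<or> b / a \<in> V"
      using total[of "a / b"] a b by (auto simp: field_simps)
    thus ?thesis using *[of a b] *[of b a] a b False by (auto simp: add.commute)
  qed (use a b in auto)
qed

lemma uminus_max_ideal: "a \<in> max_ideal V \<Longrightarrow> - a \<in> max_ideal V"
  using mult_max_ideal[of "- 1" a] by simp

lemma diff_max_ideal: "a \<in> max_ideal V \<Longrightarrow> b \<in> max_ideal V \<Longrightarrow> a - b \<in> max_ideal V"
  using add_max_ideal[of a "- b"] uminus_max_ideal by simp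

lemma mult_unit: "a \<in> V - max_ideal V \<Longrightarrow> b \<in> V - max_ideal V \<Longrightarrow> a * b \<in> V - max_ideal V"
  unfolding unit_iff by simp

lemma power_max_ideal: "a \<in> max_ideal V \<Longrightarrow> n > 0 \<Longrightarrow> a ^ n \<in> max_ideal V"
proof (cases n)
  case (Suc m)
  assume "a \<in> max_ideal V"
  thus ?thesis using mult_max_ideal[of "a ^ m" a] Suc by (auto simp: mult.commute)
qed auto

lemma prod_unit:
  "finite A \<Longrightarrow> (\<And>i. i \<in> A \<Longrightarrow> g i \<in> V - max_ideal V) \<Longrightarrow> prod g A \<in> V - max_ideal V"
  by (induction A rule: finite_induct) (use one_notin_max_ideal mult_unit in auto)

lemma power_unit: "a \<in> V - max_ideal V \<Longrightarrow> a ^ n \<in> V - max_ideal V"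
  by (induction n) (use one_notin_max_ideal mult_unit in auto)

lemma inverse_unit: "a \<in> V - max_ideal V \<Longrightarrow> inverse a \<in> V - max_ideal V"
  unfolding unit_iff by simp

lemma add_unit: "a \<in> V - max_ideal V \<Longrightarrow> b \<in> max_ideal V \<Longrightarrow> a + b \<in> V - max_ideal V"
  using diff_max_ideal[of "a + b" b] by auto

text \<open>Valuation rings are integrally closed; this special case suffices because
  \<open>y\<close> enters through N-th powers.\<close>

lemma power_in_imp:
  assumes "z \<in> F" "z ^ n \<in> V" "n > 0"
  shows "z \<in> V"
proof (rule ccontr)
  assume z: "z \<notin> V"
  hence i: "inverse z \<in> max_ideal V" using assms inverse_max_ideal by simp
  have "inverse z ^ n \<in> max_ideal V"
    using assms(3) i by (intro power_max_ideal)
  moreover have "z \<noteq> 0" using z by auto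
  ultimately have "z ^ n * inverse z ^ n \<in> max_ideal V"
    using assms(2) by (intro mult_max_ideal)
  thus False using \<open>z \<noteq> 0\<close> one_notin_max_ideal by (simp flip: power_mult_distrib)
qed

lemma uniformizer_max_ideal: "uniformizer V t \<Longrightarrow> t \<in> max_ideal V"
  unfolding uniformizer_def by (metis image_eqI mult.right_neutral one)

lemma uniformizers_assoc:
  assumes "uniformizer V t" "uniformizer V t'"
  obtains w where "w \<in> V - max_ideal V" "t' = t * w"
proof -
  have "t' \<in> times t ` V" "t \<in> times t' ` V"
    using assms uniformizer_max_ideal[OF assms(2)] uniformizer_max_ideal[OF assms(1)]
    unfolding uniformizer_def by metis+
  then obtain w w' where w: "w \<in> V" "t' = t * w" and w': "w' \<in> V" "t = t' * w'"
    by blast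
  have nz: "t \<noteq> 0" "t' \<noteq> 0" using assms by (auto simp: uniformizer_def)
  have "w * w' = 1" using w w' nz by (metis mult.assoc mult_cancel_left1)
  hence "inverse w = w'" "w \<noteq> 0" by (auto simp: inverse_unique)
  hence "w \<in> V - max_ideal V" unfolding unit_iff using w w' by simp
  thus ?thesis using that w by blast
qed

lemma power_int_unit: "u \<in> V - max_ideal V \<Longrightarrow> u powi n \<in> V - max_ideal V"
proof (cases n rule: int_cases2)
  case (nonneg m)
  assume "u \<in> V - max_ideal V"
  thus ?thesis unfolding nonneg power_int_of_nat by (rule power_unit)
next
  case (nonpos m)
  assume "u \<in> V - max_ideal V"
  thus ?thesis unfolding nonpos power_int_minus power_int_of_nat by (intro inverse_unit power_unit)
qed

lemma uniformizer_power_unique: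
  assumes "uniformizer V t" "t powi i \<in> V - max_ideal V"
  shows "i = 0"
proof (rule ccontr)
  assume "i \<noteq> 0"
  moreover have "t powi i \<in> V - max_ideal V" "t powi (- i) \<in> V - max_ideal V"
    using assms(2) inverse_unit[OF assms(2)] by (simp_all add: power_int_minus)
  ultimately obtain n :: nat where n: "n > 0" "t ^ n \<in> V - max_ideal V"
  proof (cases i rule: int_cases2)
    case (nonneg m)
    assume "i \<noteq> 0" "t powi i \<in> V - max_ideal V"
    thus ?thesis using that[of m] unfolding nonneg power_int_of_nat by simp
  next
    case (nonpos m)
    assume "i \<noteq> 0" "t powi (- i) \<in> V - max_ideal V"
    thus ?thesis using that[of m] unfolding nonpos minus_minus power_int_of_nat by simp
  qed
  thus False using power_max_ideal[OF uniformizer_max_ideal[OF assms(1)]] by simp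
qed

text \<open>The \<open>THE\<close> in \<open>valuation\<close> ranges over all uniformizers. Two of
  them differ by a unit, and a power of a uniformizer is a unit only for exponent 0, so the exponent
  is unique.\<close>

lemma valuation_eq:
  assumes t: "uniformizer V t" and u: "u \<in> V - max_ideal V" and z: "z = t powi i * u"
  shows "valuation V z = i"
  unfolding valuation_def
proof (rule the_equality)
  show "\<exists>t u. uniformizer V t \<and> u \<in> V - max_ideal V \<and> z = t powi i * u"
    using assms by blast
next
  fix j assume "\<exists>t u. uniformizer V t \<and> u \<in> V - max_ideal V \<and> z = t powi j * u"
  then obtain t' u' where *: "uniformizer V t'" "u' \<in> V - max_ideal V" "z = t' powi j * u'" by blast
  obtain w where w: "w \<in> V - max_ideal V" "t' = t * w" using uniformizers_assoc[OF t *(1)] .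
  have nz: "t \<noteq> 0" using t by (simp add: uniformizer_def)
  have nz': "u \<noteq> 0" using u unit_iff by blast
  have aux: "a / b = (c * u') * inverse u" if "a * u = b * c * u'" "b \<noteq> 0" for a b c :: 'a
    using that nz' by (simp add: divide_simps mult_ac)
  have "t powi i * u = t powi j * w powi j * u'"
    using *(3) unfolding z w(2) power_int_mult_distrib .
  from aux[OF this] have "t powi (i - j) = (w powi j * u') * inverse u"
    using nz by (simp add: power_int_diff)
  moreover have "(w powi j * u') * inverse u \<in> V - max_ideal V"
    by (intro mult_unit inverse_unit power_int_unit w u *)
  ultimately have "i - j = 0" using uniformizer_power_unique[OF t, of "i - j"] by simp
  thus "j = i" by simp
qed

text \<open>\<open>ram_index\<close> evaluates at a uniformizer picked by \<open>SOME\<close>. Two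
  choices differ by a unit of \<open>R\<close>, which is also a unit of \<open>V\<close>; comparing
  the predicates under \<open>THE\<close> avoids the question whether they are satisfied.\<close>

lemma valuation_cong:
  assumes "uniformizer R t" "uniformizer R t'" "val_ring E R" "R \<subseteq> V"
  shows "valuation V t = valuation V t'"
proof -
  interpret R: val_ring E R by fact
  obtain w where w: "w \<in> R - max_ideal R" "t' = t * w" using R.uniformizers_assoc[OF assms(1,2)] .
  have w: "w \<in> V - max_ideal V" "t' = t * w" "t = t' * inverse w" "inverse w \<in> V - max_ideal V"
    using w assms(4) unfolding unit_iff R.unit_iff by auto
  have "(\<exists>s u. uniformizer V s \<and> u \<in> V - max_ideal V \<and> t = s powi i * u) \<longleftrightarrow>
     (\<exists>s u. uniformizer V s \<and> u \<in> V - max_ideal V \<and> t' = s powi i * u)" for i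
  proof (intro iffI; elim exE conjE)
    fix s u assume *: "uniformizer V s" "u \<in> V - max_ideal V" "t = s powi i * u"
    have "u * w \<in> V - max_ideal V" using mult_unit[OF *(2) w(1)] .
    moreover have "t' = s powi i * (u * w)" unfolding w(2) *(3) by (simp only: mult.assoc)
    ultimately show "\<exists>s u. uniformizer V s \<and> u \<in> V - max_ideal V \<and> t' = s powi i * u" using *(1) by blast
  next
    fix s u assume *: "uniformizer V s" "u \<in> V - max_ideal V" "t' = s powi i * u"
    have "u * inverse w \<in> V - max_ideal V" using mult_unit[OF *(2) w(4)] .
    moreover have "t = s powi i * (u * inverse w)" unfolding *(3)[symmetric] mult.assoc[symmetric] by (rule w(3))
    ultimately show "\<exists>s u. uniformizer V s \<and> u \<in> V - max_ideal V \<and> t = s powi i * u" using *(1) by blast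
  qed
  thus ?thesis by (simp add: valuation_def)
qed

end

lemma val_ring_Int:
  assumes "val_ring F V" "subfld E" "E \<subseteq> F"
  shows "val_ring E (V \<inter> E)"
proof -
  interpret V: val_ring F V by fact
  interpret E: subfld E by fact
  show ?thesis
    using V.total assms(3)
    by unfold_locales (auto simp: valuation_ring_def subring_type_ring_iff)
qed

lemma max_ideal_Int:
  assumes "subfld E"
  shows "max_ideal (V \<inter> E) = max_ideal V \<inter> E"
proof -
  interpret subfld E by fact
  show ?thesis by (auto simp: max_ideal_def)
qed

context fld_hom
begin

lemma inv_image_iff: "V \<subseteq> F \<Longrightarrow> z \<in> F \<Longrightarrow> \<phi> z \<in> \<phi> ` V \<longleftrightarrow> z \<in> V"
  using hom_inj by (rule inj_on_image_mem_iff)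

lemma max_ideal_image:
  assumes "V \<subseteq> F"
  shows "max_ideal (\<phi> ` V) = \<phi> ` max_ideal V"
proof -
  have "inverse (\<phi> z) \<in> \<phi> ` V \<longleftrightarrow> inverse z \<in> V" if "z \<in> V" for z
    using that assms inv_image_iff[OF assms, of "inverse z"] by (metis hom_inverse inverse subset_iff)
  moreover have "\<phi> z = 0 \<longleftrightarrow> z = 0" if "z \<in> V" for z
    using that assms by auto
  ultimately have "\<phi> z \<in> max_ideal (\<phi> ` V) \<longleftrightarrow> z \<in> max_ideal V" if "z \<in> V" for z
    using that by (simp add: max_ideal_def)
  moreover have "max_ideal (\<phi> ` V) \<subseteq> \<phi> ` V" "max_ideal V \<subseteq> V" by (auto simp: max_ideal_def)
  ultimately show ?thesis by blast
qed

lemma uniformizer_image_iff: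
  assumes "V \<subseteq> F" "t \<in> F"
  shows "uniformizer (\<phi> ` V) (\<phi> t) \<longleftrightarrow> uniformizer V t"
proof -
  have sub: "max_ideal V \<subseteq> F" "times t ` V \<subseteq> F" using assms by (auto simp: max_ideal_def)
  have "times (\<phi> t) ` \<phi> ` V = \<phi> ` times t ` V"
    using assms by (auto simp: image_image hom_mult subset_iff intro!: image_cong)
  thus ?thesis
    unfolding uniformizer_def max_ideal_image[OF assms(1)]
    using assms(2) inj_on_image_eq_iff[OF hom_inj sub] by simp
qed

lemma val_ring_image:
  assumes "val_ring F V"
  shows "val_ring (\<phi> ` F) (\<phi> ` V)"
proof -
  interpret V: val_ring F V by fact
  interpret I: subfld "\<phi> ` F" by (rule subfld_image) (auto simp: subfld_axioms)
  have sub: "V \<subseteq> F" by auto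
  have "1 \<in> \<phi> ` V" using V.one hom_one by (metis image_eqI)
  moreover have "- \<phi> a \<in> \<phi> ` V" if "a \<in> V" for a
    using that sub hom_uminus[of a] by (metis V.uminus image_eqI subsetD)
  moreover have "\<phi> a + \<phi> b \<in> \<phi> ` V" "\<phi> a * \<phi> b \<in> \<phi> ` V" if "a \<in> V" "b \<in> V" for a b
    using that sub hom_add[of a b] hom_mult[of a b] by (metis V.add V.mult image_eqI subsetD)+
  moreover have "\<phi> a \<in> \<phi> ` V \<or> inverse (\<phi> a) \<in> \<phi> ` V" if "a \<in> F" for a
    using V.total[OF that] that hom_inverse[of a] by (metis image_eqI)
  ultimately show ?thesis
    using sub by unfold_locales (auto simp: valuation_ring_def subring_type_ring_iff)
qed

lemma valuation_image:
  assumes V: "V \<subseteq> F" and z: "z \<in> F"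
  shows "valuation (\<phi> ` V) (\<phi> z) = valuation V z"
proof -
  have "(\<exists>t u. uniformizer (\<phi> ` V) t \<and> u \<in> \<phi> ` V - max_ideal (\<phi> ` V) \<and> \<phi> z = t powi i * u) \<longleftrightarrow>
     (\<exists>t u. uniformizer V t \<and> u \<in> V - max_ideal V \<and> z = t powi i * u)" (is "?L \<longleftrightarrow> ?R") for i
  proof
    assume ?L
    then obtain t u where *: "uniformizer (\<phi> ` V) t" "u \<in> \<phi> ` V - max_ideal (\<phi> ` V)" "\<phi> z = t powi i * u"
      by blast
    show ?R
    \<comment> \<open>\<open>uniformizer\<close> does not say in which field t lies. That t is in
      the image follows by writing it as a quotient of two elements of the image.\<close>
    proof (cases "\<exists>t'\<in>F. t = \<phi> t'")
      case True
      then obtain t' where t': "t' \<in> F" "t = \<phi> t'" by blast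
      obtain u' where u': "u' \<in> V - max_ideal V" "u = \<phi> u'"
        using *(2) unfolding max_ideal_image[OF V] by auto
      have "u' \<in> F" using u' V by auto
      hence "\<phi> z = \<phi> (t' powi i * u')"
        using *(3) t' u' by (simp add: hom_mult hom_power_int)
      hence "z = t' powi i * u'"
        using hom_inj z t' \<open>u' \<in> F\<close> by (meson inj_onD mult power_int)
      thus ?R using u' t' *(1) uniformizer_image_iff[OF V t'(1)] by blast
    next
      case False
      have "t * \<phi> v \<in> \<phi> ` V" if "v \<in> V" for v
        using *(1) that unfolding uniformizer_def max_ideal_def by blast
      hence v: "\<exists>w\<in>V. t * \<phi> v = \<phi> w" if "v \<in> V" for v using that by blast
      have "u \<in> \<phi> ` V" using *(2) by blast
      then obtain v where "v \<in> V" "u = \<phi> v" by blast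
      obtain w where w: "w \<in> V" "t * \<phi> v = \<phi> w" using v[OF \<open>v \<in> V\<close>] by blast
      have "\<phi> v \<noteq> 0" using *(2) \<open>u = \<phi> v\<close> by (auto simp: max_ideal_def)
      hence "t = \<phi> (w / v)"
        using w \<open>v \<in> V\<close> V by (subst hom_divide) (auto simp: field_simps)
      thus ?R using False w \<open>v \<in> V\<close> V by blast
    qed
  next
    assume ?R
    then obtain t u where *: "uniformizer V t" "u \<in> V - max_ideal V" "z = t powi i * u" by blast
    have u: "u \<in> F" "u \<noteq> 0" using * V by (auto simp: max_ideal_def)
    have "t * u \<in> V" using * by (auto simp: uniformizer_def max_ideal_def)
    hence "(t * u) / u \<in> F" using u V by (intro divide) auto
    hence t: "t \<in> F" using u by simp
    have "uniformizer (\<phi> ` V) (\<phi> t)" using uniformizer_image_iff[OF V t] * by blast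
    moreover have "\<phi> u \<in> \<phi> ` V - max_ideal (\<phi> ` V)"
      unfolding max_ideal_image[OF V] using *(2) hom_inj V u
      by (auto simp: inj_on_def max_ideal_def)
    moreover have "\<phi> z = \<phi> t powi i * \<phi> u"
      using *(3) t u by (simp add: hom_mult hom_power_int)
    ultimately show ?L by blast
  qed
  thus ?thesis by (simp add: valuation_def)
qed

end


section \<open>Valuations from embeddings into Laurent series\<close>

lemma fls_subdegree_nonneg_iff: "0 \<le> fls_subdegree g \<longleftrightarrow> (\<forall>k<0. fls_nth g k = 0)"
  using fls_subdegree_ge0I[of g] by (auto dest: fls_eq0_below_subdegree)

lemma fls_subdegree_nonneg_add: "0 \<le> fls_subdegree g \<Longrightarrow> 0 \<le> fls_subdegree h \<Longrightarrow> 0 \<le> fls_subdegree (g + h)"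
  unfolding fls_subdegree_nonneg_iff by simp

lemma fls_subdegree_nonneg_mult:
  "0 \<le> fls_subdegree g \<Longrightarrow> 0 \<le> fls_subdegree h \<Longrightarrow> 0 \<le> fls_subdegree (g * h :: 'a::field fls)"
  by (cases "g = 0 \<or> h = 0") auto

text \<open>An element of order 1 makes the order function surjective onto the integers; without it
  \<open>ord\<close> could be a proper multiple of \<open>valuation\<close>.\<close>

locale fls_place = fld_hom F \<phi> for F :: "'b::field set" and \<phi> :: "'b \<Rightarrow> 'a::field fls" +
  assumes ex_param: "\<exists>t\<in>F. fls_subdegree (\<phi> t) = 1"
begin

definition ord :: "'b \<Rightarrow> int" where "ord z = fls_subdegree (\<phi> z)"
definition V :: "'b set" where "V = {z\<in>F. 0 \<le> ord z}"

lemma ord_mult: "a \<in> F \<Longrightarrow> b \<in> F \<Longrightarrow> a \<noteq> 0 \<Longrightarrow> b \<noteq> 0 \<Longrightarrow> ord (a * b) = ord a + ord b"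
  by (simp add: ord_def hom_mult)

lemma ord_inverse: "a \<in> F \<Longrightarrow> ord (inverse a) = - ord a"
  by (cases "a = 0") (auto simp: ord_def hom_inverse fls_inverse_subdegree)

lemma ord_divide: "a \<in> F \<Longrightarrow> b \<in> F \<Longrightarrow> a \<noteq> 0 \<Longrightarrow> b \<noteq> 0 \<Longrightarrow> ord (a / b) = ord a - ord b"
  by (simp add: divide_inverse ord_mult ord_inverse)

lemma ord_power_int: "a \<in> F \<Longrightarrow> ord (a powi n) = n * ord a"
  by (simp add: ord_def hom_power_int)

lemma ord_power: "a \<in> F \<Longrightarrow> ord (a ^ n) = int n * ord a"
  by (simp add: ord_def hom_power fls_subdegree_pow)

text \<open>The zero series has subdegree 0 by convention. This puts 0 into \<open>V\<close>, but
  the maximal ideal and the units have to mention it separately.\<close>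

lemma ord_0 [simp]: "ord 0 = 0"
  and ord_1 [simp]: "ord 1 = 0"
  by (simp_all add: ord_def)

lemma ord_uminus: "a \<in> F \<Longrightarrow> ord (- a) = ord a"
  by (simp add: ord_def hom_uminus)

sublocale val_ring F V
proof unfold_locales
  have "a \<in> V \<or> inverse a \<in> V" if "a \<in> F" for a
    using that ord_inverse[of a] by (auto simp: V_def)
  moreover have "a + b \<in> V" "a * b \<in> V" if "a \<in> V" "b \<in> V" for a b
    using that fls_subdegree_nonneg_add[of "\<phi> a" "\<phi> b"] fls_subdegree_nonneg_mult[of "\<phi> a" "\<phi> b"]
    by (auto simp: V_def ord_def hom_add hom_mult)
  ultimately show "valuation_ring F V"
    by (auto simp: valuation_ring_def subring_type_ring_iff V_def ord_uminus)
qed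

lemma V_iff: "z \<in> V \<longleftrightarrow> z \<in> F \<and> 0 \<le> ord z"
  by (simp add: V_def)

lemma max_ideal_eq: "max_ideal V = {z\<in>F. z = 0 \<or> 0 < ord z}"
  by (auto simp: max_ideal_def V_iff ord_inverse)

lemma unit_iff_ord: "u \<in> V - max_ideal V \<longleftrightarrow> u \<in> F \<and> u \<noteq> 0 \<and> ord u = 0"
  by (auto simp: max_ideal_eq V_iff)

lemma uniformizer_iff: "uniformizer V t \<longleftrightarrow> t \<in> F \<and> ord t = 1"
proof -
  have imp: "uniformizer V t" if t: "t \<in> F" "ord t = 1" for t
  proof -
    have t0: "t \<noteq> 0" using t by auto
    have "max_ideal V = times t ` V"
    proof (intro equalityI subsetI)
      fix z assume z: "z \<in> max_ideal V"
      have "z / t \<in> V"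
        using z t t0 by (cases "z = 0") (auto simp: max_ideal_eq V_iff ord_divide)
      thus "z \<in> times t ` V" using t0 by (intro image_eqI[of _ _ "z / t"]) auto
    next
      fix z assume "z \<in> times t ` V"
      then obtain v where v: "z = t * v" "v \<in> V" by auto
      thus "z \<in> max_ideal V"
        using t t0 by (cases "v = 0") (auto simp: max_ideal_eq V_iff ord_mult)
    qed
    thus ?thesis using t0 by (simp add: uniformizer_def)
  qed
  have "t \<in> F \<and> ord t = 1" if t: "uniformizer V t"
  proof -
    obtain s where s: "s \<in> F" "ord s = 1" using ex_param by (auto simp: ord_def)
    obtain w where w: "w \<in> V - max_ideal V" "t = s * w" using uniformizers_assoc[OF imp[OF s] t] .
    have "s \<noteq> 0" using s by auto
    thus ?thesis using w s unfolding unit_iff_ord by (simp add: ord_mult)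
  qed
  thus ?thesis using imp by blast
qed

lemma ex_uniformizer: "\<exists>t. uniformizer V t"
  using ex_param by (auto simp: uniformizer_iff ord_def)

lemma valuation_eq_ord:
  assumes "z \<in> F" "z \<noteq> 0"
  shows "valuation V z = ord z"
proof -
  obtain t where t: "uniformizer V t" using ex_uniformizer ..
  hence tF: "t \<in> F" "ord t = 1" "t \<noteq> 0" by (auto simp: uniformizer_iff)
  have "z / t powi ord z \<in> V - max_ideal V"
    unfolding unit_iff_ord using tF assms by (simp add: ord_divide ord_power_int)
  thus ?thesis
    using valuation_eq[OF t, of "z / t powi ord z" z "ord z"] tF by simp
qed

lemma V_psubset: "V \<subset> F"
proof -
  obtain t where t: "t \<in> F" "ord t = 1" using ex_uniformizer unfolding uniformizer_iff by blast
  hence "inverse t \<notin> V" "inverse t \<in> F" by (simp_all add: V_iff ord_inverse)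
  moreover have "V \<subseteq> F" by auto
  ultimately show ?thesis by (metis psubsetI)
qed

end

section \<open>Expansions at the points of the projective line\<close>

lemma fld_emb_fls_const: "fld_emb (fls_const :: 'a::field \<Rightarrow> 'a fls)"
  unfolding fld_emb_def by (intro fld_homI subfld_UNIV) (auto simp: fls_plus_const)

interpretation fls_const: fld_emb fls_const
  by (rule fld_emb_fls_const)

text \<open>\<open>Some \<xi>\<close> stands for the point with \<open>x\<close>-coordinate \<open>\<xi>\<close>, and \<open>None\<close> for \<open>\<infinity>\<close>.\<close>

definition ordp :: "'a option \<Rightarrow> 'a::field poly \<Rightarrow> int" where
  "ordp p a = (case p of Some \<xi> \<Rightarrow> int (order \<xi> a) | None \<Rightarrow> - int (degree a))"

text \<open>The expansion of x in the local parameter \<open>fls_X\<close>, which stands for x -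
  \<xi> or for 1/x.\<close>

definition place_x :: "'a option \<Rightarrow> 'a::field fls" where
  "place_x p = (case p of Some \<xi> \<Rightarrow> fls_const \<xi> + fls_X | None \<Rightarrow> inverse fls_X)"

definition expand :: "'a option \<Rightarrow> 'a::field poly \<Rightarrow> 'a fls" where
  "expand p = heval fls_const (place_x p)"

lemma expand_simps:
  "expand p (a + b) = expand p a + expand p b"
  "expand p (a * b) = expand p a * expand p b"
  "expand p 1 = 1"
  by (simp_all add: expand_def fls_const.heval_add fls_const.heval_mult)

lemma linear_quotient: "\<exists>c. b = [:poly b \<xi>:] + [:- \<xi>, 1:] * (c :: 'a::field poly)"
proof -
  have "[:- \<xi>, 1:] dvd b - [:poly b \<xi>:]"
    by (simp add: poly_eq_0_iff_dvd[symmetric])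
  then obtain c where "b - [:poly b \<xi>:] = [:- \<xi>, 1:] * c" by (elim dvdE)
  thus ?thesis by (intro exI[of _ c]) (simp add: algebra_simps)
qed

lemma order_decompose:
  assumes "a \<noteq> (0 :: 'a::field poly)"
  obtains b where "a = [:- \<xi>, 1:] ^ order \<xi> a * b" "poly b \<xi> \<noteq> 0"
proof -
  obtain b where "a = [:- \<xi>, 1:] ^ order \<xi> a * b" "\<not> [:- \<xi>, 1:] dvd b"
    using order_decomp[OF assms] by blast
  thus ?thesis using that by (simp add: poly_eq_0_iff_dvd)
qed

text \<open>At \<xi>, splitting off the power of x - \<xi> leaves a cofactor whose expansion has
  constant term \<open>poly b \<xi>\<close>, which is nonzero. At infinity each step of Horner's
  scheme lowers the order by one, so the leading term dominates.\<close>

lemma expand_subdegree: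
  assumes "a \<noteq> (0 :: 'a::field poly)"
  shows "expand p a \<noteq> 0" "fls_subdegree (expand p a) = ordp p a"
proof -
  have "expand p a \<noteq> 0 \<and> fls_subdegree (expand p a) = ordp p a"
  proof (cases p)
    case (Some \<xi>)
    have X: "expand p [:- \<xi>, 1:] = fls_X"
      by (simp add: expand_def Some place_x_def fls_const.emb_simps)
    have nonneg: "0 \<le> fls_subdegree (expand p b)" for b
    proof (induction b)
      case (pCons c b)
      have "0 \<le> fls_subdegree (fls_const \<xi> + fls_X)"
        by (intro fls_subdegree_nonneg_add) auto
      thus ?case
        using pCons by (auto simp: expand_def Some place_x_def intro!: fls_subdegree_nonneg_add fls_subdegree_nonneg_mult)
    qed (simp add: expand_def)
    obtain b where b: "a = [:- \<xi>, 1:] ^ order \<xi> a * b" "poly b \<xi> \<noteq> 0"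
      using order_decompose[OF assms] .
    obtain c where c: "b = [:poly b \<xi>:] + [:- \<xi>, 1:] * c" using linear_quotient by blast
    have "expand p b = fls_const (poly b \<xi>) + fls_X * expand p c"
      by (subst c, simp only: expand_simps X) (simp add: expand_def)
    moreover have "fls_nth (fls_X * expand p c) 0 = 0"
      using nonneg[of c] by (simp add: fls_X_times_conv_shift(1) fls_eq0_below_subdegree)
    ultimately have "fls_nth (expand p b) 0 \<noteq> 0" using b(2) by simp
    hence b0: "expand p b \<noteq> 0" "fls_subdegree (expand p b) = 0"
      using nonneg[of b] fls_subdegree_leI[of "expand p b" 0] by auto
    have "expand p a = fls_X ^ order \<xi> a * expand p b"
      by (subst b(1)) (simp add: expand_def fls_const.heval_mult fls_const.heval_power X[unfolded expand_def] del: fls_const.heval_pCons)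
    thus ?thesis
      using b0 by (simp add: fls_subdegree_pow ordp_def Some)
  next
    case None
    show ?thesis
      using assms
    proof (induction a)
      case (pCons c a)
      show ?case
      proof (cases "a = 0")
        case True
        thus ?thesis using pCons by (simp add: expand_def ordp_def None)
      next
        case False
        define h where "h = inverse fls_X * expand p a"
        have h: "h \<noteq> 0" "fls_subdegree h = - int (degree a) - 1"
          using pCons(2)[OF False] by (simp_all add: h_def ordp_def None fls_inverse_subdegree)
        have e: "expand p (pCons c a) = fls_const c + h"
          by (simp add: expand_def h_def place_x_def None)
        have "fls_subdegree (fls_const c + h) = fls_subdegree h"
          using h fls_subdegree_add_eq2[of h "fls_const c"] by (cases "c = 0") auto
        moreover have "fls_const c + h \<noteq> 0"
        proof
          assume "fls_const c + h = 0"
          hence "h = - fls_const c" by (simp add: eq_neg_iff_add_eq_0 add.commute)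
          thus False using h(2) by simp
        qed
        ultimately show ?thesis using e h False by (simp add: ordp_def None)
      qed
    qed simp
  qed
  thus "expand p a \<noteq> 0" "fls_subdegree (expand p a) = ordp p a" by auto
qed

lemma fld_emb_compose:
  "H \<noteq> 0 \<Longrightarrow> fps_nth H 0 = 0 \<Longrightarrow> fld_emb (\<lambda>z :: 'a::field fls. fls_compose_fps z H)"
  unfolding fld_emb_def
  by (intro fld_homI subfld_UNIV) (auto simp: fls_compose_fps_add fls_compose_fps_mult)

lemma fls_decompose: "g = fls_X powi fls_subdegree g * fps_to_fls (fls_base_factor_to_fps (g :: 'a::field fls))"
  using fls_conv_base_factor_to_fps_shift_subdegree[of g]
  by (simp add: fls_X_intpow_times_conv_shift)

lemma fps_X_power_neq_0 [simp]: "fps_X ^ e \<noteq> (0 :: 'a::field fps)"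
  by simp

lemma fps_X_power_nth_0: "e > 0 \<Longrightarrow> fps_nth (fps_X ^ e :: 'a::field fps) 0 = 0"
  by (simp add: fps_nth_power_0)

lemma subdegree_compose_power:
  assumes "e > 0"
  shows "fls_subdegree (fls_compose_fps g (fps_X ^ e)) = int e * fls_subdegree (g :: 'a::field fls)"
proof (cases "g = 0")
  case False
  define u where "u = fls_base_factor_to_fps g"
  have X: "fps_X ^ e \<noteq> (0 :: 'a fps)" "fps_nth (fps_X ^ e :: 'a fps) 0 = 0"
    using fps_X_power_neq_0 fps_X_power_nth_0[OF assms] by blast+
  have "fls_compose_fps g (fps_X ^ e) =
      fps_to_fls (fps_X ^ e) powi fls_subdegree g * fps_to_fls (u oo fps_X ^ e)"
  proof -
    have "fls_compose_fps (fls_X powi n * fps_to_fls v) (fps_X ^ e) =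
        fps_to_fls (fps_X ^ e) powi n * fps_to_fls (v oo fps_X ^ e)" for n and v :: "'a fps"
      by (simp add: fls_compose_fps_mult[OF X] fls_compose_fps_powi[OF X] fls_compose_fps_to_fls[OF X]
          del: fls_X_power_int)
    thus ?thesis unfolding u_def by (metis fls_decompose)
  qed
  moreover have "fps_nth (u oo fps_X ^ e) 0 = fps_nth u 0" by simp
  moreover have "fps_nth u 0 \<noteq> 0" using False by (simp add: u_def)
  ultimately have "u oo fps_X ^ e \<noteq> 0" "subdegree (u oo fps_X ^ e) = 0"
    by (metis fps_zero_nth, metis subdegree_eq_0)
  thus ?thesis
    using \<open>fls_compose_fps g (fps_X ^ e) = _\<close>
    by (simp add: fls_subdegree_fls_to_fps fps_to_fls_power fls_subdegree_pow fps_to_fls_eq_0_iff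
        del: fls_X_power_int)
qed simp

text \<open>The substitution of \<eta> T for T, which multiplies the n-th coefficient by \<eta>^n.
  For \<eta>^e = 1 these are the automorphisms of Laurent series in T over those in T^e.\<close>

definition rot :: "'a::field \<Rightarrow> 'a fls \<Rightarrow> 'a fls" where
  "rot \<eta> z = fls_compose_fps z (fps_const \<eta> * fps_X)"

lemma fld_emb_rot: "\<eta> \<noteq> 0 \<Longrightarrow> fld_emb (rot \<eta>)"
  unfolding rot_def by (intro fld_emb_compose) auto

lemma rot_nth: "\<eta> \<noteq> 0 \<Longrightarrow> fls_nth (rot \<eta> z) n = fls_nth z n * \<eta> powi n"
  unfolding rot_def by (rule fls_nth_fls_compose_fps_linear) auto

lemma subdegree_rot:
  assumes "\<eta> \<noteq> 0"
  shows "fls_subdegree (rot \<eta> z) = fls_subdegree z"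
proof (cases "z = 0")
  case False
  thus ?thesis
    using assms by (intro fls_subdegree_eqI) (auto simp: rot_nth fls_eq0_below_subdegree)
qed (simp add: rot_def)

lemma rot_power: "\<eta> ^ e = 1 \<Longrightarrow> e > 0 \<Longrightarrow> rot \<eta> (fls_compose_fps z (fps_X ^ e)) = fls_compose_fps z (fps_X ^ e :: 'a::field fps)"
proof -
  assume \<eta>: "\<eta> ^ e = 1" "e > 0"
  hence "\<eta> \<noteq> 0" by (auto simp: zero_power)
  have "(fps_X ^ e) oo (fps_const \<eta> * fps_X) = (fps_X ^ e :: 'a fps)"
    by (simp add: fps_compose_power[symmetric] power_mult_distrib fps_const_power \<eta>)
  thus ?thesis
    unfolding rot_def using \<eta> \<open>\<eta> \<noteq> 0\<close>
    by (subst fls_compose_fps_assoc) (simp_all add: fps_X_power_nth_0)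
qed

lemma fps_root_exists:
  assumes "N > 0" "fps_nth u 0 \<noteq> 0"
  shows "\<exists>\<omega>. \<omega> ^ N = (u :: 'a::{alg_closed_field,field_char_0} fps)"
proof -
  obtain k where k: "N = Suc k" using assms by (cases N) auto
  obtain c where c: "c ^ N = fps_nth u 0" using nth_root_exists[OF assms(1)] by blast
  show ?thesis
    using power_radical[of u "\<lambda>_ _. c" k] c assms k by (intro exI[of _ "fps_radical (\<lambda>_ _. c) N u"]) simp
qed

section \<open>The points of a superelliptic curve\<close>

definition uniformizer_at :: "'a option \<Rightarrow> 'a::field fn" where
  "uniformizer_at p = (case p of Some \<xi> \<Rightarrow> fn_x - fn_const \<xi> | None \<Rightarrow> inverse fn_x)"

lemma fn_x_neq_0 [simp]: "fn_x \<noteq> (0 :: 'a::field fn)"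
  by (simp add: fn_x_def)

lemma fn_x_minus_const: "fn_x - fn_const \<xi> = fn_of_poly [:- \<xi>, 1:]"
  by (simp add: fn_of_poly_eq_heval fn_const.emb_simps)

lemma uniformizer_at_neq_0 [simp]: "uniformizer_at p \<noteq> 0"
  by (cases p) (auto simp: uniformizer_at_def fn_x_minus_const)

lemma uniformizer_at_in_rational: "uniformizer_at p \<in> rational_fn_field"
proof -
  interpret subfld "rational_fn_field :: 'a fn set"
    unfolding rational_fn_field_def by (rule subfld_generate_field)
  have "fn_const c \<in> rational_fn_field" "fn_x \<in> rational_fn_field" for c :: 'a
    by (auto simp: rational_fn_field_def intro: generate_field.incl)
  thus ?thesis by (cases p) (auto simp: uniformizer_at_def)
qed

section \<open>Local numbers and expansions of x and y\<close>

context kummer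
begin

text \<open>Integers are needed because the order at infinity is minus the degree. Where f has order
  0, the values are g = N, e = 1 and m = 0.\<close>

definition nn :: "'a option \<Rightarrow> int" where "nn p = ordp p f"
definition gg :: "'a option \<Rightarrow> nat" where "gg p = nat (gcd (int N) (nn p))"
definition ee :: "'a option \<Rightarrow> nat" where "ee p = N div gg p"
definition mm :: "'a option \<Rightarrow> int" where "mm p = nn p div int (gg p)"

lemma gg_int: "int (gg p) = gcd (int N) (nn p)"
  by (simp add: gg_def)

lemma gg_pos: "gg p > 0"
  using N_pos by (simp add: gg_def)

lemma N_eq: "N = ee p * gg p"
proof -
  have "int (gg p) dvd int N" by (simp add: gg_int)
  thus ?thesis by (simp add: ee_def)
qed

lemma ee_pos: "ee p > 0"
  using N_eq[of p] N_pos by (metis gr0I mult_0)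

lemma nn_eq: "nn p = mm p * int (gg p)"
  by (simp add: mm_def gg_int)

lemma coprime_mm_ee: "algebraic_semidom_class.coprime (mm p) (int (ee p))"
proof -
  have "int (ee p) = int N div gcd (int N) (nn p)"
    by (simp add: ee_def zdiv_int gg_int)
  moreover have "mm p = nn p div gcd (int N) (nn p)"
    by (simp add: mm_def gg_int)
  ultimately show ?thesis
    using div_gcd_coprime[of "int N" "nn p"] N_pos by (simp add: coprime_commute)
qed

text \<open>The unit factor of the expansion of f has nonzero constant term, so in characteristic 0
  over an algebraically closed field it has an N-th root among power series.\<close>

lemma ex_omega: "\<exists>\<omega>. expand p f = fls_X powi nn p * fps_to_fls (\<omega> ^ N) \<and> fps_nth \<omega> 0 \<noteq> 0"
proof -
  define u where "u = fls_base_factor_to_fps (expand p f)"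
  have u0: "fps_nth u 0 \<noteq> 0"
    using expand_subdegree(1)[OF f_nonzero, of p] by (simp add: u_def)
  obtain \<omega> where \<omega>: "\<omega> ^ N = u" using fps_root_exists[OF N_pos u0] by blast
  have "fps_nth \<omega> 0 \<noteq> 0"
  proof
    assume "fps_nth \<omega> 0 = 0"
    thus False using \<omega> u0 N_pos by (auto simp: fps_nth_power_0 zero_power)
  qed
  moreover have "expand p f = fls_X powi nn p * fps_to_fls (\<omega> ^ N)"
    using fls_decompose[of "expand p f"] expand_subdegree(2)[OF f_nonzero, of p]
    unfolding \<omega> u_def nn_def by metis
  ultimately show ?thesis by blast
qed

definition \<omega> :: "'a option \<Rightarrow> 'a fps" where
  "\<omega> p = (SOME w. expand p f = fls_X powi nn p * fps_to_fls (w ^ N) \<and> fps_nth w 0 \<noteq> 0)"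

lemma omega: "expand p f = fls_X powi nn p * fps_to_fls (\<omega> p ^ N)" "fps_nth (\<omega> p) 0 \<noteq> 0"
  using someI_ex[OF ex_omega[of p]] unfolding \<omega>_def by blast+

definition \<omega>e :: "'a option \<Rightarrow> 'a fls" where
  "\<omega>e p = fps_to_fls (fps_compose (\<omega> p) (fps_X ^ ee p))"

text \<open>Substituting T^e for T turns T^n \<omega>^N into T^(en) \<omega>(T^e)^N, and en = mN. So
  this is one N-th root of the expansion of f, hence a possible expansion of y; the others are its
  multiples by roots of unity.\<close>

definition YY :: "'a option \<Rightarrow> 'a fls" where
  "YY p = fls_X powi mm p * \<omega>e p"

lemma omegae_0: "fls_nth (\<omega>e p) 0 = fps_nth (\<omega> p) 0" "fls_subdegree (\<omega>e p) = 0" "\<omega>e p \<noteq> 0"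
proof -
  have 1: "fps_nth (\<omega> p oo fps_X ^ ee p) 0 \<noteq> 0" using omega(2) by simp
  show "fls_nth (\<omega>e p) 0 = fps_nth (\<omega> p) 0" by (simp add: \<omega>e_def)
  show "fls_subdegree (\<omega>e p) = 0"
    using 1 unfolding \<omega>e_def fls_subdegree_fls_to_fps by (simp add: subdegree_eq_0)
  show "\<omega>e p \<noteq> 0" using omega(2) \<open>fls_nth (\<omega>e p) 0 = _\<close> by auto
qed

lemma subdegree_YY: "fls_subdegree (YY p) = mm p" "YY p \<noteq> 0"
  using omegae_0[of p] by (simp_all add: YY_def del: fls_X_power_int)

lemma fls_X_powi_mult: "fls_X powi (int e * n) = (fls_X ^ e :: 'a fls) powi n"
  by (simp only: power_int_mult power_int_of_nat)

lemma YY_power: "YY p ^ N = fls_compose_fps (expand p f) (fps_X ^ ee p)"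
proof -
  have X: "fps_X ^ ee p \<noteq> (0 :: 'a fps)" "fps_nth (fps_X ^ ee p :: 'a fps) 0 = 0"
    using fps_X_power_neq_0 fps_X_power_nth_0[OF ee_pos] by blast+
  have "YY p ^ N = fls_X powi (mm p * int N) * \<omega>e p ^ N"
    by (simp add: YY_def power_mult_distrib power_int_mult power_int_of_nat del: fls_X_power_int)
  also have "mm p * int N = int (ee p) * nn p"
    by (subst N_eq[of p], subst nn_eq) simp
  also have "fls_X powi (int (ee p) * nn p) = (fps_to_fls (fps_X ^ ee p) :: 'a fls) powi nn p"
    by (simp add: fls_X_powi_mult fps_to_fls_power del: fls_X_power_int)
  also have "\<omega>e p ^ N = fps_to_fls (\<omega> p ^ N oo fps_X ^ ee p)"
    unfolding \<omega>e_def fps_to_fls_power[symmetric] fps_compose_power[OF X(2)] ..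
  also have "fps_to_fls (fps_X ^ ee p) powi nn p * \<dots> = fls_compose_fps (expand p f) (fps_X ^ ee p)"
    unfolding omega(1)
    by (simp add: fls_compose_fps_mult[OF X] fls_compose_fps_powi[OF X] fls_compose_fps_to_fls[OF X]
        del: fls_X_power_int)
  finally show ?thesis .
qed

lemma ex_emb:
  assumes "c \<in> mu N"
  shows "\<exists>\<phi>. fld_hom F \<phi> \<and> (\<forall>a. \<phi> (fn_of_poly a) = fls_compose_fps (expand p a) (fps_X ^ ee p)) \<and>
    \<phi> y = fls_const c * YY p"
proof -
  interpret C: fld_emb "\<lambda>z :: 'a fls. fls_compose_fps z (fps_X ^ ee p)"
    using fps_X_power_neq_0 fps_X_power_nth_0[OF ee_pos] by (rule fld_emb_compose)
  have "(fls_const c * YY p) ^ N = fls_compose_fps (expand p f) (fps_X ^ ee p)"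
  proof -
    have "fls_const c ^ N = 1"
      using assms fls_const.emb_simps(7)[of c N] by simp
    thus ?thesis by (simp add: power_mult_distrib YY_power)
  qed
  moreover have "a = 0" if "fls_compose_fps (expand p a) (fps_X ^ ee p) = 0" for a
    using that expand_subdegree(1)[of a p] by (auto simp: C.emb_simps)
  ultimately show ?thesis
    using hom_extend[of "\<lambda>a. fls_compose_fps (expand p a) (fps_X ^ ee p)" "fls_const c * YY p"]
    by (simp add: expand_simps C.emb_simps) metis
qed

definition emb :: "'a option \<Rightarrow> 'a \<Rightarrow> 'a fn \<Rightarrow> 'a fls" where
  "emb p c = (SOME \<phi>. fld_hom F \<phi> \<and>
    (\<forall>a. \<phi> (fn_of_poly a) = fls_compose_fps (expand p a) (fps_X ^ ee p)) \<and> \<phi> y = fls_const c * YY p)"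

lemma emb:
  assumes "c \<in> mu N"
  shows "fld_hom F (emb p c)"
    and "emb p c (fn_of_poly a) = fls_compose_fps (expand p a) (fps_X ^ ee p)"
    and "emb p c y = fls_const c * YY p"
  using someI_ex[OF ex_emb[OF assms, of p]] unfolding emb_def by blast+

lemma uniformizer_at_in_F [simp, intro]: "uniformizer_at p \<in> F"
  using uniformizer_at_in_rational rational_subset_F by auto

lemma emb_const:
  assumes "c \<in> mu N"
  shows "emb p c (fn_const d) = fls_const d"
  unfolding fn_const_def by (simp add: emb[OF assms] expand_def)

lemma emb_x:
  assumes "c \<in> mu N"
  shows "emb p c fn_x = fls_compose_fps (place_x p) (fps_X ^ ee p)"
  unfolding fn_x_def by (simp add: emb[OF assms] expand_def)

lemma emb_uniformizer_at:
  assumes "c \<in> mu N"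
  shows "emb p c (uniformizer_at p) = fls_X ^ ee p"
proof -
  interpret C: fld_emb "\<lambda>z :: 'a fls. fls_compose_fps z (fps_X ^ ee p)"
    using fps_X_power_neq_0 fps_X_power_nth_0[OF ee_pos] by (rule fld_emb_compose)
  interpret fld_hom F "emb p c" using emb(1)[OF assms] .
  show ?thesis
  proof (cases p)
    case None
    have "emb p c (uniformizer_at p) = inverse (emb p c fn_x)"
      by (simp add: uniformizer_at_def None hom_inverse[unfolded None])
    also have "\<dots> = inverse (inverse (fls_compose_fps fls_X (fps_X ^ ee p)))"
      unfolding emb_x[OF assms] C.emb_simps(5)[symmetric] by (simp add: place_x_def None)
    finally show ?thesis by (simp only: inverse_inverse_eq fls_compose_fps_X fps_to_fls_power fps_X_to_fls)
  next
    case (Some \<xi>)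
    have "emb p c (uniformizer_at p) = emb p c fn_x - emb p c (fn_const \<xi>)"
      by (simp add: uniformizer_at_def Some hom_diff[unfolded Some])
    also have "\<dots> = fls_compose_fps fls_X (fps_X ^ ee p)"
      unfolding emb_x[OF assms] emb_const[OF assms]
      by (simp add: Some place_x_def C.emb_simps[unfolded Some])
    finally show ?thesis by (simp add: fps_to_fls_power)
  qed
qed

text \<open>In the expansion y has order m and the parameter of the line has order e. As these are
  coprime, a product of their powers with Bezout exponents has order 1.\<close>

lemma fls_place_emb:
  assumes "c \<in> mu N"
  shows "fls_place F (emb p c)"
proof -
  interpret fld_hom F "emb p c" using emb(1)[OF assms] .
  obtain a b where ab: "a * mm p + b * int (ee p) = 1"
    using bezout_int[of "mm p" "int (ee p)"] coprime_mm_ee[of p] by (auto simp: coprime_iff_gcd_eq_1)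
  define t where "t = y powi a * uniformizer_at p powi b"
  have c: "c \<noteq> 0" using mu_nonzero[OF assms N_pos] .
  have "emb p c t = (fls_const c * YY p) powi a * (fls_X ^ ee p) powi b"
    unfolding t_def by (simp add: hom_mult hom_power_int emb[OF assms] emb_uniformizer_at[OF assms])
  moreover have "fls_subdegree \<dots> = a * mm p + b * int (ee p)"
    using c subdegree_YY[of p] by (simp add: power_int_mult_distrib fls_subdegree_pow)
  moreover have "t \<in> F" unfolding t_def by simp
  ultimately have "\<exists>t\<in>F. fls_subdegree (emb p c t) = 1"
    using ab by (intro bexI[of _ t]) (simp_all del: fls_subdegree_mult)
  thus ?thesis by unfold_locales
qed

text \<open>The index \<open>c\<close> runs over all of \<open>mu N\<close>, which names each of the
  g points over p several times: only \<open>c ^ ee p\<close> matters, by \<open>pt_eq_iff\<close>.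
  The redundancy is kept because the averages are taken over the whole group
  \<open>mu N\<close>.\<close>

definition pt :: "'a option \<Rightarrow> 'a \<Rightarrow> 'a fn set" where
  "pt p c = fls_place.V F (emb p c)"

definition vord :: "'a option \<Rightarrow> 'a \<Rightarrow> 'a fn \<Rightarrow> int" where
  "vord p c z = fls_subdegree (emb p c z)"

lemma vord_uniformizer_at: "c \<in> mu N \<Longrightarrow> vord p c (uniformizer_at p) = int (ee p)"
  by (simp add: vord_def emb_uniformizer_at fls_subdegree_pow)

lemma vord_y: "c \<in> mu N \<Longrightarrow> vord p c y = mm p"
  using mu_nonzero[of c N] N_pos subdegree_YY[of p] by (simp add: vord_def emb(3))

lemma vord_const: "c \<in> mu N \<Longrightarrow> vord p c (fn_const d) = 0"
  by (simp add: vord_def emb_const)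

end

context fls_place
begin
lemma in_V_imp_ord: "z \<in> V \<Longrightarrow> 0 \<le> ord z"
  by (simp add: V_iff)
end

context kummer
begin

lemma pt_iff: "c \<in> mu N \<Longrightarrow> z \<in> pt p c \<longleftrightarrow> z \<in> F \<and> 0 \<le> vord p c z"
  using fls_place.V_iff[OF fls_place_emb] by (simp add: pt_def vord_def fls_place.ord_def[OF fls_place_emb])

lemma val_ring_pt: "c \<in> mu N \<Longrightarrow> val_ring F (pt p c)"
proof -
  assume "c \<in> mu N"
  then interpret fls_place F "emb p c" by (rule fls_place_emb)
  show ?thesis unfolding pt_def by (rule val_ring_axioms)
qed

end

section \<open>Rational functions in a valuation ring with given centre\<close>

lemma order_le_imp_dvd:
  fixes a b :: "'a::alg_closed_field poly"
  assumes "a \<noteq> 0" "b \<noteq> 0" "\<And>\<xi>. order \<xi> b \<le> order \<xi> a"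
  shows "b dvd a"
  using assms
proof (induction "degree b" arbitrary: a b rule: less_induct)
  case less
  show ?case
  proof (cases "degree b = 0")
    case True
    then obtain c where "b = [:c:]" by (auto elim: degree_eq_zeroE)
    thus ?thesis using less.prems by (simp add: const_poly_dvd_iff dvd_field_iff)
  next
    case False
    then obtain \<xi> where \<xi>: "poly b \<xi> = 0" using alg_closed_imp_poly_has_root by blast
    have "poly a \<xi> = 0"
      using less.prems(3)[of \<xi>] less.prems(1,2) \<xi> order_root[of b \<xi>] order_root[of a \<xi>] by auto
    then obtain a' b' where ab: "a = [:- \<xi>, 1:] * a'" "b = [:- \<xi>, 1:] * b'"
      using \<xi> unfolding poly_eq_0_iff_dvd by (elim dvdE)
    have nz: "a' \<noteq> 0" "b' \<noteq> 0" using ab less.prems by auto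
    have "degree b' < degree b" using nz ab by (simp add: degree_mult_eq del: mult_pCons_left)
    moreover have "order z b' \<le> order z a'" for z
      using less.prems(3)[of z] less.prems(1,2) unfolding ab by (simp add: order_mult del: mult_pCons_left)
    ultimately have "b' dvd a'" using less.hyps nz by blast
    thus ?thesis unfolding ab by (rule mult_dvd_mono[OF dvd_refl])
  qed
qed

lemma fn_of_poly_eq_iff: "fn_of_poly a = fn_of_poly b \<longleftrightarrow> a = b"
  by (simp add: fn_of_poly_def eq_fract)

lemma rational_Fract:
  fixes z :: "'a::field fn"
  assumes "z \<in> rational_fn_field"
  obtains a b where "b \<noteq> 0" "z = fn_of_poly a / fn_of_poly b"
proof -
  obtain r where "z = to_ac r" using assms by (auto simp: rational_fn_field_eq)
  thus ?thesis using that by (cases r) (auto simp: to_ac_Fract)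
qed

lemma subfld_rational: "subfld (rational_fn_field :: 'a::field fn set)"
  unfolding rational_fn_field_def by (rule subfld_generate_field)

lemma fn_of_poly_in_rational: "fn_of_poly a \<in> rational_fn_field"
  by (simp add: rational_fn_field_eq fn_of_poly_def)

lemma fn_const_in_rational: "fn_const a \<in> rational_fn_field"
  by (simp add: fn_const_def fn_of_poly_in_rational)

lemma points_val_ring: "Q \<in> points F \<Longrightarrow> subfld F \<Longrightarrow> val_ring F Q"
  by (simp add: points_def val_ring_def val_ring_axioms_def)

text \<open>A valuation ring containing the constants and having the parameter of p in its maximal
  ideal sees a polynomial only through its order at p. This holds for the explicit rings
  \<open>pt p c\<close> and for abstract points alike, which allows their comparison.\<close>

lemma fn_of_poly_decompose:
  fixes a :: "'a::field poly"
  assumes "val_ring F Q" and const: "\<And>c. fn_const c \<in> Q" and F: "rational_fn_field \<subseteq> F"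
    and t: "uniformizer_at p \<in> max_ideal Q" and "a \<noteq> 0"
  shows "\<exists>u\<in>Q - max_ideal Q. fn_of_poly a = uniformizer_at p powi ordp p a * u"
proof -
  interpret val_ring F Q by fact
  have cu: "fn_const c \<in> Q - max_ideal Q" if "c \<noteq> 0" for c
    unfolding unit_iff using const[of c] const[of "inverse c"] that by (simp add: fn_const.emb_simps)
  show ?thesis
  proof (cases p)
    case (Some \<xi>)
    have t': "fn_x - fn_const \<xi> \<in> max_ideal Q" using t by (simp add: uniformizer_at_def Some)
    hence "(fn_x - fn_const \<xi>) + fn_const \<xi> \<in> Q" using const by blast
    hence x: "fn_x \<in> Q" by simp
    have Qp: "fn_of_poly c \<in> Q" for c
      unfolding fn_of_poly_eq_heval by (induction c) (use const x in auto)
    obtain b where b: "a = [:- \<xi>, 1:] ^ order \<xi> a * b" "poly b \<xi> \<noteq> 0"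
      using order_decompose[OF \<open>a \<noteq> 0\<close>] .
    obtain c where c: "b = [:poly b \<xi>:] + [:- \<xi>, 1:] * c" using linear_quotient by blast
    have "fn_of_poly b = fn_const (poly b \<xi>) + fn_of_poly c * (fn_x - fn_const \<xi>)"
      by (subst c) (simp only: fn_of_poly_simps fn_const_def[symmetric] fn_x_minus_const mult.commute)
    moreover have "\<dots> \<in> Q - max_ideal Q"
      using t' Qp by (intro add_unit cu b mult_max_ideal)
    moreover have "fn_of_poly a = uniformizer_at p powi ordp p a * fn_of_poly b"
      by (subst b(1)) (simp only: fn_of_poly_simps fn_of_poly_power uniformizer_at_def Some ordp_def
          option.case power_int_of_nat fn_x_minus_const)
    ultimately show ?thesis by metis
  next
    case None
    have t': "inverse fn_x \<in> max_ideal Q" using t by (simp add: uniformizer_at_def None)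
    have "\<exists>u\<in>Q - max_ideal Q. fn_of_poly a = fn_x ^ degree a * u"
      using \<open>a \<noteq> 0\<close>
    proof (induction a)
      case (pCons c a)
      have e: "fn_of_poly (pCons c a) = fn_const c + fn_x * fn_of_poly a"
        by (simp add: fn_of_poly_eq_heval)
      show ?case
      proof (cases "a = 0")
        case True
        hence "c \<noteq> 0" using pCons by simp
        thus ?thesis using True e cu by auto
      next
        case False
        then obtain u where u: "u \<in> Q - max_ideal Q" "fn_of_poly a = fn_x ^ degree a * u"
          using pCons by blast
        have "u + fn_const c * inverse fn_x ^ Suc (degree a) \<in> Q - max_ideal Q"
          by (intro add_unit u mult_max_ideal const power_max_ideal t') simp
        moreover have "fn_of_poly (pCons c a) =
            fn_x ^ degree (pCons c a) * (u + fn_const c * inverse fn_x ^ Suc (degree a))"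
          unfolding e u(2) using False by (simp add: field_simps)
        ultimately show ?thesis by blast
      qed
    qed simp
    thus ?thesis
      by (simp add: uniformizer_at_def None ordp_def power_int_minus power_inverse)
  qed
qed

definition ordr :: "'a option \<Rightarrow> 'a::field poly \<Rightarrow> 'a poly \<Rightarrow> int" where
  "ordr p a b = ordp p a - ordp p b"

lemma rational_decompose:
  fixes a b :: "'a::field poly"
  assumes Q: "val_ring F Q" and const: "\<And>c. fn_const c \<in> Q" and F: "rational_fn_field \<subseteq> F"
    and t: "uniformizer_at p \<in> max_ideal Q" and "a \<noteq> 0" "b \<noteq> 0"
  shows "\<exists>u\<in>Q - max_ideal Q. fn_of_poly a / fn_of_poly b = uniformizer_at p powi ordr p a b * u"
proof -
  interpret val_ring F Q by fact
  obtain u v where u: "u \<in> Q - max_ideal Q" "fn_of_poly a = uniformizer_at p powi ordp p a * u"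
    and v: "v \<in> Q - max_ideal Q" "fn_of_poly b = uniformizer_at p powi ordp p b * v"
    using fn_of_poly_decompose[OF Q const F t] assms(5,6) by metis
  have "fn_of_poly a / fn_of_poly b = uniformizer_at p powi ordr p a b * (u * inverse v)"
    unfolding u v ordr_def by (simp add: power_int_diff divide_inverse mult_ac)
  thus ?thesis using mult_unit[OF u(1) inverse_unit[OF v(1)]] by blast
qed

lemma rational_mem_iff:
  fixes a b :: "'a::field poly"
  assumes Q: "val_ring F Q" and const: "\<And>c. fn_const c \<in> Q" and F: "rational_fn_field \<subseteq> F"
    and t: "uniformizer_at p \<in> max_ideal Q" and "a \<noteq> 0" "b \<noteq> 0"
  shows "fn_of_poly a / fn_of_poly b \<in> Q \<longleftrightarrow> 0 \<le> ordr p a b"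
    and "fn_of_poly a / fn_of_poly b \<in> max_ideal Q \<longleftrightarrow> 0 < ordr p a b"
proof -
  interpret val_ring F Q by fact
  define k where "k = ordr p a b"
  obtain u where u: "u \<in> Q - max_ideal Q" "fn_of_poly a / fn_of_poly b = uniformizer_at p powi k * u"
    using rational_decompose[OF assms] unfolding k_def by blast
  have pos: "z * u \<in> max_ideal Q" if "k > 0" "z = uniformizer_at p powi k" for z
  proof -
    have "z = uniformizer_at p ^ nat k" using that by (simp add: power_int_def)
    hence "z \<in> max_ideal Q" using power_max_ideal[OF t] that(1) by simp
    thus ?thesis using mult_max_ideal[of u z] u(1) by (simp add: mult.commute)
  qed
  have neg: "z * u \<notin> Q" if "k < 0" "z = uniformizer_at p powi k" for z
  proof
    assume "z * u \<in> Q"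
    hence "z * u * inverse u \<in> Q" using inverse_unit[OF u(1)] by blast
    moreover have "u \<noteq> 0" using u(1) unit_iff by blast
    ultimately have "z \<in> Q" by (simp add: mult.assoc)
    have "inverse z = uniformizer_at p ^ nat (- k)" using that by (simp add: power_int_def power_inverse)
    hence "inverse z \<in> max_ideal Q" using power_max_ideal[OF t] that(1) by simp
    hence "z * inverse z \<in> max_ideal Q" using mult_max_ideal \<open>z \<in> Q\<close> by blast
    moreover have "z \<noteq> 0" using that by simp
    ultimately show False using one_notin_max_ideal by simp
  qed
  consider "k > 0" | "k = 0" | "k < 0" by linarith
  hence "(uniformizer_at p powi k * u \<in> Q \<longleftrightarrow> 0 \<le> k) \<and> (uniformizer_at p powi k * u \<in> max_ideal Q \<longleftrightarrow> 0 < k)"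
  proof cases
    case 1 thus ?thesis using pos max_ideal_subset by force
  next
    case 2 thus ?thesis using u(1) by simp
  next
    case 3 thus ?thesis using neg max_ideal_subset by force
  qed
  thus "fn_of_poly a / fn_of_poly b \<in> Q \<longleftrightarrow> 0 \<le> ordr p a b"
    "fn_of_poly a / fn_of_poly b \<in> max_ideal Q \<longleftrightarrow> 0 < ordr p a b"
    unfolding u(2) k_def[symmetric] by blast+
qed

text \<open>This transfers statements about rational functions from an explicit point to any other
  point with the same centre.\<close>

lemma rational_mem_cong:
  fixes z :: "'a::field fn"
  assumes Q: "val_ring F Q" "\<And>c. fn_const c \<in> Q" "rational_fn_field \<subseteq> F" "uniformizer_at p \<in> max_ideal Q"
    and Q': "val_ring F' Q'" "\<And>c. fn_const c \<in> Q'" "rational_fn_field \<subseteq> F'" "uniformizer_at p \<in> max_ideal Q'"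
    and z: "z \<in> rational_fn_field"
  shows "z \<in> Q \<longleftrightarrow> z \<in> Q'" and "z \<in> max_ideal Q \<longleftrightarrow> z \<in> max_ideal Q'"
proof -
  obtain a b where ab: "b \<noteq> 0" "z = fn_of_poly a / fn_of_poly b" using rational_Fract[OF z] .
  have "(z \<in> Q \<longleftrightarrow> z \<in> Q') \<and> (z \<in> max_ideal Q \<longleftrightarrow> z \<in> max_ideal Q')"
  proof (cases "a = 0")
    case True
    thus ?thesis
      using ab val_ring.zero[OF Q(1)] val_ring.zero[OF Q'(1)]
        val_ring.zero_max_ideal[OF Q(1)] val_ring.zero_max_ideal[OF Q'(1)] by simp
  next
    case False
    thus ?thesis unfolding ab(2)
      using rational_mem_iff[OF Q False ab(1)] rational_mem_iff[OF Q' False ab(1)] by blast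
  qed
  thus "z \<in> Q \<longleftrightarrow> z \<in> Q'" and "z \<in> max_ideal Q \<longleftrightarrow> z \<in> max_ideal Q'" by auto
qed

lemma Int_rational_eq_line_point_iff:
  assumes Q: "val_ring F Q" "\<And>c. fn_const c \<in> Q" "rational_fn_field \<subseteq> F"
  shows "Q \<inter> rational_fn_field = line_point \<xi> \<longleftrightarrow> uniformizer_at (Some \<xi>) \<in> max_ideal Q"
proof
  interpret val_ring F Q by fact
  have t: "uniformizer_at (Some \<xi>) = fn_of_poly [:- \<xi>, 1:]"
    by (simp add: uniformizer_at_def fn_x_minus_const)
  assume eq: "Q \<inter> rational_fn_field = line_point \<xi>"
  have "fn_of_poly [:- \<xi>, 1:] / fn_of_poly 1 \<in> line_point \<xi>"
    unfolding line_point_def by (intro CollectI exI[of _ "[:- \<xi>, 1:]"] exI[of _ 1] conjI refl) simp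
  hence "uniformizer_at (Some \<xi>) \<in> Q" using eq t by auto
  moreover have "inverse (uniformizer_at (Some \<xi>)) \<notin> Q"
  proof
    assume "inverse (uniformizer_at (Some \<xi>)) \<in> Q"
    hence "inverse (fn_of_poly [:- \<xi>, 1:]) \<in> line_point \<xi>"
      using eq t subfld.inverse[OF subfld_rational fn_of_poly_in_rational[of "[:- \<xi>, 1:]"]] by auto
    then obtain a b where ab: "inverse (fn_of_poly [:- \<xi>, 1:]) = fn_of_poly a / fn_of_poly b" "poly b \<xi> \<noteq> 0"
      unfolding line_point_def by blast
    have "b \<noteq> 0" using ab by auto
    hence "fn_of_poly b = fn_of_poly (a * [:- \<xi>, 1:])"
      using ab(1) by (simp add: field_simps del: mult_pCons_right)
    hence "b = a * [:- \<xi>, 1:]" by (metis fn_of_poly_eq_iff)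
    thus False using ab(2) by simp
  qed
  ultimately show "uniformizer_at (Some \<xi>) \<in> max_ideal Q" by (simp add: max_ideal_def)
next
  interpret val_ring F Q by fact
  assume t: "uniformizer_at (Some \<xi>) \<in> max_ideal Q"
  show "Q \<inter> rational_fn_field = line_point \<xi>"
  proof (intro equalityI subsetI)
    fix z assume "z \<in> line_point \<xi>"
    then obtain a b where ab: "z = fn_of_poly a / fn_of_poly b" "poly b \<xi> \<noteq> 0"
      unfolding line_point_def by blast
    have b: "b \<noteq> 0" using ab by auto
    have "z \<in> rational_fn_field"
      unfolding ab(1) by (intro subfld.divide[OF subfld_rational] fn_of_poly_in_rational)
    moreover have "z \<in> Q"
    proof (cases "a = 0")
      case False
      thus ?thesis
        unfolding ab(1) using ab(2) by (subst rational_mem_iff[OF Q t _ b]) (auto simp: ordr_def ordp_def order_0I)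
    qed (use ab in auto)
    ultimately show "z \<in> Q \<inter> rational_fn_field" by blast
  next
    fix z assume z: "z \<in> Q \<inter> rational_fn_field"
    then obtain a b where ab: "b \<noteq> 0" "z = fn_of_poly a / fn_of_poly b" using rational_Fract by blast
    show "z \<in> line_point \<xi>"
    proof (cases "a = 0")
      case True
      hence "z = fn_of_poly 0 / fn_of_poly 1" using ab by simp
      thus ?thesis unfolding line_point_def by (intro CollectI exI[of _ 0] exI[of _ 1] conjI) auto
    next
      case False
      have le: "order \<xi> b \<le> order \<xi> a"
        using z rational_mem_iff(1)[OF Q t False ab(1)] unfolding ab(2) by (simp add: ordr_def ordp_def)
      obtain a' where a': "a = [:- \<xi>, 1:] ^ order \<xi> a * a'" using order_decompose[OF False] by metis
      obtain b' where b': "b = [:- \<xi>, 1:] ^ order \<xi> b * b'" "poly b' \<xi> \<noteq> 0"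
        using order_decompose[OF ab(1)] .
      define w where "w = [:- \<xi>, 1:] ^ order \<xi> b"
      have "a = w * ([:- \<xi>, 1:] ^ (order \<xi> a - order \<xi> b) * a')"
        using le by (subst a') (simp add: w_def mult.assoc[symmetric] power_add[symmetric])
      moreover have "b = w * b'" using b'(1) by (simp add: w_def)
      moreover have "w \<noteq> 0" by (simp add: w_def)
      ultimately have "z = fn_of_poly ([:- \<xi>, 1:] ^ (order \<xi> a - order \<xi> b) * a') / fn_of_poly b'"
        unfolding ab(2) by (metis fn_of_poly_simps(2) fn_of_poly_simps(5) mult_divide_mult_cancel_left)
      thus ?thesis unfolding line_point_def using b'(2) by blast
    qed
  qed
qed

declare mu_iff [simp del]

lemma power_int_power_commute: "(x powi m) ^ n = (x ^ n :: 'a::field) powi m"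
  by (simp only: power_int_of_nat[symmetric] power_int_mult[symmetric] mult.commute)

section \<open>Regular functions on the curve\<close>

context kummer
begin

lemma pt_const: "c \<in> mu N \<Longrightarrow> fn_const d \<in> pt p c"
  by (simp add: pt_iff vord_const)

lemma pt_max_ideal: "c \<in> mu N \<Longrightarrow> max_ideal (pt p c) = {z\<in>F. z = 0 \<or> 0 < vord p c z}"
  using fls_place.max_ideal_eq[OF fls_place_emb, of c p]
  by (simp add: pt_def vord_def fls_place.ord_def[OF fls_place_emb])

lemma pt_uniformizer_at: "c \<in> mu N \<Longrightarrow> uniformizer_at p \<in> max_ideal (pt p c)"
  using ee_pos by (simp add: pt_max_ideal vord_uniformizer_at)

lemma pt_points: "c \<in> mu N \<Longrightarrow> pt p c \<in> points F"
proof -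
  assume c: "c \<in> mu N"
  interpret P: fls_place F "emb p c" using fls_place_emb[OF c] .
  have "inverse (uniformizer_at p) \<notin> range fn_const"
  proof
    assume "inverse (uniformizer_at p) \<in> range fn_const"
    then obtain d where "inverse (uniformizer_at p) = fn_const d" by blast
    hence "vord p c (inverse (uniformizer_at p)) = 0" using c by (simp add: vord_const)
    thus False using P.ord_inverse[of "uniformizer_at p"] c ee_pos[of p]
      by (simp add: P.ord_def vord_uniformizer_at flip: vord_def)
  qed
  moreover have "uniformizer_at p \<notin> range fn_const"
  proof
    assume "uniformizer_at p \<in> range fn_const"
    then obtain d where "uniformizer_at p = fn_const d" by blast
    thus False using vord_uniformizer_at[OF c, of p] ee_pos[of p] by (simp add: vord_const c)
  qed
  moreover have "uniformizer_at p \<in> pt p c" using pt_uniformizer_at[OF c] by (auto simp: max_ideal_def)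
  ultimately have "range fn_const \<subset> pt p c" using pt_const[OF c] by blast
  moreover have "pt p c \<subset> F" unfolding pt_def by (rule P.V_psubset)
  ultimately show ?thesis
    using val_ring.val_ring[OF val_ring_pt[OF c]] by (simp add: points_def)
qed

lemma pt_valuation: "c \<in> mu N \<Longrightarrow> z \<in> F \<Longrightarrow> z \<noteq> 0 \<Longrightarrow> valuation (pt p c) z = vord p c z"
  using fls_place.valuation_eq_ord[OF fls_place_emb, of c z p]
  by (simp add: pt_def vord_def fls_place.ord_def[OF fls_place_emb])

lemma pt_ex_uniformizer: "c \<in> mu N \<Longrightarrow> \<exists>t. uniformizer (pt p c) t"
  using fls_place.ex_uniformizer[OF fls_place_emb] by (simp add: pt_def)

lemma pt_uniformizer_iff: "c \<in> mu N \<Longrightarrow> uniformizer (pt p c) t \<longleftrightarrow> t \<in> F \<and> vord p c t = 1"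
  using fls_place.uniformizer_iff[OF fls_place_emb, of c p t]
  by (simp add: pt_def vord_def fls_place.ord_def[OF fls_place_emb])

lemma vord_mult:
  "c \<in> mu N \<Longrightarrow> a \<in> F \<Longrightarrow> b \<in> F \<Longrightarrow> a \<noteq> 0 \<Longrightarrow> b \<noteq> 0 \<Longrightarrow> vord p c (a * b) = vord p c a + vord p c b"
  using fls_place.ord_mult[OF fls_place_emb] by (simp add: vord_def fls_place.ord_def[OF fls_place_emb])

lemma vord_power: "c \<in> mu N \<Longrightarrow> a \<in> F \<Longrightarrow> vord p c (a ^ i) = int i * vord p c a"
  using fls_place.ord_power[OF fls_place_emb] by (simp add: vord_def fls_place.ord_def[OF fls_place_emb])

lemma vord_divide:
  "c \<in> mu N \<Longrightarrow> a \<in> F \<Longrightarrow> b \<in> F \<Longrightarrow> a \<noteq> 0 \<Longrightarrow> b \<noteq> 0 \<Longrightarrow> vord p c (a / b) = vord p c a - vord p c b"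
  using fls_place.ord_divide[OF fls_place_emb] by (simp add: vord_def fls_place.ord_def[OF fls_place_emb])

lemma one_mu [simp]: "1 \<in> mu N"
  by (simp add: mu_iff)

lemma emb_rational:
  assumes "c \<in> mu N" "c' \<in> mu N"
  shows "emb p c (to_ac r) = emb p c' (to_ac r)"
proof -
  interpret C: fld_hom F "emb p c" using emb(1)[OF assms(1)] .
  interpret C': fld_hom F "emb p c'" using emb(1)[OF assms(2)] .
  show ?thesis
    by (cases r) (simp add: to_ac_Fract C.hom_divide C'.hom_divide emb(2)[OF assms(1)] emb(2)[OF assms(2)])
qed

lemma emb_term:
  assumes "c \<in> mu N"
  shows "emb p c (to_ac r * y ^ i) = fls_const (c ^ i) * (emb p 1 (to_ac r) * YY p ^ i)"
proof -
  interpret C: fld_hom F "emb p c" using emb(1)[OF assms(1)] .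
  show ?thesis
    using emb_rational[OF assms one_mu, of p r]
    by (simp add: C.hom_mult C.hom_power emb(3)[OF assms] power_mult_distrib fls_const_power)
qed

text \<open>By \<open>sum_mu\<close>, averaging the expansions of z over all c with weights c^(-i)
  leaves the expansion of the i-th term. A term is thus regular wherever z is regular at all points
  with the same centre.\<close>

lemma expansion_term_in_pt:
  assumes z: "z = (\<Sum>i<N. to_ac (r i) * y ^ i)" "\<And>c. c \<in> mu N \<Longrightarrow> z \<in> pt p c" and i: "i < N" and c: "c \<in> mu N"
  shows "to_ac (r i) * y ^ i \<in> pt p c"
proof -
  define B where "B = (\<lambda>j. emb p 1 (to_ac (r j)) * YY p ^ j)"
  have z_emb: "emb p d z = (\<Sum>j<N. fls_const (d ^ j) * B j)" if "d \<in> mu N" for d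
  proof -
    interpret C: fld_hom F "emb p d" using emb(1)[OF that] .
    show ?thesis
      unfolding z(1) by (subst C.hom_sum) (auto simp: emb_term[OF that] B_def)
  qed
  have "(\<Sum>d\<in>mu N. fls_const (inverse d ^ i) * emb p d z) =
      (\<Sum>d\<in>mu N. \<Sum>j<N. fls_const (d ^ j * inverse d ^ i) * B j)"
  proof (intro sum.cong refl)
    fix d :: 'a assume "d \<in> mu N"
    show "fls_const (inverse d ^ i) * emb p d z = (\<Sum>j<N. fls_const (d ^ j * inverse d ^ i) * B j)"
      unfolding z_emb[OF \<open>d \<in> mu N\<close>] sum_distrib_left fls_const_mult_const[symmetric]
      by (simp only: mult_ac)
  qed
  also have "\<dots> = (\<Sum>j<N. fls_const (\<Sum>d\<in>mu N. d ^ j * inverse d ^ i) * B j)"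
    by (subst sum.swap) (simp add: fls_const.hom_sum sum_distrib_right)
  also have "\<dots> = (\<Sum>j<N. if j = i then fls_const (of_nat N) * B j else 0)"
    using i N_pos by (intro sum.cong refl) (simp add: sum_mu)
  also have "\<dots> = fls_const (of_nat N) * B i" using i by simp
  finally have eq: "fls_const (of_nat N) * B i = (\<Sum>d\<in>mu N. fls_const (inverse d ^ i) * emb p d z)" ..
  have nonneg: "0 \<le> fls_subdegree (\<Sum>d\<in>A. fls_const (inverse d ^ i) * emb p d z)" if "A \<subseteq> mu N" for A
    using finite_subset[OF that mu_proots(1)[OF N_pos]] that
  proof (induction A rule: finite_induct)
    case (insert d A)
    have "0 \<le> fls_subdegree (emb p d z)" using z(2)[of d] insert(4) by (simp add: pt_iff vord_def)
    thus ?case using insert by (auto intro!: fls_subdegree_nonneg_add fls_subdegree_nonneg_mult)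
  qed simp
  have "inverse (of_nat N) * of_nat N = (1 :: 'a)"
    using N_pos by simp
  hence e1: "fls_const (inverse (of_nat N)) * (fls_const (of_nat N) * B i) = B i"
    by (simp only: mult.assoc[symmetric] fls_const_mult_const fls_const_1 mult_1_left)
  have "0 \<le> fls_subdegree (fls_const (inverse (of_nat N)) * (fls_const (of_nat N) * B i))"
    unfolding eq using nonneg[OF order_refl] by (intro fls_subdegree_nonneg_mult) simp_all
  hence "0 \<le> fls_subdegree (B i)" unfolding e1 .
  hence "0 \<le> vord p c (to_ac (r i) * y ^ i)"
    unfolding vord_def emb_term[OF c] using fls_subdegree_nonneg_mult[of "fls_const (c ^ i)" "B i"]
    by (simp only: B_def fls_const_subdegree order_refl)
  thus ?thesis using c by (simp add: pt_iff)
qed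

text \<open>The N-th power replaces y by f, so questions about a single term are decided on the
  line.\<close>

lemma term_power_rational: "(to_ac r * y ^ i) ^ N \<in> rational_fn_field"
proof -
  have eq: "(to_ac r * y ^ i) ^ N = to_ac (r ^ N * Fract f 1 ^ i)"
    using y_power by (simp add: power_mult_distrib to_ac_Fract power_mult[symmetric] mult.commute[of i])
      (simp add: power_mult)
  show ?thesis unfolding rational_fn_field_eq eq by (rule rangeI)
qed

lemma points_facts:
  assumes "Q \<in> points F"
  shows "val_ring F Q" "fn_const c \<in> Q" "Q \<subset> F"
  using assms F.subfld_axioms by (auto simp: points_def val_ring_def val_ring_axioms_def)

text \<open>Membership of the N-th power of each term depends on the centre p alone, and
  \<open>Q\<close> is integrally closed. Abstract points are controlled by the explicit ones through
  this lemma.\<close>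

lemma in_point_if_in_pts:
  assumes Q: "Q \<in> points F" "uniformizer_at p \<in> max_ideal Q"
    and z: "\<And>c. c \<in> mu N \<Longrightarrow> z \<in> pt p c"
  shows "z \<in> Q"
proof -
  interpret val_ring F Q using points_facts[OF Q(1)] by blast
  have "z \<in> F" using z[OF one_mu] by (simp add: pt_iff)
  then obtain r where r: "z = (\<Sum>i<N. to_ac (r i) * y ^ i)" by (rule F_expand)
  have "to_ac (r i) * y ^ i \<in> Q" if "i < N" for i
  proof (rule power_in_imp[OF _ _ N_pos])
    have "(to_ac (r i) * y ^ i) ^ N \<in> pt p 1"
      using expansion_term_in_pt[OF r z that one_mu] val_ring.power[OF val_ring_pt[OF one_mu]] by blast
    thus "(to_ac (r i) * y ^ i) ^ N \<in> Q"
      using rational_mem_cong(1)[OF val_ring_pt[OF one_mu] pt_const[OF one_mu] rational_subset_F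
          pt_uniformizer_at[OF one_mu] points_facts(1,2)[OF Q(1)] rational_subset_F Q(2) term_power_rational]
      by blast
  qed auto
  thus ?thesis unfolding r by (intro sum) auto
qed

text \<open>Without finite poles the denominator divides the numerator; without a pole at infinity
  the quotient has degree 0.\<close>

lemma rational_regular_constant:
  assumes z: "z \<in> rational_fn_field" and reg: "\<And>p. z \<in> pt p 1"
  shows "z \<in> range fn_const"
proof -
  obtain a b where ab: "b \<noteq> 0" "z = fn_of_poly a / fn_of_poly b" using rational_Fract[OF z] .
  show ?thesis
  proof (cases "a = 0")
    case True
    thus ?thesis using ab by (intro range_eqI[of _ _ 0]) (simp add: fn_const_def)
  next
    case False
    have ord: "0 \<le> ordr p a b" for p
      using reg[of p] rational_mem_iff(1)[OF val_ring_pt[OF one_mu] pt_const[OF one_mu] rational_subset_F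
          pt_uniformizer_at[OF one_mu] False ab(1)] unfolding ab(2) by blast
    have "b dvd a"
      using ord[of "Some _"] by (intro order_le_imp_dvd False ab) (simp add: ordr_def ordp_def)
    then obtain q where q: "a = b * q" by (elim dvdE)
    hence "degree q = 0"
      using ord[of None] False ab(1) by (simp add: ordr_def ordp_def degree_mult_eq)
    then obtain d where "q = [:d:]" by (auto elim: degree_eq_zeroE)
    hence "z = fn_const d" using ab q by (simp add: fn_const_def del: mult_pCons_right)
    thus ?thesis by blast
  qed
qed

text \<open>Each term is regular everywhere, so its N-th power is a rational constant; the constants
  being algebraically closed, the term itself is one of the N constant roots.\<close>

lemma regular_constant:
  assumes reg: "\<And>p c. c \<in> mu N \<Longrightarrow> z \<in> pt p c"
  shows "z \<in> range fn_const"
proof -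
  have "z \<in> F" using reg[OF one_mu] by (simp add: pt_iff)
  then obtain r where r: "z = (\<Sum>i<N. to_ac (r i) * y ^ i)" by (rule F_expand)
  have "to_ac (r i) * y ^ i \<in> range fn_const" if "i < N" for i
  proof -
    define w where "w = to_ac (r i) * y ^ i"
    have "w ^ N \<in> range fn_const"
      unfolding w_def
    proof (rule rational_regular_constant[OF term_power_rational])
      show "(to_ac (r i) * y ^ i) ^ N \<in> pt p 1" for p
        using expansion_term_in_pt[OF r reg that one_mu] val_ring.power[OF val_ring_pt[OF one_mu]] by blast
    qed
    then obtain d where "w ^ N = fn_const d" by blast
    moreover obtain d' where "d' ^ N = d" using nth_root_exists[OF N_pos] by blast
    ultimately have "w ^ N - fn_const d' ^ N = 0"
      by (simp only: fn_const.hom_power[OF UNIV_I, symmetric] diff_self)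
    hence "(\<Prod>b\<in>mu N. w - fn_const b * fn_const d') = 0"
      by (simp only: prod_mu_diff[OF fld_emb_fn_const N_pos])
    hence "\<exists>b\<in>mu N. w - fn_const b * fn_const d' = 0"
      by (simp only: prod_zero_iff[OF mu_proots(1)[OF N_pos, where ?'a = 'a]])
    then obtain b where "w = fn_const b * fn_const d'" by auto
    thus ?thesis unfolding w_def by (intro range_eqI[of _ _ "b * d'"]) (simp add: fn_const.emb_simps)
  qed
  hence ex: "\<exists>d. to_ac (r i) * y ^ i = fn_const d" if "i < N" for i using that by blast
  have d: "to_ac (r i) * y ^ i = fn_const (SOME d. to_ac (r i) * y ^ i = fn_const d)" if "i < N" for i
    using someI_ex[OF ex[OF that]] .
  have "z = (\<Sum>i<N. fn_const (SOME d. to_ac (r i) * y ^ i = fn_const d))"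
    unfolding r using d by (intro sum.cong refl) simp
  thus ?thesis by (simp only: fn_const.hom_sum[OF UNIV_I, symmetric] rangeI)
qed

text \<open>
  If \<open>\<eta>\<^sup>e = 1\<close>, then substituting \<open>\<eta> T\<close> for the parameter \<open>T\<close> fixes the expansion of \<open>x\<close> and
  multiplies that of \<open>y\<close> by \<open>\<eta>\<^sup>m\<close>.
\<close>

lemma rot_emb:
  assumes c: "c \<in> mu N" and \<eta>: "\<eta> ^ ee p = 1" and z: "z \<in> F"
  shows "c * \<eta> powi mm p \<in> mu N" "rot \<eta> (emb p c z) = emb p (c * \<eta> powi mm p) z"
proof -
  have \<eta>0: "\<eta> \<noteq> 0" using \<eta> ee_pos[of p] by (auto simp: zero_power)
  interpret R: fld_emb "rot \<eta>" using fld_emb_rot[OF \<eta>0] .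
  have "\<eta> ^ N = 1"
    by (subst N_eq[of p]) (simp add: power_mult \<eta>)
  thus c': "c * \<eta> powi mm p \<in> mu N"
    using c by (simp add: mu_iff power_mult_distrib power_int_power_commute)
  have "(fps_X ^ ee p) oo (fps_const \<eta> * fps_X) = (fps_X ^ ee p :: 'a fps)"
    by (simp add: fps_compose_power[symmetric] power_mult_distrib fps_const_power \<eta>)
  hence "rot \<eta> (\<omega>e p) = \<omega>e p"
    unfolding rot_def \<omega>e_def using \<eta>0 ee_pos[of p]
    by (subst fls_compose_fps_to_fls) (auto simp: fps_compose_assoc[symmetric] fps_X_power_nth_0)
  moreover have "rot \<eta> fls_X = fls_const \<eta> * fls_X"
    by (simp add: rot_def fls_times_fps_to_fls)
  moreover have "rot \<eta> (fls_const d) = fls_const d" for d by (simp add: rot_def)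
  ultimately have Y: "rot \<eta> (fls_const c * YY p) = fls_const (c * \<eta> powi mm p) * YY p"
    by (simp add: YY_def R.emb_simps power_int_mult_distrib fls_const_power_int mult_ac
        del: fls_X_power_int flip: fls_const_mult_const)
  have hom: "fld_hom F (\<lambda>z. rot \<eta> (emb p c z))"
    using fld_hom_comp[OF emb(1)[OF c] R.fld_hom_axioms] by simp
  show "rot \<eta> (emb p c z) = emb p (c * \<eta> powi mm p) z"
    by (rule hom_unique[OF hom emb(1)[OF c'] _ _ _ z])
       (use ee_pos[of p] \<eta> in \<open>simp_all add: emb_const[OF c] emb_const[OF c'] emb_x[OF c] emb_x[OF c']
          emb(3)[OF c] emb(3)[OF c'] rot_power Y\<close>, simp_all add: rot_def)
qed

text \<open>The quotient d = c'/c satisfies d^e = 1. As m is prime to e, d is the m-th power of some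
  \<eta> with \<eta>^e = 1, so the two expansions differ by T \<mapsto> \<eta> T, which preserves
  orders.\<close>

lemma pt_cong:
  assumes c: "c \<in> mu N" "c' \<in> mu N" "c ^ ee p = c' ^ ee p"
  shows "pt p c = pt p c'"
proof -
  obtain a b where ab: "a * mm p + b * int (ee p) = 1"
    using bezout_int[of "mm p" "int (ee p)"] coprime_mm_ee[of p] by (auto simp: coprime_iff_gcd_eq_1)
  have c0: "c \<noteq> 0" "c' \<noteq> 0" using mu_nonzero[OF _ N_pos] c by auto
  define d where "d = c' / c"
  have d: "d ^ ee p = 1" "d \<noteq> 0" using c c0 by (auto simp: d_def power_divide)
  define \<eta> where "\<eta> = d powi a"
  have \<eta>: "\<eta> ^ ee p = 1"
    by (simp add: \<eta>_def power_int_power_commute d)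
  have "d powi (a * mm p + int (ee p) * b) = \<eta> powi mm p * (d ^ ee p) powi b"
    unfolding \<eta>_def power_int_of_nat[symmetric] power_int_mult[symmetric] using d(2) by (simp add: power_int_add)
  hence "\<eta> powi mm p = d" using d ab by (simp add: mult.commute[of b])
  hence c': "c' = c * \<eta> powi mm p" using c0 by (simp add: d_def)
  have "\<eta> \<noteq> 0" using d by (simp add: \<eta>_def)
  have "vord p c z = vord p c' z" if "z \<in> F" for z
    using rot_emb(2)[OF c(1) \<eta> that] subdegree_rot[OF \<open>\<eta> \<noteq> 0\<close>] unfolding vord_def c' by metis
  thus ?thesis using c by (auto simp: pt_iff)
qed

section \<open>Classification of the points with given centre\<close>

definition w0 :: "'a option \<Rightarrow> 'a" where "w0 p = fps_nth (\<omega> p) 0 ^ ee p"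
text \<open>A function separating the points over p: its order at each of them is em - me = 0, and
  its residue at \<open>pt p c\<close> is \<open>c ^ ee p * w0 p\<close>.\<close>

definition ww :: "'a option \<Rightarrow> 'a fn" where "ww p = y ^ ee p / uniformizer_at p powi mm p"

lemma w0_nonzero: "w0 p \<noteq> 0"
  using omega(2) by (simp add: w0_def)

lemma ww_in_F [simp, intro]: "ww p \<in> F"
  unfolding ww_def by (intro F.divide F.power F.power_int) auto

lemma emb_ww:
  assumes "c \<in> mu N"
  shows "emb p c (ww p) = fls_const (c ^ ee p) * \<omega>e p ^ ee p"
proof -
  interpret C: fld_hom F "emb p c" using emb(1)[OF assms] .
  have "emb p c (ww p) = (fls_const c * YY p) ^ ee p / (fls_X ^ ee p) powi mm p"
    unfolding ww_def
    by (simp only: C.hom_divide C.hom_power C.hom_power_int F.power F.power_int y_in_F uniformizer_at_in_F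
        emb(3)[OF assms] emb_uniformizer_at[OF assms])
  also have "(fls_const c * YY p) ^ ee p = fls_const (c ^ ee p) * \<omega>e p ^ ee p * (fls_X ^ ee p) powi mm p"
    unfolding YY_def power_mult_distrib fls_const.hom_power[OF UNIV_I, symmetric] power_int_power_commute
    by (simp only: mult_ac)
  finally show ?thesis by (simp del: fls_X_power_int)
qed

lemma ww_minus_const:
  assumes "c \<in> mu N"
  shows "ww p - fn_const d \<in> pt p c" "ww p - fn_const d \<in> max_ideal (pt p c) \<longleftrightarrow> d = c ^ ee p * w0 p"
proof -
  interpret C: fld_hom F "emb p c" using emb(1)[OF assms] .
  define h where "h = emb p c (ww p - fn_const d)"
  have "\<omega>e p ^ ee p = fps_to_fls ((\<omega> p oo fps_X ^ ee p) ^ ee p)"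
    by (simp add: \<omega>e_def fps_to_fls_power)
  define u where "u = fps_const (c ^ ee p) * (\<omega> p oo fps_X ^ ee p) ^ ee p - fps_const d"
  have u: "h = fps_to_fls u"
    unfolding h_def u_def using \<open>\<omega>e p ^ ee p = _\<close>
    by (simp add: C.hom_diff emb_ww[OF assms] emb_const[OF assms] fls_times_fps_to_fls
        flip: fls_const_mult_const)
  have u0: "fps_nth u 0 = c ^ ee p * w0 p - d"
    by (simp add: u_def fps_nth_power_0 w0_def)
  have vord: "vord p c (ww p - fn_const d) = int (subdegree u)"
    unfolding vord_def h_def[symmetric] u by (rule fls_subdegree_fls_to_fps)
  thus "ww p - fn_const d \<in> pt p c" using assms by (simp add: pt_iff)
  have "ww p - fn_const d = 0 \<longleftrightarrow> u = 0"
    using C.hom_eq_0_iff[of "ww p - fn_const d"] unfolding h_def[symmetric] u by (simp add: fps_to_fls_eq_0_iff)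
  hence "ww p - fn_const d \<in> max_ideal (pt p c) \<longleftrightarrow> fps_nth u 0 = 0"
    unfolding pt_max_ideal[OF assms] using vord by (auto simp: subdegree_eq_0_iff)
  thus "ww p - fn_const d \<in> max_ideal (pt p c) \<longleftrightarrow> d = c ^ ee p * w0 p"
    unfolding u0 by auto
qed

lemma ww_power_rational: "ww p ^ gg p \<in> rational_fn_field"
proof -
  interpret R: subfld "rational_fn_field :: 'a fn set" by (rule subfld_rational)
  have "ww p ^ gg p = fn_of_poly f / (uniformizer_at p powi mm p) ^ gg p"
    using y_power by (subst (asm) N_eq[of p]) (simp add: ww_def power_divide power_mult)
  moreover have "\<dots> \<in> rational_fn_field"
    by (intro R.divide R.power R.power_int uniformizer_at_in_rational fn_of_poly_in_rational)
  ultimately show ?thesis by (simp only:)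
qed

text \<open>The g-th power of \<open>ww\<close> is rational, so its residue is the same at all
  points over p and can be computed at \<open>pt p 1\<close>.\<close>

lemma ww_power_in_point:
  assumes Q: "Q \<in> points F" "uniformizer_at p \<in> max_ideal Q"
  shows "ww p ^ gg p - fn_const (w0 p) ^ gg p \<in> max_ideal Q" "ww p \<in> Q"
proof -
  interpret P: val_ring F "pt p 1" using val_ring_pt[OF one_mu] .
  interpret Q: val_ring F Q using points_facts(1)[OF Q(1)] .
  define z where "z = ww p ^ gg p - fn_const (w0 p) ^ gg p"
  have "(\<Prod>b\<in>mu (gg p) - {1}. ww p - fn_const b * fn_const (w0 p)) \<in> pt p 1"
    using ww_minus_const(1)[OF one_mu] by (intro P.prod) (simp flip: fn_const.emb_simps)
  moreover have "ww p - fn_const 1 * fn_const (w0 p) \<in> max_ideal (pt p 1)"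
    using ww_minus_const(2)[OF one_mu, of p "w0 p"] by simp
  moreover have "z = (\<Prod>b\<in>mu (gg p) - {1}. ww p - fn_const b * fn_const (w0 p)) * (ww p - fn_const 1 * fn_const (w0 p))"
    using prod.remove[OF mu_proots(1)[OF gg_pos], of 1 p "\<lambda>b. ww p - fn_const b * fn_const (w0 p)"]
      prod_mu_diff[OF fld_emb_fn_const gg_pos, of "ww p" "fn_const (w0 p)" p]
    by (simp only: z_def mu_iff power_one mult.commute)
  ultimately have "z \<in> max_ideal (pt p 1)" using P.mult_max_ideal by simp
  moreover have "z \<in> rational_fn_field"
    unfolding z_def
    by (rule subfld.diff[OF subfld_rational ww_power_rational
          subfld.power[OF subfld_rational fn_const_in_rational]])
  ultimately show z: "z \<in> max_ideal Q"
    using rational_mem_cong(2)[OF val_ring_pt[OF one_mu] pt_const[OF one_mu] rational_subset_F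
        pt_uniformizer_at[OF one_mu] points_facts(1,2)[OF Q(1)] rational_subset_F Q(2)] by blast
  have "z + fn_const (w0 p) ^ gg p \<in> Q"
    using z points_facts(2)[OF Q(1)] by (intro Q.add Q.power) auto
  hence "ww p ^ gg p \<in> Q" by (simp add: z_def)
  thus "ww p \<in> Q" using Q.power_in_imp[OF ww_in_F _ gg_pos] by blast
qed

text \<open>A larger ring contains some z of negative order; any u is then u/z^M times z^M, with
  u/z^M regular for large M.\<close>

lemma pt_maximal:
  assumes c: "c \<in> mu N" and Q: "val_ring F Q" "pt p c \<subseteq> Q" "Q \<noteq> F"
  shows "Q = pt p c"
proof (rule ccontr)
  interpret Q: val_ring F Q using Q(1) .
  assume "Q \<noteq> pt p c"
  then obtain z where z: "z \<in> Q" "z \<notin> pt p c" using Q(2) by (metis subsetI subset_antisym)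
  have zF: "z \<in> F" using Q.in_F[OF z(1)] .
  have z0: "z \<noteq> 0" using z(2) val_ring.zero[OF val_ring_pt[OF c]] by metis
  have "\<not> 0 \<le> vord p c z" using z(2) zF pt_iff[OF c] by metis
  hence neg: "vord p c z \<le> - 1" by simp
  have "u \<in> Q" if u: "u \<in> F" for u
  proof (cases "u = 0")
    case False
    define M where "M = nat \<bar>vord p c u\<bar>"
    have "int M * vord p c z \<le> int M * (- 1)" by (rule mult_left_mono[OF neg]) simp
    moreover have "- int M \<le> vord p c u" by (simp add: M_def)
    moreover have "z ^ M \<in> F" "z ^ M \<noteq> 0" using F.power[OF zF] z0 by simp_all
    hence "vord p c (u / z ^ M) = vord p c u - int M * vord p c z"
      using vord_divide[OF c u _ False] vord_power[OF c zF] by simp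
    ultimately have "0 \<le> vord p c (u / z ^ M)" by linarith
    hence "u / z ^ M \<in> pt p c"
      using F.divide[OF u F.power[OF zF]] pt_iff[OF c] by blast
    hence "u / z ^ M \<in> Q" using Q(2) by blast
    hence "u / z ^ M * z ^ M \<in> Q" by (rule Q.mult[OF _ Q.power[OF z(1)]])
    moreover have "z ^ M \<noteq> 0" using z0 by simp
    ultimately show ?thesis by (metis nonzero_eq_divide_eq times_divide_eq_left)
  qed simp
  thus False using Q(3) Q.in_F by blast
qed

text \<open>The product of all ww - b w0 with b^g = 1 lies in the maximal ideal, which is prime, so
  some b occurs as residue; c is an e-th root of b.\<close>

lemma ex_residue:
  assumes Q: "Q \<in> points F" "uniformizer_at p \<in> max_ideal Q"
  shows "\<exists>c\<in>mu N. ww p - fn_const (c ^ ee p * w0 p) \<in> max_ideal Q"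
proof -
  interpret Q: val_ring F Q using points_facts(1)[OF Q(1)] .
  have "(\<Prod>b\<in>mu (gg p). ww p - fn_const b * fn_const (w0 p)) \<in> max_ideal Q"
    unfolding prod_mu_diff[OF fld_emb_fn_const gg_pos] by (rule ww_power_in_point(1)[OF Q])
  hence "\<not> (\<forall>b\<in>mu (gg p). ww p - fn_const b * fn_const (w0 p) \<in> Q - max_ideal Q)"
    using Q.prod_unit[OF mu_proots(1)[OF gg_pos, where ?'a = 'a], of p "\<lambda>b. ww p - fn_const b * fn_const (w0 p)"] by auto
  then obtain b where b: "b \<in> mu (gg p)" "ww p - fn_const b * fn_const (w0 p) \<notin> Q - max_ideal Q" by blast
  have "ww p - fn_const b * fn_const (w0 p) \<in> Q"
    by (intro Q.diff Q.mult ww_power_in_point(2)[OF Q] points_facts(2)[OF Q(1)])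
  hence "ww p - fn_const b * fn_const (w0 p) \<in> max_ideal Q" using b(2) by blast
  hence "ww p - fn_const (b * w0 p) \<in> max_ideal Q" by (simp only: fn_const.emb_simps)
  moreover obtain c where c: "c ^ ee p = b" using nth_root_exists[OF ee_pos] by blast
  moreover have "c ^ N = (c ^ ee p) ^ gg p"
    by (subst N_eq[of p]) (rule power_mult)
  ultimately show ?thesis using b(1) by (intro bexI[of _ c]) (simp_all add: mu_iff)
qed

text \<open>By maximality it suffices to show that \<open>Q\<close> contains \<open>pt p c\<close>.
  The product q of the factors belonging to the other residues is a unit in \<open>Q\<close> but
  vanishes at all other explicit points over p. For z regular at \<open>pt p c\<close>, a high power
  of q removes its poles over p, so z q^M lies in \<open>Q\<close>, and q can be cancelled
  there.\<close>

lemma point_eq_pt: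
  assumes Q: "Q \<in> points F" "uniformizer_at p \<in> max_ideal Q"
    and c: "c \<in> mu N" "ww p - fn_const (c ^ ee p * w0 p) \<in> max_ideal Q"
  shows "Q = pt p c"
proof (rule pt_maximal[OF c(1)])
  show vr: "val_ring F Q" using points_facts(1)[OF Q(1)] .
  show "Q \<noteq> F" using points_facts(3)[OF Q(1)] by blast
  interpret Q: val_ring F Q by fact
  define B where "B = mu (gg p) - {c ^ ee p}"
  define fac where "fac = (\<lambda>b. ww p - fn_const (b * w0 p))"
  define q where "q = prod fac B"
  have cg: "d ^ ee p \<in> mu (gg p)" if "d \<in> mu N" for d
    using that N_eq[of p] by (simp add: mu_iff power_mult[symmetric])
  have fin: "finite B" using mu_proots(1)[OF gg_pos] by (simp add: B_def)
  have "fac b \<in> Q - max_ideal Q" if "b \<in> B" for b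
  proof -
    define d where "d = (c ^ ee p - b) * w0 p"
    have "d \<noteq> 0" using that w0_nonzero by (auto simp: d_def B_def)
    hence "fn_const d \<in> Q - max_ideal Q"
      unfolding Q.unit_iff using points_facts(2)[OF Q(1), of d] points_facts(2)[OF Q(1), of "inverse d"]
      by (simp add: fn_const.emb_simps)
    moreover have "fac b = fn_const d + (ww p - fn_const (c ^ ee p * w0 p))"
      by (simp add: fac_def d_def fn_const.emb_simps algebra_simps)
    ultimately show ?thesis using Q.add_unit c(2) by simp
  qed
  hence q_unit: "q \<in> Q - max_ideal Q" unfolding q_def by (intro Q.prod_unit fin)
  hence q0: "q \<noteq> 0" "q \<in> F" using Q.unit_iff by blast+
  have q_pt: "q \<in> pt p d" if "d \<in> mu N" for d
    unfolding q_def fac_def using ww_minus_const(1)[OF that]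
    by (intro val_ring.prod[OF val_ring_pt[OF that]])
  have q_pos: "0 < vord p d q" if d: "d \<in> mu N" "d ^ ee p \<noteq> c ^ ee p" for d
  proof -
    interpret P: val_ring F "pt p d" using val_ring_pt[OF d(1)] .
    have "d ^ ee p \<in> B" using cg d by (simp add: B_def)
    hence "q = prod fac (B - {d ^ ee p}) * fac (d ^ ee p)"
      unfolding q_def using fin by (simp add: prod.remove mult.commute)
    moreover have "prod fac (B - {d ^ ee p}) \<in> pt p d"
      unfolding fac_def using ww_minus_const(1)[OF d(1)] by (intro P.prod)
    moreover have "fac (d ^ ee p) \<in> max_ideal (pt p d)"
      using ww_minus_const(2)[OF d(1)] by (simp add: fac_def)
    ultimately have "q \<in> max_ideal (pt p d)" using P.mult_max_ideal by simp
    thus ?thesis using q0 by (simp add: pt_max_ideal[OF d(1)])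
  qed
  show "pt p c \<subseteq> Q"
  proof
    fix z assume z: "z \<in> pt p c"
    have zF: "z \<in> F" using z c(1) by (simp add: pt_iff)
    show "z \<in> Q"
    proof (cases "z = 0")
      case False
      \<comment> \<open>The sum of the absolute orders bounds each of them, so one exponent works at
        all points over p.\<close>
      define M where "M = (\<Sum>d\<in>mu N. nat \<bar>vord p d z\<bar>)"
      have "z * q ^ M \<in> pt p d" if d: "d \<in> mu N" for d
      proof (cases "d ^ ee p = c ^ ee p")
        case True
        hence "z \<in> pt p d" using pt_cong[OF d c(1)] z by simp
        thus ?thesis using q_pt[OF d] val_ring.mult[OF val_ring_pt[OF d]] val_ring.power[OF val_ring_pt[OF d]] by blast
      next
        case False
        have "nat \<bar>vord p d z\<bar> \<le> M"
          unfolding M_def by (rule member_le_sum[OF d]) (simp_all add: mu_proots N_pos)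
        moreover have "int M * 1 \<le> int M * vord p d q"
          using q_pos[OF d False] by (intro mult_left_mono) auto
        ultimately have "0 \<le> vord p d z + int M * vord p d q" by linarith
        thus ?thesis
          using d zF q0 \<open>z \<noteq> 0\<close> by (simp add: pt_iff vord_mult vord_power)
      qed
      hence "z * q ^ M \<in> Q" by (rule in_point_if_in_pts[OF Q])
      moreover have u: "inverse (q ^ M) \<in> Q" using Q.inverse_unit[OF Q.power_unit[OF q_unit]] by blast
      ultimately have "z * q ^ M * inverse (q ^ M) \<in> Q" by (rule Q.mult)
      thus ?thesis using q0 by (simp add: mult.assoc)
    qed simp
  qed
qed

text \<open>Without a centre, x and the inverses of all nonzero polynomials would lie in
  \<open>Q\<close>. Then \<open>Q\<close> would contain the rational functions and, being integrally
  closed, all of \<open>F\<close>.\<close>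

lemma ex_center:
  assumes Q: "Q \<in> points F"
  shows "\<exists>p. uniformizer_at p \<in> max_ideal Q"
proof (rule ccontr)
  assume neg: "\<not> (\<exists>p. uniformizer_at p \<in> max_ideal Q)"
  interpret Q: val_ring F Q using points_facts(1)[OF Q] .
  note const = points_facts(2)[OF Q]
  have "uniformizer_at None \<notin> max_ideal Q" using neg by blast
  hence x: "fn_x \<in> Q"
    using Q.inverse_max_ideal[of fn_x] by (auto simp: uniformizer_at_def)
  have lin: "fn_of_poly [:- \<xi>, 1:] \<in> Q - max_ideal Q" for \<xi>
  proof -
    have "uniformizer_at (Some \<xi>) \<notin> max_ideal Q" using neg by blast
    moreover have "fn_x - fn_const \<xi> \<in> Q" using Q.diff[OF x const] .
    ultimately show ?thesis by (simp add: uniformizer_at_def fn_x_minus_const)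
  qed
  have unit: "fn_of_poly a \<in> Q - max_ideal Q" if a: "a \<noteq> 0" for a
  proof -
    obtain A where A: "a = smult (lead_coeff a) (\<Prod>x\<in>#A. [:- x, 1:])"
      using alg_closed_imp_factorization[OF a] by blast
    have "fn_of_poly (\<Prod>x\<in>#A. [:- x, 1:]) \<in> Q - max_ideal Q"
    proof (induction A)
      case empty
      show ?case using Q.one_notin_max_ideal by simp
    next
      case (add x A)
      show ?case unfolding image_mset_add_mset prod_mset.add_mset fn_of_poly_simps(2)
        by (rule Q.mult_unit[OF lin add])
    qed
    moreover have "fn_const (lead_coeff a) \<in> Q - max_ideal Q"
      unfolding Q.unit_iff using a const[of "lead_coeff a"] const[of "inverse (lead_coeff a)"]
      by (simp add: fn_const.emb_simps)
    moreover have "fn_of_poly a = fn_const (lead_coeff a) * fn_of_poly (\<Prod>x\<in>#A. [:- x, 1:])"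
      by (subst A) (simp add: fn_const_def flip: fn_of_poly_simps)
    ultimately show ?thesis by (simp only: Q.mult_unit)
  qed
  have rat: "z \<in> Q" if z: "z \<in> rational_fn_field" for z
  proof -
    obtain a b where ab: "b \<noteq> 0" "z = fn_of_poly a / fn_of_poly b" using rational_Fract[OF z] .
    have "fn_of_poly a \<in> Q" using unit[of a] by (cases "a = 0") simp_all
    moreover have "inverse (fn_of_poly b) \<in> Q" by (rule DiffD1[OF Q.inverse_unit[OF unit[OF ab(1)]]])
    ultimately show ?thesis unfolding ab(2) divide_inverse by (rule Q.mult)
  qed
  have "z \<in> Q" if z: "z \<in> F" for z
  proof -
    obtain r where r: "z = (\<Sum>i<N. to_ac (r i) * y ^ i)" using F_expand[OF z] .
    have "to_ac (r i) * y ^ i \<in> Q" for i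
      by (rule Q.power_in_imp[OF _ rat[OF term_power_rational] N_pos]) simp
    thus ?thesis unfolding r by (rule Q.sum)
  qed
  thus False using points_facts(3)[OF Q] by blast
qed

lemma point_over_eq_pt:
  assumes "Q \<in> points F" "uniformizer_at p \<in> max_ideal Q"
  shows "Q \<in> pt p ` mu N"
proof -
  obtain c where c: "c \<in> mu N" "ww p - fn_const (c ^ ee p * w0 p) \<in> max_ideal Q"
    using ex_residue[OF assms] by (elim bexE)
  show ?thesis using point_eq_pt[OF assms c] c(1) by (rule image_eqI)
qed

theorem points_classification:
  assumes "Q \<in> points F"
  obtains p c where "c \<in> mu N" "Q = pt p c"
proof -
  obtain p where "uniformizer_at p \<in> max_ideal Q" using ex_center[OF assms] by (elim exE)
  from point_over_eq_pt[OF assms this] show ?thesis using that by (elim imageE)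
qed

lemma pt_eq_iff:
  assumes "c \<in> mu N" "c' \<in> mu N"
  shows "pt p c = pt p c' \<longleftrightarrow> c ^ ee p = c' ^ ee p"
proof
  assume eq: "pt p c = pt p c'"
  have "ww p - fn_const (c ^ ee p * w0 p) \<in> max_ideal (pt p c')"
    unfolding eq[symmetric] using ww_minus_const(2)[OF assms(1)] by blast
  hence "c ^ ee p * w0 p = c' ^ ee p * w0 p" using ww_minus_const(2)[OF assms(2)] by blast
  thus "c ^ ee p = c' ^ ee p" using w0_nonzero by simp
qed (rule pt_cong[OF assms])

definition points_over :: "'a \<Rightarrow> 'a fn set set" where
  "points_over \<xi> = {Q\<in>points F. Q \<inter> rational_fn_field = line_point \<xi>}"

lemma points_over_eq: "points_over \<xi> = pt (Some \<xi>) ` mu N"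
proof -
  have iff: "Q \<inter> rational_fn_field = line_point \<xi> \<longleftrightarrow> uniformizer_at (Some \<xi>) \<in> max_ideal Q" if "Q \<in> points F" for Q
    using Int_rational_eq_line_point_iff[OF points_facts(1,2)[OF that] rational_subset_F] .
  show ?thesis
  proof (intro equalityI subsetI)
    fix Q assume "Q \<in> points_over \<xi>"
    hence "Q \<in> points F" "uniformizer_at (Some \<xi>) \<in> max_ideal Q" using iff by (auto simp: points_over_def)
    thus "Q \<in> pt (Some \<xi>) ` mu N" by (rule point_over_eq_pt)
  next
    fix Q assume "Q \<in> pt (Some \<xi>) ` mu N"
    then obtain c where "c \<in> mu N" "Q = pt (Some \<xi>) c" by blast
    thus "Q \<in> points_over \<xi>" using iff pt_points pt_uniformizer_at by (simp add: points_over_def)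
  qed
qed

text \<open>Raising to the power e maps \<open>mu N\<close> onto \<open>mu (gg p)\<close>, and by
  \<open>pt_eq_iff\<close> its fibres are the sets of indices naming the same point.\<close>

lemma card_points_over: "finite (points_over \<xi>)" "card (points_over \<xi>) = gg (Some \<xi>)"
proof -
  show "finite (points_over \<xi>)" unfolding points_over_eq using mu_proots(1)[OF N_pos, where ?'a = 'a] by simp
  define p where "p = Some \<xi>"
  have img: "(\<lambda>c. c ^ ee p) ` mu N = (mu (gg p) :: 'a set)"
  proof (intro equalityI subsetI)
    fix b :: 'a assume b: "b \<in> mu (gg p)"
    obtain c where c: "c ^ ee p = b" using nth_root_exists[OF ee_pos] by blast
    have "c ^ N = (c ^ ee p) ^ gg p" by (subst N_eq[of p]) (rule power_mult)
    thus "b \<in> (\<lambda>c. c ^ ee p) ` mu N" using b c by (auto simp: mu_iff)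
  next
    fix b :: 'a assume "b \<in> (\<lambda>c. c ^ ee p) ` mu N"
    then obtain c where c: "c \<in> mu N" "b = c ^ ee p" by blast
    have "c ^ N = (c ^ ee p) ^ gg p" by (subst N_eq[of p]) (rule power_mult)
    thus "b \<in> mu (gg p)" using c by (simp add: mu_iff)
  qed
  define h where "h = (\<lambda>b. pt p (SOME c. c \<in> mu N \<and> c ^ ee p = b))"
  have h: "h (c ^ ee p) = pt p c" if "c \<in> mu N" for c
  proof -
    have "(SOME d. d \<in> mu N \<and> d ^ ee p = c ^ ee p) \<in> mu N \<and> (SOME d. d \<in> mu N \<and> d ^ ee p = c ^ ee p) ^ ee p = c ^ ee p"
      by (rule someI[of _ c]) (use that in simp)
    thus ?thesis unfolding h_def using pt_cong that by blast
  qed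
  have "h ` mu (gg p) = pt p ` mu N"
    unfolding img[symmetric] image_image using h by (intro image_cong) auto
  moreover have "inj_on h (mu (gg p))"
    unfolding img[symmetric] inj_on_def using h pt_eq_iff by auto
  ultimately have "card (pt p ` mu N) = card (mu (gg p) :: 'a set)" by (metis card_image)
  thus "card (points_over \<xi>) = gg (Some \<xi>)"
    unfolding points_over_eq p_def by (simp add: mu_proots gg_pos)
qed

lemma point_uniformizer:
  assumes "Q \<in> points F"
  shows "\<exists>t. uniformizer Q t" "uniformizer Q t \<Longrightarrow> t \<in> F \<and> t \<noteq> 0"
proof -
  obtain p c where c: "c \<in> mu N" "Q = pt p c" using points_classification[OF assms] .
  show "\<exists>t. uniformizer Q t" unfolding c(2) by (rule pt_ex_uniformizer[OF c(1)])
  assume t: "uniformizer Q t"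
  have "t \<in> F" using t pt_uniformizer_iff[OF c(1)] unfolding c(2) by simp
  moreover have "t \<noteq> 0" using t by (simp add: uniformizer_def)
  ultimately show "t \<in> F \<and> t \<noteq> 0" ..
qed

end


section \<open>One step of the tower\<close>

text \<open>The covering of degree l given by y \<mapsto> y^l; \<open>E\<close> denotes the lower
  curve, with the same witness \<open>\<xi>\<^sub>0\<close>.\<close>

locale kummer_step = kummer +
  fixes l :: nat
  assumes l_prime: "Factorial_Ring.prime l" and l_dvd: "l dvd N"
begin

lemma l_pos: "l > 0"
  using l_prime by (simp add: prime_gt_0_nat)

sublocale E: kummer f "y ^ l" "N div l" \<xi>\<^sub>0
proof
  show "N div l > 0" using l_dvd N_pos l_pos by (simp add: dvd_imp_le div_greater_zero_iff)
  show "(y ^ l) ^ (N div l) = fn_of_poly f"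
    using y_power l_dvd by (simp flip: power_mult)
  show "algebraic_semidom_class.coprime (order \<xi>\<^sub>0 f) (N div l)"
    using coprime l_dvd by (metis coprime_mult_right_iff dvd_div_mult_self)
qed (rule f_nonzero)

lemma E_subset: "E.F \<subseteq> F"
  unfolding fn_field_def[of "y ^ l"]
  by (rule generate_field_minimal[OF F.subfld_axioms]) auto

lemma E_in_F: "h \<in> E.F \<Longrightarrow> h \<in> F"
  using E_subset by (rule subsetD)

lemma mu_l: "b \<in> mu l \<Longrightarrow> b \<in> mu N"
  using l_dvd by (auto simp: mu_iff power_mult elim!: dvdE)

lemma mu_mult: "c \<in> mu m \<Longrightarrow> b \<in> mu m \<Longrightarrow> c * b \<in> mu m"
  by (simp add: mu_iff power_mult_distrib)

lemma F_decompose: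
  assumes "g \<in> F"
  shows "\<exists>h. (\<forall>i<l. h i \<in> E.F) \<and> g = (\<Sum>i<l. h i * y ^ i)"
proof -
  define A where "A = {\<Sum>i<l. h i * y ^ i | h. \<forall>i<l. h i \<in> E.F}"
  have A0: "0 \<in> A"
    unfolding A_def by (intro CollectI exI[of _ "\<lambda>_. 0"]) simp
  have A_add: "a + b \<in> A" if ab: "a \<in> A" "b \<in> A" for a b
  proof -
    obtain h h' where h: "a = (\<Sum>i<l. h i * y ^ i)" "\<forall>i<l. h i \<in> E.F"
      "b = (\<Sum>i<l. h' i * y ^ i)" "\<forall>i<l. h' i \<in> E.F"
      using ab unfolding A_def by blast
    show ?thesis unfolding A_def
      by (intro CollectI exI[of _ "\<lambda>i. h i + h' i"]) (simp add: h sum.distrib algebra_simps)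
  qed
  have A_term: "to_ac r * y ^ j \<in> A" for r j
  proof -
    define h where "h = (\<lambda>i. if i = j mod l then to_ac r * (y ^ l) ^ (j div l) else 0)"
    have "y ^ j = (y ^ l) ^ (j div l) * y ^ (j mod l)"
      by (simp flip: power_mult power_add)
    hence "to_ac r * y ^ j = h (j mod l) * y ^ (j mod l)"
      unfolding h_def by (simp add: mult_ac)
    also have "\<dots> = (\<Sum>i<l. if i = j mod l then h (j mod l) * y ^ (j mod l) else 0)"
      using l_pos by simp
    also have "\<dots> = (\<Sum>i<l. h i * y ^ i)"
      by (intro sum.cong) (auto simp: h_def)
    finally have "to_ac r * y ^ j = (\<Sum>i<l. h i * y ^ i)" .
    moreover have "\<forall>i<l. h i \<in> E.F" by (simp add: h_def)
    ultimately show ?thesis unfolding A_def by blast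
  qed
  obtain r where r: "g = (\<Sum>i<N. to_ac (r i) * y ^ i)" using F_expand[OF assms] .
  have "(\<Sum>i<M. to_ac (r i) * y ^ i) \<in> A" for M
    by (induction M) (simp_all add: A0 A_add A_term)
  hence "g \<in> A" unfolding r .
  thus ?thesis unfolding A_def by blast
qed

text \<open>Passing from c to \<open>c * b\<close> amounts to applying y \<mapsto> b y before
  expanding. The automorphisms of the covering are only ever used in this form.\<close>

lemma emb_E:
  assumes c: "c \<in> mu N" and b: "b \<in> mu l" and h: "h \<in> E.F"
  shows "emb p (c * b) h = emb p c h"
proof -
  have cb: "c * b \<in> mu N" using mu_mult[OF c mu_l[OF b]] .
  interpret C: fld_hom F "emb p c" using emb(1)[OF c] .
  interpret CB: fld_hom F "emb p (c * b)" using emb(1)[OF cb] .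
  have "emb p (c * b) (y ^ l) = emb p c (y ^ l)"
    using b by (simp add: C.hom_power CB.hom_power emb(3)[OF c] emb(3)[OF cb] power_mult_distrib mu_iff
        flip: fls_const.hom_power[OF UNIV_I])
  thus ?thesis
    using E.hom_unique[OF fld_hom_subset[OF CB.fld_hom_axioms E.F.subfld_axioms E_subset]
        fld_hom_subset[OF C.fld_hom_axioms E.F.subfld_axioms E_subset] _ _ _ h]
    by (simp add: emb_const[OF c] emb_const[OF cb] emb_x[OF c] emb_x[OF cb])
qed

lemma pt_E:
  assumes "c \<in> mu N" "b \<in> mu l"
  shows "pt p (c * b) \<inter> E.F = pt p c \<inter> E.F"
  using assms mu_mult[OF assms(1) mu_l[OF assms(2)]] emb_E[OF assms] E_in_F
  by (auto simp: pt_iff vord_def)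

lemma emb_decompose:
  assumes c: "c \<in> mu N" and b: "b \<in> mu l" and h: "\<And>i. i < l \<Longrightarrow> h i \<in> E.F" "g = (\<Sum>i<l. h i * y ^ i)"
  shows "emb p (c * b) g = (\<Sum>i<l. fls_const (b ^ i) * emb p c (h i * y ^ i))"
proof -
  have cb: "c * b \<in> mu N" using mu_mult[OF c mu_l[OF b]] .
  interpret C: fld_hom F "emb p c" using emb(1)[OF c] .
  interpret CB: fld_hom F "emb p (c * b)" using emb(1)[OF cb] .
  have hF: "i < l \<Longrightarrow> h i \<in> F" for i using h(1) E_in_F by simp
  have "emb p (c * b) g = (\<Sum>i<l. emb p (c * b) (h i * y ^ i))"
    unfolding h(2) using hF by (intro CB.hom_sum) auto
  also have "\<dots> = (\<Sum>i<l. fls_const (b ^ i) * emb p c (h i * y ^ i))"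
  proof (intro sum.cong refl)
    fix i assume i: "i \<in> {..<l}"
    have "emb p (c * b) (h i * y ^ i) = emb p c (h i) * (fls_const (c * b) * YY p) ^ i"
      using i hF by (simp add: CB.hom_mult CB.hom_power emb(3)[OF cb] emb_E[OF c b h(1)])
    also have "\<dots> = fls_const (b ^ i) * (emb p c (h i) * (fls_const c * YY p) ^ i)"
      unfolding fls_const_mult_const[symmetric] power_mult_distrib fls_const.hom_power[OF UNIV_I]
      by (simp only: mult_ac)
    also have "emb p c (h i) * (fls_const c * YY p) ^ i = emb p c (h i * y ^ i)"
      using i hF by (simp add: C.hom_mult C.hom_power emb(3)[OF c])
    finally show "emb p (c * b) (h i * y ^ i) = fls_const (b ^ i) * emb p c (h i * y ^ i)" .
  qed
  finally show ?thesis .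
qed

text \<open>The averaging argument again, now over \<open>mu l\<close>. All conjugate expansions of
  g have the same order, so after division by g they stay regular, and so does their weighted
  mean.\<close>

lemma decompose_term_in_pt:
  assumes c: "c \<in> mu N" and h: "\<And>i. i < l \<Longrightarrow> h i \<in> E.F" "g = (\<Sum>i<l. h i * y ^ i)" and g: "g \<noteq> 0"
    and ord: "\<And>b. b \<in> mu l \<Longrightarrow> vord p (c * b) g = vord p c g" and i: "i < l"
  shows "h i * y ^ i / g \<in> pt p c"
proof -
  interpret C: fld_hom F "emb p c" using emb(1)[OF c] .
  have hF: "j < l \<Longrightarrow> h j \<in> F" for j using h(1) E_in_F by simp
  have tF: "j < l \<Longrightarrow> h j * y ^ j \<in> F" for j using hF by simp
  have gF: "g \<in> F" unfolding h(2) using tF by (intro F.sum) simp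
  define B where "B = (\<lambda>j. emb p c (h j * y ^ j))"
  have "(\<Sum>b\<in>mu l. fls_const (inverse b ^ i) * emb p (c * b) g) =
      (\<Sum>b\<in>mu l. \<Sum>j<l. fls_const (b ^ j * inverse b ^ i) * B j)"
  proof (intro sum.cong refl)
    fix b :: 'a assume b: "b \<in> mu l"
    show "fls_const (inverse b ^ i) * emb p (c * b) g = (\<Sum>j<l. fls_const (b ^ j * inverse b ^ i) * B j)"
      by (subst emb_decompose[OF c b h])
        (simp_all only: sum_distrib_left fls_const_mult_const[symmetric] B_def mult_ac)
  qed
  also have "\<dots> = (\<Sum>j<l. fls_const (\<Sum>b\<in>mu l. b ^ j * inverse b ^ i) * B j)"
    by (subst sum.swap) (simp add: fls_const.hom_sum sum_distrib_right)
  also have "\<dots> = (\<Sum>j<l. if j = i then fls_const (of_nat l) * B j else 0)"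
    using i l_pos by (intro sum.cong refl) (simp add: sum_mu)
  also have "\<dots> = fls_const (of_nat l) * B i" using i by simp
  finally have eq: "fls_const (of_nat l) * B i = (\<Sum>b\<in>mu l. fls_const (inverse b ^ i) * emb p (c * b) g)" ..
  have inv: "inverse (of_nat l) * of_nat l = (1 :: 'a)"
    using l_pos by simp
  have "B i / emb p c g = fls_const (inverse (of_nat l)) * (fls_const (of_nat l) * B i) / emb p c g"
    by (simp only: mult.assoc[symmetric] fls_const_mult_const inv fls_const_1 mult_1_left)
  also have "\<dots> = fls_const (inverse (of_nat l)) * (\<Sum>b\<in>mu l. fls_const (inverse b ^ i) * (emb p (c * b) g / emb p c g))"
    unfolding eq by (simp only: times_divide_eq_right sum_divide_distrib[symmetric])
  finally have Bi: "B i / emb p c g = fls_const (inverse (of_nat l)) *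
      (\<Sum>b\<in>mu l. fls_const (inverse b ^ i) * (emb p (c * b) g / emb p c g))" .
  have quot: "fls_subdegree (emb p (c * b) g / emb p c g) = 0" if b: "b \<in> mu l" for b
  proof -
    have cb: "c * b \<in> mu N" using mu_mult[OF c mu_l[OF b]] .
    interpret CB: fld_hom F "emb p (c * b)" using emb(1)[OF cb] .
    show ?thesis
      using ord[OF b] gF g by (simp add: divide_inverse fls_inverse_subdegree vord_def)
  qed
  have "0 \<le> fls_subdegree (\<Sum>b\<in>A. fls_const (inverse b ^ i) * (emb p (c * b) g / emb p c g))" if "A \<subseteq> mu l" for A
    using finite_subset[OF that mu_proots(1)[OF l_pos]] that
  proof (induction A rule: finite_induct)
    case (insert b A)
    have "0 \<le> fls_subdegree (fls_const (inverse b ^ i) * (emb p (c * b) g / emb p c g))"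
      using quot[of b] insert(4) by (intro fls_subdegree_nonneg_mult) simp_all
    thus ?case using insert by (simp add: fls_subdegree_nonneg_add)
  qed simp
  hence "0 \<le> fls_subdegree (B i / emb p c g)"
    unfolding Bi by (intro fls_subdegree_nonneg_mult) simp_all
  hence "0 \<le> vord p c (h i * y ^ i / g)"
    unfolding vord_def B_def using C.hom_divide[OF tF[OF i] gF] by simp
  thus ?thesis using pt_iff[OF c] F.divide[OF tF[OF i] gF] by simp
qed

text \<open>
  Where \<open>l\<close> divides the ramification index \<open>e\<close>, the expansions of functions on the lower curve are
  fixed by \<open>T \<mapsto> \<eta> T\<close> for \<open>\<eta>\<^sup>l = 1\<close>, hence are Laurent series in \<open>T\<^sup>l\<close>.
\<close>

lemma l_dvd_vord:
  assumes e: "l dvd ee p" and h: "h \<in> E.F" "h \<noteq> 0"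
  shows "int l dvd vord p 1 h"
proof (rule ccontr)
  assume neg: "\<not> int l dvd vord p 1 h"
  interpret C: fld_hom F "emb p 1" using emb(1)[OF one_mu] .
  define k where "k = vord p 1 h"
  have nz: "fls_nth (emb p 1 h) k \<noteq> 0"
    using h E_in_F by (simp add: k_def vord_def)
  have "algebraic_semidom_class.coprime k (int l)"
    using prime_imp_coprime[of "int l" k] neg l_prime by (simp add: k_def coprime_commute)
  then obtain a b where ab: "a * k + b * int l = 1"
    using bezout_int[of k "int l"] by (auto simp: coprime_iff_gcd_eq_1)
  \<comment> \<open>Invariance of the lowest coefficient under the substitution gives \<eta>^k = 1.
    Together with \<eta>^l = 1 and k prime to l this makes \<eta> trivial, although there are l such
    roots of unity.\<close>
  have "\<eta> = 1" if \<eta>: "\<eta> \<in> mu l" for \<eta> :: 'a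
  proof -
    have \<eta>0: "\<eta> \<noteq> 0" using mu_nonzero[OF \<eta> l_pos] .
    have "\<eta> ^ ee p = 1" using \<eta> e by (auto simp: mu_iff power_mult elim!: dvdE)
    moreover have "\<eta> powi mm p \<in> mu l" using \<eta> by (simp add: mu_iff power_int_power_commute)
    ultimately have "rot \<eta> (emb p 1 h) = emb p 1 h"
      using rot_emb(2)[OF one_mu _ E_in_F[OF h(1)], of \<eta> p] emb_E[OF one_mu _ h(1), of "\<eta> powi mm p" p] by simp
    hence "fls_nth (emb p 1 h) k * \<eta> powi k = fls_nth (emb p 1 h) k"
      using rot_nth[OF \<eta>0, of "emb p 1 h" k] by simp
    hence "\<eta> powi k = 1" using nz by simp
    moreover have "\<eta> powi int l = 1" using \<eta> by (simp add: mu_iff)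
    moreover have "\<eta> powi (k * a + int l * b) = (\<eta> powi k) powi a * (\<eta> powi int l) powi b"
      unfolding power_int_mult[symmetric] using \<eta>0 by (simp add: power_int_add)
    moreover have "k * a + int l * b = 1" using ab by (simp add: mult.commute)
    ultimately show ?thesis by simp
  qed
  hence "mu l \<subseteq> {1 :: 'a}" by auto
  hence "card (mu l :: 'a set) \<le> 1" using card_mono[of "{1 :: 'a}" "mu l"] by simp
  thus False using mu_proots(2)[OF l_pos, where ?'a = 'a] prime_gt_1_nat[OF l_prime] by simp
qed

lemma ram_index_eq:
  assumes Q: "pt p c \<inter> E.F \<in> points E.F" and c: "c \<in> mu N"
  obtains t where "t \<in> E.F" "t \<noteq> 0" "t = (SOME t. uniformizer (pt p c \<inter> E.F) t)"
    "ram_index E.F (pt p c) = vord p c t"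
proof -
  define t where "t = (SOME t. uniformizer (pt p c \<inter> E.F) t)"
  have "uniformizer (pt p c \<inter> E.F) t"
    unfolding t_def by (rule someI_ex[OF E.point_uniformizer(1)[OF Q]])
  hence t: "t \<in> E.F" "t \<noteq> 0" using E.point_uniformizer(2)[OF Q] by simp_all
  moreover have "ram_index E.F (pt p c) = vord p c t"
    unfolding ram_index_def t_def[symmetric] using pt_valuation[OF c E_in_F[OF t(1)] t(2)] .
  ultimately show ?thesis using that t_def by simp
qed

text \<open>The divisor of g is invariant under y \<mapsto> b y. Hence every h_i y^i / g is regular
  everywhere and so constant, and a single nonzero h_i gives one exponent i for all \<xi>. The
  orders of h_i and the pullback contribute multiples of l wherever l divides the ramification
  index.\<close>

theorem kernel:
  fixes B D :: "'a divisor"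
  assumes g: "g \<in> F" "g \<noteq> 0" and B: "\<And>P. B P \<noteq> 0 \<Longrightarrow> P \<in> points E.F"
    and D: "\<And>p c. c \<in> mu N \<Longrightarrow> D (pt p c) = D (pt p 1)"
    and div: "\<And>p c. c \<in> mu N \<Longrightarrow> vord p c g = D (pt p c) + ram_index E.F (pt p c) * B (pt p c \<inter> E.F)"
  shows "\<exists>i. \<forall>\<xi>. l dvd ee (Some \<xi>) \<longrightarrow> int l dvd D (pt (Some \<xi>) 1) - i * mm (Some \<xi>)"
proof -
  have ord: "vord p (c * b) g = vord p c g" if c: "c \<in> mu N" and b: "b \<in> mu l" for p c b
  proof -
    have cb: "c * b \<in> mu N" using mu_mult[OF c mu_l[OF b]] .
    have "ram_index E.F (pt p (c * b)) * B (pt p c \<inter> E.F) = ram_index E.F (pt p c) * B (pt p c \<inter> E.F)"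
    \<comment> \<open>Either the term vanishes, or the support of \<open>B\<close> shows that the
      restricted ring is a point of the lower curve. The choice made by \<open>SOME\<close> in
      \<open>ram_index\<close> depends only on that ring, which c and \<open>c * b\<close>
      share.\<close>
    proof (cases "B (pt p c \<inter> E.F) = 0")
      case False
      hence Q: "pt p c \<inter> E.F \<in> points E.F" by (rule B)
      obtain t where t: "t \<in> E.F" "t = (SOME t. uniformizer (pt p c \<inter> E.F) t)"
          "ram_index E.F (pt p c) = vord p c t"
        using ram_index_eq[OF Q c] by metis
      obtain t' where t': "t' = (SOME t. uniformizer (pt p c \<inter> E.F) t)"
          "ram_index E.F (pt p (c * b)) = vord p (c * b) t'"
        using ram_index_eq[OF _ cb, of p, unfolded pt_E[OF c b]] Q by metis
      have "vord p (c * b) t = vord p c t" unfolding vord_def emb_E[OF c b t(1)] ..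
      thus ?thesis using t t' by simp
    qed simp
    thus ?thesis
      using div[OF c, of p] div[OF cb, of p] D[OF c, of p] D[OF cb, of p] pt_E[OF c b, of p] by simp
  qed
  obtain h where h: "\<And>i. i < l \<Longrightarrow> h i \<in> E.F" "g = (\<Sum>i<l. h i * y ^ i)"
    using F_decompose[OF g(1)] by blast
  have "\<exists>i<l. h i \<noteq> 0"
  proof (rule ccontr)
    assume "\<not> (\<exists>i<l. h i \<noteq> 0)"
    hence "g = 0" unfolding h(2) by (intro sum.neutral) simp
    thus False using g(2) by simp
  qed
  then obtain i where i: "i < l" "h i \<noteq> 0" by blast
  \<comment> \<open>Only regularity is known from the averaging; that there are no nonconstant
    regular functions upgrades it to an equality up to a constant.\<close>
  have "h i * y ^ i / g \<in> range fn_const"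
    by (rule regular_constant) (rule decompose_term_in_pt[OF _ h g(2) ord i(1)])
  then obtain d where d: "h i * y ^ i / g = fn_const d" by blast
  have hF: "h i \<in> F" using E_in_F[OF h(1)[OF i(1)]] .
  have vg: "vord p 1 g = vord p 1 (h i) + int i * mm p" for p
  proof -
    have "0 = vord p 1 (h i * y ^ i / g)" unfolding d by (simp add: vord_const)
    also have "\<dots> = vord p 1 (h i) + int i * mm p - vord p 1 g"
      using hF g i(2) y_nonzero by (simp add: vord_divide vord_mult vord_power vord_y)
    finally show ?thesis by simp
  qed
  have "int l dvd D (pt (Some \<xi>) 1) - int i * mm (Some \<xi>)" if e: "l dvd ee (Some \<xi>)" for \<xi>
  proof -
    define p where "p = Some \<xi>"
    have "int l dvd ram_index E.F (pt p 1) * B (pt p 1 \<inter> E.F)"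
    proof (cases "B (pt p 1 \<inter> E.F) = 0")
      case False
      obtain t where t: "t \<in> E.F" "t \<noteq> 0" "ram_index E.F (pt p 1) = vord p 1 t"
        using ram_index_eq[OF B[OF False] one_mu] by metis
      thus ?thesis using l_dvd_vord[of p t] e by (simp add: p_def)
    qed simp
    moreover have "int l dvd vord p 1 (h i)" using l_dvd_vord[of p] e h(1)[OF i(1)] i(2) by (simp add: p_def)
    moreover have "D (pt p 1) - int i * mm p = vord p 1 (h i) - ram_index E.F (pt p 1) * B (pt p 1 \<inter> E.F)"
      using vg[of p] div[OF one_mu, of p] by simp
    ultimately show ?thesis unfolding p_def[symmetric] by simp
  qed
  thus ?thesis by blast
qed

end

section \<open>Galois action on divisors\<close>

text \<open>What a Galois element has to satisfy in order to act on the function field by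
  coefficients; k occurs only through f. The same f serves both levels of a step.\<close>

definition coeff_aut :: "'a::field poly \<Rightarrow> ('a \<Rightarrow> 'a) \<Rightarrow> bool" where
  "coeff_aut f \<sigma> \<longleftrightarrow> fld_emb \<sigma> \<and> bij \<sigma> \<and> map_poly \<sigma> f = f"

lemma coeff_aut_inv:
  assumes "coeff_aut f \<sigma>"
  shows "coeff_aut f (inv_into UNIV \<sigma>)"
proof -
  interpret fld_emb \<sigma> using assms by (simp add: coeff_aut_def)
  have b: "bij \<sigma>" using assms by (simp add: coeff_aut_def)
  have s: "\<sigma> (inv_into UNIV \<sigma> z) = z" for z using b by (simp add: bij_is_surj surj_f_inv_f)
  have eqI: "inv_into UNIV \<sigma> a = c" if "a = \<sigma> c" for a c using b that by (simp add: bij_is_inj)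
  have "fld_emb (inv_into UNIV \<sigma>)"
    unfolding fld_emb_def by (intro fld_homI subfld_UNIV eqI) (simp_all add: emb_simps s)
  moreover have "map_poly (inv_into UNIV \<sigma>) f = f"
  proof (rule poly_eqI)
    fix i
    have "coeff f i = \<sigma> (coeff f i)"
      using assms coeff_map_poly[of \<sigma> f i] by (simp add: coeff_aut_def)
    hence "inv_into UNIV \<sigma> (coeff f i) = coeff f i" by (rule eqI)
    moreover have "inv_into UNIV \<sigma> 0 = 0" by (rule eqI) simp
    ultimately show "coeff (map_poly (inv_into UNIV \<sigma>) f) i = coeff f i"
      by (simp add: coeff_map_poly)
  qed
  ultimately show ?thesis using b by (simp add: coeff_aut_def bij_imp_bij_inv)
qed

context kummer
begin

abbreviation aut :: "('a \<Rightarrow> 'a) \<Rightarrow> 'a fn \<Rightarrow> 'a fn" where "aut \<equiv> fn_aut y"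

text \<open>Since \<sigma> fixes the coefficients of f, \<open>y\<close> is an N-th root of the
  transported f and \<open>hom_extend\<close> applies. This gives content to the \<open>SOME\<close>
  in \<open>fn_aut\<close>.\<close>

lemma fn_aut_exists:
  assumes \<sigma>: "coeff_aut f \<sigma>"
  shows "\<exists>\<phi>. fld_hom F \<phi> \<and> \<phi> ` F = F \<and> (\<forall>c. \<phi> (fn_const c) = fn_const (\<sigma> c)) \<and> \<phi> fn_x = fn_x \<and> \<phi> y = y"
proof -
  interpret S: fld_emb \<sigma> using \<sigma> by (simp add: coeff_aut_def)
  have bij: "bij \<sigma>" using \<sigma> by (simp add: coeff_aut_def)
  have "fld_emb (\<lambda>c. fn_const (\<sigma> c))"
    unfolding fld_emb_def using fld_hom_comp[OF S.fld_hom_axioms fn_const.fld_hom_axioms] by simp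
  then interpret C: fld_emb "\<lambda>c. fn_const (\<sigma> c)" .
  define h where "h = heval (\<lambda>c. fn_const (\<sigma> c)) fn_x"
  have h_eq: "h a = fn_of_poly (map_poly \<sigma> a)" for a
  proof -
    have "map_poly (\<lambda>c. fn_const (\<sigma> c)) a = map_poly fn_const (map_poly \<sigma> a)"
      by (rule poly_eqI) (simp add: coeff_map_poly)
    thus ?thesis unfolding h_def fn_of_poly_eq_heval heval_def by simp
  qed
  have "a = 0" if "h a = 0" for a
    using that unfolding h_eq by (simp add: map_poly_eq_0_iff)
  moreover have "y ^ N = h f" using \<sigma> by (simp add: h_eq y_power coeff_aut_def)
  ultimately obtain \<phi> where \<phi>: "fld_hom F \<phi>" "\<And>a. \<phi> (fn_of_poly a) = h a" "\<phi> y = y"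
    using hom_extend[of h y] by (auto simp: h_def C.heval_add C.heval_mult)
  interpret \<phi>: fld_hom F \<phi> by fact
  have const: "\<phi> (fn_const c) = fn_const (\<sigma> c)" for c
    unfolding fn_const_def \<phi>(2) h_eq by (simp add: map_poly_pCons)
  have x: "\<phi> fn_x = fn_x"
    unfolding fn_x_def \<phi>(2) h_eq by (simp add: map_poly_pCons)
  have "F \<subseteq> {z\<in>F. \<phi> z \<in> F}"
    unfolding fn_field_def
    by (rule generate_field_minimal[OF \<phi>.subfld_vimage[OF F.subfld_axioms, unfolded fn_field_def]])
       (auto simp: const x \<phi>(3) intro: generate_field.incl)
  moreover have "F \<subseteq> \<phi> ` F"
  proof -
    have "fn_const c \<in> \<phi> ` F" for c
    proof (rule image_eqI)
      show "fn_const c = \<phi> (fn_const (inv_into UNIV \<sigma> c))"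
        unfolding const using bij by (simp add: bij_is_surj surj_f_inv_f)
    qed simp
    moreover have "fn_x \<in> \<phi> ` F" "y \<in> \<phi> ` F"
      using imageI[of fn_x F \<phi>] imageI[of y F \<phi>] by (simp_all add: x \<phi>(3))
    ultimately show ?thesis
      unfolding fn_field_def[of y]
      by (intro generate_field_minimal[OF \<phi>.subfld_image[OF F.subfld_axioms, unfolded fn_field_def]])
         (auto simp: fn_field_def)
  qed
  ultimately have "\<phi> ` F = F" by auto
  thus ?thesis using \<phi> const x by blast
qed

lemma fn_aut:
  assumes "coeff_aut f \<sigma>"
  shows "fld_hom F (aut \<sigma>)" "aut \<sigma> ` F = F" "aut \<sigma> (fn_const c) = fn_const (\<sigma> c)" "aut \<sigma> fn_x = fn_x" "aut \<sigma> y = y"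
proof -
  have "\<exists>\<phi>. \<phi> \<in> ring_iso (type_ring\<lparr>carrier := F\<rparr>) (type_ring\<lparr>carrier := F\<rparr>) \<and>
      (\<forall>c. \<phi> (fn_const c) = fn_const (\<sigma> c)) \<and> \<phi> fn_x = fn_x \<and> \<phi> y = y"
    using fn_aut_exists[OF assms] unfolding ring_iso_type_ring_iff[OF F.subfld_axioms F.subfld_axioms] by blast
  from someI_ex[OF this, folded fn_aut_def]
  show "fld_hom F (aut \<sigma>)" "aut \<sigma> ` F = F" "aut \<sigma> (fn_const c) = fn_const (\<sigma> c)"
      "aut \<sigma> fn_x = fn_x" "aut \<sigma> y = y"
    unfolding ring_iso_type_ring_iff[OF F.subfld_axioms F.subfld_axioms] by blast+
qed

abbreviation iaut :: "('a \<Rightarrow> 'a) \<Rightarrow> 'a fn \<Rightarrow> 'a fn" where "iaut \<sigma> \<equiv> fn_aut y (inv_into UNIV \<sigma>)"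

lemmas fn_iaut = fn_aut[OF coeff_aut_inv]

lemma aut_in_F: "coeff_aut f \<sigma> \<Longrightarrow> z \<in> F \<Longrightarrow> aut \<sigma> z \<in> F"
  using fn_aut(2)[of \<sigma>] by blast

lemma iaut_aut:
  assumes \<sigma>: "coeff_aut f \<sigma>" and z: "z \<in> F"
  shows "iaut \<sigma> (aut \<sigma> z) = z" "aut \<sigma> (iaut \<sigma> z) = z"
proof -
  have b: "bij \<sigma>" using \<sigma> by (simp add: coeff_aut_def)
  have id: "fld_hom F (\<lambda>z. z)" by (intro fld_homI F.subfld_axioms) auto
  note comp = fld_hom_comp[OF fn_aut(1)[OF \<sigma>] fn_iaut(1)[OF \<sigma>]] fld_hom_comp[OF fn_iaut(1)[OF \<sigma>] fn_aut(1)[OF \<sigma>]]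
  show "iaut \<sigma> (aut \<sigma> z) = z"
    using b by (intro hom_unique[OF comp(1) id _ _ _ z])
      (simp_all add: fn_aut[OF \<sigma>] fn_iaut[OF \<sigma>] bij_is_inj)
  show "aut \<sigma> (iaut \<sigma> z) = z"
    using b by (intro hom_unique[OF comp(2) id _ _ _ z])
      (simp_all add: fn_aut[OF \<sigma>] fn_iaut[OF \<sigma>] bij_is_surj surj_f_inv_f)
qed

lemma iaut_aut_image:
  assumes "coeff_aut f \<sigma>" "Q \<subseteq> F"
  shows "iaut \<sigma> ` aut \<sigma> ` Q = Q" "aut \<sigma> ` iaut \<sigma> ` Q = Q"
proof -
  have "z \<in> Q \<Longrightarrow> z \<in> F" for z using assms(2) by (rule subsetD)
  thus "iaut \<sigma> ` aut \<sigma> ` Q = Q" "aut \<sigma> ` iaut \<sigma> ` Q = Q"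
    by (simp_all add: image_image iaut_aut[OF assms(1)])
qed

lemma points_subset: "Q \<in> points F \<Longrightarrow> Q \<subseteq> F"
  by (simp add: points_def psubset_imp_subset)

lemma aut_points:
  assumes \<sigma>: "coeff_aut f \<sigma>" and Q: "Q \<in> points F"
  shows "aut \<sigma> ` Q \<in> points F"
proof -
  interpret A: fld_hom F "aut \<sigma>" using fn_aut(1)[OF \<sigma>] .
  have sub: "Q \<subseteq> F" using points_subset[OF Q] .
  have "val_ring F (aut \<sigma> ` Q)"
    using A.val_ring_image[OF points_facts(1)[OF Q]] fn_aut(2)[OF \<sigma>] by simp
  moreover have "range fn_const = aut \<sigma> ` range fn_const"
    unfolding image_image fn_aut(3)[OF \<sigma>]
    using \<sigma> by (simp add: coeff_aut_def bij_is_surj flip: image_image[of fn_const \<sigma>])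
  moreover have "aut \<sigma> ` range fn_const \<subset> aut \<sigma> ` Q" "aut \<sigma> ` Q \<subset> aut \<sigma> ` F"
    using Q sub A.hom_inj by (intro image_strict_mono; auto simp: points_def intro: inj_on_subset)+
  ultimately show ?thesis
    using val_ring.val_ring[of F "aut \<sigma> ` Q"] fn_aut(2)[OF \<sigma>] by (simp add: points_def)
qed

definition supported :: "'a divisor \<Rightarrow> bool" where
  "supported D \<longleftrightarrow> (\<forall>P. D P \<noteq> 0 \<longrightarrow> P \<in> points F)"

text \<open>On points the automorphism is bijective, so the sum in \<open>div_act\<close> has at
  most one term and becomes composition with the inverse. Support on points is needed because
  \<open>fn_aut\<close> is arbitrary outside \<open>F\<close>.\<close>

lemma div_act_eq:
  assumes \<sigma>: "coeff_aut f \<sigma>" and D: "supported D"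
  shows "div_act y \<sigma> D = (\<lambda>Q. if Q \<in> points F then D (iaut \<sigma> ` Q) else 0)"
proof
  fix Q
  show "div_act y \<sigma> D Q = (if Q \<in> points F then D (iaut \<sigma> ` Q) else 0)"
  proof (cases "Q \<in> points F")
    case True
    have eq: "{P. D P \<noteq> 0 \<and> aut \<sigma> ` P = Q} = {P. D P \<noteq> 0 \<and> P = iaut \<sigma> ` Q}"
    proof -
      have "aut \<sigma> ` P = Q \<longleftrightarrow> P = iaut \<sigma> ` Q" if "D P \<noteq> 0" for P
      proof -
        have "P \<subseteq> F" using D that points_subset by (simp add: supported_def)
        show ?thesis
        proof
          assume "aut \<sigma> ` P = Q"
          thus "P = iaut \<sigma> ` Q" using iaut_aut_image(1)[OF \<sigma> \<open>P \<subseteq> F\<close>] by simp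
        next
          assume "P = iaut \<sigma> ` Q"
          thus "aut \<sigma> ` P = Q" using iaut_aut_image(2)[OF \<sigma> points_subset[OF True]] by simp
        qed
      qed
      thus ?thesis by blast
    qed
    have "div_act y \<sigma> D Q = sum D {P. D P \<noteq> 0 \<and> P = iaut \<sigma> ` Q}"
      unfolding div_act_def by (simp only: eq)
    also have "\<dots> = D (iaut \<sigma> ` Q)"
    proof (cases "D (iaut \<sigma> ` Q) = 0")
      case False
      hence "{P. D P \<noteq> 0 \<and> P = iaut \<sigma> ` Q} = {iaut \<sigma> ` Q}" by blast
      thus ?thesis by simp
    next
      case True
      hence "{P. D P \<noteq> 0 \<and> P = iaut \<sigma> ` Q} = {}" by blast
      thus ?thesis using True by simp
    qed
    finally show ?thesis using True by simp
  next
    case False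
    have "aut \<sigma> ` P \<noteq> Q" if "D P \<noteq> 0" for P
      using aut_points[OF \<sigma>, of P] D that False by (auto simp: supported_def)
    hence "{P. D P \<noteq> 0 \<and> aut \<sigma> ` P = Q} = {}" by blast
    hence "div_act y \<sigma> D Q = 0" unfolding div_act_def by (simp only: sum.empty)
    thus ?thesis using False by simp
  qed
qed

lemma supported_div_act: "coeff_aut f \<sigma> \<Longrightarrow> supported D \<Longrightarrow> supported (div_act y \<sigma> D)"
  by (simp add: div_act_eq supported_def)

lemma supported_add: "supported D \<Longrightarrow> supported D' \<Longrightarrow> supported (\<lambda>Q. D Q + D' Q)"
  unfolding supported_def
proof (intro allI impI)
  fix P
  assume "\<forall>P. D P \<noteq> 0 \<longrightarrow> P \<in> points F" "\<forall>P. D' P \<noteq> 0 \<longrightarrow> P \<in> points F" "D P + D' P \<noteq> 0"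
  thus "P \<in> points F" by (cases "D P = 0") simp_all
qed

lemma div_act_add:
  assumes "coeff_aut f \<sigma>" "supported D" "supported D'"
  shows "div_act y \<sigma> (\<lambda>Q. D Q + D' Q) = (\<lambda>Q. div_act y \<sigma> D Q + div_act y \<sigma> D' Q)"
  by (auto simp: div_act_eq assms supported_add)

lemma supported_principal: "supported (principal_div F z)"
  by (simp add: supported_def principal_div_def)

lemma supported_fibre: "supported (fibre_div F \<xi>)"
  by (simp add: supported_def fibre_div_def)

lemma valuation_aut:
  assumes \<sigma>: "coeff_aut f \<sigma>" and Q: "Q \<in> points F" and z: "z \<in> F"
  shows "valuation (iaut \<sigma> ` Q) z = valuation Q (aut \<sigma> z)"
proof -
  interpret A: fld_hom F "aut \<sigma>" using fn_aut(1)[OF \<sigma>] .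
  have "iaut \<sigma> ` Q \<subseteq> F" using points_subset[OF aut_points[OF coeff_aut_inv[OF \<sigma>] Q]] .
  from A.valuation_image[OF this z] show ?thesis
    using iaut_aut_image(2)[OF \<sigma> points_subset[OF Q]] by simp
qed

lemma div_act_principal:
  assumes "coeff_aut f \<sigma>" "z \<in> F"
  shows "div_act y \<sigma> (principal_div F z) = principal_div F (aut \<sigma> z)"
proof
  fix Q
  show "div_act y \<sigma> (principal_div F z) Q = principal_div F (aut \<sigma> z) Q"
    unfolding div_act_eq[OF assms(1) supported_principal] unfolding principal_div_def
    using valuation_aut[OF assms(1) _ assms(2), of Q] aut_points[OF coeff_aut_inv[OF assms(1)], of Q] by simp
qed

lemma div_act_principal_image:
  assumes \<sigma>: "coeff_aut f \<sigma>"
  shows "div_act y \<sigma> ` principal_div F ` (F - {0}) = principal_div F ` (F - {0})"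
proof -
  interpret A: fld_hom F "aut \<sigma>" using fn_aut(1)[OF \<sigma>] .
  have "aut \<sigma> ` (F - {0}) = F - {0}"
  proof -
    have "aut \<sigma> ` (F - {0}) = aut \<sigma> ` F - aut \<sigma> ` {0}"
      by (rule inj_on_image_set_diff[OF A.hom_inj]) simp_all
    thus ?thesis using fn_aut(2)[OF \<sigma>] by simp
  qed
  moreover have "div_act y \<sigma> ` principal_div F ` (F - {0}) = principal_div F ` aut \<sigma> ` (F - {0})"
    unfolding image_image using div_act_principal[OF \<sigma>] by (intro image_cong) simp_all
  ultimately show ?thesis by simp
qed

lemma fibre_div_iff:
  assumes "Q \<in> points F"
  shows "fibre_div F \<xi> Q = (if uniformizer_at (Some \<xi>) \<in> max_ideal Q then 1 else 0)"
  using Int_rational_eq_line_point_iff[OF points_facts(1,2)[OF assms] rational_subset_F, of \<xi>] assms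
  by (simp add: fibre_div_def)

text \<open>The automorphism fixes x and acts by \<sigma> on constants, so it carries x - \<xi> to x
  - \<sigma>(\<xi>).\<close>

lemma div_act_fibre:
  assumes \<sigma>: "coeff_aut f \<sigma>"
  shows "div_act y \<sigma> (fibre_div F \<xi>) = fibre_div F (\<sigma> \<xi>)"
proof
  fix Q
  interpret A: fld_hom F "aut \<sigma>" using fn_aut(1)[OF \<sigma>] .
  show "div_act y \<sigma> (fibre_div F \<xi>) Q = fibre_div F (\<sigma> \<xi>) Q"
  proof (cases "Q \<in> points F")
    case True
    define Q' where "Q' = iaut \<sigma> ` Q"
    have Q': "Q' \<in> points F" unfolding Q'_def by (rule aut_points[OF coeff_aut_inv[OF \<sigma>] True])
    have QQ': "Q = aut \<sigma> ` Q'" unfolding Q'_def using iaut_aut_image(2)[OF \<sigma> points_subset[OF True]] by simp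
    have "aut \<sigma> (uniformizer_at (Some \<xi>)) = uniformizer_at (Some (\<sigma> \<xi>))"
      by (simp add: uniformizer_at_def A.hom_diff fn_aut[OF \<sigma>])
    moreover have "max_ideal Q' \<subseteq> F" using points_subset[OF Q'] by (auto simp: max_ideal_def)
    hence "aut \<sigma> (uniformizer_at (Some \<xi>)) \<in> aut \<sigma> ` max_ideal Q' \<longleftrightarrow> uniformizer_at (Some \<xi>) \<in> max_ideal Q'"
      by (rule A.inv_image_iff) simp
    ultimately have "uniformizer_at (Some (\<sigma> \<xi>)) \<in> max_ideal Q \<longleftrightarrow> uniformizer_at (Some \<xi>) \<in> max_ideal Q'"
      unfolding QQ' A.max_ideal_image[OF points_subset[OF Q']] by simp
    thus ?thesis
      by (simp add: div_act_eq[OF \<sigma> supported_fibre] True fibre_div_iff[OF True] fibre_div_iff[OF Q'] flip: Q'_def)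
  next
    case False
    thus ?thesis unfolding div_act_eq[OF \<sigma> supported_fibre] by (simp add: fibre_div_def)
  qed
qed

lemma Div_carrier_iff: "D \<in> carrier (Div F) \<longleftrightarrow> finite {P. D P \<noteq> 0} \<and> supported D"
  by (auto simp: Div_def supported_def)

lemma Div0_carrier_iff: "D \<in> carrier (Div0 F) \<longleftrightarrow> finite {P. D P \<noteq> 0} \<and> supported D \<and> div_deg D = 0"
  by (auto simp: Div0_def Div_carrier_iff)

lemma div_act_Div0:
  assumes \<sigma>: "coeff_aut f \<sigma>" and D: "D \<in> carrier (Div0 F)"
  shows "div_act y \<sigma> D \<in> carrier (Div0 F)"
proof -
  have s: "supported D" "finite {P. D P \<noteq> 0}" "div_deg D = 0" using D by (simp_all add: Div0_carrier_iff)
  have P: "P \<subseteq> F" if "D P \<noteq> 0" for P using s(1) that points_subset by (simp add: supported_def)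
  have supp: "{Q. div_act y \<sigma> D Q \<noteq> 0} = (\<lambda>P. aut \<sigma> ` P) ` {P. D P \<noteq> 0}"
  proof (intro equalityI subsetI)
    fix Q assume "Q \<in> {Q. div_act y \<sigma> D Q \<noteq> 0}"
    hence "Q \<in> points F" "D (iaut \<sigma> ` Q) \<noteq> 0" by (simp_all add: div_act_eq[OF \<sigma> s(1)] split: if_splits)
    thus "Q \<in> (\<lambda>P. aut \<sigma> ` P) ` {P. D P \<noteq> 0}"
      using iaut_aut_image(2)[OF \<sigma> points_subset] by (intro image_eqI[of _ _ "iaut \<sigma> ` Q"]) simp_all
  next
    fix Q assume "Q \<in> (\<lambda>P. aut \<sigma> ` P) ` {P. D P \<noteq> 0}"
    then obtain R where R: "D R \<noteq> 0" "Q = aut \<sigma> ` R" by blast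
    have "Q \<in> points F" unfolding R(2) using aut_points[OF \<sigma>] s(1) R(1) by (simp add: supported_def)
    thus "Q \<in> {Q. div_act y \<sigma> D Q \<noteq> 0}"
      using iaut_aut_image(1)[OF \<sigma> P[OF R(1)]] R by (simp add: div_act_eq[OF \<sigma> s(1)])
  qed
  have inj: "inj_on (\<lambda>P. aut \<sigma> ` P) {P. D P \<noteq> 0}"
  proof (rule inj_onI)
    fix R R' assume *: "R \<in> {P. D P \<noteq> 0}" "R' \<in> {P. D P \<noteq> 0}" "aut \<sigma> ` R = aut \<sigma> ` R'"
    have "R = iaut \<sigma> ` aut \<sigma> ` R" using iaut_aut_image(1)[OF \<sigma> P] *(1) by simp
    also have "\<dots> = iaut \<sigma> ` aut \<sigma> ` R'" by (simp only: *(3))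
    also have "\<dots> = R'" using iaut_aut_image(1)[OF \<sigma> P] *(2) by simp
    finally show "R = R'" .
  qed
  have "div_deg (div_act y \<sigma> D) = (\<Sum>R | D R \<noteq> 0. div_act y \<sigma> D (aut \<sigma> ` R))"
    unfolding div_deg_def supp by (rule sum.reindex[OF inj, unfolded o_def])
  also have "\<dots> = div_deg D"
    unfolding div_deg_def
    using iaut_aut_image(1)[OF \<sigma> P] aut_points[OF \<sigma>] s(1)
    by (intro sum.cong refl) (simp add: div_act_eq[OF \<sigma> s(1)] supported_def)
  finally show ?thesis
    unfolding Div0_carrier_iff using supp s supported_div_act[OF \<sigma> s(1)] by simp
qed

lemma div_act_inv:
  assumes \<sigma>: "coeff_aut f \<sigma>" and D: "supported D"
  shows "div_act y \<sigma> (div_act y (inv_into UNIV \<sigma>) D) = D"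
proof
  fix Q
  have ii: "inv_into UNIV (inv_into UNIV \<sigma>) = \<sigma>" using \<sigma> by (simp add: coeff_aut_def inv_inv_eq)
  note i = coeff_aut_inv[OF \<sigma>]
  show "div_act y \<sigma> (div_act y (inv_into UNIV \<sigma>) D) Q = D Q"
    unfolding div_act_eq[OF \<sigma> supported_div_act[OF i D]] unfolding div_act_eq[OF i D] ii
    using aut_points[OF i, of Q] iaut_aut_image(2)[OF \<sigma> points_subset, of Q] D
    by (auto simp: supported_def)
qed

end

section \<open>Pullbacks and classes modulo the lower Jacobian\<close>

context kummer_step
begin

lemma aut_E:
  assumes \<sigma>: "coeff_aut f \<sigma>" and z: "z \<in> E.F"
  shows "aut \<sigma> z = E.aut \<sigma> z"
proof -
  interpret A: fld_hom F "aut \<sigma>" using fn_aut(1)[OF \<sigma>] .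
  show ?thesis
    by (rule E.hom_unique[OF fld_hom_subset[OF A.fld_hom_axioms E.F.subfld_axioms E_subset] E.fn_aut(1)[OF \<sigma>] _ _ _ z])
       (simp_all add: fn_aut[OF \<sigma>] E.fn_aut[OF \<sigma>] A.hom_power)
qed

lemma aut_Int_E:
  assumes \<sigma>: "coeff_aut f \<sigma>" and Q: "Q \<subseteq> F"
  shows "aut \<sigma> ` Q \<inter> E.F = E.aut \<sigma> ` (Q \<inter> E.F)"
proof (intro equalityI subsetI)
  fix z assume z: "z \<in> aut \<sigma> ` Q \<inter> E.F"
  then obtain q where q: "q \<in> Q" "z = aut \<sigma> q" by blast
  have "z \<in> E.aut \<sigma> ` E.F" using z E.fn_aut(2)[OF \<sigma>] by simp
  then obtain e where e: "e \<in> E.F" "z = E.aut \<sigma> e" by blast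
  have "aut \<sigma> e = aut \<sigma> q" using q e aut_E[OF \<sigma> e(1)] by simp
  hence "e = q"
    using fld_hom.hom_inj[OF fn_aut(1)[OF \<sigma>]] E_in_F[OF e(1)] subsetD[OF Q q(1)] by (simp add: inj_on_eq_iff)
  hence "e \<in> Q \<inter> E.F" using q(1) e(1) by simp
  with e(2) show "z \<in> E.aut \<sigma> ` (Q \<inter> E.F)" by (rule image_eqI)
next
  fix z assume "z \<in> E.aut \<sigma> ` (Q \<inter> E.F)"
  then obtain e where e: "e \<in> Q" "e \<in> E.F" "z = E.aut \<sigma> e" by blast
  hence "z = aut \<sigma> e" using aut_E[OF \<sigma>] by simp
  moreover have "z \<in> E.F" unfolding e(3) using E.aut_in_F[OF \<sigma> e(2)] .
  ultimately show "z \<in> aut \<sigma> ` Q \<inter> E.F" using e(1) by simp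
qed

lemma val_ring_Int_E: "Q \<in> points F \<Longrightarrow> val_ring E.F (Q \<inter> E.F)"
  by (rule val_ring_Int[OF points_facts(1) E.F.subfld_axioms E_subset])

text \<open>The uniformizer chosen below the image of \<open>Q\<close> need not be the image of the
  one chosen below \<open>Q\<close>; \<open>valuation_cong\<close> makes the choice
  irrelevant.\<close>

lemma ram_index_aut:
  assumes \<sigma>: "coeff_aut f \<sigma>" and Q: "Q \<in> points F" and QE: "Q \<inter> E.F \<in> points E.F"
  shows "ram_index E.F (aut \<sigma> ` Q) = ram_index E.F Q"
proof -
  interpret A: fld_hom F "aut \<sigma>" using fn_aut(1)[OF \<sigma>] .
  interpret AE: fld_hom E.F "E.aut \<sigma>" using E.fn_aut(1)[OF \<sigma>] .
  have sub: "Q \<subseteq> F" using points_subset[OF Q] .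
  have AQ: "aut \<sigma> ` Q \<in> points F" using aut_points[OF \<sigma> Q] .
  interpret V: val_ring F "aut \<sigma> ` Q" using points_facts(1)[OF AQ] .
  define t where "t = (SOME t. uniformizer (Q \<inter> E.F) t)"
  define t' where "t' = (SOME t. uniformizer (aut \<sigma> ` Q \<inter> E.F) t)"
  have t: "uniformizer (Q \<inter> E.F) t"
    unfolding t_def by (rule someI_ex[OF E.point_uniformizer(1)[OF QE]])
  hence tE: "t \<in> E.F" using E.point_uniformizer(2)[OF QE] by simp
  have int: "aut \<sigma> ` Q \<inter> E.F = E.aut \<sigma> ` (Q \<inter> E.F)" using aut_Int_E[OF \<sigma> sub] .
  have t': "uniformizer (aut \<sigma> ` Q \<inter> E.F) t'"
    unfolding t'_def
  proof (rule someI_ex)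
    show "\<exists>t. uniformizer (aut \<sigma> ` Q \<inter> E.F) t"
      using AE.uniformizer_image_iff[of "Q \<inter> E.F" t] tE t unfolding int by blast
  qed
  have at: "uniformizer (aut \<sigma> ` Q \<inter> E.F) (aut \<sigma> t)"
    using AE.uniformizer_image_iff[of "Q \<inter> E.F" t] tE t unfolding int aut_E[OF \<sigma> tE] by simp
  have "valuation (aut \<sigma> ` Q) t' = valuation (aut \<sigma> ` Q) (aut \<sigma> t)"
    by (rule V.valuation_cong[OF t' at val_ring_Int_E[OF AQ]]) simp
  also have "\<dots> = valuation Q t" using A.valuation_image[OF sub E_in_F[OF tE]] .
  finally show ?thesis unfolding ram_index_def t_def t'_def .
qed

lemma supported_pullback: "supported (div_pullback E.F F B)"
  by (simp add: supported_def div_pullback_def)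

lemma div_act_pullback:
  assumes \<sigma>: "coeff_aut f \<sigma>" and B: "E.supported B"
  shows "div_act y \<sigma> (div_pullback E.F F B) = div_pullback E.F F (div_act (y ^ l) \<sigma> B)"
proof
  fix Q
  show "div_act y \<sigma> (div_pullback E.F F B) Q = div_pullback E.F F (div_act (y ^ l) \<sigma> B) Q"
  proof (cases "Q \<in> points F")
    case True
    note i = coeff_aut_inv[OF \<sigma>]
    define Q' where "Q' = iaut \<sigma> ` Q"
    have Q': "Q' \<in> points F" unfolding Q'_def by (rule aut_points[OF i True])
    have int: "Q' \<inter> E.F = E.iaut \<sigma> ` (Q \<inter> E.F)"
      unfolding Q'_def by (rule aut_Int_E[OF i points_subset[OF True]])
    have L: "div_act y \<sigma> (div_pullback E.F F B) Q = ram_index E.F Q' * B (Q' \<inter> E.F)"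
      unfolding div_act_eq[OF \<sigma> supported_pullback] Q'_def[symmetric] using True Q' by (simp add: div_pullback_def)
    have R: "div_pullback E.F F (div_act (y ^ l) \<sigma> B) Q =
        ram_index E.F Q * (if Q \<inter> E.F \<in> points E.F then B (Q' \<inter> E.F) else 0)"
      unfolding E.div_act_eq[OF \<sigma> B] int using True by (simp add: div_pullback_def)
    show ?thesis
    proof (cases "Q \<inter> E.F \<in> points E.F")
      case QE: True
      have "ram_index E.F Q' = ram_index E.F Q"
        unfolding Q'_def by (rule ram_index_aut[OF i True QE])
      thus ?thesis using L R QE by simp
    next
      case False
      have "Q' \<inter> E.F \<notin> points E.F"
      proof
        assume "Q' \<inter> E.F \<in> points E.F"
        from E.aut_points[OF \<sigma> this] have "E.aut \<sigma> ` E.iaut \<sigma> ` (Q \<inter> E.F) \<in> points E.F" unfolding int .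
        thus False using False E.iaut_aut_image(2)[OF \<sigma>, of "Q \<inter> E.F"] by simp
      qed
      hence "B (Q' \<inter> E.F) = 0" using B by (auto simp: E.supported_def)
      thus ?thesis using L R by simp
    qed
  next
    case False
    thus ?thesis unfolding div_act_eq[OF \<sigma> supported_pullback] by (simp add: div_pullback_def)
  qed
qed

definition PD :: "'a divisor set" where "PD = principal_div F ` (F - {0})"

text \<open>The divisors representing the sum of the class of the pullback of \<open>B\<close> and
  the class of \<open>D\<close>. There are two principal summands because the product of two classes
  adds a representative of each.\<close>

definition coset :: "'a divisor \<Rightarrow> 'a divisor \<Rightarrow> 'a divisor set" where
  "coset B D = {\<lambda>Q. (p Q + div_pullback E.F F B Q) + (p' Q + D Q) | p p'. p \<in> PD \<and> p' \<in> PD}"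

definition alphaE :: "'a divisor \<Rightarrow> 'a divisor set set" where
  "alphaE D = Jac_pullback E.F F #>\<^bsub>Jac F\<^esub> div_class F D"

lemma cosetI:
  "p \<in> PD \<Longrightarrow> p' \<in> PD \<Longrightarrow> (\<lambda>Q. (p Q + div_pullback E.F F B Q) + (p' Q + D Q)) \<in> coset B D"
  unfolding coset_def by (rule CollectI, rule exI[of _ p], rule exI[of _ p']) simp

lemma cosetE:
  assumes "z \<in> coset B D"
  obtains p p' where "p \<in> PD" "p' \<in> PD" "z = (\<lambda>Q. (p Q + div_pullback E.F F B Q) + (p' Q + D Q))"
  using assms unfolding coset_def by (elim CollectE exE conjE)

lemma Div0_mult: "monoid.mult (Div0 F) D D' = (\<lambda>Q. D Q + D' Q)"
  by (simp add: Div0_def Div_def)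

lemma div_class_eq: "div_class F D = (\<lambda>p Q. p Q + D Q) ` PD"
  unfolding div_class_def r_coset_def PD_def[symmetric] Div0_mult UNION_singleton_eq_range ..

lemma Jac_mult: "monoid.mult (Jac F) U U' = {\<lambda>Q. a Q + b Q | a b. a \<in> U \<and> b \<in> U'}"
proof -
  have "monoid.mult (Jac F) U U' = set_mult (Div0 F) U U'" by (simp add: Jac_def FactGroup_def)
  also have "\<dots> = {\<lambda>Q. a Q + b Q | a b. a \<in> U \<and> b \<in> U'}" unfolding set_mult_def Div0_mult by blast
  finally show ?thesis .
qed

lemma div_class_mult: "monoid.mult (Jac F) (div_class F (div_pullback E.F F B)) (div_class F D) = coset B D"
proof (intro equalityI subsetI)
  fix z assume "z \<in> div_class F (div_pullback E.F F B) \<otimes>\<^bsub>Jac F\<^esub> div_class F D"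
  then obtain a b where z: "z = (\<lambda>Q. a Q + b Q)" "a \<in> div_class F (div_pullback E.F F B)" "b \<in> div_class F D"
    unfolding Jac_mult by (elim CollectE exE conjE)
  obtain p where p: "p \<in> PD" "a = (\<lambda>Q. p Q + div_pullback E.F F B Q)"
    using z(2) unfolding div_class_eq by (elim imageE)
  obtain p' where p': "p' \<in> PD" "b = (\<lambda>Q. p' Q + D Q)"
    using z(3) unfolding div_class_eq by (elim imageE)
  show "z \<in> coset B D" unfolding z(1) p(2) p'(2) by (rule cosetI[OF p(1) p'(1)])
next
  fix z assume "z \<in> coset B D"
  then obtain p p' where z: "p \<in> PD" "p' \<in> PD" "z = (\<lambda>Q. (p Q + div_pullback E.F F B Q) + (p' Q + D Q))"
    by (rule cosetE)
  have *: "(\<lambda>Q. p Q + div_pullback E.F F B Q) \<in> div_class F (div_pullback E.F F B)" "(\<lambda>Q. p' Q + D Q) \<in> div_class F D"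
    unfolding div_class_eq by (rule imageI[OF z(1)], rule imageI[OF z(2)])
  show "z \<in> div_class F (div_pullback E.F F B) \<otimes>\<^bsub>Jac F\<^esub> div_class F D"
    unfolding Jac_mult z(3)
    by (rule CollectI, rule exI[of _ "\<lambda>Q. p Q + div_pullback E.F F B Q"], rule exI[of _ "\<lambda>Q. p' Q + D Q"])
       (simp add: *)
qed

lemma alphaE_eq: "alphaE D = (\<lambda>B. coset B D) ` carrier (Div0 E.F)"
  unfolding alphaE_def r_coset_def Jac_pullback_def UNION_singleton_eq_range image_image div_class_mult ..

lemma supported_PD: "p \<in> PD \<Longrightarrow> supported p"
  unfolding PD_def by (elim imageE) (simp add: supported_principal)

lemma div_act_coset:
  assumes \<sigma>: "coeff_aut f \<sigma>" and B: "E.supported B" and D: "supported D"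
  shows "div_act y \<sigma> ` coset B D = coset (div_act (y ^ l) \<sigma> B) (div_act y \<sigma> D)"
proof -
  let ?b = "div_pullback E.F F B"
  have eq: "div_act y \<sigma> (\<lambda>Q. (p Q + ?b Q) + (p' Q + D Q)) =
      (\<lambda>Q. (div_act y \<sigma> p Q + div_pullback E.F F (div_act (y ^ l) \<sigma> B) Q) + (div_act y \<sigma> p' Q + div_act y \<sigma> D Q))"
    if "p \<in> PD" "p' \<in> PD" for p p'
    unfolding div_act_pullback[OF \<sigma> B, symmetric]
    using div_act_add[OF \<sigma> supported_add[OF supported_PD[OF that(1)] supported_pullback[of B]]
        supported_add[OF supported_PD[OF that(2)] D]]
      div_act_add[OF \<sigma> supported_PD[OF that(1)] supported_pullback[of B]]
      div_act_add[OF \<sigma> supported_PD[OF that(2)] D] by simp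
  have PD: "div_act y \<sigma> ` PD = PD"
    unfolding PD_def by (rule div_act_principal_image[OF \<sigma>])
  show ?thesis
  proof (intro equalityI subsetI)
    fix z assume "z \<in> div_act y \<sigma> ` coset B D"
    then obtain p p' where p: "p \<in> PD" "p' \<in> PD" "z = div_act y \<sigma> (\<lambda>Q. (p Q + ?b Q) + (p' Q + D Q))"
      by (elim imageE cosetE) (simp only:)
    have "div_act y \<sigma> p \<in> PD" "div_act y \<sigma> p' \<in> PD"
      using imageI[OF p(1), of "div_act y \<sigma>"] imageI[OF p(2), of "div_act y \<sigma>"] PD by simp_all
    thus "z \<in> coset (div_act (y ^ l) \<sigma> B) (div_act y \<sigma> D)"
      unfolding p(3) eq[OF p(1,2)] by (rule cosetI)
  next
    fix z assume "z \<in> coset (div_act (y ^ l) \<sigma> B) (div_act y \<sigma> D)"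
    then obtain q q' where q: "q \<in> PD" "q' \<in> PD"
      "z = (\<lambda>Q. (q Q + div_pullback E.F F (div_act (y ^ l) \<sigma> B) Q) + (q' Q + div_act y \<sigma> D Q))"
      by (rule cosetE)
    have "q \<in> div_act y \<sigma> ` PD" "q' \<in> div_act y \<sigma> ` PD" using q(1,2) PD by simp_all
    then obtain p p' where p: "p \<in> PD" "p' \<in> PD" "q = div_act y \<sigma> p" "q' = div_act y \<sigma> p'"
      by (elim imageE)
    have "z = div_act y \<sigma> (\<lambda>Q. (p Q + ?b Q) + (p' Q + D Q))"
      unfolding q(3) p(3,4) eq[OF p(1,2)] ..
    thus "z \<in> div_act y \<sigma> ` coset B D" using cosetI[OF p(1,2)] by (rule image_eqI)
  qed
qed

text \<open>An element of the quotient is the family of cosets for all \<open>B\<close> of degree 0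
  on the lower curve. The action moves \<open>B\<close> as well, but it permutes these divisors, so
  the family is only reindexed.\<close>

lemma quot_act_alphaE:
  assumes \<sigma>: "coeff_aut f \<sigma>" and D: "supported D"
  shows "quot_act y \<sigma> (alphaE D) = alphaE (div_act y \<sigma> D)"
proof -
  have supp: "E.supported B" if "B \<in> carrier (Div0 E.F)" for B
    using that by (simp add: E.Div0_carrier_iff)
  have perm: "div_act (y ^ l) \<sigma> ` carrier (Div0 E.F) = carrier (Div0 E.F)"
  proof (intro equalityI subsetI)
    fix B assume B: "B \<in> carrier (Div0 E.F)"
    show "B \<in> div_act (y ^ l) \<sigma> ` carrier (Div0 E.F)"
      using E.div_act_inv[OF \<sigma> supp[OF B]] E.div_act_Div0[OF coeff_aut_inv[OF \<sigma>] B] by (metis image_eqI)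
  qed (use E.div_act_Div0[OF \<sigma>] in blast)
  have "quot_act y \<sigma> (alphaE D) = (\<lambda>B. coset (div_act (y ^ l) \<sigma> B) (div_act y \<sigma> D)) ` carrier (Div0 E.F)"
    unfolding quot_act_def Jac_act_def alphaE_eq image_image
    using div_act_coset[OF \<sigma> supp D] by (intro image_cong) simp_all
  also have "\<dots> = (\<lambda>B. coset B (div_act y \<sigma> D)) ` div_act (y ^ l) \<sigma> ` carrier (Div0 E.F)"
    unfolding image_image ..
  finally show ?thesis unfolding perm alphaE_eq .
qed

lemma principal_pt: "c \<in> mu N \<Longrightarrow> z \<in> F - {0} \<Longrightarrow> principal_div F z (pt p c) = vord p c z"
  using pt_points pt_valuation by (simp add: principal_div_def)

text \<open>The coset of D with B = 0 must occur in the family of D'. So D - D' is a pullback plus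
  two principal divisors, and \<open>kernel\<close> applies to the product of the two functions with
  -B in place of B.\<close>

lemma alphaE_eq_imp:
  assumes eq: "alphaE D = alphaE D'"
    and D: "\<And>p c. c \<in> mu N \<Longrightarrow> D (pt p c) = D (pt p 1)"
    and D': "\<And>p c. c \<in> mu N \<Longrightarrow> D' (pt p c) = D' (pt p 1)"
  shows "\<exists>i. \<forall>\<xi>. l dvd ee (Some \<xi>) \<longrightarrow>
    int l dvd D (pt (Some \<xi>) 1) - D' (pt (Some \<xi>) 1) - i * mm (Some \<xi>)"
proof -
  \<comment> \<open>The divisor of the constant 1: the zero divisor as a member of
    \<open>PD\<close>.\<close>
  define one where "one = principal_div F 1"
  have one: "one \<in> PD" unfolding one_def PD_def by simp
  have one_pt: "one (pt p c) = 0" if "c \<in> mu N" for p c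
    using principal_pt[OF that, of 1 p] vord_const[OF that, of p 1] by (simp add: one_def)
  have zero: "(\<lambda>_. 0) \<in> carrier (Div0 E.F)"
    by (simp add: E.Div0_carrier_iff E.supported_def div_deg_def)
  have "coset (\<lambda>_. 0) D \<in> alphaE D" unfolding alphaE_eq by (rule imageI[OF zero])
  hence "coset (\<lambda>_. 0) D \<in> alphaE D'" unfolding eq .
  then obtain B where B: "B \<in> carrier (Div0 E.F)" "coset (\<lambda>_. 0) D = coset B D'"
    unfolding alphaE_eq by blast
  have "(\<lambda>Q. (one Q + div_pullback E.F F (\<lambda>_. 0) Q) + (one Q + D Q)) \<in> coset B D'"
    unfolding B(2)[symmetric] by (rule cosetI[OF one one])
  then obtain p p' where p: "p \<in> PD" "p' \<in> PD"
    "(\<lambda>Q. (one Q + div_pullback E.F F (\<lambda>_. 0) Q) + (one Q + D Q)) =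
     (\<lambda>Q. (p Q + div_pullback E.F F B Q) + (p' Q + D' Q))"
    by (rule cosetE)
  obtain z z' where z: "z \<in> F - {0}" "p = principal_div F z" "z' \<in> F - {0}" "p' = principal_div F z'"
    using p(1,2) unfolding PD_def by blast
  have key: "vord q c (z * z') = (D (pt q c) - D' (pt q c)) + ram_index E.F (pt q c) * (- B (pt q c \<inter> E.F))"
    if c: "c \<in> mu N" for q c
  proof -
    have "one (pt q c) + div_pullback E.F F (\<lambda>_. 0) (pt q c) + (one (pt q c) + D (pt q c)) =
        (p (pt q c) + div_pullback E.F F B (pt q c)) + (p' (pt q c) + D' (pt q c))"
      using fun_cong[OF p(3), of "pt q c"] .
    hence "D (pt q c) = vord q c z + ram_index E.F (pt q c) * B (pt q c \<inter> E.F) + (vord q c z' + D' (pt q c))"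
      unfolding z(2,4) principal_pt[OF c z(1)] principal_pt[OF c z(3)] one_pt[OF c]
      using pt_points[OF c] by (simp add: div_pullback_def)
    moreover have "vord q c (z * z') = vord q c z + vord q c z'"
      using z c by (simp add: vord_mult)
    ultimately show ?thesis by simp
  qed
  have supp: "E.supported B" using B(1) by (simp add: E.Div0_carrier_iff)
  show ?thesis
  proof (rule kernel[where g = "z * z'" and B = "\<lambda>P. - B P" and D = "\<lambda>P. D P - D' P"])
    show "P \<in> points E.F" if "- B P \<noteq> 0" for P using supp that by (simp add: E.supported_def)
    show "D (pt p c) - D' (pt p c) = D (pt p 1) - D' (pt p 1)" if "c \<in> mu N" for p c
      using D[OF that] D'[OF that] by simp
  qed (use z key in simp_all)
qed

text \<open>If a second parameter lay in the maximal ideal, the ideal would contain a nonzero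
  constant, or the product of x and 1/x when p is infinity.\<close>

lemma fibre_pt:
  assumes c: "c \<in> mu N"
  shows "fibre_div F \<xi> (pt p c) = (if p = Some \<xi> then 1 else 0)"
proof -
  interpret P: val_ring F "pt p c" using val_ring_pt[OF c] .
  have "uniformizer_at (Some \<xi>) \<in> max_ideal (pt p c) \<longleftrightarrow> p = Some \<xi>"
  proof
    assume m: "uniformizer_at (Some \<xi>) \<in> max_ideal (pt p c)"
    have m': "uniformizer_at p \<in> max_ideal (pt p c)" using pt_uniformizer_at[OF c] .
    show "p = Some \<xi>"
    proof (cases p)
      case None
      have "fn_x - fn_const \<xi> \<in> pt p c" using m by (auto simp: uniformizer_at_def max_ideal_def)
      hence "(fn_x - fn_const \<xi>) + fn_const \<xi> \<in> pt p c" by (rule P.add[OF _ pt_const[OF c]])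
      hence "fn_x * inverse fn_x \<in> max_ideal (pt p c)"
        using m' by (intro P.mult_max_ideal) (simp_all add: uniformizer_at_def None)
      thus ?thesis using P.one_notin_max_ideal by simp
    next
      case (Some \<xi>')
      have "uniformizer_at (Some \<xi>) - uniformizer_at (Some \<xi>') \<in> max_ideal (pt p c)"
        using P.diff_max_ideal[OF m] m' unfolding Some by simp
      hence d: "fn_const (\<xi>' - \<xi>) \<in> max_ideal (pt p c)"
        by (simp add: uniformizer_at_def fn_const.emb_simps)
      have "vord p c (fn_const (\<xi>' - \<xi>)) = 0" by (rule vord_const[OF c])
      hence "fn_const (\<xi>' - \<xi>) = 0" using d unfolding pt_max_ideal[OF c] by simp
      hence "\<xi>' - \<xi> = 0" by (simp only: fn_const.hom_eq_0_iff[OF UNIV_I])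
      thus ?thesis by (simp add: Some)
    qed
  qed (use pt_uniformizer_at[OF c] in simp)
  thus ?thesis using fibre_div_iff[OF pt_points[OF c], of \<xi> p] by simp
qed

end

section \<open>The field of definition of a set of roots\<close>

lemma subfld_fixed:
  assumes "\<And>\<sigma>. \<sigma> \<in> H \<Longrightarrow> fld_hom UNIV \<sigma>"
  shows "subfld {z. \<forall>\<sigma>\<in>H. \<sigma> z = z}"
proof -
  have hom: "\<sigma> (a + b) = \<sigma> a + \<sigma> b" "\<sigma> (a * b) = \<sigma> a * \<sigma> b" "\<sigma> 1 = 1" "\<sigma> (- a) = - \<sigma> a"
    "\<sigma> (inverse a) = inverse (\<sigma> a)" if "\<sigma> \<in> H" for \<sigma> a b
  proof -
    interpret fld_hom UNIV \<sigma> using assms[OF that] .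
    show "\<sigma> (a + b) = \<sigma> a + \<sigma> b" "\<sigma> (a * b) = \<sigma> a * \<sigma> b" "\<sigma> 1 = 1" "\<sigma> (- a) = - \<sigma> a"
      "\<sigma> (inverse a) = inverse (\<sigma> a)"
      by (simp_all add: hom_add hom_mult hom_uminus hom_inverse)
  qed
  show ?thesis unfolding subfld_def subfield_type_ring_iff by (auto simp: hom)
qed

text \<open>As \<open>H\<close> contains the pointwise stabilizer of \<open>T\<close>, its fixed
  field lies in k(T); as \<open>H\<close> preserves \<open>T\<close>, it normalizes that stabilizer
  and hence maps k(T) to itself. Artin's theorem then supplies the degree and the
  finiteness.\<close>

theorem stabilizer_extension:
  fixes T :: "'a::field_char_0 set" and H :: "('a \<Rightarrow> 'a) set"
  assumes T: "finite T" and H: "H \<subseteq> absolute_Gal k" and perm: "\<And>\<sigma>. \<sigma> \<in> H \<Longrightarrow> \<sigma> ` T = T"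
    and id: "id \<in> H" and comp: "\<And>\<sigma> \<tau>. \<sigma> \<in> H \<Longrightarrow> \<tau> \<in> H \<Longrightarrow> \<sigma> \<circ> \<tau> \<in> H"
    and stab: "\<And>\<sigma>. \<sigma> \<in> absolute_Gal k \<Longrightarrow> (\<And>t. t \<in> T \<Longrightarrow> \<sigma> t = t) \<Longrightarrow> \<sigma> \<in> H"
  defines "L \<equiv> gset_field k (\<lambda>\<sigma>. \<sigma>) T" and "M \<equiv> {z. \<forall>\<sigma>\<in>H. \<sigma> z = z}"
    and "\<Gamma> \<equiv> (\<lambda>\<sigma>. restrict \<sigma> T) ` H"
  shows "galois_extension M L" "finite_extension M L" "ext_degree M L = card \<Gamma>"
    "card \<Gamma> = 1 \<Longrightarrow> L = M"
proof -
  define N where "N = {\<sigma>\<in>absolute_Gal k. \<forall>t\<in>T. \<sigma> t = t}"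
  have Gal: "\<sigma> \<in> absolute_Gal k" if "\<sigma> \<in> H" for \<sigma> using that H by blast
  have hom: "fld_hom UNIV \<sigma>" if "\<sigma> \<in> absolute_Gal k" for \<sigma>
    using that Gal_iff[OF subfld_UNIV] by blast
  have L_eq: "L = {z. \<forall>\<sigma>\<in>N. \<sigma> z = z}" by (auto simp: L_def gset_field_def N_def)
  have L: "subfld L" unfolding L_eq by (rule subfld_fixed) (simp add: N_def hom)
  have TL: "T \<subseteq> L" by (auto simp: L_eq N_def)
  have M_sub_L: "M \<subseteq> L"
  proof
    fix z assume "z \<in> M"
    thus "z \<in> L" unfolding M_def L_eq using stab by (simp add: N_def)
  qed
  have inv: "inv_into UNIV \<sigma> \<in> absolute_Gal k" "bij \<sigma>" if "\<sigma> \<in> absolute_Gal k" for \<sigma>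
    using absolute_Gal_inv[OF that] by simp_all
  have inv_simps: "inv_into UNIV \<sigma> (\<sigma> z) = z" "\<sigma> (inv_into UNIV \<sigma> z) = z" if "\<sigma> \<in> absolute_Gal k" for \<sigma> z
    using inv(2)[OF that] by (simp_all add: bij_is_inj bij_is_surj surj_f_inv_f)
  have maps: "\<sigma> z \<in> L" if \<sigma>: "\<sigma> \<in> absolute_Gal k" "\<sigma> ` T = T" and z: "z \<in> L" for \<sigma> z
    unfolding L_eq
  proof (intro CollectI ballI)
    fix \<tau> assume \<tau>: "\<tau> \<in> N"
    \<comment> \<open>The conjugate of \<tau> by \<sigma> again fixes \<open>T\<close> pointwise,
      because \<sigma> permutes \<open>T\<close>.\<close>
    define \<rho> where "\<rho> = inv_into UNIV \<sigma> \<circ> (\<tau> \<circ> \<sigma>)"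
    have "\<rho> \<in> absolute_Gal k"
      unfolding \<rho>_def using \<tau> by (intro Gal_comp[OF subfld_UNIV] inv \<sigma>) (simp add: N_def)
    moreover have "\<rho> t = t" if "t \<in> T" for t
    proof -
      have "\<sigma> t \<in> T" using \<sigma>(2) that by blast
      thus ?thesis using \<tau> inv_simps(1)[OF \<sigma>(1)] by (simp add: \<rho>_def N_def)
    qed
    ultimately have "\<rho> z = z" using z by (simp add: L_eq N_def)
    hence "\<sigma> (\<rho> z) = \<sigma> z" by simp
    thus "\<tau> (\<sigma> z) = \<sigma> z" by (simp add: \<rho>_def inv_simps(2)[OF \<sigma>(1)])
  qed
  have onto: "\<sigma> ` L = L" if \<sigma>: "\<sigma> \<in> H" for \<sigma>
  proof (intro equalityI subsetI)
    show "z \<in> L" if "z \<in> \<sigma> ` L" for z using maps[OF Gal[OF \<sigma>] perm[OF \<sigma>]] that by blast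
    have "inv_into UNIV \<sigma> ` T = inv_into UNIV \<sigma> ` \<sigma> ` T" by (simp add: perm[OF \<sigma>])
    also have "\<dots> = T" unfolding image_image inv_simps(1)[OF Gal[OF \<sigma>]] by simp
    finally have T': "inv_into UNIV \<sigma> ` T = T" .
    fix z assume "z \<in> L"
    hence "inv_into UNIV \<sigma> z \<in> L" by (rule maps[OF inv(1)[OF Gal[OF \<sigma>]] T'])
    thus "z \<in> \<sigma> ` L" using inv_simps(2)[OF Gal[OF \<sigma>], of z] by (metis imageI)
  qed
  have faithful: "\<sigma> z = \<tau> z"
    if \<sigma>: "\<sigma> \<in> H" and \<tau>: "\<tau> \<in> H" and eq: "\<And>t. t \<in> T \<Longrightarrow> \<sigma> t = \<tau> t" and z: "z \<in> L" for \<sigma> \<tau> z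
  proof -
    define \<rho> where "\<rho> = inv_into UNIV \<sigma> \<circ> \<tau>"
    have "\<rho> \<in> absolute_Gal k"
      unfolding \<rho>_def by (intro Gal_comp[OF subfld_UNIV] inv Gal \<sigma> \<tau>)
    moreover have "\<rho> t = t" if "t \<in> T" for t
      using inv_simps(1)[OF Gal[OF \<sigma>], of t] eq[OF that] by (simp add: \<rho>_def)
    ultimately have "\<rho> z = z" using z by (simp add: L_eq N_def)
    hence "\<sigma> (\<rho> z) = \<sigma> z" by simp
    thus ?thesis by (simp add: \<rho>_def inv_simps(2)[OF Gal[OF \<sigma>]])
  qed
  have M_eq: "M = {z\<in>L. \<forall>\<sigma>\<in>H. \<sigma> z = z}" using M_sub_L by (auto simp: M_def)
  have homL: "fld_hom L \<sigma>" if "\<sigma> \<in> H" for \<sigma>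
    by (rule fld_hom_subset[OF hom[OF Gal[OF that]] L]) simp
  note artin = artin[OF L T TL homL onto perm id comp _ M_eq]
  show "galois_extension M L" by (rule artin(1)) (assumption | (rule faithful; blast))+
  show "finite_extension M L" by (rule artin(2)) (assumption | (rule faithful; blast))+
  show "ext_degree M L = card \<Gamma>" unfolding \<Gamma>_def by (rule artin(3)) (assumption | (rule faithful; blast))+
  show "L = M" if "card \<Gamma> = 1"
  proof (rule subset_antisym[OF _ M_sub_L], rule subsetI)
    fix z assume z: "z \<in> L"
    have "\<sigma> z = z" if \<sigma>: "\<sigma> \<in> H" for \<sigma>
    proof -
      obtain \<gamma> where "\<Gamma> = {\<gamma>}" using \<open>card \<Gamma> = 1\<close> by (rule card_1_singletonE)
      moreover have "restrict \<sigma> T \<in> \<Gamma>" "restrict id T \<in> \<Gamma>" unfolding \<Gamma>_def by (rule imageI[OF \<sigma>], rule imageI[OF id])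
      ultimately have eq: "restrict \<sigma> T = restrict id T" by simp
      have "\<sigma> t = id t" if "t \<in> T" for t using fun_cong[OF eq, of t] that by simp
      from faithful[OF \<sigma> id this z] show ?thesis by simp
    qed
    thus "z \<in> M" by (simp add: M_def)
  qed
qed

section \<open>Roots of the defining polynomial\<close>

lemma order_linear: "order \<xi> [:- \<zeta>, 1:] = (if \<xi> = \<zeta> then 1 else (0 :: nat))"
  for \<xi> :: "'a::field"
  using order_power_n_n[of \<zeta> 1] by (auto intro!: order_0I)

lemma order_prod_linear:
  fixes S :: "'a::field set"
  assumes "finite S"
  shows "order \<xi> (\<Prod>\<zeta>\<in>S. [:- \<zeta>, 1:] ^ e \<zeta>) = (if \<xi> \<in> S then e \<xi> else 0)"
  using assms
proof (induction S)
  case (insert \<zeta> S)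
  have nz: "(\<Prod>\<zeta>\<in>S. [:- \<zeta>, 1:] ^ e \<zeta>) \<noteq> 0" using insert(1) by (simp add: prod_zero_iff)
  have "order \<xi> (\<Prod>\<zeta>\<in>insert \<zeta> S. [:- \<zeta>, 1:] ^ e \<zeta>) =
      order \<xi> ([:- \<zeta>, 1:] ^ e \<zeta>) + order \<xi> (\<Prod>\<zeta>\<in>S. [:- \<zeta>, 1:] ^ e \<zeta>)"
    unfolding prod.insert[OF insert(1,2)] using nz by (intro order_mult) simp
  thus ?case using insert by (auto simp: order_power order_linear)
qed (simp add: order_0I)

lemma degree_prod_linear:
  fixes S :: "'a::field set"
  shows "Polynomial.degree (\<Prod>\<zeta>\<in>S. [:- \<zeta>, 1:] ^ e \<zeta>) = (\<Sum>\<zeta>\<in>S. e \<zeta>)"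
  by (subst degree_prod_eq_sum_degree) (auto simp: degree_linear_power)

text \<open>If l divided all exponents, f would be an l-th power h^l, the leading constant having an
  l-th root, and Y^m - h would be a proper factor of Y^(lm) - f.\<close>

lemma irreducible_superelliptic:
  fixes lam :: "'a::alg_closed_field"
  assumes irr: "Factorial_Ring.irreducible (Polynomial.monom 1 (l * m) - [:f:] :: 'a poly poly)"
    and f: "f = Polynomial.smult lam (\<Prod>\<xi>\<in>S. [:- \<xi>, 1:] ^ e \<xi>)" and l: "l > 1" and m: "m > 0"
  shows "\<exists>\<xi>\<in>S. \<not> l dvd e \<xi>"
proof (rule ccontr)
  assume neg: "\<not> (\<exists>\<xi>\<in>S. \<not> l dvd e \<xi>)"
  obtain \<mu> where \<mu>: "\<mu> ^ l = lam" using nth_root_exists[of l lam] l by auto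
  define h where "h = Polynomial.smult \<mu> (\<Prod>\<xi>\<in>S. [:- \<xi>, 1:] ^ (e \<xi> div l))"
  have "h ^ l = Polynomial.smult lam (\<Prod>\<xi>\<in>S. [:- \<xi>, 1:] ^ (e \<xi> div l * l))"
    by (simp add: h_def smult_power \<mu> prod_power_distrib power_mult)
  also have "\<dots> = f"
    unfolding f using neg by (intro arg_cong[of _ _ "Polynomial.smult lam"] prod.cong refl) simp
  finally have h: "h ^ l = f" .
  define P where "P = Polynomial.monom (1 :: 'a poly) m"
  define C where "C = (\<Sum>i<l. [:h:] ^ (l - Suc i) * P ^ i)"
  have "Polynomial.monom 1 (l * m) - [:f:] = P ^ l - [:h:] ^ l"
    by (simp add: P_def monom_power poly_const_pow h mult.commute)
  also have "\<dots> = (P - [:h:]) * C" unfolding C_def by (rule power_diff_sumr2)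
  finally have fact: "Polynomial.monom 1 (l * m) - [:f:] = (P - [:h:]) * C" .
  have deg: "Polynomial.degree (Polynomial.monom 1 i - [:c:] :: 'a poly poly) = i" if "i > 0" for i c
    unfolding diff_conv_add_uminus using that
    by (subst degree_add_eq_left) (simp_all add: degree_monom_eq)
  have lm: "l * m > m" using l m by simp
  have d1: "Polynomial.degree (P - [:h:]) = m" unfolding P_def using m by (rule deg)
  have d: "Polynomial.degree ((P - [:h:]) * C) = l * m"
    unfolding fact[symmetric] by (rule deg) (use lm in simp)
  have nz: "P - [:h:] \<noteq> 0" "C \<noteq> 0" using d lm by auto
  hence d2: "m + Polynomial.degree C = l * m" using d d1 by (simp add: degree_mult_eq)
  have unit: "Polynomial.degree p = 0" if p: "p dvd 1" for p :: "'a poly poly"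
  proof -
    obtain q where q: "1 = p * q" using p by (elim dvdE)
    hence "p \<noteq> 0" "q \<noteq> 0" by auto
    thus ?thesis using arg_cong[OF q, of Polynomial.degree] by (simp add: degree_mult_eq)
  qed
  have "P - [:h:] dvd 1 \<or> C dvd 1" using irr fact by (rule Factorial_Ring.irreducibleD)
  thus False using unit[of "P - [:h:]"] unit[of C] d1 d2 m lm by auto
qed

section \<open>Ramification over the line\<close>

context kummer
begin

text \<open>The line is itself an instance of \<open>kummer\<close>, with N = 1 and f in the role of
  y. Its classification identifies the restricted ring as a point with e = 1, where the parameter
  has order 1.\<close>

lemma pt_Int_rational:
  shows "pt p 1 \<inter> rational_fn_field \<in> points rational_fn_field"
    and "uniformizer (pt p 1 \<inter> rational_fn_field) (uniformizer_at p)"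
proof -
  define R where "R = pt p 1 \<inter> rational_fn_field"
  interpret K: kummer f "fn_of_poly f" 1 \<xi>\<^sub>0 by unfold_locales (simp_all add: f_nonzero)
  have KF: "K.F = rational_fn_field"
  proof (rule subset_antisym)
    show "K.F \<subseteq> rational_fn_field"
      unfolding fn_field_def
    proof (rule generate_field_minimal[OF subfld_rational])
      have "fn_x \<in> rational_fn_field" by (simp add: fn_x_def fn_of_poly_in_rational)
      thus "range fn_const \<union> {fn_x, fn_of_poly f} \<subseteq> rational_fn_field"
        using fn_const_in_rational fn_of_poly_in_rational by blast
    qed
  qed (rule K.rational_subset_F)
  have R: "val_ring rational_fn_field R"
    unfolding R_def by (rule val_ring_Int[OF val_ring_pt[OF one_mu] subfld_rational rational_subset_F])
  interpret R: val_ring rational_fn_field R by (rule R)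
  have const: "fn_const c \<in> R" for c
    unfolding R_def by (rule IntI[OF pt_const[OF one_mu] fn_const_in_rational])
  have t: "uniformizer_at p \<in> max_ideal R"
    unfolding R_def max_ideal_Int[OF subfld_rational]
    by (rule IntI[OF pt_uniformizer_at[OF one_mu] uniformizer_at_in_rational])
  have nt: "inverse (uniformizer_at p) \<notin> R" using t by (simp add: max_ideal_def)
  have "inverse (uniformizer_at p) \<in> rational_fn_field"
    by (rule R.F.inverse[OF uniformizer_at_in_rational])
  with nt have "R \<noteq> rational_fn_field" by blast
  moreover have "R \<subseteq> rational_fn_field" by (simp add: R_def)
  moreover have "uniformizer_at p \<notin> range fn_const"
  proof
    assume "uniformizer_at p \<in> range fn_const"
    then obtain c where "uniformizer_at p = fn_const c" by (elim rangeE)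
    hence "inverse (uniformizer_at p) = fn_const (inverse c)" by (simp add: fn_const.emb_simps)
    thus False using nt const by simp
  qed
  hence "range fn_const \<noteq> R" using t R.max_ideal_subset by metis
  moreover have "range fn_const \<subseteq> R" using const by (intro image_subsetI)
  ultimately show pts: "R \<in> points rational_fn_field"
    using R.val_ring by (simp add: points_def psubset_eq)
  have "R \<in> K.pt p ` mu 1"
    by (rule K.point_over_eq_pt) (simp_all only: KF pts t)
  then obtain c where c: "c \<in> mu 1" "R = K.pt p c" by (elim imageE)
  have "K.ee p = 1" using K.N_eq[of p] by simp
  hence "K.vord p c (uniformizer_at p) = 1" using K.vord_uniformizer_at[OF c(1)] by simp
  thus "uniformizer R (uniformizer_at p)"
    unfolding c(2) K.pt_uniformizer_iff[OF c(1)] using K.uniformizer_at_in_F by (rule conjI[rotated])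
qed

lemma ram_index_rational: "ram_index rational_fn_field (pt p 1) = int (ee p)"
proof -
  define R where "R = pt p 1 \<inter> rational_fn_field"
  have R: "val_ring rational_fn_field R"
    unfolding R_def by (rule val_ring_Int[OF val_ring_pt[OF one_mu] subfld_rational rational_subset_F])
  have t: "uniformizer R (uniformizer_at p)" unfolding R_def by (rule pt_Int_rational)
  have "ram_index rational_fn_field (pt p 1) = valuation (pt p 1) (uniformizer_at p)"
    unfolding ram_index_def R_def[symmetric]
    by (rule val_ring.valuation_cong[OF val_ring_pt[OF one_mu] someI[of "uniformizer R", OF t] t R]) (simp add: R_def)
  also have "\<dots> = int (ee p)"
    using pt_valuation[OF one_mu uniformizer_at_in_F uniformizer_at_neq_0] vord_uniformizer_at[OF one_mu] by simp
  finally show ?thesis .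
qed

lemma ramified_in_branch_locus: "ee p > 1 \<Longrightarrow> pt p 1 \<inter> rational_fn_field \<in> branch_locus F"
  unfolding branch_locus_def using pt_Int_rational(1)[of p] pt_points[OF one_mu, of p] ram_index_rational[of p]
  by (intro CollectI conjI bexI[of _ "pt p 1"]) simp_all

text \<open>A ramified point over infinity would restrict to a \<open>line_point\<close>. It would
  then contain x, while 1/x lies in its maximal ideal.\<close>

lemma unramified_at_infinity: "branch_locus F \<subseteq> range line_point \<Longrightarrow> ee None = 1"
proof (rule ccontr)
  assume b: "branch_locus F \<subseteq> range line_point" and "ee None \<noteq> 1"
  hence "ee None > 1" using ee_pos[of None] by linarith
  then obtain \<xi> where "pt None 1 \<inter> rational_fn_field = line_point \<xi>"
    using subsetD[OF b ramified_in_branch_locus] by blast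
  hence \<xi>: "uniformizer_at (Some \<xi>) \<in> max_ideal (pt None 1)"
    using Int_rational_eq_line_point_iff[OF val_ring_pt[OF one_mu] pt_const[OF one_mu] rational_subset_F] by blast
  interpret P: val_ring F "pt None 1" by (rule val_ring_pt[OF one_mu])
  have "fn_x - fn_const \<xi> \<in> pt None 1" using \<xi> by (simp add: uniformizer_at_def max_ideal_def)
  hence "(fn_x - fn_const \<xi>) + fn_const \<xi> \<in> pt None 1" by (rule P.add[OF _ pt_const[OF one_mu]])
  hence "fn_x * inverse fn_x \<in> max_ideal (pt None 1)"
    using pt_uniformizer_at[OF one_mu, of None] by (intro P.mult_max_ideal) (simp_all add: uniformizer_at_def)
  thus False using P.one_notin_max_ideal by simp
qed

text \<open>With e = 1 at infinity, the gcd of N and the order -deg f is N itself.\<close>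

lemma dvd_degree: "branch_locus F \<subseteq> range line_point \<Longrightarrow> N dvd degree f"
  using unramified_at_infinity nn_eq[of None] N_eq[of None] by (simp add: nn_def ordp_def) (metis dvd_minus_iff dvd_triv_right int_dvd_int_iff)


section \<open>Combinations of reduced fibres\<close>

definition fibres :: "'a set \<Rightarrow> ('a \<Rightarrow> int) \<Rightarrow> 'a divisor" where
  "fibres T a = (\<lambda>Q. \<Sum>\<xi>\<in>T. a \<xi> * fibre_div F \<xi> Q)"

lemma supported_fibres: "supported (fibres T a)"
  by (auto simp: supported_def fibres_def fibre_div_def sum.neutral intro: ccontr)

text \<open>Stating the relation as \<open>b (\<sigma> \<xi>) = a \<xi>\<close> on \<open>T\<close>
  covers b = a composed with the inverse of \<sigma> and also, when \<sigma> fixes \<open>T\<close>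
  pointwise, b = a.\<close>

lemma div_act_fibres:
  assumes \<sigma>: "coeff_aut f \<sigma>" and perm: "bij_betw \<sigma> T T" and inv: "\<And>\<xi>. \<xi> \<in> T \<Longrightarrow> b (\<sigma> \<xi>) = a \<xi>"
  shows "div_act y \<sigma> (fibres T a) = fibres T b"
proof
  fix Q
  have "div_act y \<sigma> (fibres T a) Q = (\<Sum>\<xi>\<in>T. a \<xi> * div_act y \<sigma> (fibre_div F \<xi>) Q)"
    unfolding div_act_eq[OF \<sigma> supported_fibres] div_act_eq[OF \<sigma> supported_fibre] by (simp add: fibres_def)
  also have "\<dots> = (\<Sum>\<xi>\<in>T. b (\<sigma> \<xi>) * fibre_div F (\<sigma> \<xi>) Q)"
    using inv by (intro sum.cong refl) (simp add: div_act_fibre[OF \<sigma>])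
  also have "\<dots> = (\<Sum>\<xi>\<in>T. b \<xi> * fibre_div F \<xi> Q)" by (rule sum.reindex_bij_betw[OF perm])
  finally show "div_act y \<sigma> (fibres T a) Q = fibres T b Q" by (simp add: fibres_def)
qed

lemma fibres_carrier: "finite T \<Longrightarrow> fibres T a \<in> carrier (Div F)"
  and div_deg_fibres: "finite T \<Longrightarrow> div_deg (fibres T a) = (\<Sum>\<xi>\<in>T. a \<xi> * int (gg (Some \<xi>)))"
proof -
  assume T: "finite T"
  define A where "A = (\<Union>\<xi>\<in>T. points_over \<xi>)"
  have A: "finite A" unfolding A_def using T card_points_over(1) by blast
  have out: "fibre_div F \<xi> Q = 0" if "\<xi> \<in> T" "Q \<notin> A" for \<xi> Q
    using that by (auto simp: A_def points_over_def fibre_div_def)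
  have sub: "{Q. fibres T a Q \<noteq> 0} \<subseteq> A"
  proof
    fix Q assume Q: "Q \<in> {Q. fibres T a Q \<noteq> 0}"
    show "Q \<in> A"
    proof (rule ccontr)
      assume "Q \<notin> A"
      hence "fibres T a Q = 0" unfolding fibres_def using out by (intro sum.neutral) simp
      thus False using Q by simp
    qed
  qed
  show "fibres T a \<in> carrier (Div F)"
    unfolding Div_carrier_iff using supported_fibres finite_subset[OF sub A] by (intro conjI)
  have "div_deg (fibres T a) = (\<Sum>Q\<in>A. fibres T a Q)"
    unfolding div_deg_def by (rule sum.mono_neutral_left[OF A sub]) simp
  also have "\<dots> = (\<Sum>\<xi>\<in>T. a \<xi> * (\<Sum>Q\<in>A. fibre_div F \<xi> Q))"
    unfolding fibres_def by (subst sum.swap) (simp add: sum_distrib_left)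
  also have "\<dots> = (\<Sum>\<xi>\<in>T. a \<xi> * int (gg (Some \<xi>)))"
  proof (rule sum.cong[OF refl])
    fix \<xi> assume \<xi>: "\<xi> \<in> T"
    have "(\<Sum>Q\<in>A. fibre_div F \<xi> Q) = (\<Sum>Q\<in>points_over \<xi>. fibre_div F \<xi> Q)"
      using \<xi> by (intro sum.mono_neutral_right A) (auto simp: A_def points_over_def fibre_div_def)
    also have "\<dots> = (\<Sum>Q\<in>points_over \<xi>. 1)"
      by (rule sum.cong[OF refl]) (simp add: points_over_def fibre_div_def)
    finally show "a \<xi> * (\<Sum>Q\<in>A. fibre_div F \<xi> Q) = a \<xi> * int (gg (Some \<xi>))"
      by (simp add: card_points_over)
  qed
  finally show "div_deg (fibres T a) = (\<Sum>\<xi>\<in>T. a \<xi> * int (gg (Some \<xi>)))" .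
qed

lemma Div_simps:
  "monoid.mult (Div F) D D' = (\<lambda>P. D P + D' P)" "one (Div F) = (\<lambda>_. 0)"
  by (simp_all add: Div_def)

lemma Div_inv:
  assumes "D \<in> carrier (Div F)"
  shows "m_inv (Div F) D = (\<lambda>P. - D P)"
  unfolding m_inv_def
proof (rule the_equality)
  have "(\<lambda>P. - D P) \<in> carrier (Div F)" using assms by (simp add: Div_def)
  thus "(\<lambda>P. - D P) \<in> carrier (Div F) \<and> D \<otimes>\<^bsub>Div F\<^esub> (\<lambda>P. - D P) = \<one>\<^bsub>Div F\<^esub> \<and> (\<lambda>P. - D P) \<otimes>\<^bsub>Div F\<^esub> D = \<one>\<^bsub>Div F\<^esub>"
    by (simp add: Div_simps)
next
  fix D' assume "D' \<in> carrier (Div F) \<and> D \<otimes>\<^bsub>Div F\<^esub> D' = \<one>\<^bsub>Div F\<^esub> \<and> D' \<otimes>\<^bsub>Div F\<^esub> D = \<one>\<^bsub>Div F\<^esub>"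
  hence "(\<lambda>P. D P + D' P) = (\<lambda>_. 0)" by (simp add: Div_simps)
  from fun_cong[OF this] have "D P + D' P = 0" for P .
  thus "D' = (\<lambda>P. - D P)" by (intro ext) (simp add: eq_neg_iff_add_eq_0 add.commute)
qed

lemma fibre_div_carrier: "fibre_div F \<xi> \<in> carrier (Div F)"
  using fibres_carrier[of "{\<xi>}" "\<lambda>_. 1"] by (simp add: fibres_def)

lemma generate_fibres:
  assumes T: "finite T"
  shows "generate (Div F) (fibre_div F ` T) = range (fibres T)"
proof (intro equalityI subsetI)
  fix D assume "D \<in> generate (Div F) (fibre_div F ` T)"
  thus "D \<in> range (fibres T)"
  proof (induction D rule: generate.induct)
    case one
    show ?case by (rule range_eqI[of _ _ "\<lambda>_. 0"]) (simp add: Div_simps fibres_def)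
  next
    case (incl D)
    then obtain \<xi> where \<xi>: "\<xi> \<in> T" "D = fibre_div F \<xi>" by (elim imageE)
    show ?case
      using \<xi> T by (intro range_eqI[of _ _ "\<lambda>\<zeta>. if \<zeta> = \<xi> then 1 else 0"])
        (simp add: fibres_def if_distrib[of "\<lambda>c. c * _"] sum.delta cong: if_cong)
  next
    case (inv D)
    then obtain \<xi> where \<xi>: "\<xi> \<in> T" "D = fibre_div F \<xi>" by (elim imageE)
    show ?case unfolding \<xi>(2) Div_inv[OF fibre_div_carrier]
      using \<xi> T by (intro range_eqI[of _ _ "\<lambda>\<zeta>. if \<zeta> = \<xi> then - 1 else 0"])
        (simp add: fibres_def if_distrib[of "\<lambda>c. c * _"] sum.delta cong: if_cong)
  next
    case (eng D D')
    then obtain a b where "D = fibres T a" "D' = fibres T b" by (elim rangeE)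
    thus ?case
      by (intro range_eqI[of _ _ "\<lambda>\<xi>. a \<xi> + b \<xi>"])
         (simp add: Div_simps fibres_def sum.distrib distrib_right)
  qed
next
  fix D assume "D \<in> range (fibres T)"
  then obtain a where a: "D = fibres T a" by (elim rangeE)
  let ?G = "generate (Div F) (fibre_div F ` T)"
  have zero: "(\<lambda>_. 0) \<in> ?G" using generate.one[of "Div F"] by (simp add: Div_simps)
  have add: "(\<lambda>P. D P + D' P) \<in> ?G" if "D \<in> ?G" "D' \<in> ?G" for D D'
    using generate.eng[OF that] by (simp add: Div_simps)
  have mult: "(\<lambda>P. i * fibre_div F \<xi> P) \<in> ?G" if \<xi>: "\<xi> \<in> T" for i \<xi>
  proof -
    have incl: "fibre_div F \<xi> \<in> ?G" using \<xi> by (intro generate.incl imageI)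
    have inv: "(\<lambda>P. - fibre_div F \<xi> P) \<in> ?G"
      using generate.inv[OF imageI[OF \<xi>, of "fibre_div F"], of "Div F"] by (simp add: Div_inv[OF fibre_div_carrier])
    show ?thesis
    proof (induction i rule: int_induct[of _ 0])
      case base
      show ?case using zero by simp
    next
      case (step1 i)
      show ?case using add[OF step1(2) incl] by (simp add: distrib_right)
    next
      case (step2 i)
      show ?case using add[OF step2(2) inv] by (simp add: left_diff_distrib)
    qed
  qed
  have "(\<lambda>P. \<Sum>\<xi>\<in>U. a \<xi> * fibre_div F \<xi> P) \<in> ?G" if "U \<subseteq> T" for U
    using finite_subset[OF that T] that
  proof (induction U)
    case (insert \<xi> U)
    thus ?case using add[OF mult, of \<xi> _ "a \<xi>"] by simp
  qed (simp add: zero)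
  thus "D \<in> ?G" unfolding a fibres_def by blast
qed

end

section \<open>Galois action on the roots\<close>

lemma map_poly_mult_hom:
  assumes "fld_emb \<sigma>"
  shows "map_poly \<sigma> (p * q) = map_poly \<sigma> p * map_poly \<sigma> q"
proof -
  interpret fld_emb \<sigma> by fact
  show ?thesis by (intro poly_eqI) (simp add: coeff_map_poly coeff_mult hom_sum emb_simps)
qed

text \<open>Applying \<sigma> to a factor (x - \<xi>)^r of f produces the factor (x -
  \<sigma>(\<xi>))^r; the opposite inequality is the same statement for the inverse.\<close>

lemma order_coeff_aut:
  assumes \<sigma>: "coeff_aut f \<sigma>" and f: "f \<noteq> 0"
  shows "order (\<sigma> \<xi>) f = order \<xi> f"
proof -
  have le: "order \<xi> f \<le> order (\<sigma> \<xi>) f" if \<sigma>: "coeff_aut f \<sigma>" for \<sigma> \<xi>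
  proof -
    interpret fld_emb \<sigma> using \<sigma> by (simp add: coeff_aut_def)
    obtain q where q: "f = [:- \<xi>, 1:] ^ order \<xi> f * q" using order_1[of \<xi> f] by (elim dvdE)
    have pow: "map_poly \<sigma> ([:- \<xi>, 1:] ^ i) = [:- \<sigma> \<xi>, 1:] ^ i" for i
    proof (induction i)
      case (Suc i)
      have "map_poly \<sigma> [:- \<xi>, 1:] = [:- \<sigma> \<xi>, 1:]" by (simp add: map_poly_pCons emb_simps)
      thus ?case unfolding power_Suc map_poly_mult_hom[OF fld_emb_axioms] Suc by simp
    qed (simp add: map_poly_1)
    have "f = map_poly \<sigma> ([:- \<xi>, 1:] ^ order \<xi> f * q)" using \<sigma> q by (simp add: coeff_aut_def)
    also have "\<dots> = [:- \<sigma> \<xi>, 1:] ^ order \<xi> f * map_poly \<sigma> q"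
      unfolding map_poly_mult_hom[OF fld_emb_axioms] pow ..
    finally have "[:- \<sigma> \<xi>, 1:] ^ order \<xi> f dvd f" by (rule dvdI)
    thus ?thesis using f by (simp add: order_divides)
  qed
  have "inv_into UNIV \<sigma> (\<sigma> \<xi>) = \<xi>" using \<sigma> by (simp add: coeff_aut_def bij_is_inj)
  thus ?thesis using le[OF \<sigma>, of \<xi>] le[OF coeff_aut_inv[OF \<sigma>], of "\<sigma> \<xi>"] by simp
qed

lemma coeff_aut_absolute_Gal:
  assumes "\<sigma> \<in> absolute_Gal k" "\<forall>i. coeff f i \<in> k"
  shows "coeff_aut f \<sigma>"
proof -
  have \<sigma>: "fld_hom UNIV \<sigma>" "\<forall>z\<in>k. \<sigma> z = z" using assms(1) Gal_iff[OF subfld_UNIV] by blast+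
  interpret fld_hom UNIV \<sigma> by (rule \<sigma>(1))
  have "map_poly \<sigma> f = f" using assms(2) \<sigma>(2) by (intro poly_eqI) (simp add: coeff_map_poly)
  thus ?thesis using absolute_Gal_inv(1)[OF assms(1)] \<sigma>(1) by (simp add: coeff_aut_def fld_emb_def)
qed


section \<open>The tower\<close>

text \<open>The root \<open>\<xi>\<^sub>0\<close> is supplied by the irreducibility of Y^(l^n) - f,
  and \<open>branch\<close> expresses that infinity is not a branch point of C.\<close>

locale superelliptic_tower =
  fixes k S :: "'a::{alg_closed_field,field_char_0} set" and l n s :: nat and lam :: 'a
    and e :: "'a \<Rightarrow> nat" and f :: "'a poly" and y :: "'a fn" and \<xi>\<^sub>0 :: 'a
  assumes l_prime: "Factorial_Ring.prime l" and lam: "lam \<noteq> 0" and finite_S: "finite S"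
    and e_pos: "\<And>\<xi>. \<xi> \<in> S \<Longrightarrow> 0 < e \<xi>"
    and f_eq: "f = smult lam (\<Prod>\<xi>\<in>S. [:- \<xi>, 1:] ^ e \<xi>)"
    and coeffs: "\<forall>i. coeff f i \<in> k"
    and y_power: "y ^ (l ^ n) = fn_of_poly f"
    and branch: "branch_locus (fn_field y) \<subseteq> range line_point"
    and s: "1 \<le> s" "s \<le> n"
    and \<xi>\<^sub>0: "\<xi>\<^sub>0 \<in> S" "\<not> l dvd e \<xi>\<^sub>0"
begin

lemma f_nonzero: "f \<noteq> 0"
  using lam finite_S by (simp add: f_eq prod_zero_iff)

lemma order_f: "order \<xi> f = (if \<xi> \<in> S then e \<xi> else 0)"
  unfolding f_eq order_smult[OF lam] by (rule order_prod_linear[OF finite_S])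

lemma degree_f: "degree f = (\<Sum>\<xi>\<in>S. e \<xi>)"
  unfolding f_eq using lam by (simp add: degree_prod_linear)

lemma coprime_\<xi>\<^sub>0: "algebraic_semidom_class.coprime (order \<xi>\<^sub>0 f) (l ^ i)"
  using \<xi>\<^sub>0 l_prime prime_imp_coprime[of l "e \<xi>\<^sub>0"] by (simp add: order_f coprime_commute)

lemma tower_coord_power: "tower_coord l n y s ^ (l ^ s) = fn_of_poly f"
  using s y_power by (simp add: tower_coord_def flip: power_mult power_add)

text \<open>The curve C_s over C_(s-1), the latter appearing as \<open>C.E\<close> because y_(s-1) =
  y_s^l.\<close>

sublocale C: kummer_step f "tower_coord l n y s" "l ^ s" \<xi>\<^sub>0 l
proof unfold_locales
  show "0 < l ^ s" using l_prime by (simp add: prime_gt_0_nat)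
  show "l dvd l ^ s" using s by (intro dvd_power) simp
qed (rule f_nonzero tower_coord_power coprime_\<xi>\<^sub>0 l_prime)+

text \<open>The branch locus is that of C itself, so the local computation at infinity is made at
  level n.\<close>

lemma dvd_degree: "l ^ n dvd degree f"
proof -
  interpret kummer f y "l ^ n" \<xi>\<^sub>0
  proof unfold_locales
    show "0 < l ^ n" using l_prime by (simp add: prime_gt_0_nat)
  qed (rule f_nonzero y_power coprime_\<xi>\<^sub>0)+
  show ?thesis by (rule dvd_degree[OF branch])
qed

abbreviation T :: "'a set" where "T \<equiv> strata_below l S e s"
abbreviation S0 :: "'a set" where "S0 \<equiv> stratum l S e 0"

lemma T_iff: "\<xi> \<in> T \<longleftrightarrow> \<xi> \<in> S \<and> multiplicity l (e \<xi>) < s"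
  by (auto simp: strata_below_def stratum_def)

lemma S0_iff: "\<xi> \<in> S0 \<longleftrightarrow> \<xi> \<in> S \<and> \<not> l dvd e \<xi>"
proof -
  have "multiplicity l (e \<xi>) = 0 \<longleftrightarrow> \<not> l dvd e \<xi>" if "\<xi> \<in> S"
    using e_pos[OF that] prime_elem_multiplicity_eq_zero_iff[OF prime_imp_prime_elem[OF l_prime], of "e \<xi>"] by simp
  thus ?thesis by (auto simp: stratum_def)
qed

lemma S0_subset: "S0 \<subseteq> T"
  using s by (auto simp: T_iff stratum_def)

lemma finite_T: "finite T"
  by (rule finite_subset[OF _ finite_S]) (auto simp: T_iff)

lemma gg_eq:
  assumes "\<xi> \<in> S"
  shows "C.gg (Some \<xi>) = gcd (l ^ s) (e \<xi>)"
proof -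
  have "C.nn (Some \<xi>) = int (e \<xi>)" using assms by (simp add: C.nn_def ordp_def order_f)
  hence "int (C.gg (Some \<xi>)) = int (gcd (l ^ s) (e \<xi>))" unfolding C.gg_int by (simp only: gcd_int_int_eq)
  thus ?thesis by (simp only: of_nat_eq_iff)
qed

text \<open>For an exponent l^j x with x prime to l and j < s, the gcd with l^s is l^j, so m = x and
  the ramification index is l^(s-j). It is j < s that makes l divide this index, as
  \<open>kernel\<close> requires.\<close>

lemma local_numbers:
  assumes \<xi>: "\<xi> \<in> T"
  obtains j x where "j < s" "e \<xi> = l ^ j * x" "\<not> l dvd x" "C.gg (Some \<xi>) = l ^ j"
    "C.mm (Some \<xi>) = int x" "l dvd C.ee (Some \<xi>)"
proof -
  have \<xi>S: "\<xi> \<in> S" and js: "multiplicity l (e \<xi>) < s" using \<xi> by (simp_all add: T_iff)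
  define j where "j = multiplicity l (e \<xi>)"
  have "e \<xi> \<noteq> 0" "\<not> is_unit l" using e_pos[OF \<xi>S] prime_gt_1_nat[OF l_prime] by simp_all
  from multiplicity_decompose'[OF this]
  obtain x where x: "e \<xi> = l ^ j * x" "\<not> l dvd x" unfolding j_def by blast
  have l0: "l > 0" using l_prime by (rule prime_gt_0_nat)
  have sj: "l ^ s = l ^ j * l ^ (s - j)" using js by (simp add: j_def flip: power_add)
  have "coprime (l ^ (s - j)) x" using x(2) l_prime by (auto intro: prime_imp_coprime)
  hence "gcd (l ^ s) (e \<xi>) = l ^ j"
    unfolding x(1) sj gcd_mult_distrib_nat[symmetric] by (simp only: coprime_imp_gcd_eq_1 mult_1_right)
  hence g: "C.gg (Some \<xi>) = l ^ j" by (simp only: gg_eq[OF \<xi>S])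
  have "int (e \<xi>) = C.mm (Some \<xi>) * int (l ^ j)"
    using C.nn_eq[of "Some \<xi>"] \<xi>S by (simp add: g C.nn_def ordp_def order_f)
  hence m: "C.mm (Some \<xi>) = int x" using l0 by (simp add: x(1))
  have "l ^ s = C.ee (Some \<xi>) * l ^ j" using C.N_eq[of "Some \<xi>"] unfolding g .
  with sj have "l ^ j * l ^ (s - j) = C.ee (Some \<xi>) * l ^ j" by (rule trans[OF sym])
  hence "l ^ j * l ^ (s - j) = l ^ j * C.ee (Some \<xi>)" by (rule trans[OF _ mult.commute])
  hence "C.ee (Some \<xi>) = l ^ (s - j)" using l0 by simp
  hence "l dvd C.ee (Some \<xi>)" using js by (simp add: j_def dvd_power)
  moreover have "j < s" using js by (simp add: j_def)
  ultimately show ?thesis by (intro that[OF _ x g m])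
qed

lemma T_facts:
  assumes "\<xi> \<in> T"
  shows "\<not> int l dvd C.mm (Some \<xi>)" "l dvd C.ee (Some \<xi>)"
    "\<xi> \<notin> S0 \<Longrightarrow> l dvd C.gg (Some \<xi>)"
    "\<xi> \<in> S0 \<Longrightarrow> C.gg (Some \<xi>) = 1" "\<xi> \<in> S0 \<Longrightarrow> C.mm (Some \<xi>) = int (e \<xi>)"
proof -
  obtain j x where *: "j < s" "e \<xi> = l ^ j * x" "\<not> l dvd x" "C.gg (Some \<xi>) = l ^ j"
    "C.mm (Some \<xi>) = int x" "l dvd C.ee (Some \<xi>)" using local_numbers[OF assms] .
  show "\<not> int l dvd C.mm (Some \<xi>)" "l dvd C.ee (Some \<xi>)" using * by simp_all
  have S0: "\<xi> \<in> S0 \<longleftrightarrow> j = 0"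
    using *(2,3) assms by (cases j) (auto simp: S0_iff T_iff)
  show "l dvd C.gg (Some \<xi>)" if "\<xi> \<notin> S0" using that S0 *(4) by (simp add: dvd_power)
  show "C.gg (Some \<xi>) = 1" "C.mm (Some \<xi>) = int (e \<xi>)" if "\<xi> \<in> S0" using that S0 * by simp_all
qed

text \<open>The degree of f is the sum of all exponents. Those outside S[0] are divisible by l, and
  even by l^s if no root has multiplicity strictly between 0 and s; both powers of l divide the
  degree.\<close>

lemma sum_S0:
  "int l dvd (\<Sum>\<xi>\<in>S0. C.mm (Some \<xi>))"
  "T = S0 \<Longrightarrow> int (l ^ s) dvd (\<Sum>\<xi>\<in>S0. C.mm (Some \<xi>))"
proof -
  have sum: "(\<Sum>\<xi>\<in>S0. C.mm (Some \<xi>)) = int (\<Sum>\<xi>\<in>S0. e \<xi>)"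
    unfolding of_nat_sum using T_facts(5) S0_subset by (intro sum.cong refl) blast
  have "S0 \<subseteq> S" by (auto simp: S0_iff)
  hence deg: "degree f = (\<Sum>\<xi>\<in>S0. e \<xi>) + (\<Sum>\<xi>\<in>S - S0. e \<xi>)"
    unfolding degree_f using finite_S by (simp add: sum.subset_diff add.commute)
  have d: "l ^ i dvd degree f" if "i \<le> n" for i
    using dvd_trans[OF le_imp_power_dvd[OF that] dvd_degree] .
  have "l dvd (\<Sum>\<xi>\<in>S - S0. e \<xi>)" by (rule dvd_sum) (simp add: S0_iff)
  moreover have "l dvd degree f" using d[of 1] s by simp
  ultimately have "l dvd (\<Sum>\<xi>\<in>S0. e \<xi>)" unfolding deg by (simp only: dvd_add_left_iff)
  thus "int l dvd (\<Sum>\<xi>\<in>S0. C.mm (Some \<xi>))" unfolding sum int_dvd_int_iff .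
  assume T: "T = S0"
  have "l ^ s dvd e \<xi>" if "\<xi> \<in> S - S0" for \<xi>
  proof (rule multiplicity_dvd')
    show "s \<le> multiplicity l (e \<xi>)" using that T_iff[of \<xi>] unfolding T by (simp add: not_less)
  qed
  hence "l ^ s dvd (\<Sum>\<xi>\<in>S - S0. e \<xi>)" by (rule dvd_sum)
  with d[OF s(2)] have "l ^ s dvd (\<Sum>\<xi>\<in>S0. e \<xi>)" unfolding deg by (simp only: dvd_add_left_iff)
  thus "int (l ^ s) dvd (\<Sum>\<xi>\<in>S0. C.mm (Some \<xi>))" unfolding sum int_dvd_int_iff .
qed

lemma Gal_S:
  assumes "\<sigma> \<in> absolute_Gal k" "\<xi> \<in> S"
  shows "\<sigma> \<xi> \<in> S" "e (\<sigma> \<xi>) = e \<xi>"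
proof -
  have "order (\<sigma> \<xi>) f = e \<xi>"
    using order_coeff_aut[OF coeff_aut_absolute_Gal[OF assms(1) coeffs] f_nonzero, of \<xi>] assms(2)
    by (simp add: order_f)
  thus "\<sigma> \<xi> \<in> S" "e (\<sigma> \<xi>) = e \<xi>"
    using e_pos[OF assms(2)] by (auto simp: order_f split: if_splits)
qed

lemma Gal_T: "\<sigma> \<in> absolute_Gal k \<Longrightarrow> bij_betw \<sigma> T T"
proof -
  assume \<sigma>: "\<sigma> \<in> absolute_Gal k"
  have inj: "inj_on \<sigma> T" using absolute_Gal_inv(1)[OF \<sigma>] by (meson bij_is_inj inj_on_subset subset_UNIV)
  have "\<sigma> ` T \<subseteq> T" using Gal_S[OF \<sigma>] by (auto simp: T_iff)
  thus ?thesis unfolding bij_betw_def using inj endo_inj_surj[OF finite_T] by blast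
qed

lemma Gal_invariants:
  assumes "\<sigma> \<in> absolute_Gal k" "\<xi> \<in> T"
  shows "\<sigma> \<xi> \<in> S0 \<longleftrightarrow> \<xi> \<in> S0" "C.gg (Some (\<sigma> \<xi>)) = C.gg (Some \<xi>)" "C.mm (Some (\<sigma> \<xi>)) = C.mm (Some \<xi>)"
proof -
  have \<xi>: "\<xi> \<in> S" using assms(2) by (simp add: T_iff)
  show "\<sigma> \<xi> \<in> S0 \<longleftrightarrow> \<xi> \<in> S0" using Gal_S[OF assms(1) \<xi>] \<xi> by (simp add: S0_iff)
  show g: "C.gg (Some (\<sigma> \<xi>)) = C.gg (Some \<xi>)" using Gal_S[OF assms(1) \<xi>] \<xi> by (simp add: gg_eq)
  show "C.mm (Some (\<sigma> \<xi>)) = C.mm (Some \<xi>)"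
    using Gal_S[OF assms(1) \<xi>] \<xi> g by (simp add: C.mm_def C.nn_def ordp_def order_f)
qed

text \<open>Degree zero of the divisor: the reduced fibre over \<xi> consists of
  \<open>C.gg (Some \<xi>)\<close> points.\<close>

definition deg0 :: "('a \<Rightarrow> int) \<Rightarrow> bool" where
  "deg0 a \<longleftrightarrow> (\<Sum>\<xi>\<in>T. a \<xi> * int (C.gg (Some \<xi>))) = 0"

abbreviation \<alpha> :: "('a \<Rightarrow> int) \<Rightarrow> 'a divisor set set" where
  "\<alpha> a \<equiv> C.alphaE (C.fibres T a)"

lemma W_space_eq: "W_space l n y S e s = \<alpha> ` Collect deg0"
proof -
  have "tower_coord l n y s ^ l = tower_coord l n y (s - 1)"
  proof -
    have "n - (s - 1) = Suc (n - s)" using s by simp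
    thus ?thesis by (simp add: tower_coord_def mult.commute flip: power_mult)
  qed
  hence "alpha l n y s D = C.alphaE D" for D
    by (simp add: alpha_def C.alphaE_def tower_field_def Let_def)
  moreover have "W_div0 l n y S e s = C.fibres T ` Collect deg0"
  proof -
    have "W_div0 l n y S e s = range (C.fibres T) \<inter> carrier (Div0 C.F)"
      unfolding W_div0_def tower_field_def Let_def C.generate_fibres[OF finite_T] ..
    also have "carrier (Div0 C.F) = {D \<in> carrier (Div C.F). div_deg D = 0}" by (simp add: Div0_def)
    also have "range (C.fibres T) \<inter> \<dots> = C.fibres T ` Collect deg0"
      using C.fibres_carrier[OF finite_T] C.div_deg_fibres[OF finite_T] by (auto simp: deg0_def)
    finally show ?thesis .
  qed
  ultimately show ?thesis unfolding W_space_def by (simp add: image_image)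
qed

lemma quot_act_\<alpha>:
  assumes "\<sigma> \<in> absolute_Gal k" "\<And>\<xi>. \<xi> \<in> T \<Longrightarrow> b (\<sigma> \<xi>) = a \<xi>"
  shows "quot_act (tower_coord l n y s) \<sigma> (\<alpha> a) = \<alpha> b"
proof -
  have \<sigma>: "coeff_aut f \<sigma>" by (rule coeff_aut_absolute_Gal[OF assms(1) coeffs])
  have eq: "div_act (tower_coord l n y s) \<sigma> (C.fibres T a) = C.fibres T b"
    by (rule C.div_act_fibres[OF \<sigma> Gal_T[OF assms(1)]]) (rule assms(2))
  from C.quot_act_alphaE[OF \<sigma> C.supported_fibres, of T a] show ?thesis unfolding eq .
qed

lemma deg0_perm:
  assumes \<sigma>: "\<sigma> \<in> absolute_Gal k" and b: "\<And>\<xi>. \<xi> \<in> T \<Longrightarrow> b (\<sigma> \<xi>) = a \<xi>"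
  shows "deg0 b \<longleftrightarrow> deg0 a"
proof -
  have "(\<Sum>\<xi>\<in>T. b \<xi> * int (C.gg (Some \<xi>))) = (\<Sum>\<xi>\<in>T. b (\<sigma> \<xi>) * int (C.gg (Some (\<sigma> \<xi>))))"
    using sum.reindex_bij_betw[OF Gal_T[OF \<sigma>], of "\<lambda>\<xi>. b \<xi> * int (C.gg (Some \<xi>))"] by (rule sym)
  also have "\<dots> = (\<Sum>\<xi>\<in>T. a \<xi> * int (C.gg (Some \<xi>)))"
    by (intro sum.cong refl arg_cong2[where f = times] b arg_cong[where f = int] Gal_invariants(2)[OF \<sigma>])
  finally show ?thesis unfolding deg0_def by (simp only:)
qed

lemma \<alpha>_eq_imp:
  assumes "\<alpha> a = \<alpha> b"
  shows "\<exists>i. \<forall>\<xi>\<in>T. int l dvd a \<xi> - b \<xi> - i * C.mm (Some \<xi>)"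
proof -
  have pt: "C.fibres T a (C.pt p c) = (\<Sum>\<xi>\<in>T. if p = Some \<xi> then a \<xi> else 0)" if "c \<in> mu (l ^ s)" for a p c
    unfolding C.fibres_def C.fibre_pt[OF that] by (intro sum.cong refl) simp
  have val: "C.fibres T a (C.pt (Some \<xi>) 1) = a \<xi>" if "\<xi> \<in> T" for a \<xi>
    unfolding pt[OF C.one_mu] using that finite_T by (simp add: sum.delta')
  have const: "C.fibres T a (C.pt p c) = C.fibres T a (C.pt p 1)" if "c \<in> mu (l ^ s)" for a p c
    by (simp only: pt[OF that] pt[OF C.one_mu])
  have "\<exists>i. \<forall>\<xi>. l dvd C.ee (Some \<xi>) \<longrightarrow>
      int l dvd C.fibres T a (C.pt (Some \<xi>) 1) - C.fibres T b (C.pt (Some \<xi>) 1) - i * C.mm (Some \<xi>)"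
    by (rule C.alphaE_eq_imp[OF assms]) (rule const, assumption)+
  then obtain i where i: "\<forall>\<xi>. l dvd C.ee (Some \<xi>) \<longrightarrow>
      int l dvd C.fibres T a (C.pt (Some \<xi>) 1) - C.fibres T b (C.pt (Some \<xi>) 1) - i * C.mm (Some \<xi>)" ..
  have "int l dvd a \<xi> - b \<xi> - i * C.mm (Some \<xi>)" if "\<xi> \<in> T" for \<xi>
    using i[rule_format, OF T_facts(2)[OF that]] unfolding val[OF that] .
  thus ?thesis by (intro exI ballI)
qed

definition H :: "('a \<Rightarrow> 'a) set" where
  "H = {\<sigma>\<in>absolute_Gal k. \<forall>Y\<in>W_space l n y S e s. quot_act (tower_coord l n y s) \<sigma> Y = Y}"

lemma H_iff:
  "\<sigma> \<in> H \<longleftrightarrow> \<sigma> \<in> absolute_Gal k \<and> (\<forall>a. deg0 a \<longrightarrow> quot_act (tower_coord l n y s) \<sigma> (\<alpha> a) = \<alpha> a)"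
  by (auto simp: H_def W_space_eq)

lemma Gal_inv_apply: "\<sigma> \<in> absolute_Gal k \<Longrightarrow> inv_into UNIV \<sigma> (\<sigma> \<xi>) = \<xi>"
  using absolute_Gal_inv(1)[of \<sigma> k] by (simp add: bij_is_inj)

lemma H_\<alpha>: "\<sigma> \<in> H \<Longrightarrow> deg0 a \<Longrightarrow> \<alpha> (\<lambda>\<xi>. a (inv_into UNIV \<sigma> \<xi>)) = \<alpha> a"
  using quot_act_\<alpha>[of \<sigma> "\<lambda>\<xi>. a (inv_into UNIV \<sigma> \<xi>)" a] Gal_inv_apply by (simp add: H_iff)

lemma stab_H:
  assumes "\<sigma> \<in> absolute_Gal k" "\<And>t. t \<in> T \<Longrightarrow> \<sigma> t = t"
  shows "\<sigma> \<in> H"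
  unfolding H_iff using assms quot_act_\<alpha>[OF assms(1)] by simp

lemma id_H: "id \<in> H"
proof (rule stab_H)
  have "fld_hom UNIV id" by (rule fld_homI[OF subfld_UNIV]) simp_all
  thus "id \<in> absolute_Gal k" unfolding Gal_iff[OF subfld_UNIV] by simp
qed simp

text \<open>Instead of an action law for \<open>quot_act\<close>, the effect on
  \<open>\<alpha> a\<close> is computed through the permuted coefficients, using triviality of
  \<sigma> and then of \<tau>.\<close>

lemma comp_H:
  assumes \<sigma>: "\<sigma> \<in> H" and \<tau>: "\<tau> \<in> H"
  shows "\<sigma> \<circ> \<tau> \<in> H"
  unfolding H_iff
proof (intro conjI allI impI)
  have G: "\<sigma> \<in> absolute_Gal k" "\<tau> \<in> absolute_Gal k" using \<sigma> \<tau> by (simp_all add: H_iff)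
  show comp: "\<sigma> \<circ> \<tau> \<in> absolute_Gal k" by (rule Gal_comp[OF subfld_UNIV G])
  fix a assume a: "deg0 a"
  define b where "b = (\<lambda>\<xi>. a (inv_into UNIV \<tau> \<xi>))"
  have b: "deg0 b"
    using deg0_perm[OF G(2), of b a] Gal_inv_apply[OF G(2)] a by (simp add: b_def)
  have "quot_act (tower_coord l n y s) (\<sigma> \<circ> \<tau>) (\<alpha> a) = \<alpha> (\<lambda>\<xi>. b (inv_into UNIV \<sigma> \<xi>))"
    by (rule quot_act_\<alpha>[OF comp]) (simp add: b_def Gal_inv_apply[OF G(1)] Gal_inv_apply[OF G(2)])
  also have "\<dots> = \<alpha> b" by (rule H_\<alpha>[OF \<sigma> b])
  also have "\<dots> = \<alpha> a" unfolding b_def by (rule H_\<alpha>[OF \<tau> a])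
  finally show "quot_act (tower_coord l n y s) (\<sigma> \<circ> \<tau>) (\<alpha> a) = \<alpha> a" .
qed

sublocale P: trivial_action T S0 l s "\<lambda>\<xi>. C.mm (Some \<xi>)" "\<lambda>\<xi>. int (C.gg (Some \<xi>))" "(\<lambda>\<sigma>. restrict \<sigma> T) ` H"
proof (unfold_locales, goal_cases)
  case 1 show ?case by (rule finite_T)
next
  case 2 show ?case by (rule S0_subset)
next
  case 3 show ?case using \<xi>\<^sub>0 S0_iff by blast
next
  case 4 show ?case by (rule l_prime)
next
  case (5 \<xi>) thus ?case by (rule T_facts(1))
next
  case (6 \<xi>) thus ?case using T_facts(4)[of \<xi>] S0_subset by auto
next
  case (7 \<xi>) thus ?case using T_facts(3)[of \<xi>] by simp
next
  case (8 \<gamma>)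
  then obtain \<sigma> where \<sigma>: "\<sigma> \<in> H" "\<gamma> = restrict \<sigma> T" by (elim imageE)
  show ?case using Gal_T[of \<sigma>] \<sigma>(1) unfolding \<sigma>(2) H_iff by (simp add: bij_betw_restrict_eq)
next
  case (9 \<gamma>) thus ?case by auto
next
  case (10 \<gamma> \<xi>)
  then obtain \<sigma> where \<sigma>: "\<sigma> \<in> H" "\<gamma> = restrict \<sigma> T" by (elim imageE)
  show ?case using Gal_invariants(1)[of \<sigma> \<xi>] \<sigma>(1) 10(2) unfolding \<sigma>(2) H_iff by simp
next
  case (11 \<gamma> \<xi>)
  then obtain \<sigma> where \<sigma>: "\<sigma> \<in> H" "\<gamma> = restrict \<sigma> T" by (elim imageE)
  show ?case using Gal_invariants(3)[of \<sigma> \<xi>] \<sigma>(1) 11(2) unfolding \<sigma>(2) H_iff by simp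
next
  case 12 show ?case by (rule imageI[OF id_H])
next
  case (13 \<gamma> \<gamma>')
  then obtain \<sigma> \<sigma>' where \<sigma>: "\<sigma> \<in> H" "\<gamma> = restrict \<sigma> T" "\<sigma>' \<in> H" "\<gamma>' = restrict \<sigma>' T" by (elim imageE)
  have "\<sigma>' \<xi> \<in> T" if "\<xi> \<in> T" for \<xi>
    using Gal_T[of \<sigma>'] \<sigma>(3) that by (auto simp: H_iff bij_betw_def)
  hence "restrict (\<gamma> \<circ> \<gamma>') T = restrict (\<sigma> \<circ> \<sigma>') T" unfolding \<sigma> by (intro restrict_ext) simp
  thus ?case using imageI[OF comp_H[OF \<sigma>(1,3)], of "\<lambda>\<sigma>. restrict \<sigma> T"] by simp
next
  \<comment> \<open>Triviality on W_s says that a and a composed with the inverse of \<sigma> have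
    the same image. The resulting congruence is read at \<sigma>(\<xi>), where m has the same value
    as at \<xi>.\<close>
  case (14 \<gamma> a)
  then obtain \<sigma> where \<sigma>: "\<sigma> \<in> H" "\<gamma> = restrict \<sigma> T" by (elim imageE)
  have G: "\<sigma> \<in> absolute_Gal k" using \<sigma>(1) by (simp add: H_iff)
  have "\<alpha> a = \<alpha> (\<lambda>\<xi>. a (inv_into UNIV \<sigma> \<xi>))"
    by (rule H_\<alpha>[OF \<sigma>(1), symmetric]) (use 14 in \<open>simp add: deg0_def\<close>)
  from \<alpha>_eq_imp[OF this] obtain i where
    i: "\<And>\<xi>. \<xi> \<in> T \<Longrightarrow> int l dvd a \<xi> - a (inv_into UNIV \<sigma> \<xi>) - i * C.mm (Some \<xi>)" by blast
  have "int l dvd a (\<gamma> \<xi>) - a \<xi> - i * C.mm (Some \<xi>)" if \<xi>: "\<xi> \<in> T" for \<xi>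
  proof -
    have "\<sigma> \<xi> \<in> T" using Gal_T[OF G] \<xi> by (auto simp: bij_betw_def)
    from i[OF this] show ?thesis
      using \<xi> by (simp add: \<sigma>(2) Gal_inv_apply[OF G] Gal_invariants(3)[OF G \<xi>])
  qed
  thus ?case by blast
next
  case 15 show ?case by (rule sum_S0(1))
next
  case 16 thus ?case by (rule sum_S0(2))
next
  case 17 show ?case by (rule s(1))
qed

lemma M_eq: "gset_field k (quot_act (tower_coord l n y s)) (W_space l n y S e s) = {z. \<forall>\<sigma>\<in>H. \<sigma> z = z}"
  by (auto simp: gset_field_def H_def)

lemma perm_H: "\<sigma> \<in> H \<Longrightarrow> \<sigma> ` T = T"
  using Gal_T[of \<sigma>] by (simp add: H_iff bij_betw_def)

lemma H_subset: "H \<subseteq> absolute_Gal k"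
  by (auto simp: H_iff)

lemma extension:
  defines "L \<equiv> gset_field k (\<lambda>\<sigma>. \<sigma>) T"
    and "M \<equiv> gset_field k (quot_act (tower_coord l n y s)) (W_space l n y S e s)"
    and "d \<equiv> card ((\<lambda>\<sigma>. restrict \<sigma> T) ` H)"
  shows "galois_extension M L" "finite_extension M L" "ext_degree M L = d" "d = 1 \<Longrightarrow> L = M"
  unfolding L_def M_def d_def M_eq
  by (rule stabilizer_extension[OF finite_T H_subset perm_H id_H comp_H];
      (assumption | (rule stab_H; blast)))+

end


theorem proposition7p3:
  fixes k S :: "'a :: {alg_closed_field, field_char_0} set"
    and l n s :: nat
    and lam :: 'a
    and e :: "'a \<Rightarrow> nat"
    and f :: "'a poly"
    and y :: "'a fn"
  assumes "number_field k"
    and "algebraic_extension k UNIV"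
    and "Factorial_Ring.prime l"
    and "1 \<le> n"
    and "lam \<in> k - {0}"
    and "finite S"
    and "\<forall>\<xi>\<in>S. 0 < e \<xi> \<and> e \<xi> < l ^ n"
    and "f = Polynomial.smult lam (\<Prod>\<xi>\<in>S. [:- \<xi>, 1:] ^ e \<xi>)"
    and "\<forall>i. Polynomial.coeff f i \<in> k"
    and "Factorial_Ring.irreducible (Polynomial.monom 1 (l ^ n) - [:f:] :: 'a poly poly)"
    and "y ^ (l ^ n) = fn_of_poly f"
    and "branch_locus (fn_field y) = line_point ` S"
    and "\<forall>V\<in>finite_places_away l k. good_reduction_Jac k y V"
    and "gset_field k (\<lambda>\<sigma>. \<sigma>) S \<subseteq> max_pro_unramified k l"
    and "1 \<le> s" and "s \<le> n"
  shows
    "let L = gset_field k (\<lambda>\<sigma>. \<sigma>) (strata_below l S e s);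
         M = gset_field k (quot_act (tower_coord l n y s)) (W_space l n y S e s);
         d = ext_degree M L;
         S0 = stratum l S e 0;
         r0 = card S0
     in galois_extension M L \<and> finite_extension M L \<and> d \<le> 4 \<and>
        (d = 1 \<and> L = M \<or>
         l = 3 \<and> strata_below l S e s = S0 \<and> r0 = 3 \<and> s = 1 \<and> d = 3 \<or>
         l = 2 \<and> strata_below l S e s = S0 \<and> r0 = 4 \<and> s \<le> 2 \<and> d = 4 \<or>
         l = 2 \<and> strata_below l S e s = S0 \<and> r0 = 4 \<and> d = 2 \<or>
         l = 2 \<and> strata_below l S e s = S0 \<and> r0 = 2 \<and> s = 1 \<and> d = 2 \<or>
         l = 2 \<and> strata_below l S e s \<noteq> S0 \<and> r0 = 2 \<and> d = 2)"
proof -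
  have l: "l > 1" using assms(3) by (rule prime_gt_1_nat)
  have "l * l ^ (n - 1) = l ^ n" using assms(4) by (cases n) simp_all
  \<comment> \<open>Writing l^n as l times l^(n-1) exposes the factor that a common divisor l of all
    exponents would produce.\<close>
  hence "\<exists>\<xi>\<in>S. \<not> l dvd e \<xi>"
    using assms(10) l by (intro irreducible_superelliptic[OF _ assms(8) l, of "l ^ (n - 1)"]) simp_all
  then obtain \<xi>\<^sub>0 where \<xi>\<^sub>0: "\<xi>\<^sub>0 \<in> S" "\<not> l dvd e \<xi>\<^sub>0" by (elim bexE)
  interpret superelliptic_tower k S l n s lam e f y \<xi>\<^sub>0
  proof unfold_locales
    show "branch_locus (fn_field y) \<subseteq> range line_point" unfolding assms(12) by (rule image_mono) simp
    show "lam \<noteq> 0" using assms(5) by simp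
    show "0 < e \<xi>" if "\<xi> \<in> S" for \<xi> using assms(7) that by simp
  qed (rule assms \<xi>\<^sub>0)+
  show ?thesis
    unfolding Let_def extension(3)
  proof (intro conjI extension(1,2))
    show "card ((\<lambda>\<sigma>. restrict \<sigma> T) ` H) \<le> 4" by (rule conjunct1[OF P.cases])
    from conjunct2[OF P.cases]
    show "card ((\<lambda>\<sigma>. restrict \<sigma> T) ` H) = 1 \<and>
        gset_field k (\<lambda>\<sigma>. \<sigma>) T = gset_field k (quot_act (tower_coord l n y s)) (W_space l n y S e s) \<or>
      l = 3 \<and> T = S0 \<and> card S0 = 3 \<and> s = 1 \<and> card ((\<lambda>\<sigma>. restrict \<sigma> T) ` H) = 3 \<or>
      l = 2 \<and> T = S0 \<and> card S0 = 4 \<and> s \<le> 2 \<and> card ((\<lambda>\<sigma>. restrict \<sigma> T) ` H) = 4 \<or>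
      l = 2 \<and> T = S0 \<and> card S0 = 4 \<and> card ((\<lambda>\<sigma>. restrict \<sigma> T) ` H) = 2 \<or>
      l = 2 \<and> T = S0 \<and> card S0 = 2 \<and> s = 1 \<and> card ((\<lambda>\<sigma>. restrict \<sigma> T) ` H) = 2 \<or>
      l = 2 \<and> T \<noteq> S0 \<and> card S0 = 2 \<and> card ((\<lambda>\<sigma>. restrict \<sigma> T) ` H) = 2"
      \<comment> \<open>Only the first case gains a conjunct: degree 1 also gives equality of the
        two fields.\<close>
      by (rule disj_forward) (rule conjI, assumption, erule extension(4))
  qed
qed

end
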